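(* Let $p$ be a prime, $q$ a power of $p$, and $\mathbb{F}$ an algebraic field extension of $\mathbb{F}_q$. Let $$\mathbf{Y}=\mathrm{Spec}\left(\mathbb{F}[x,y]/(xy^q-yx^q-1)\right).$$ Then $\mathrm{Pic}(\mathbf{Y})[p]=0$.
   Context: For an abelian group $M$, $M[p]=\{m\in M: pm=0\}$. *)

theory Defs
  imports "HOL-Algebra.Algebra" "HOL-Analysis.Abstract_Topology"
begin

section \<open>Ringed spaces and sheaves of modules\<close>

text \<open>
  A ringed space consists of a topology, the rings of sections over open sets, and the restriction
  maps; \<open>rs_res Y U V\<close> restricts from \<open>U\<close> to \<open>V\<close>, for \<open>V \<subseteq> U\<close>. Similarly for modules over the
  structure sheaf. Values at sets that are not open carry no information.
\<close>

record ('p, 's) ringed_space =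
  rs_top :: "'p topology"
  rs_ring :: "'p set \<Rightarrow> 's ring"
  rs_res :: "'p set \<Rightarrow> 'p set \<Rightarrow> 's \<Rightarrow> 's"

record ('p, 's, 'm) sheaf_mod =
  sm_sec :: "'p set \<Rightarrow> ('s, 'm) module"
  sm_res :: "'p set \<Rightarrow> 'p set \<Rightarrow> 'm \<Rightarrow> 'm"

abbreviation rs_open :: "('p, 's) ringed_space \<Rightarrow> 'p set \<Rightarrow> bool" where
  "rs_open Y U \<equiv> openin (rs_top Y) U"

definition module_presheaf :: "('p, 's) ringed_space \<Rightarrow> ('p, 's, 'm) sheaf_mod \<Rightarrow> bool" where
  "module_presheaf Y L \<longleftrightarrow>
     (\<forall>U. rs_open Y U \<longrightarrow> Module.module (rs_ring Y U) (sm_sec L U)) \<and>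
     (\<forall>U V. rs_open Y U \<and> rs_open Y V \<and> V \<subseteq> U \<longrightarrow>
        sm_res L U V \<in> carrier (sm_sec L U) \<rightarrow> carrier (sm_sec L V) \<and>
        (\<forall>s\<in>carrier (sm_sec L U). \<forall>t\<in>carrier (sm_sec L U).
           sm_res L U V (s \<oplus>\<^bsub>sm_sec L U\<^esub> t) = sm_res L U V s \<oplus>\<^bsub>sm_sec L V\<^esub> sm_res L U V t) \<and>
        (\<forall>r\<in>carrier (rs_ring Y U). \<forall>s\<in>carrier (sm_sec L U).
           sm_res L U V (r \<odot>\<^bsub>sm_sec L U\<^esub> s) = rs_res Y U V r \<odot>\<^bsub>sm_sec L V\<^esub> sm_res L U V s)) \<and>
     (\<forall>U. rs_open Y U \<longrightarrow> (\<forall>s\<in>carrier (sm_sec L U). sm_res L U U s = s)) \<and>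
     (\<forall>U V W. rs_open Y U \<and> rs_open Y V \<and> rs_open Y W \<and> W \<subseteq> V \<and> V \<subseteq> U \<longrightarrow>
        (\<forall>s\<in>carrier (sm_sec L U). sm_res L V W (sm_res L U V s) = sm_res L U W s))"

definition module_sheaf :: "('p, 's) ringed_space \<Rightarrow> ('p, 's, 'm) sheaf_mod \<Rightarrow> bool" where
  "module_sheaf Y L \<longleftrightarrow> module_presheaf Y L \<and>
     (\<forall>\<U> s. (\<forall>V\<in>\<U>. rs_open Y V \<and> s V \<in> carrier (sm_sec L V)) \<and>
        (\<forall>V\<in>\<U>. \<forall>W\<in>\<U>. sm_res L V (V \<inter> W) (s V) = sm_res L W (V \<inter> W) (s W)) \<longrightarrow>
        (\<exists>!t. t \<in> carrier (sm_sec L (\<Union>\<U>)) \<and> (\<forall>V\<in>\<U>. sm_res L (\<Union>\<U>) V t = s V)))"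

definition structure_mod :: "('p, 's) ringed_space \<Rightarrow> ('p, 's, 's) sheaf_mod" where
  "structure_mod Y =
     \<lparr>sm_sec = (\<lambda>U. \<lparr>carrier = carrier (rs_ring Y U), monoid.mult = monoid.mult (rs_ring Y U),
                   monoid.one = \<one>\<^bsub>rs_ring Y U\<^esub>, ring.zero = \<zero>\<^bsub>rs_ring Y U\<^esub>,
                   ring.add = ring.add (rs_ring Y U),
                   smult = monoid.mult (rs_ring Y U)\<rparr>),
      sm_res = rs_res Y\<rparr>"

text \<open>The restrictions of two modules to the open subspace \<open>U\<close> are isomorphic.\<close>

definition sheaf_iso_on ::
  "('p, 's) ringed_space \<Rightarrow> 'p set \<Rightarrow> ('p, 's, 'm) sheaf_mod \<Rightarrow> ('p, 's, 'n) sheaf_mod \<Rightarrow> bool" where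
  "sheaf_iso_on Y U L M \<longleftrightarrow> (\<exists>\<phi>.
     (\<forall>V. rs_open Y V \<and> V \<subseteq> U \<longrightarrow>
        bij_betw (\<phi> V) (carrier (sm_sec L V)) (carrier (sm_sec M V)) \<and>
        (\<forall>s\<in>carrier (sm_sec L V). \<forall>t\<in>carrier (sm_sec L V).
           \<phi> V (s \<oplus>\<^bsub>sm_sec L V\<^esub> t) = \<phi> V s \<oplus>\<^bsub>sm_sec M V\<^esub> \<phi> V t) \<and>
        (\<forall>r\<in>carrier (rs_ring Y V). \<forall>s\<in>carrier (sm_sec L V).
           \<phi> V (r \<odot>\<^bsub>sm_sec L V\<^esub> s) = r \<odot>\<^bsub>sm_sec M V\<^esub> \<phi> V s)) \<and>
     (\<forall>V W. rs_open Y V \<and> rs_open Y W \<and> W \<subseteq> V \<and> V \<subseteq> U \<longrightarrow>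
        (\<forall>s\<in>carrier (sm_sec L V). \<phi> W (sm_res L V W s) = sm_res M V W (\<phi> V s))))"

definition sheaf_iso ::
  "('p, 's) ringed_space \<Rightarrow> ('p, 's, 'm) sheaf_mod \<Rightarrow> ('p, 's, 'n) sheaf_mod \<Rightarrow> bool" where
  "sheaf_iso Y L M \<longleftrightarrow> sheaf_iso_on Y (topspace (rs_top Y)) L M"

definition invertible_sheaf :: "('p, 's) ringed_space \<Rightarrow> ('p, 's, 'm) sheaf_mod \<Rightarrow> bool" where
  "invertible_sheaf Y L \<longleftrightarrow> module_sheaf Y L \<and>
     (\<forall>x\<in>topspace (rs_top Y). \<exists>U. rs_open Y U \<and> x \<in> U \<and> sheaf_iso_on Y U L (structure_mod Y))"

section \<open>Sheafification\<close>

definition germ :: "('p, 's) ringed_space \<Rightarrow> ('p, 's, 'm) sheaf_mod \<Rightarrow> 'p \<Rightarrow> 'p set \<Rightarrow> 'm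
    \<Rightarrow> ('p set \<times> 'm) set" where
  "germ Y L x U s = {(V, t). rs_open Y V \<and> x \<in> V \<and> t \<in> carrier (sm_sec L V) \<and>
     (\<exists>W. rs_open Y W \<and> x \<in> W \<and> W \<subseteq> U \<inter> V \<and> sm_res L U W s = sm_res L V W t)}"

definition stalk :: "('p, 's) ringed_space \<Rightarrow> ('p, 's, 'm) sheaf_mod \<Rightarrow> 'p
    \<Rightarrow> ('p set \<times> 'm) set set" where
  "stalk Y L x = {germ Y L x U s |U s. rs_open Y U \<and> x \<in> U \<and> s \<in> carrier (sm_sec L U)}"

text \<open>
  Sections over \<open>U\<close> are the families of germs over the points of \<open>U\<close> that are locally induced by a
  section of the presheaf. Operations on equivalence classes (germs here, fractions and cosets
  below) are written as unions over all representatives; all members of such a union coincide.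
  The multiplicative part of the record underlying \<^typ>\<open>('s, 'm) module\<close> is irrelevant for modules.
\<close>

definition sheafification :: "('p, 's) ringed_space \<Rightarrow> ('p, 's, 'm) sheaf_mod
    \<Rightarrow> ('p, 's, 'p \<Rightarrow> ('p set \<times> 'm) set) sheaf_mod" where
  "sheafification Y L =
     \<lparr>sm_sec = (\<lambda>U.
        \<lparr>carrier = {\<sigma> \<in> (\<Pi>\<^sub>E x\<in>U. stalk Y L x).
            \<forall>x\<in>U. \<exists>V t. rs_open Y V \<and> x \<in> V \<and> V \<subseteq> U \<and> t \<in> carrier (sm_sec L V) \<and>
              (\<forall>y\<in>V. \<sigma> y = germ Y L y V t)},
         monoid.mult = undefined,
         monoid.one = undefined,
         ring.zero = (\<lambda>x\<in>U. germ Y L x U \<zero>\<^bsub>sm_sec L U\<^esub>),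
         ring.add = (\<lambda>\<sigma> \<tau>. \<lambda>x\<in>U. \<Union>(V, s)\<in>\<sigma> x. \<Union>(W, t)\<in>\<tau> x.
            germ Y L x (V \<inter> W)
              (sm_res L V (V \<inter> W) s \<oplus>\<^bsub>sm_sec L (V \<inter> W)\<^esub> sm_res L W (V \<inter> W) t)),
         smult = (\<lambda>r \<sigma>. \<lambda>x\<in>U. \<Union>(V, s)\<in>\<sigma> x.
            germ Y L x (U \<inter> V)
              (rs_res Y U (U \<inter> V) r \<odot>\<^bsub>sm_sec L (U \<inter> V)\<^esub> sm_res L V (U \<inter> V) s))\<rparr>),
      sm_res = (\<lambda>U V \<sigma>. restrict \<sigma> V)\<rparr>"

section \<open>Tensor products\<close>

definition tensor_relators :: "('s, 'c) ring_scheme \<Rightarrow> ('s, 'm) module \<Rightarrow> ('s, 'n) module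
    \<Rightarrow> ('m \<times> 'n \<Rightarrow>\<^sub>0 int) set" where
  "tensor_relators R M N =
     {frag_of (x \<oplus>\<^bsub>M\<^esub> x', y) - frag_of (x, y) - frag_of (x', y) |x x' y.
        x \<in> carrier M \<and> x' \<in> carrier M \<and> y \<in> carrier N} \<union>
     {frag_of (x, y \<oplus>\<^bsub>N\<^esub> y') - frag_of (x, y) - frag_of (x, y') |x y y'.
        x \<in> carrier M \<and> y \<in> carrier N \<and> y' \<in> carrier N} \<union>
     {frag_of (r \<odot>\<^bsub>M\<^esub> x, y) - frag_of (x, r \<odot>\<^bsub>N\<^esub> y) |r x y.
        r \<in> carrier R \<and> x \<in> carrier M \<and> y \<in> carrier N}"

abbreviation tensor_free :: "('s, 'm) module \<Rightarrow> ('s, 'n) module \<Rightarrow> ('m \<times> 'n \<Rightarrow>\<^sub>0 int) monoid" where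
  "tensor_free M N \<equiv> free_Abelian_group (carrier M \<times> carrier N)"

definition tensor_kernel :: "('s, 'c) ring_scheme \<Rightarrow> ('s, 'm) module \<Rightarrow> ('s, 'n) module
    \<Rightarrow> ('m \<times> 'n \<Rightarrow>\<^sub>0 int) set" where
  "tensor_kernel R M N = generate (tensor_free M N) (tensor_relators R M N)"

definition tensor :: "('s, 'c) ring_scheme \<Rightarrow> ('s, 'm) module \<Rightarrow> ('s, 'n) module
    \<Rightarrow> ('s, ('m \<times> 'n \<Rightarrow>\<^sub>0 int) set) module" where
  "tensor R M N =
     \<lparr>carrier = carrier (tensor_free M N Mod tensor_kernel R M N),
      monoid.mult = undefined,
      monoid.one = undefined,
      ring.zero = \<one>\<^bsub>tensor_free M N Mod tensor_kernel R M N\<^esub>,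
      ring.add = monoid.mult (tensor_free M N Mod tensor_kernel R M N),
      smult = (\<lambda>r C. \<Union>c\<in>C. tensor_kernel R M N
        #>\<^bsub>tensor_free M N\<^esub> frag_extend (\<lambda>(x, y). frag_of (r \<odot>\<^bsub>M\<^esub> x, y)) c)\<rparr>"

definition tensor_presheaf :: "('p, 's) ringed_space \<Rightarrow> ('p, 's, 'm) sheaf_mod
    \<Rightarrow> ('p, 's, 'n) sheaf_mod \<Rightarrow> ('p, 's, ('m \<times> 'n \<Rightarrow>\<^sub>0 int) set) sheaf_mod" where
  "tensor_presheaf Y L M =
     \<lparr>sm_sec = (\<lambda>U. tensor (rs_ring Y U) (sm_sec L U) (sm_sec M U)),
      sm_res = (\<lambda>U V C. \<Union>c\<in>C. tensor_kernel (rs_ring Y V) (sm_sec L V) (sm_sec M V)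
        #>\<^bsub>tensor_free (sm_sec L V) (sm_sec M V)\<^esub>
          frag_extend (\<lambda>(x, y). frag_of (sm_res L U V x, sm_res M U V y)) c)\<rparr>"

definition tensor_sheaf :: "('p, 's) ringed_space \<Rightarrow> ('p, 's, 'm) sheaf_mod
    \<Rightarrow> ('p, 's, 'n) sheaf_mod
    \<Rightarrow> ('p, 's, 'p \<Rightarrow> ('p set \<times> ('m \<times> 'n \<Rightarrow>\<^sub>0 int) set) set) sheaf_mod" where
  "tensor_sheaf Y L M = sheafification Y (tensor_presheaf Y L M)"

section \<open>The Picard group\<close>

text \<open>
  Isomorphism classes have to be formed inside a fixed type of sections. Choosing at each point an
  isomorphism between the stalk of an invertible sheaf and the stalk of the structure sheaf
  identifies sections over \<open>U\<close> with families of germs of the structure sheaf, so every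
  invertible sheaf, whatever its type of sections, is isomorphic to one with sections
  of type \<^typ>\<open>'p \<Rightarrow> ('p set \<times> 's) set\<close>. Hence this type yields the full Picard group.
\<close>

type_synonym ('p, 's) line_bundle = "('p, 's, 'p \<Rightarrow> ('p set \<times> 's) set) sheaf_mod"

definition iso_class :: "('p, 's) ringed_space \<Rightarrow> ('p, 's, 'm) sheaf_mod
    \<Rightarrow> ('p, 's) line_bundle set" where
  "iso_class Y L = {N. invertible_sheaf Y N \<and> sheaf_iso Y N L}"

definition Pic :: "('p, 's) ringed_space \<Rightarrow> ('p, 's) line_bundle set monoid" where
  "Pic Y =
     \<lparr>carrier = {iso_class Y L |L :: ('p, 's) line_bundle. invertible_sheaf Y L},
      monoid.mult = (\<lambda>c d. \<Union>L\<in>c. \<Union>M\<in>d. iso_class Y (tensor_sheaf Y L M)),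
      monoid.one = iso_class Y (structure_mod Y)\<rparr>"

text \<open>The \<open>n\<close>-torsion of an abelian group, which is written multiplicatively here.\<close>

definition torsion_part :: "('g, 'c) monoid_scheme \<Rightarrow> nat \<Rightarrow> 'g set" where
  "torsion_part G n = {g \<in> carrier G. g [^]\<^bsub>G\<^esub> n = \<one>\<^bsub>G\<^esub>}"

section \<open>The spectrum of a ring\<close>

definition loc_frac :: "('a, 'b) ring_scheme \<Rightarrow> 'a set \<Rightarrow> 'a \<Rightarrow> 'a \<Rightarrow> ('a \<times> 'a) set" where
  "loc_frac A S a s = {(b, t). b \<in> carrier A \<and> t \<in> S \<and>
     (\<exists>u\<in>S. u \<otimes>\<^bsub>A\<^esub> (a \<otimes>\<^bsub>A\<^esub> t) = u \<otimes>\<^bsub>A\<^esub> (b \<otimes>\<^bsub>A\<^esub> s))}"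

definition localization :: "('a, 'b) ring_scheme \<Rightarrow> 'a set \<Rightarrow> ('a \<times> 'a) set ring" where
  "localization A S =
     \<lparr>carrier = {loc_frac A S a s |a s. a \<in> carrier A \<and> s \<in> S},
      monoid.mult = (\<lambda>c d. \<Union>(a, s)\<in>c. \<Union>(b, t)\<in>d. loc_frac A S (a \<otimes>\<^bsub>A\<^esub> b) (s \<otimes>\<^bsub>A\<^esub> t)),
      monoid.one = loc_frac A S \<one>\<^bsub>A\<^esub> \<one>\<^bsub>A\<^esub>,
      ring.zero = loc_frac A S \<zero>\<^bsub>A\<^esub> \<one>\<^bsub>A\<^esub>,
      ring.add = (\<lambda>c d. \<Union>(a, s)\<in>c. \<Union>(b, t)\<in>d.
        loc_frac A S (a \<otimes>\<^bsub>A\<^esub> t \<oplus>\<^bsub>A\<^esub> b \<otimes>\<^bsub>A\<^esub> s) (s \<otimes>\<^bsub>A\<^esub> t))\<rparr>"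

abbreviation local_ring :: "('a, 'b) ring_scheme \<Rightarrow> 'a set \<Rightarrow> ('a \<times> 'a) set ring" where
  "local_ring A P \<equiv> localization A (carrier A - P)"

definition zariski_open :: "('a, 'b) ring_scheme \<Rightarrow> 'a set set \<Rightarrow> bool" where
  "zariski_open A U \<longleftrightarrow> (\<exists>E\<subseteq>carrier A. U = {P. primeideal P A \<and> \<not> E \<subseteq> P})"

lemma istopology_zariski: "istopology (zariski_open A)"
  unfolding istopology_def
proof (intro conjI allI impI)
  fix U V
  assume "zariski_open A U" "zariski_open A V"
  then obtain E E' where E: "E \<subseteq> carrier A" "U = {P. primeideal P A \<and> \<not> E \<subseteq> P}"
    and E': "E' \<subseteq> carrier A" "V = {P. primeideal P A \<and> \<not> E' \<subseteq> P}"
    unfolding zariski_open_def by auto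
  show "zariski_open A (U \<inter> V)"
  proof (cases "\<exists>P. primeideal P A")
    case True
    then interpret cring A unfolding primeideal_def by blast
    define D where "D = (\<lambda>(x, y). x \<otimes>\<^bsub>A\<^esub> y) ` (E \<times> E')"
    have "D \<subseteq> P \<longleftrightarrow> E \<subseteq> P \<or> E' \<subseteq> P" if P: "primeideal P A" for P
    proof
      interpret primeideal P A by (rule P)
      show "E \<subseteq> P \<or> E' \<subseteq> P" if D: "D \<subseteq> P"
      proof (rule ccontr)
        assume "\<not> (E \<subseteq> P \<or> E' \<subseteq> P)"
        then obtain x y where xy: "x \<in> E" "x \<notin> P" "y \<in> E'" "y \<notin> P" by auto
        then have "x \<otimes>\<^bsub>A\<^esub> y \<in> P" using D unfolding D_def by auto
        then show False using I_prime[of x y] xy E(1) E'(1) by auto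
      qed
      show "D \<subseteq> P" if "E \<subseteq> P \<or> E' \<subseteq> P"
        using that E(1) E'(1) unfolding D_def
        by (auto intro: I_l_closed I_r_closed dest: subsetD)
    qed
    then have "U \<inter> V = {P. primeideal P A \<and> \<not> D \<subseteq> P}"
      unfolding E(2) E'(2) by auto
    moreover have "D \<subseteq> carrier A" using E(1) E'(1) unfolding D_def by auto
    ultimately show ?thesis unfolding zariski_open_def by (intro exI[of _ D]) simp
  next
    case False
    then have "U \<inter> V = {P. primeideal P A \<and> \<not> {} \<subseteq> P}" unfolding E(2) by auto
    then show ?thesis unfolding zariski_open_def by (intro exI[of _ "{}"]) simp
  qed
next
  fix \<K>
  assume "\<forall>K\<in>\<K>. zariski_open A K"
  then have K: "\<exists>E\<subseteq>carrier A. K = {P. primeideal P A \<and> \<not> E \<subseteq> P}" if "K \<in> \<K>" for K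
    using that unfolding zariski_open_def by simp
  define D where "D = \<Union>{E. E \<subseteq> carrier A \<and> {P. primeideal P A \<and> \<not> E \<subseteq> P} \<in> \<K>}"
  have "P \<in> \<Union>\<K> \<longleftrightarrow> primeideal P A \<and> \<not> D \<subseteq> P" for P
  proof
    assume "P \<in> \<Union>\<K>"
    then obtain K' where K': "K' \<in> \<K>" "P \<in> K'" by auto
    from K[OF K'(1)] obtain E where E: "E \<subseteq> carrier A" "K' = {P. primeideal P A \<and> \<not> E \<subseteq> P}"
      by auto
    then have "E \<subseteq> D" using K'(1) unfolding D_def by auto
    with K'(2) show "primeideal P A \<and> \<not> D \<subseteq> P" unfolding E(2) by auto
  next
    assume P: "primeideal P A \<and> \<not> D \<subseteq> P"
    then obtain x where x: "x \<in> D" "x \<notin> P" by auto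
    from x(1) obtain E where "x \<in> E" "{P. primeideal P A \<and> \<not> E \<subseteq> P} \<in> \<K>"
      unfolding D_def by auto
    moreover have "P \<in> {P. primeideal P A \<and> \<not> E \<subseteq> P}" using P x(2) \<open>x \<in> E\<close> by auto
    ultimately show "P \<in> \<Union>\<K>" by (rule_tac UnionI)
  qed
  then have "\<Union>\<K> = {P. primeideal P A \<and> \<not> D \<subseteq> P}" by blast
  moreover have "D \<subseteq> carrier A" unfolding D_def by auto
  ultimately show "zariski_open A (\<Union>\<K>)" unfolding zariski_open_def by (intro exI[of _ D]) simp
qed

text \<open>
  A section of the structure sheaf over \<open>U\<close> assigns to each prime \<open>P\<close> in \<open>U\<close> an element of the
  local ring at \<open>P\<close>, and is locally given by a fraction.
\<close>

definition Spec :: "('a, 'b) ring_scheme \<Rightarrow> ('a set, 'a set \<Rightarrow> ('a \<times> 'a) set) ringed_space" where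
  "Spec A =
     \<lparr>rs_top = topology (zariski_open A),
      rs_ring = (\<lambda>U.
        \<lparr>carrier = {f \<in> (\<Pi>\<^sub>E P\<in>U. carrier (local_ring A P)).
            \<forall>P\<in>U. \<exists>V a s. zariski_open A V \<and> P \<in> V \<and> V \<subseteq> U \<and> a \<in> carrier A \<and> s \<in> carrier A \<and>
              (\<forall>Q\<in>V. s \<notin> Q \<and> f Q = loc_frac A (carrier A - Q) a s)},
         monoid.mult = (\<lambda>f g. \<lambda>P\<in>U. f P \<otimes>\<^bsub>local_ring A P\<^esub> g P),
         monoid.one = (\<lambda>P\<in>U. \<one>\<^bsub>local_ring A P\<^esub>),
         ring.zero = (\<lambda>P\<in>U. \<zero>\<^bsub>local_ring A P\<^esub>),
         ring.add = (\<lambda>f g. \<lambda>P\<in>U. f P \<oplus>\<^bsub>local_ring A P\<^esub> g P)\<rparr>),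
      rs_res = (\<lambda>U V f. restrict f V)\<rparr>"

section \<open>The coordinate ring\<close>

text \<open>
  The ring \<open>F[x, y] / (x y^q - y x^q - 1)\<close>, where \<open>F[x, y]\<close> is the iterated polynomial ring
  \<open>(F[x])[y]\<close>.
\<close>

definition poly_xy :: "('a, 'b) ring_scheme \<Rightarrow> (nat \<Rightarrow> 'a, nat \<Rightarrow> nat \<Rightarrow> 'a) up_ring" where
  "poly_xy F = UP (UP F)"

definition var_x :: "('a, 'b) ring_scheme \<Rightarrow> nat \<Rightarrow> nat \<Rightarrow> 'a" where
  "var_x F = monom (poly_xy F) (monom (UP F) \<one>\<^bsub>F\<^esub> 1) 0"

definition var_y :: "('a, 'b) ring_scheme \<Rightarrow> nat \<Rightarrow> nat \<Rightarrow> 'a" where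
  "var_y F = monom (poly_xy F) \<one>\<^bsub>UP F\<^esub> 1"

definition coord_ring :: "('a, 'b) ring_scheme \<Rightarrow> nat \<Rightarrow> (nat \<Rightarrow> nat \<Rightarrow> 'a) set ring" where
  "coord_ring F q = poly_xy F Quot PIdl\<^bsub>poly_xy F\<^esub>
     (var_x F \<otimes>\<^bsub>poly_xy F\<^esub> var_y F [^]\<^bsub>poly_xy F\<^esub> q \<ominus>\<^bsub>poly_xy F\<^esub>
      var_y F \<otimes>\<^bsub>poly_xy F\<^esub> var_x F [^]\<^bsub>poly_xy F\<^esub> q \<ominus>\<^bsub>poly_xy F\<^esub> \<one>\<^bsub>poly_xy F\<^esub>)"

end

theory Submission imports Defs "HOL-Number_Theory.Residues" begin

text \<open>
  Let \<open>A\<close> be the coordinate ring. The equation says \<open>x (y\<^sup>q - y x\<^bsup>q-1\<^esup>) = 1\<close>, so \<open>x\<close> is a unit;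
  in terms of \<open>s = y / x\<close> and \<open>T = s\<^sup>q - s\<close> it becomes \<open>T x\<^bsup>q+1\<^esup> = 1\<close>. Thus the curve is the
  cover of degree \<open>q + 1\<close> of the line with the \<open>q\<close> points of \<open>K\<close> removed that adjoins a root of \<open>1 / T\<close>,
  and \<open>A\<close> is the direct sum of the \<open>F[s] x\<^sup>k\<close>, where \<open>k\<close> runs through any \<open>q + 1\<close> consecutive exponents
  (\<open>curve_span\<close>, \<open>curve_free\<close>). Comparing leading terms shows that \<open>A\<close> is a domain (\<open>cover_domain\<close>).

  Let \<open>L\<close> be a line bundle with \<open>L\<^sup>p\<close> trivial. Local frames of \<open>L\<close> with transition functions \<open>g\<close> give
  frames of \<open>L\<^sup>p\<close> with transition functions \<open>g\<^sup>p\<close>, and a trivialisation of \<open>L\<^sup>p\<close> expresses them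
  by local units \<open>u\<close> with \<open>u\<^sub>j = g\<^sup>p u\<^sub>i\<close> (\<open>torsion_units\<close>). In the fraction field the \<open>u\<^sub>i\<close> agree up to
  \<open>p\<close>-th powers. If \<open>u\<^sub>i = w v\<^sub>i\<^sup>p\<close> with one global unit \<open>w\<close>, then \<open>v\<^sub>j = g v\<^sub>i\<close>, since Frobenius is
  injective, and the local frames divided by the \<open>v\<^sub>i\<close> glue to a global frame of \<open>L\<close>. This reduces the
  statement to finding \<open>w\<close>, which is a question about elements of \<open>A\<close>
  (\<open>Pic_Spec_torsion_trivial\<close>).

  The derivation \<open>D = d/ds\<close> extends to \<open>A\<close>, as \<open>x\<^sup>2\<close> times the one in \<open>curve_derivation\<close>. It satisfies \<open>D\<^sup>p = 0\<close>, and its kernel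
  consists of the \<open>p\<close>-th powers, because an algebraic extension of a finite field is perfect
  (\<open>Cartier_kernel\<close>). The logarithmic derivative \<open>g = D u\<^sub>i / u\<^sub>i\<close> is the same for all \<open>i\<close>, and it has no
  poles, because each point has a neighbourhood on which some \<open>u\<^sub>i\<close> is a unit; so \<open>g \<in> A\<close>. If \<open>g = D w / w\<close>
  for a unit \<open>w\<close> of \<open>A\<close>, then \<open>D (u\<^sub>i / w) = 0\<close> and \<open>w\<close> is as required. By Jacobson's formula
  \<open>(D + g)\<^sup>p 1 = D\<^bsup>p-1\<^esup> g + g\<^sup>p\<close>, the element \<open>g\<close> satisfies \<open>D\<^bsup>p-1\<^esup> g = - g\<^sup>p\<close> (\<open>p_curvature\<close>,
  \<open>local_p_powers\<close>). It remains to see that every solution of this equation in \<open>A\<close> is a logarithmic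
  derivative of a unit.

  In terms of the Cartier operator \<open>C\<close>, defined by \<open>D\<^bsup>p-1\<^esup> a = - (C a)\<^sup>p\<close>, the equation is \<open>C g = g\<close>.
  Because of \<open>x\<^sup>k = (x\<^sup>k)\<^bsup>q\<^sup>2\<^esup> T\<^bsup>(q-1)k\<^esup>\<close>, the iterate of \<open>C\<close> that takes \<open>q\<^sup>2\<close>-th roots respects the
  decomposition into the \<open>F[s] x\<^sup>k\<close> (\<open>fixed_repr\<close>). Divisibility by \<open>T\<close> and a comparison of degrees
  leave only the summand \<open>k = q + 1\<close>, that is, \<open>g = r / T\<close> with a polynomial \<open>r\<close> in \<open>s\<close> of degree less
  than \<open>q\<close> (\<open>fixed_form\<close>). Such a \<open>g\<close> has simple poles at the points \<open>a\<close> of \<open>K\<close>; its residues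
  \<open>- r(a)\<close> are fixed by Frobenius (\<open>fixed_residue\<close>), hence are integers \<open>m\<^sub>a\<close> modulo \<open>p\<close>, and \<open>g\<close> is the
  logarithmic derivative of the product of the \<open>(s - a)\<^bsup>m\<^sub>a\<^esup>\<close>, which is a unit since \<open>s - a\<close> divides
  \<open>T\<close> (\<open>dlog_fixed\<close>).
\<close>

section \<open>Tensor products of modules\<close>

definition tensor_class :: "('s, 'c) ring_scheme \<Rightarrow> ('s, 'm) module \<Rightarrow> ('s, 'n) module
    \<Rightarrow> ('m \<times> 'n \<Rightarrow>\<^sub>0 int) \<Rightarrow> ('m \<times> 'n \<Rightarrow>\<^sub>0 int) set" where
  "tensor_class R M N c = tensor_kernel R M N #>\<^bsub>tensor_free M N\<^esub> c"

locale tensor_pair = M: module R M + N: module R N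
  for R :: "('s, 'c) ring_scheme" and M :: "('s, 'm) module" and N :: "('s, 'n) module"
begin

abbreviation "Ker \<equiv> tensor_kernel R M N"
abbreviation "cls \<equiv> tensor_class R M N"
abbreviation "S \<equiv> carrier M \<times> carrier N"

lemma relators_carrier: "tensor_relators R M N \<subseteq> carrier (tensor_free M N)"
proof -
  have k2: "Poly_Mapping.keys (frag_of a - frag_of b) \<subseteq> A" if "a \<in> A" "b \<in> A"
    for a b :: "'m \<times> 'n" and A
    using that keys_diff[of "frag_of a" "frag_of b"] by (auto simp: keys_frag_of)
  have k3: "Poly_Mapping.keys (frag_of a - frag_of b - frag_of c) \<subseteq> A" if "a \<in> A" "b \<in> A" "c \<in> A"
    for a b c :: "'m \<times> 'n" and A
    using that keys_diff[of "frag_of a - frag_of b" "frag_of c"] k2[of a A b] by (auto simp: keys_frag_of)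
  have "Poly_Mapping.keys c \<subseteq> S" if "c \<in> tensor_relators R M N" for c
    using that unfolding tensor_relators_def
    by (elim UnE CollectE exE conjE) (simp_all only: k2 k3 mem_Times_iff fst_conv snd_conv simp_thms M.a_closed N.a_closed M.smult_closed N.smult_closed)
  then show ?thesis by auto
qed

lemma Ker_subgroup: "subgroup Ker (tensor_free M N)"
  unfolding tensor_kernel_def
  by (rule group.generate_is_subgroup[OF group_free_Abelian_group relators_carrier])

lemma Ker_carrier: "c \<in> Ker \<Longrightarrow> Poly_Mapping.keys c \<subseteq> S"
  using subsetD[OF subgroup.subset[OF Ker_subgroup], of c] by simp

lemma Ker_0: "0 \<in> Ker"
  using subgroup.one_closed[OF Ker_subgroup] by simp

lemma Ker_add: "c \<in> Ker \<Longrightarrow> d \<in> Ker \<Longrightarrow> c + d \<in> Ker"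
  using subgroup.m_closed[OF Ker_subgroup] by simp

lemma Ker_minus: "c \<in> Ker \<Longrightarrow> - c \<in> Ker"
  using subgroup.m_inv_closed[OF Ker_subgroup, of c] Ker_carrier by simp

lemma Ker_diff: "c \<in> Ker \<Longrightarrow> d \<in> Ker \<Longrightarrow> c - d \<in> Ker"
  using Ker_add[of c "-d"] Ker_minus by simp

lemma Ker_relator: "c \<in> tensor_relators R M N \<Longrightarrow> c \<in> Ker"
  unfolding tensor_kernel_def by (rule generate.incl)

lemma mem_cls: "d \<in> cls c \<longleftrightarrow> d - c \<in> Ker"
proof
  assume "d \<in> cls c"
  then obtain k where "k \<in> Ker" "d = k + c"
    unfolding tensor_class_def r_coset_def by auto
  then show "d - c \<in> Ker" by simp
next
  assume "d - c \<in> Ker"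
  then show "d \<in> cls c"
    unfolding tensor_class_def r_coset_def by (auto intro!: bexI[of _ "d - c"])
qed

lemma cls_eq: "cls c = cls d \<longleftrightarrow> c - d \<in> Ker"
proof
  assume "cls c = cls d"
  moreover have "c \<in> cls c" using Ker_0 by (simp add: mem_cls)
  ultimately show "c - d \<in> Ker" using mem_cls by simp
next
  assume a: "c - d \<in> Ker"
  have "e \<in> cls c \<longleftrightarrow> e \<in> cls d" for e
    using Ker_add[OF _ a, of "e - c"] Ker_diff[OF _ a, of "e - d"] by (auto simp: mem_cls)
  then show "cls c = cls d" by blast
qed

lemma mem_cls_self: "c \<in> cls c"
  using Ker_0 by (simp add: mem_cls)

lemma cls_add_l: "x \<in> carrier M \<Longrightarrow> x' \<in> carrier M \<Longrightarrow> y \<in> carrier N \<Longrightarrow>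
    cls (frag_of (x \<oplus>\<^bsub>M\<^esub> x', y)) = cls (frag_of (x, y) + frag_of (x', y))"
  unfolding cls_eq diff_diff_eq[symmetric]
  by (rule Ker_relator) (auto simp: tensor_relators_def)

lemma cls_add_r: "x \<in> carrier M \<Longrightarrow> y \<in> carrier N \<Longrightarrow> y' \<in> carrier N \<Longrightarrow>
    cls (frag_of (x, y \<oplus>\<^bsub>N\<^esub> y')) = cls (frag_of (x, y) + frag_of (x, y'))"
  unfolding cls_eq diff_diff_eq[symmetric]
  by (rule Ker_relator) (auto simp: tensor_relators_def)

lemma cls_smult: "r \<in> carrier R \<Longrightarrow> x \<in> carrier M \<Longrightarrow> y \<in> carrier N \<Longrightarrow>
    cls (frag_of (r \<odot>\<^bsub>M\<^esub> x, y)) = cls (frag_of (x, r \<odot>\<^bsub>N\<^esub> y))"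
  unfolding cls_eq by (rule Ker_relator) (auto simp: tensor_relators_def)

lemma carrier_tensor: "carrier (tensor R M N) = cls ` {c. Poly_Mapping.keys c \<subseteq> S}"
  unfolding tensor_def tensor_class_def FactGroup_def RCOSETS_def
  by (auto simp: free_Abelian_group_def)

lemma zero_tensor: "\<zero>\<^bsub>tensor R M N\<^esub> = cls 0"
  unfolding tensor_def tensor_class_def FactGroup_def
  using r_coset_def[of "tensor_free M N" Ker] by simp

lemma add_tensor: "cls c \<oplus>\<^bsub>tensor R M N\<^esub> cls d = cls (c + d)"
proof -
  have "cls c \<oplus>\<^bsub>tensor R M N\<^esub> cls d = (\<Union>a\<in>cls c. \<Union>b\<in>cls d. {a + b})"
    unfolding tensor_def FactGroup_def set_mult_def by simp
  also have "\<dots> = cls (c + d)"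
  proof (intro equalityI subsetI)
    fix e assume "e \<in> (\<Union>a\<in>cls c. \<Union>b\<in>cls d. {a + b})"
    then obtain a b where ab: "a - c \<in> Ker" "b - d \<in> Ker" "e = a + b" by (auto simp: mem_cls)
    show "e \<in> cls (c + d)" using Ker_add[OF ab(1,2)] by (simp add: mem_cls ab(3) algebra_simps)
  next
    fix e assume "e \<in> cls (c + d)"
    then have "e - d \<in> cls c" by (simp add: mem_cls algebra_simps)
    moreover have "e = (e - d) + d" by simp
    ultimately show "e \<in> (\<Union>a\<in>cls c. \<Union>b\<in>cls d. {a + b})" using mem_cls_self by blast
  qed
  finally show ?thesis .
qed

end

text \<open>
  Semilinear maps send each of the three kinds of relators to a relator of the same kind, hence the
  subgroup generated by relators into the corresponding subgroup.
\<close>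

lemma tensor_map_Ker:
  assumes "tensor_pair R M N" "tensor_pair R' M' N'"
    and f: "\<And>x. x \<in> carrier M \<Longrightarrow> f x \<in> carrier M'" "\<And>y. y \<in> carrier N \<Longrightarrow> g y \<in> carrier N'"
    and add: "\<And>x x'. x \<in> carrier M \<Longrightarrow> x' \<in> carrier M \<Longrightarrow> f (x \<oplus>\<^bsub>M\<^esub> x') = f x \<oplus>\<^bsub>M'\<^esub> f x'"
      "\<And>x x'. x \<in> carrier N \<Longrightarrow> x' \<in> carrier N \<Longrightarrow> g (x \<oplus>\<^bsub>N\<^esub> x') = g x \<oplus>\<^bsub>N'\<^esub> g x'"
    and smult: "\<And>r. r \<in> carrier R \<Longrightarrow> \<rho> r \<in> carrier R'"
      "\<And>r x. r \<in> carrier R \<Longrightarrow> x \<in> carrier M \<Longrightarrow> f (r \<odot>\<^bsub>M\<^esub> x) = \<rho> r \<odot>\<^bsub>M'\<^esub> f x"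
      "\<And>r x. r \<in> carrier R \<Longrightarrow> x \<in> carrier N \<Longrightarrow> g (r \<odot>\<^bsub>N\<^esub> x) = \<rho> r \<odot>\<^bsub>N'\<^esub> g x"
    and c: "c \<in> tensor_kernel R M N"
  shows "frag_extend (\<lambda>(x, y). frag_of (f x, g y)) c \<in> tensor_kernel R' M' N'"
proof -
  interpret A: tensor_pair R M N by fact
  interpret B: tensor_pair R' M' N' by fact
  let ?h = "frag_extend (\<lambda>(x, y). frag_of (f x, g y))"
  have rel: "?h k \<in> B.Ker" if "k \<in> tensor_relators R M N" for k
  proof -
    from that consider
      (add_l) x x' y where "k = frag_of (x \<oplus>\<^bsub>M\<^esub> x', y) - frag_of (x, y) - frag_of (x', y)"
        "x \<in> carrier M" "x' \<in> carrier M" "y \<in> carrier N"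
      | (add_r) x y y' where "k = frag_of (x, y \<oplus>\<^bsub>N\<^esub> y') - frag_of (x, y) - frag_of (x, y')"
        "x \<in> carrier M" "y \<in> carrier N" "y' \<in> carrier N"
      | (smult) r x y where "k = frag_of (r \<odot>\<^bsub>M\<^esub> x, y) - frag_of (x, r \<odot>\<^bsub>N\<^esub> y)"
        "r \<in> carrier R" "x \<in> carrier M" "y \<in> carrier N"
      unfolding tensor_relators_def by blast
    then show ?thesis
    proof cases
      case add_l
      then show ?thesis
        using B.cls_add_l[of "f x" "f x'" "g y"]
        by (simp add: frag_extend_diff frag_extend_add add f B.cls_eq diff_diff_eq)
    next
      case add_r
      then show ?thesis
        using B.cls_add_r[of "f x" "g y" "g y'"]
        by (simp add: frag_extend_diff frag_extend_add add f B.cls_eq diff_diff_eq)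
    next
      case (smult r x y)
      then show ?thesis
        using B.cls_smult[of "\<rho> r" "f x" "g y"]
        by (simp add: frag_extend_diff assms f B.cls_eq)
    qed
  qed
  show ?thesis using c unfolding tensor_kernel_def[of R M N]
  proof (induction rule: generate.induct)
    case one
    then show ?case using B.Ker_0 by simp
  next
    case (incl k)
    then show ?case by (rule rel)
  next
    case (inv k)
    then have "inv\<^bsub>tensor_free M N\<^esub> k = - k"
      using subsetD[OF A.relators_carrier, of k] by simp
    then show ?case using B.Ker_minus[OF rel[OF inv]] by (simp add: frag_extend_minus)
  next
    case (eng h1 h2)
    then show ?case using B.Ker_add by (simp add: frag_extend_add)
  qed
qed

lemma keys_frag_extend_pair:
  assumes f: "\<And>x. x \<in> A \<Longrightarrow> f x \<in> A'" "\<And>y. y \<in> B \<Longrightarrow> g y \<in> B'"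
    and c: "Poly_Mapping.keys c \<subseteq> A \<times> B"
  shows "Poly_Mapping.keys (frag_extend (\<lambda>(x, y). frag_of (f x, g y)) c) \<subseteq> A' \<times> B'"
  using keys_frag_extend[of "\<lambda>(x, y). frag_of (f x, g y)" c] c f
  by (fastforce simp: keys_frag_of split: prod.splits)

text \<open>
  The scalar action and the restriction maps of a tensor product are unions over all representatives of
  a class. By \<open>tensor_map_Ker\<close> all representatives contribute the same coset, and the union collapses.
\<close>

lemma tensor_map_class:
  assumes AB: "tensor_pair R M N" "tensor_pair R' M' N'"
    and f: "\<And>x. x \<in> carrier M \<Longrightarrow> f x \<in> carrier M'" "\<And>y. y \<in> carrier N \<Longrightarrow> g y \<in> carrier N'"
    and add: "\<And>x x'. x \<in> carrier M \<Longrightarrow> x' \<in> carrier M \<Longrightarrow> f (x \<oplus>\<^bsub>M\<^esub> x') = f x \<oplus>\<^bsub>M'\<^esub> f x'"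
      "\<And>x x'. x \<in> carrier N \<Longrightarrow> x' \<in> carrier N \<Longrightarrow> g (x \<oplus>\<^bsub>N\<^esub> x') = g x \<oplus>\<^bsub>N'\<^esub> g x'"
    and smult: "\<And>r. r \<in> carrier R \<Longrightarrow> \<rho> r \<in> carrier R'"
      "\<And>r x. r \<in> carrier R \<Longrightarrow> x \<in> carrier M \<Longrightarrow> f (r \<odot>\<^bsub>M\<^esub> x) = \<rho> r \<odot>\<^bsub>M'\<^esub> f x"
      "\<And>r x. r \<in> carrier R \<Longrightarrow> x \<in> carrier N \<Longrightarrow> g (r \<odot>\<^bsub>N\<^esub> x) = \<rho> r \<odot>\<^bsub>N'\<^esub> g x"
  shows "(\<Union>c\<in>tensor_class R M N d. tensor_kernel R' M' N' #>\<^bsub>tensor_free M' N'\<^esub>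
      frag_extend (\<lambda>(x, y). frag_of (f x, g y)) c) =
    tensor_class R' M' N' (frag_extend (\<lambda>(x, y). frag_of (f x, g y)) d)"
proof -
  interpret A: tensor_pair R M N by fact
  interpret B: tensor_pair R' M' N' by fact
  let ?h = "frag_extend (\<lambda>(x, y). frag_of (f x, g y))"
  have eq: "tensor_class R' M' N' (?h c) = tensor_class R' M' N' (?h d)" if "c \<in> tensor_class R M N d" for c
  proof -
    have "?h (c - d) \<in> B.Ker"
      by (rule tensor_map_Ker[OF AB f add smult]) (use that A.mem_cls in auto)
    then show ?thesis by (simp add: B.cls_eq frag_extend_diff)
  qed
  show ?thesis unfolding tensor_class_def[of R', symmetric]
    by (rule UN_constant_eq[OF A.mem_cls_self]) (intro ballI, rule eq)
qed

context tensor_pair begin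

lemma pair_self: "tensor_pair R M N" by unfold_locales

lemma smult_tensor:
  assumes r: "r \<in> carrier R"
  shows "r \<odot>\<^bsub>tensor R M N\<^esub> cls c = cls (frag_extend (\<lambda>(x, y). frag_of (r \<odot>\<^bsub>M\<^esub> x, y)) c)"
  unfolding tensor_def module.simps
  by (rule tensor_map_class[OF pair_self pair_self, where \<rho> = id])
    (use r in \<open>auto simp: M.smult_r_distr M.smult_assoc1[symmetric] M.R.m_comm\<close>)

lemma keys_smult:
  assumes "r \<in> carrier R" "Poly_Mapping.keys c \<subseteq> S"
  shows "Poly_Mapping.keys (frag_extend (\<lambda>(x, y). frag_of (r \<odot>\<^bsub>M\<^esub> x, y)) c) \<subseteq> S"
  using assms by (intro keys_frag_extend_pair) auto

lemma tensor_module: "module R (tensor R M N)"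
proof (rule moduleI)
  show "cring R" by unfold_locales
  show "abelian_group (tensor R M N)"
  proof (rule abelian_groupI)
    fix x y z
    assume "x \<in> carrier (tensor R M N)" "y \<in> carrier (tensor R M N)"
    then obtain c d where cd: "x = cls c" "y = cls d" "Poly_Mapping.keys c \<subseteq> S" "Poly_Mapping.keys d \<subseteq> S"
      by (auto simp: carrier_tensor)
    show "x \<oplus>\<^bsub>tensor R M N\<^esub> y \<in> carrier (tensor R M N)"
      using cd keys_add[of c d] by (auto simp: add_tensor carrier_tensor)
    show "x \<oplus>\<^bsub>tensor R M N\<^esub> y = y \<oplus>\<^bsub>tensor R M N\<^esub> x"
      using cd by (simp add: add_tensor add.commute)
    show "\<zero>\<^bsub>tensor R M N\<^esub> \<oplus>\<^bsub>tensor R M N\<^esub> x = x" by (simp add: zero_tensor cd add_tensor)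
    show "\<exists>y\<in>carrier (tensor R M N). y \<oplus>\<^bsub>tensor R M N\<^esub> x = \<zero>\<^bsub>tensor R M N\<^esub>"
    proof
      show "cls (- c) \<oplus>\<^bsub>tensor R M N\<^esub> x = \<zero>\<^bsub>tensor R M N\<^esub>"
        by (simp add: cd add_tensor zero_tensor)
      show "cls (- c) \<in> carrier (tensor R M N)" using cd(3) by (auto simp: carrier_tensor)
    qed
    assume "z \<in> carrier (tensor R M N)"
    then obtain e where e: "z = cls e" by (auto simp: carrier_tensor)
    show "(x \<oplus>\<^bsub>tensor R M N\<^esub> y) \<oplus>\<^bsub>tensor R M N\<^esub> z = x \<oplus>\<^bsub>tensor R M N\<^esub> (y \<oplus>\<^bsub>tensor R M N\<^esub> z)"
      by (simp add: cd e add_tensor add.assoc)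
  qed (auto simp: zero_tensor carrier_tensor)
next
  fix a x assume a: "a \<in> carrier R" and "x \<in> carrier (tensor R M N)"
  then obtain c where c: "x = cls c" "Poly_Mapping.keys c \<subseteq> S" by (auto simp: carrier_tensor)
  show "a \<odot>\<^bsub>tensor R M N\<^esub> x \<in> carrier (tensor R M N)"
    using keys_smult[OF a c(2)] by (auto simp: c smult_tensor[OF a] carrier_tensor)
  fix b assume b: "b \<in> carrier R"
  have "frag_extend (\<lambda>(x, y). frag_of ((a \<oplus>\<^bsub>R\<^esub> b) \<odot>\<^bsub>M\<^esub> x, y)) c - (frag_extend (\<lambda>(x, y). frag_of (a \<odot>\<^bsub>M\<^esub> x, y)) c
    + frag_extend (\<lambda>(x, y). frag_of (b \<odot>\<^bsub>M\<^esub> x, y)) c) \<in> Ker" (is "?D c \<in> _")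
    using c(2)
  proof (induction c rule: frag_induction)
    case zero
    then show ?case using Ker_0 by simp
  next
    case (one z)
    then obtain u v where uv: "z = (u, v)" "u \<in> carrier M" "v \<in> carrier N" by auto
    show ?case using cls_add_l[of "a \<odot>\<^bsub>M\<^esub> u" "b \<odot>\<^bsub>M\<^esub> u" v] uv a b
      by (simp add: cls_eq M.smult_l_distr)
  next
    case (diff a b)
    have "?D (a - b) = ?D a - ?D b" by (simp add: frag_extend_diff algebra_simps)
    then show ?case using diff Ker_diff by simp
  qed
  then show "(a \<oplus>\<^bsub>R\<^esub> b) \<odot>\<^bsub>tensor R M N\<^esub> x = a \<odot>\<^bsub>tensor R M N\<^esub> x \<oplus>\<^bsub>tensor R M N\<^esub> b \<odot>\<^bsub>tensor R M N\<^esub> x"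
    using a b by (simp add: c smult_tensor add_tensor cls_eq)
  have "frag_extend (\<lambda>(x, y). frag_of ((a \<otimes>\<^bsub>R\<^esub> b) \<odot>\<^bsub>M\<^esub> x, y)) c =
    frag_extend (\<lambda>(x, y). frag_of (a \<odot>\<^bsub>M\<^esub> x, y)) (frag_extend (\<lambda>(x, y). frag_of (b \<odot>\<^bsub>M\<^esub> x, y)) c)"
    using c(2)
    by (induction c rule: frag_induction)
      (auto simp: M.smult_assoc1 a b frag_extend_diff)
  then show "(a \<otimes>\<^bsub>R\<^esub> b) \<odot>\<^bsub>tensor R M N\<^esub> x = a \<odot>\<^bsub>tensor R M N\<^esub> (b \<odot>\<^bsub>tensor R M N\<^esub> x)"
    using a b by (simp add: c smult_tensor)
next
  fix a x y assume a: "a \<in> carrier R" and "x \<in> carrier (tensor R M N)" "y \<in> carrier (tensor R M N)"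
  then obtain c d where c: "x = cls c" "y = cls d" by (auto simp: carrier_tensor)
  show "a \<odot>\<^bsub>tensor R M N\<^esub> (x \<oplus>\<^bsub>tensor R M N\<^esub> y) =
    a \<odot>\<^bsub>tensor R M N\<^esub> x \<oplus>\<^bsub>tensor R M N\<^esub> a \<odot>\<^bsub>tensor R M N\<^esub> y"
    by (simp add: c add_tensor smult_tensor a frag_extend_add)
next
  fix x assume "x \<in> carrier (tensor R M N)"
  then obtain c where c: "x = cls c" "Poly_Mapping.keys c \<subseteq> S" by (auto simp: carrier_tensor)
  have "frag_extend (\<lambda>(x, y). frag_of (\<one>\<^bsub>R\<^esub> \<odot>\<^bsub>M\<^esub> x, y)) c = c" using c(2)
    by (induction c rule: frag_induction) (auto simp: frag_extend_diff)
  then show "\<one>\<^bsub>R\<^esub> \<odot>\<^bsub>tensor R M N\<^esub> x = x" by (simp add: c smult_tensor)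
qed

end

section \<open>Presheaves of modules\<close>

lemma presheaf_module: "module_presheaf Y L \<Longrightarrow> rs_open Y U \<Longrightarrow> module (rs_ring Y U) (sm_sec L U)"
  by (simp add: module_presheaf_def Pi_iff)

lemma presheaf_res_closed: "module_presheaf Y L \<Longrightarrow> rs_open Y U \<Longrightarrow> rs_open Y V \<Longrightarrow> V \<subseteq> U \<Longrightarrow>
    s \<in> carrier (sm_sec L U) \<Longrightarrow> sm_res L U V s \<in> carrier (sm_sec L V)"
  by (simp add: module_presheaf_def Pi_iff)

lemma presheaf_res_add: "module_presheaf Y L \<Longrightarrow> rs_open Y U \<Longrightarrow> rs_open Y V \<Longrightarrow> V \<subseteq> U \<Longrightarrow>
    s \<in> carrier (sm_sec L U) \<Longrightarrow> t \<in> carrier (sm_sec L U) \<Longrightarrow>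
    sm_res L U V (s \<oplus>\<^bsub>sm_sec L U\<^esub> t) = sm_res L U V s \<oplus>\<^bsub>sm_sec L V\<^esub> sm_res L U V t"
  by (simp add: module_presheaf_def Pi_iff)

lemma presheaf_res_smult: "module_presheaf Y L \<Longrightarrow> rs_open Y U \<Longrightarrow> rs_open Y V \<Longrightarrow> V \<subseteq> U \<Longrightarrow>
    r \<in> carrier (rs_ring Y U) \<Longrightarrow> s \<in> carrier (sm_sec L U) \<Longrightarrow>
    sm_res L U V (r \<odot>\<^bsub>sm_sec L U\<^esub> s) = rs_res Y U V r \<odot>\<^bsub>sm_sec L V\<^esub> sm_res L U V s"
  by (simp add: module_presheaf_def Pi_iff)

lemma presheaf_res_id: "module_presheaf Y L \<Longrightarrow> rs_open Y U \<Longrightarrow> s \<in> carrier (sm_sec L U) \<Longrightarrow>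
    sm_res L U U s = s"
  by (simp add: module_presheaf_def Pi_iff)

lemma presheaf_res_comp: "module_presheaf Y L \<Longrightarrow> rs_open Y U \<Longrightarrow> rs_open Y V \<Longrightarrow> rs_open Y W \<Longrightarrow>
    W \<subseteq> V \<Longrightarrow> V \<subseteq> U \<Longrightarrow> s \<in> carrier (sm_sec L U) \<Longrightarrow>
    sm_res L V W (sm_res L U V s) = sm_res L U W s"
  by (simp add: module_presheaf_def Pi_iff)

lemma structure_mod_simps [simp]:
  "carrier (sm_sec (structure_mod Y) U) = carrier (rs_ring Y U)"
  "a \<oplus>\<^bsub>sm_sec (structure_mod Y) U\<^esub> b = a \<oplus>\<^bsub>rs_ring Y U\<^esub> b"
  "a \<odot>\<^bsub>sm_sec (structure_mod Y) U\<^esub> b = a \<otimes>\<^bsub>rs_ring Y U\<^esub> b"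
  "sm_res (structure_mod Y) = rs_res Y"
  unfolding structure_mod_def by simp_all

text \<open>
  That restriction is a ring homomorphism is mostly contained in the sheaf axioms for the structure
  sheaf as a module over itself; these do not determine the image of the unit.
\<close>

locale sheaf_ringed =
  fixes Y :: "('p, 's) ringed_space"
  assumes structure_sheaf: "module_sheaf Y (structure_mod Y)"
    and res_one: "\<And>U V. rs_open Y U \<Longrightarrow> rs_open Y V \<Longrightarrow> V \<subseteq> U \<Longrightarrow>
      rs_res Y U V \<one>\<^bsub>rs_ring Y U\<^esub> = \<one>\<^bsub>rs_ring Y V\<^esub>"
begin

abbreviation "\<O> \<equiv> rs_ring Y"

lemma structure_presheaf: "module_presheaf Y (structure_mod Y)"
  using structure_sheaf unfolding module_sheaf_def by blast

lemma cring_O: "rs_open Y U \<Longrightarrow> cring (\<O> U)"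
  using presheaf_module[OF structure_presheaf] module.axioms(1) by blast

lemma res_closed: "rs_open Y U \<Longrightarrow> rs_open Y V \<Longrightarrow> V \<subseteq> U \<Longrightarrow> a \<in> carrier (\<O> U) \<Longrightarrow>
    rs_res Y U V a \<in> carrier (\<O> V)"
  using presheaf_res_closed[OF structure_presheaf, of U V a] by simp

lemma res_mult: "rs_open Y U \<Longrightarrow> rs_open Y V \<Longrightarrow> V \<subseteq> U \<Longrightarrow> a \<in> carrier (\<O> U) \<Longrightarrow> b \<in> carrier (\<O> U) \<Longrightarrow>
    rs_res Y U V (a \<otimes>\<^bsub>\<O> U\<^esub> b) = rs_res Y U V a \<otimes>\<^bsub>\<O> V\<^esub> rs_res Y U V b"
  using presheaf_res_smult[OF structure_presheaf, of U V a b] by simp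

lemma res_comp: "rs_open Y U \<Longrightarrow> rs_open Y V \<Longrightarrow> rs_open Y W \<Longrightarrow> W \<subseteq> V \<Longrightarrow> V \<subseteq> U \<Longrightarrow> a \<in> carrier (\<O> U) \<Longrightarrow>
    rs_res Y V W (rs_res Y U V a) = rs_res Y U W a"
  using presheaf_res_comp[OF structure_presheaf, of U V W a] by simp

lemma tensor_pair_presheaf:
  "module_presheaf Y L \<Longrightarrow> module_presheaf Y M \<Longrightarrow> rs_open Y U \<Longrightarrow>
    tensor_pair (\<O> U) (sm_sec L U) (sm_sec M U)"
  by (intro tensor_pair.intro presheaf_module)

lemma tensor_presheaf_sec: "sm_sec (tensor_presheaf Y L M) U = tensor (\<O> U) (sm_sec L U) (sm_sec M U)"
  by (simp add: tensor_presheaf_def)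

lemma tensor_presheaf_res:
  assumes "module_presheaf Y L" "module_presheaf Y M" "rs_open Y U" "rs_open Y V" "V \<subseteq> U"
  shows "sm_res (tensor_presheaf Y L M) U V (tensor_class (\<O> U) (sm_sec L U) (sm_sec M U) c) =
    tensor_class (\<O> V) (sm_sec L V) (sm_sec M V)
      (frag_extend (\<lambda>(x, y). frag_of (sm_res L U V x, sm_res M U V y)) c)"
  unfolding tensor_presheaf_def sheaf_mod.simps
  using assms
  by (intro tensor_map_class[where \<rho> = "rs_res Y U V"] tensor_pair_presheaf presheaf_res_closed
      presheaf_res_add presheaf_res_smult res_closed)

lemma tensor_presheaf_presheaf:
  assumes L: "module_presheaf Y L" and M: "module_presheaf Y M"
  shows "module_presheaf Y (tensor_presheaf Y L M)"
proof -
  let ?T = "tensor_presheaf Y L M"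
  let ?c = "\<lambda>U. tensor_class (\<O> U) (sm_sec L U) (sm_sec M U)"
  have mod: "module (\<O> U) (sm_sec ?T U)" if "rs_open Y U" for U
    using tensor_pair.tensor_module[OF tensor_pair_presheaf[OF L M that]]
    by (simp add: tensor_presheaf_sec)
  have maps: "sm_res ?T U V s \<in> carrier (sm_sec ?T V)"
    "t \<in> carrier (sm_sec ?T U) \<Longrightarrow>
      sm_res ?T U V (s \<oplus>\<^bsub>sm_sec ?T U\<^esub> t) = sm_res ?T U V s \<oplus>\<^bsub>sm_sec ?T V\<^esub> sm_res ?T U V t"
    "r \<in> carrier (\<O> U) \<Longrightarrow>
      sm_res ?T U V (r \<odot>\<^bsub>sm_sec ?T U\<^esub> s) = rs_res Y U V r \<odot>\<^bsub>sm_sec ?T V\<^esub> sm_res ?T U V s"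
    if UV: "rs_open Y U" "rs_open Y V" "V \<subseteq> U" and s: "s \<in> carrier (sm_sec ?T U)" for U V s t r
  proof -
    interpret U: tensor_pair "\<O> U" "sm_sec L U" "sm_sec M U" by (rule tensor_pair_presheaf) fact+
    interpret V: tensor_pair "\<O> V" "sm_sec L V" "sm_sec M V" by (rule tensor_pair_presheaf) fact+
    note res = tensor_presheaf_res[OF L M UV]
    from s obtain c where c: "s = ?c U c" "Poly_Mapping.keys c \<subseteq> U.S"
      by (auto simp: tensor_presheaf_sec U.carrier_tensor)
    let ?h = "frag_extend (\<lambda>(x, y). frag_of (sm_res L U V x, sm_res M U V y))"
    have "Poly_Mapping.keys (?h c) \<subseteq> V.S"
      by (rule keys_frag_extend_pair[OF _ _ c(2)])
        (use presheaf_res_closed[OF L UV] presheaf_res_closed[OF M UV] in auto)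
    then show "sm_res ?T U V s \<in> carrier (sm_sec ?T V)"
      by (auto simp: c res tensor_presheaf_sec V.carrier_tensor)
    show "sm_res ?T U V (s \<oplus>\<^bsub>sm_sec ?T U\<^esub> t) = sm_res ?T U V s \<oplus>\<^bsub>sm_sec ?T V\<^esub> sm_res ?T U V t"
      if t: "t \<in> carrier (sm_sec ?T U)"
    proof -
      from t obtain d where d: "t = ?c U d"
        by (auto simp: tensor_presheaf_sec U.carrier_tensor)
      show ?thesis
        by (simp add: c d tensor_presheaf_sec U.add_tensor V.add_tensor res frag_extend_add)
    qed
    show "sm_res ?T U V (r \<odot>\<^bsub>sm_sec ?T U\<^esub> s) = rs_res Y U V r \<odot>\<^bsub>sm_sec ?T V\<^esub> sm_res ?T U V s"
      if r: "r \<in> carrier (\<O> U)"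
    proof -
      have "?h (frag_extend (\<lambda>(x, y). frag_of (r \<odot>\<^bsub>sm_sec L U\<^esub> x, y)) c) =
        frag_extend (\<lambda>(x, y). frag_of (rs_res Y U V r \<odot>\<^bsub>sm_sec L V\<^esub> x, y)) (?h c)"
        using c(2)
        by (induction c rule: frag_induction)
          (auto simp: frag_extend_diff presheaf_res_smult[OF L UV r])
      then show ?thesis using r res_closed[OF UV r]
        by (simp add: c tensor_presheaf_sec U.smult_tensor V.smult_tensor res)
    qed
  qed
  have "sm_res ?T U U s = s" if U: "rs_open Y U" and s: "s \<in> carrier (sm_sec ?T U)" for U s
  proof -
    interpret U: tensor_pair "\<O> U" "sm_sec L U" "sm_sec M U" by (rule tensor_pair_presheaf) fact+
    from s obtain c where c: "s = ?c U c" "Poly_Mapping.keys c \<subseteq> U.S"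
      by (auto simp: tensor_presheaf_sec U.carrier_tensor)
    have "frag_extend (\<lambda>(x, y). frag_of (sm_res L U U x, sm_res M U U y)) c = c" using c(2)
      by (induction c rule: frag_induction)
        (auto simp: frag_extend_diff presheaf_res_id[OF L U] presheaf_res_id[OF M U])
    then show ?thesis by (simp add: c tensor_presheaf_res[OF L M U U])
  qed
  moreover have "sm_res ?T V W (sm_res ?T U V s) = sm_res ?T U W s"
    if UVW: "rs_open Y U" "rs_open Y V" "rs_open Y W" "W \<subseteq> V" "V \<subseteq> U"
      and s: "s \<in> carrier (sm_sec ?T U)" for U V W s
  proof -
    interpret U: tensor_pair "\<O> U" "sm_sec L U" "sm_sec M U" by (rule tensor_pair_presheaf) fact+
    from s obtain c where c: "s = ?c U c" "Poly_Mapping.keys c \<subseteq> U.S"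
      by (auto simp: tensor_presheaf_sec U.carrier_tensor)
    have "frag_extend (\<lambda>(x, y). frag_of (sm_res L V W x, sm_res M V W y))
        (frag_extend (\<lambda>(x, y). frag_of (sm_res L U V x, sm_res M U V y)) c) =
        frag_extend (\<lambda>(x, y). frag_of (sm_res L U W x, sm_res M U W y)) c" using c(2)
      by (induction c rule: frag_induction)
        (auto simp: frag_extend_diff presheaf_res_comp[OF L UVW] presheaf_res_comp[OF M UVW])
    moreover have "W \<subseteq> U" using UVW by blast
    ultimately show ?thesis using UVW by (simp add: c tensor_presheaf_res[OF L M])
  qed
  ultimately show ?thesis unfolding module_presheaf_def using mod maps by simp
qed

end

section \<open>Frames of rank one\<close>

context tensor_pair begin

text \<open>
  Coordinates \<open>\<alpha>\<close> and \<open>\<beta>\<close> along the two generators make \<open>\<alpha> x \<cdot> \<beta> y\<close> vanish on the relators, which gives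
  injectivity; moving all scalars to the left factor gives surjectivity.
\<close>

lemma tensor_rank_one:
  assumes e: "e \<in> carrier M" "bij_betw (\<lambda>r. r \<odot>\<^bsub>M\<^esub> e) (carrier R) (carrier M)"
    and f: "f \<in> carrier N" "bij_betw (\<lambda>r. r \<odot>\<^bsub>N\<^esub> f) (carrier R) (carrier N)"
  shows "bij_betw (\<lambda>r. cls (frag_of (r \<odot>\<^bsub>M\<^esub> e, f))) (carrier R) (carrier (tensor R M N))"
proof -
  define \<alpha> where "\<alpha> = inv_into (carrier R) (\<lambda>r. r \<odot>\<^bsub>M\<^esub> e)"
  define \<beta> where "\<beta> = inv_into (carrier R) (\<lambda>r. r \<odot>\<^bsub>N\<^esub> f)"
  have \<alpha>: "\<alpha> x \<in> carrier R" "\<alpha> x \<odot>\<^bsub>M\<^esub> e = x" if "x \<in> carrier M" for x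
    using that e(2) unfolding \<alpha>_def bij_betw_def by (auto intro: inv_into_into f_inv_into_f)
  have \<alpha>': "\<alpha> (r \<odot>\<^bsub>M\<^esub> e) = r" if "r \<in> carrier R" for r
    using that e(2) unfolding \<alpha>_def bij_betw_def by (auto intro: inv_into_f_f)
  have \<beta>: "\<beta> x \<in> carrier R" "\<beta> x \<odot>\<^bsub>N\<^esub> f = x" if "x \<in> carrier N" for x
    using that f(2) unfolding \<beta>_def bij_betw_def by (auto intro: inv_into_into f_inv_into_f)
  have \<beta>': "\<beta> (r \<odot>\<^bsub>N\<^esub> f) = r" if "r \<in> carrier R" for r
    using that f(2) unfolding \<beta>_def bij_betw_def by (auto intro: inv_into_f_f)
  have \<alpha>_add: "\<alpha> (x \<oplus>\<^bsub>M\<^esub> y) = \<alpha> x \<oplus>\<^bsub>R\<^esub> \<alpha> y" if "x \<in> carrier M" "y \<in> carrier M" for x y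
    using \<alpha>'[of "\<alpha> x \<oplus>\<^bsub>R\<^esub> \<alpha> y"] \<alpha> that e(1) by (simp add: M.smult_l_distr)
  have \<beta>_add: "\<beta> (x \<oplus>\<^bsub>N\<^esub> y) = \<beta> x \<oplus>\<^bsub>R\<^esub> \<beta> y" if "x \<in> carrier N" "y \<in> carrier N" for x y
    using \<beta>'[of "\<beta> x \<oplus>\<^bsub>R\<^esub> \<beta> y"] \<beta> that f(1) by (simp add: N.smult_l_distr)
  have \<alpha>_smult: "\<alpha> (r \<odot>\<^bsub>M\<^esub> x) = r \<otimes>\<^bsub>R\<^esub> \<alpha> x" if "r \<in> carrier R" "x \<in> carrier M" for r x
    using \<alpha>'[of "r \<otimes>\<^bsub>R\<^esub> \<alpha> x"] \<alpha> that e(1) by (simp add: M.smult_assoc1)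
  have \<beta>_smult: "\<beta> (r \<odot>\<^bsub>N\<^esub> x) = r \<otimes>\<^bsub>R\<^esub> \<beta> x" if "r \<in> carrier R" "x \<in> carrier N" for r x
    using \<beta>'[of "r \<otimes>\<^bsub>R\<^esub> \<beta> x"] \<beta> that f(1) by (simp add: N.smult_assoc1)
  have "(\<lambda>(x, y). \<alpha> x \<otimes>\<^bsub>R\<^esub> \<beta> y) ` S \<subseteq> carrier (add_monoid R)"
    using \<alpha> \<beta> by auto
  from comm_group.free_Abelian_group_universal[OF M.R.a_comm_group this]
  obtain h where h: "h \<in> hom (tensor_free M N) (add_monoid R)"
    and h': "\<And>z. z \<in> S \<Longrightarrow> h (frag_of z) = (\<lambda>(x, y). \<alpha> x \<otimes>\<^bsub>R\<^esub> \<beta> y) z"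
    by blast
  have h_of: "h (frag_of (x, y)) = \<alpha> x \<otimes>\<^bsub>R\<^esub> \<beta> y" if "x \<in> carrier M" "y \<in> carrier N" for x y
    using h'[of "(x, y)"] that by simp
  have h_add: "h (c + d) = h c \<oplus>\<^bsub>R\<^esub> h d" if "Poly_Mapping.keys c \<subseteq> S" "Poly_Mapping.keys d \<subseteq> S" for c d
    using hom_mult[OF h, of c d] that by simp
  have h_closed: "h c \<in> carrier R" if "Poly_Mapping.keys c \<subseteq> S" for c
    using hom_in_carrier[OF h, of c] that by simp
  have vanish: "h d = \<zero>\<^bsub>R\<^esub>" if "Poly_Mapping.keys d \<subseteq> S" "Poly_Mapping.keys c \<subseteq> S" "h (d + c) = h c" for c d
    using that h_add[of d c] h_closed[of c] h_closed[of d] M.R.add.right_cancel[of "h c" "h d" "\<zero>\<^bsub>R\<^esub>"] by simp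
  have rel: "h c = \<zero>\<^bsub>R\<^esub>" if c: "c \<in> tensor_relators R M N" for c
  proof -
    have kc: "Poly_Mapping.keys c \<subseteq> S" using subsetD[OF relators_carrier c] by simp
    from c consider
      (add_l) x x' y where "c = frag_of (x \<oplus>\<^bsub>M\<^esub> x', y) - frag_of (x, y) - frag_of (x', y)"
        "x \<in> carrier M" "x' \<in> carrier M" "y \<in> carrier N"
      | (add_r) x y y' where "c = frag_of (x, y \<oplus>\<^bsub>N\<^esub> y') - frag_of (x, y) - frag_of (x, y')"
        "x \<in> carrier M" "y \<in> carrier N" "y' \<in> carrier N"
      | (smult) r x y where "c = frag_of (r \<odot>\<^bsub>M\<^esub> x, y) - frag_of (x, r \<odot>\<^bsub>N\<^esub> y)"
        "r \<in> carrier R" "x \<in> carrier M" "y \<in> carrier N"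
      unfolding tensor_relators_def by blast
    then show ?thesis
    proof cases
      case add_l
      have k: "Poly_Mapping.keys (frag_of (x, y) + frag_of (x', y)) \<subseteq> S"
        using keys_add[of "frag_of (x, y)" "frag_of (x', y)"] add_l by (auto simp: keys_frag_of)
      have "h (frag_of (x, y) + frag_of (x', y)) = h (frag_of (x, y)) \<oplus>\<^bsub>R\<^esub> h (frag_of (x', y))"
        by (rule h_add) (use add_l in \<open>auto simp: keys_frag_of\<close>)
      then show ?thesis using add_l
        by (intro vanish[OF kc k]) (simp add: h_of \<alpha>_add \<alpha> \<beta> M.R.l_distr)
    next
      case add_r
      have k: "Poly_Mapping.keys (frag_of (x, y) + frag_of (x, y')) \<subseteq> S"
        using keys_add[of "frag_of (x, y)" "frag_of (x, y')"] add_r by (auto simp: keys_frag_of)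
      have "h (frag_of (x, y) + frag_of (x, y')) = h (frag_of (x, y)) \<oplus>\<^bsub>R\<^esub> h (frag_of (x, y'))"
        by (rule h_add) (use add_r in \<open>auto simp: keys_frag_of\<close>)
      then show ?thesis using add_r
        by (intro vanish[OF kc k]) (simp add: h_of \<beta>_add \<alpha> \<beta> M.R.r_distr)
    next
      case (smult r x y)
      show ?thesis
        by (rule vanish[OF kc, of "frag_of (x, r \<odot>\<^bsub>N\<^esub> y)"])
          (use smult in \<open>auto simp: keys_frag_of h_of \<alpha>_smult \<beta>_smult \<alpha> \<beta> M.R.m_assoc M.R.m_lcomm\<close>)
    qed
  qed
  have grp: "group_hom (tensor_free M N) (add_monoid R) h"
    using h by (simp add: group_hom_def group_hom_axioms_def M.R.a_group)
  have "tensor_relators R M N \<subseteq> kernel (tensor_free M N) (add_monoid R) h"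
    using rel subsetD[OF relators_carrier] by (simp add: kernel_def subset_iff del: carrier_free_Abelian_group_iff)
  then have ker: "Ker \<subseteq> kernel (tensor_free M N) (add_monoid R) h"
    unfolding tensor_kernel_def
    by (intro group.generate_subgroup_incl[OF group_free_Abelian_group] group_hom.subgroup_kernel[OF grp])
  have \<beta>f: "\<beta> f = \<one>\<^bsub>R\<^esub>" using \<beta>'[of "\<one>\<^bsub>R\<^esub>"] f(1) by simp
  have inj: "inj_on (\<lambda>r. cls (frag_of (r \<odot>\<^bsub>M\<^esub> e, f))) (carrier R)"
  proof (rule inj_onI)
    fix r r' assume r: "r \<in> carrier R" "r' \<in> carrier R"
      and eq: "cls (frag_of (r \<odot>\<^bsub>M\<^esub> e, f)) = cls (frag_of (r' \<odot>\<^bsub>M\<^esub> e, f))"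
    let ?d = "frag_of (r \<odot>\<^bsub>M\<^esub> e, f) - frag_of (r' \<odot>\<^bsub>M\<^esub> e, f)"
    from eq have d: "?d \<in> Ker" by (simp add: cls_eq)
    then have "h ?d = \<zero>\<^bsub>R\<^esub>" using ker by (auto simp: kernel_def)
    moreover have "h (?d + frag_of (r' \<odot>\<^bsub>M\<^esub> e, f)) = h ?d \<oplus>\<^bsub>R\<^esub> h (frag_of (r' \<odot>\<^bsub>M\<^esub> e, f))"
      by (rule h_add) (use r e f Ker_carrier[OF d] in \<open>auto simp: keys_frag_of\<close>)
    ultimately show "r = r'"
      using r e f by (simp add: h_of \<alpha>' \<beta>f)
  qed
  have surj: "\<exists>r\<in>carrier R. cls c = cls (frag_of (r \<odot>\<^bsub>M\<^esub> e, f))" if "Poly_Mapping.keys c \<subseteq> S" for c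
    using that
  proof (induction c rule: frag_induction)
    case zero
    have "cls 0 = cls (frag_of (\<zero>\<^bsub>R\<^esub> \<odot>\<^bsub>M\<^esub> e, f))"
      using cls_add_l[of "\<zero>\<^bsub>M\<^esub>" "\<zero>\<^bsub>M\<^esub>" f] e f Ker_minus by (simp add: cls_eq)
    then show ?case by blast
  next
    case (one z)
    then obtain x y where z: "z = (x, y)" "x \<in> carrier M" "y \<in> carrier N" by auto
    have "cls (frag_of (\<beta> y \<odot>\<^bsub>M\<^esub> x, f)) = cls (frag_of (x, y))"
      using cls_smult[of "\<beta> y" x f] \<beta>[OF z(3)] z f by simp
    then have "cls (frag_of z) = cls (frag_of ((\<beta> y \<otimes>\<^bsub>R\<^esub> \<alpha> x) \<odot>\<^bsub>M\<^esub> e, f))"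
      using \<alpha>[OF z(2)] \<beta>[OF z(3)] e by (simp add: z M.smult_assoc1)
    then show ?case using \<alpha>[OF z(2)] \<beta>[OF z(3)] by blast
  next
    case (diff a b)
    then obtain r r' where r: "r \<in> carrier R" "r' \<in> carrier R"
      "cls a = cls (frag_of (r \<odot>\<^bsub>M\<^esub> e, f))" "cls b = cls (frag_of (r' \<odot>\<^bsub>M\<^esub> e, f))" by blast
    let ?s = "r \<ominus>\<^bsub>R\<^esub> r'"
    have s: "?s \<in> carrier R" "?s \<oplus>\<^bsub>R\<^esub> r' = r" using r
      by (auto simp: a_minus_def M.R.a_assoc M.R.l_neg)
    have "?s \<odot>\<^bsub>M\<^esub> e \<oplus>\<^bsub>M\<^esub> r' \<odot>\<^bsub>M\<^esub> e = r \<odot>\<^bsub>M\<^esub> e"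
      using s r e M.smult_l_distr[of ?s r' e] by simp
    then have k: "frag_of (r \<odot>\<^bsub>M\<^esub> e, f) - (frag_of (?s \<odot>\<^bsub>M\<^esub> e, f) + frag_of (r' \<odot>\<^bsub>M\<^esub> e, f)) \<in> Ker"
      using cls_add_l[of "?s \<odot>\<^bsub>M\<^esub> e" "r' \<odot>\<^bsub>M\<^esub> e" f] s r e f by (simp add: cls_eq)
    have "a - frag_of (r \<odot>\<^bsub>M\<^esub> e, f) \<in> Ker" "b - frag_of (r' \<odot>\<^bsub>M\<^esub> e, f) \<in> Ker"
      using r by (simp_all add: cls_eq)
    from Ker_add[OF Ker_diff[OF this] k]
    have "a - b - frag_of (?s \<odot>\<^bsub>M\<^esub> e, f) \<in> Ker" by (simp add: algebra_simps)
    then show ?case using s by (auto simp: cls_eq)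
  qed
  have cl: "cls (frag_of (r \<odot>\<^bsub>M\<^esub> e, f)) \<in> carrier (tensor R M N)" if "r \<in> carrier R" for r
    using that e f by (auto simp: carrier_tensor keys_frag_of)
  show ?thesis unfolding bij_betw_def
    using inj surj cl by (fastforce simp: carrier_tensor image_iff)
qed

end

text \<open>
  Isomorphism of families with the maps exposed, so that frames can be transported along them.
\<close>

definition iso_via :: "('p, 's) ringed_space \<Rightarrow> ('p set \<Rightarrow> 'm \<Rightarrow> 'n) \<Rightarrow> 'p set
    \<Rightarrow> ('p, 's, 'm) sheaf_mod \<Rightarrow> ('p, 's, 'n) sheaf_mod \<Rightarrow> bool" where
  "iso_via Y \<phi> U L M \<longleftrightarrow>
     (\<forall>V. rs_open Y V \<and> V \<subseteq> U \<longrightarrow>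
        bij_betw (\<phi> V) (carrier (sm_sec L V)) (carrier (sm_sec M V)) \<and>
        (\<forall>s\<in>carrier (sm_sec L V). \<forall>t\<in>carrier (sm_sec L V).
           \<phi> V (s \<oplus>\<^bsub>sm_sec L V\<^esub> t) = \<phi> V s \<oplus>\<^bsub>sm_sec M V\<^esub> \<phi> V t) \<and>
        (\<forall>r\<in>carrier (rs_ring Y V). \<forall>s\<in>carrier (sm_sec L V).
           \<phi> V (r \<odot>\<^bsub>sm_sec L V\<^esub> s) = r \<odot>\<^bsub>sm_sec M V\<^esub> \<phi> V s)) \<and>
     (\<forall>V W. rs_open Y V \<and> rs_open Y W \<and> W \<subseteq> V \<and> V \<subseteq> U \<longrightarrow>
        (\<forall>s\<in>carrier (sm_sec L V). \<phi> W (sm_res L V W s) = sm_res M V W (\<phi> V s)))"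

lemma sheaf_iso_on_iff: "sheaf_iso_on Y U L M \<longleftrightarrow> (\<exists>\<phi>. iso_via Y \<phi> U L M)"
  unfolding sheaf_iso_on_def iso_via_def ..

lemma iso_viaD:
  assumes "iso_via Y \<phi> U L M" "rs_open Y V" "V \<subseteq> U"
  shows "bij_betw (\<phi> V) (carrier (sm_sec L V)) (carrier (sm_sec M V))"
    and "s \<in> carrier (sm_sec L V) \<Longrightarrow> t \<in> carrier (sm_sec L V) \<Longrightarrow>
      \<phi> V (s \<oplus>\<^bsub>sm_sec L V\<^esub> t) = \<phi> V s \<oplus>\<^bsub>sm_sec M V\<^esub> \<phi> V t"
    and "r \<in> carrier (rs_ring Y V) \<Longrightarrow> s \<in> carrier (sm_sec L V) \<Longrightarrow>
      \<phi> V (r \<odot>\<^bsub>sm_sec L V\<^esub> s) = r \<odot>\<^bsub>sm_sec M V\<^esub> \<phi> V s"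
    and "rs_open Y W \<Longrightarrow> W \<subseteq> V \<Longrightarrow> s \<in> carrier (sm_sec L V) \<Longrightarrow>
      \<phi> W (sm_res L V W s) = sm_res M V W (\<phi> V s)"
  using assms unfolding iso_via_def by simp_all

text \<open>
  A frame is a generator: \<open>r \<mapsto> r e\<close> is an isomorphism from the structure sheaf on \<open>U\<close>. For a presheaf of
  modules the clauses on sums, products and restrictions are consequences of the module axioms
  (\<open>frame_presheafI\<close>); as part of the definition they make sense of a frame of a sheafification.
\<close>

definition frame :: "('p, 's) ringed_space \<Rightarrow> ('p, 's, 'm) sheaf_mod \<Rightarrow> 'p set \<Rightarrow> 'm \<Rightarrow> bool" where
  "frame Y L U e \<longleftrightarrow> rs_open Y U \<and> e \<in> carrier (sm_sec L U) \<and>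
     (\<forall>V. rs_open Y V \<and> V \<subseteq> U \<longrightarrow>
        bij_betw (\<lambda>r. r \<odot>\<^bsub>sm_sec L V\<^esub> sm_res L U V e) (carrier (rs_ring Y V)) (carrier (sm_sec L V)) \<and>
        (\<forall>a\<in>carrier (rs_ring Y V). \<forall>b\<in>carrier (rs_ring Y V).
           (a \<oplus>\<^bsub>rs_ring Y V\<^esub> b) \<odot>\<^bsub>sm_sec L V\<^esub> sm_res L U V e =
           a \<odot>\<^bsub>sm_sec L V\<^esub> sm_res L U V e \<oplus>\<^bsub>sm_sec L V\<^esub> b \<odot>\<^bsub>sm_sec L V\<^esub> sm_res L U V e) \<and>
        (\<forall>a\<in>carrier (rs_ring Y V). \<forall>b\<in>carrier (rs_ring Y V).
           (a \<otimes>\<^bsub>rs_ring Y V\<^esub> b) \<odot>\<^bsub>sm_sec L V\<^esub> sm_res L U V e =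
           a \<odot>\<^bsub>sm_sec L V\<^esub> (b \<odot>\<^bsub>sm_sec L V\<^esub> sm_res L U V e))) \<and>
     (\<forall>V W. rs_open Y V \<and> rs_open Y W \<and> W \<subseteq> V \<and> V \<subseteq> U \<longrightarrow>
        (\<forall>a\<in>carrier (rs_ring Y V).
           sm_res L V W (a \<odot>\<^bsub>sm_sec L V\<^esub> sm_res L U V e) =
           rs_res Y V W a \<odot>\<^bsub>sm_sec L W\<^esub> sm_res L U W e))"

lemma frameD:
  assumes "frame Y L U e"
  shows "rs_open Y U" "e \<in> carrier (sm_sec L U)"
    and "rs_open Y V \<Longrightarrow> V \<subseteq> U \<Longrightarrow>
      bij_betw (\<lambda>r. r \<odot>\<^bsub>sm_sec L V\<^esub> sm_res L U V e) (carrier (rs_ring Y V)) (carrier (sm_sec L V))"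
    and "rs_open Y V \<Longrightarrow> V \<subseteq> U \<Longrightarrow> a \<in> carrier (rs_ring Y V) \<Longrightarrow> b \<in> carrier (rs_ring Y V) \<Longrightarrow>
      (a \<oplus>\<^bsub>rs_ring Y V\<^esub> b) \<odot>\<^bsub>sm_sec L V\<^esub> sm_res L U V e =
      a \<odot>\<^bsub>sm_sec L V\<^esub> sm_res L U V e \<oplus>\<^bsub>sm_sec L V\<^esub> b \<odot>\<^bsub>sm_sec L V\<^esub> sm_res L U V e"
    and "rs_open Y V \<Longrightarrow> V \<subseteq> U \<Longrightarrow> a \<in> carrier (rs_ring Y V) \<Longrightarrow> b \<in> carrier (rs_ring Y V) \<Longrightarrow>
      (a \<otimes>\<^bsub>rs_ring Y V\<^esub> b) \<odot>\<^bsub>sm_sec L V\<^esub> sm_res L U V e =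
      a \<odot>\<^bsub>sm_sec L V\<^esub> (b \<odot>\<^bsub>sm_sec L V\<^esub> sm_res L U V e)"
    and "rs_open Y V \<Longrightarrow> V \<subseteq> U \<Longrightarrow> rs_open Y W \<Longrightarrow> W \<subseteq> V \<Longrightarrow> a \<in> carrier (rs_ring Y V) \<Longrightarrow>
      sm_res L V W (a \<odot>\<^bsub>sm_sec L V\<^esub> sm_res L U V e) =
      rs_res Y V W a \<odot>\<^bsub>sm_sec L W\<^esub> sm_res L U W e"
  using assms unfolding frame_def by simp_all

lemma frame_eq_iff:
  assumes "frame Y L U e" "rs_open Y V" "V \<subseteq> U" "a \<in> carrier (rs_ring Y V)" "b \<in> carrier (rs_ring Y V)"
  shows "a \<odot>\<^bsub>sm_sec L V\<^esub> sm_res L U V e = b \<odot>\<^bsub>sm_sec L V\<^esub> sm_res L U V e \<longleftrightarrow> a = b"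
  using frameD(3)[OF assms(1-3)] assms(4,5) unfolding bij_betw_def inj_on_def by auto

lemma frame_coeff:
  assumes "frame Y L U e" "rs_open Y V" "V \<subseteq> U" "s \<in> carrier (sm_sec L V)"
  obtains a where "a \<in> carrier (rs_ring Y V)" "s = a \<odot>\<^bsub>sm_sec L V\<^esub> sm_res L U V e"
  using frameD(3)[OF assms(1-3)] assms(4) unfolding bij_betw_def by auto

lemma frame_closed:
  assumes "frame Y L U e" "rs_open Y V" "V \<subseteq> U" "a \<in> carrier (rs_ring Y V)"
  shows "a \<odot>\<^bsub>sm_sec L V\<^esub> sm_res L U V e \<in> carrier (sm_sec L V)"
  using frameD(3)[OF assms(1-3)] assms(4) unfolding bij_betw_def by auto

lemma frame_presheafI:
  assumes L: "module_presheaf Y L" and U: "rs_open Y U" and e: "e \<in> carrier (sm_sec L U)"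
    and bij: "\<And>V. rs_open Y V \<Longrightarrow> V \<subseteq> U \<Longrightarrow>
      bij_betw (\<lambda>r. r \<odot>\<^bsub>sm_sec L V\<^esub> sm_res L U V e) (carrier (rs_ring Y V)) (carrier (sm_sec L V))"
  shows "frame Y L U e"
proof -
  have "(a \<oplus>\<^bsub>rs_ring Y V\<^esub> b) \<odot>\<^bsub>sm_sec L V\<^esub> sm_res L U V e =
           a \<odot>\<^bsub>sm_sec L V\<^esub> sm_res L U V e \<oplus>\<^bsub>sm_sec L V\<^esub> b \<odot>\<^bsub>sm_sec L V\<^esub> sm_res L U V e"
    "(a \<otimes>\<^bsub>rs_ring Y V\<^esub> b) \<odot>\<^bsub>sm_sec L V\<^esub> sm_res L U V e =
           a \<odot>\<^bsub>sm_sec L V\<^esub> (b \<odot>\<^bsub>sm_sec L V\<^esub> sm_res L U V e)"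
    if "rs_open Y V" "V \<subseteq> U" "a \<in> carrier (rs_ring Y V)" "b \<in> carrier (rs_ring Y V)" for V a b
  proof -
    interpret module "rs_ring Y V" "sm_sec L V" by (rule presheaf_module) fact+
    have "sm_res L U V e \<in> carrier (sm_sec L V)" by (rule presheaf_res_closed) fact+
    then show "(a \<oplus>\<^bsub>rs_ring Y V\<^esub> b) \<odot>\<^bsub>sm_sec L V\<^esub> sm_res L U V e =
           a \<odot>\<^bsub>sm_sec L V\<^esub> sm_res L U V e \<oplus>\<^bsub>sm_sec L V\<^esub> b \<odot>\<^bsub>sm_sec L V\<^esub> sm_res L U V e"
    "(a \<otimes>\<^bsub>rs_ring Y V\<^esub> b) \<odot>\<^bsub>sm_sec L V\<^esub> sm_res L U V e =
           a \<odot>\<^bsub>sm_sec L V\<^esub> (b \<odot>\<^bsub>sm_sec L V\<^esub> sm_res L U V e)"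
      using that by (simp_all add: smult_l_distr smult_assoc1)
  qed
  moreover have "sm_res L V W (a \<odot>\<^bsub>sm_sec L V\<^esub> sm_res L U V e) =
           rs_res Y V W a \<odot>\<^bsub>sm_sec L W\<^esub> sm_res L U W e"
    if VW: "rs_open Y V" "V \<subseteq> U" "rs_open Y W" "W \<subseteq> V" "a \<in> carrier (rs_ring Y V)" for V W a
    using presheaf_res_smult[OF L VW(1,3,4,5) presheaf_res_closed[OF L U VW(1,2) e]]
      presheaf_res_comp[OF L U VW(1,3,4,2) e] by simp
  ultimately show ?thesis unfolding frame_def using U e bij by simp
qed

lemma frame_restrict:
  assumes L: "module_presheaf Y L" and e: "frame Y L U e" and V: "rs_open Y V" "V \<subseteq> U"
  shows "frame Y L V (sm_res L U V e)"
proof (rule frame_presheafI[OF L V(1)])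
  show "sm_res L U V e \<in> carrier (sm_sec L V)"
    by (rule presheaf_res_closed[OF L frameD(1)[OF e] V frameD(2)[OF e]])
  fix W assume W: "rs_open Y W" "W \<subseteq> V"
  then have "W \<subseteq> U" using V by blast
  then show "bij_betw (\<lambda>r. r \<odot>\<^bsub>sm_sec L W\<^esub> sm_res L V W (sm_res L U V e)) (carrier (rs_ring Y W)) (carrier (sm_sec L W))"
    using frameD(3)[OF e W(1)] presheaf_res_comp[OF L frameD(1)[OF e] V(1) W(1,2) V(2) frameD(2)[OF e]] by simp
qed

text \<open>
  Multiples of \<open>n\<close> are the preimages under \<open>\<phi>\<close> of the multiples of \<open>\<sigma>\<close>.
\<close>

lemma iso_frame:
  assumes N: "module_presheaf Y N" and \<phi>: "iso_via Y \<phi> U N T" and \<sigma>: "frame Y T U \<sigma>"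
    and n: "n \<in> carrier (sm_sec N U)" "\<phi> U n = \<sigma>"
  shows "frame Y N U n"
proof (rule frame_presheafI[OF N frameD(1)[OF \<sigma>] n(1)])
  fix V assume V: "rs_open Y V" "V \<subseteq> U"
  note U = frameD(1)[OF \<sigma>]
  interpret module "rs_ring Y V" "sm_sec N V" by (rule presheaf_module) fact+
  have nV: "sm_res N U V n \<in> carrier (sm_sec N V)" by (rule presheaf_res_closed[OF N U V n(1)])
  have "\<phi> V (sm_res N U V n) = sm_res T U V \<sigma>"
    using iso_viaD(4)[OF \<phi> U order_refl V n(1)] n(2) by simp
  then have "\<phi> V (r \<odot>\<^bsub>sm_sec N V\<^esub> sm_res N U V n) = r \<odot>\<^bsub>sm_sec T V\<^esub> sm_res T U V \<sigma>"
    if "r \<in> carrier (rs_ring Y V)" for r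
    using iso_viaD(3)[OF \<phi> V that nV] by simp
  then have "bij_betw (\<phi> V \<circ> (\<lambda>r. r \<odot>\<^bsub>sm_sec N V\<^esub> sm_res N U V n)) (carrier (rs_ring Y V)) (carrier (sm_sec T V))"
    using frameD(3)[OF \<sigma> V] by (subst bij_betw_cong[where g = "\<lambda>r. r \<odot>\<^bsub>sm_sec T V\<^esub> sm_res T U V \<sigma>"]) simp_all
  then show "bij_betw (\<lambda>r. r \<odot>\<^bsub>sm_sec N V\<^esub> sm_res N U V n) (carrier (rs_ring Y V)) (carrier (sm_sec N V))"
    using bij_betw_comp_iff2[OF iso_viaD(1)[OF \<phi> V], of "\<lambda>r. r \<odot>\<^bsub>sm_sec N V\<^esub> sm_res N U V n" "carrier (rs_ring Y V)"] nV
    by (auto simp: image_subset_iff)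
qed

lemma iso_frame_ex:
  assumes N: "module_presheaf Y N" and \<phi>: "iso_via Y \<phi> U N T" and \<sigma>: "frame Y T U \<sigma>"
  obtains n where "frame Y N U n" "\<phi> U n = \<sigma>"
proof -
  have "\<sigma> \<in> \<phi> U ` carrier (sm_sec N U)"
    unfolding bij_betw_imp_surj_on[OF iso_viaD(1)[OF \<phi> frameD(1)[OF \<sigma>] order_refl]]
    by (rule frameD(2)[OF \<sigma>])
  then show ?thesis using that[OF iso_frame[OF N \<phi> \<sigma>]] by (elim imageE) simp
qed

lemma iso_via_restrict:
  assumes \<phi>: "iso_via Y \<phi> U L M" and V: "V \<subseteq> U"
  shows "iso_via Y \<phi> V L M"
  unfolding iso_via_def
proof (intro conjI allI impI ballI; elim conjE)
  fix W assume W: "rs_open Y W" "W \<subseteq> V"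
  then have WU: "W \<subseteq> U" using V by (rule_tac order_trans)
  note D = iso_viaD[OF \<phi> W(1) WU]
  show "bij_betw (\<phi> W) (carrier (sm_sec L W)) (carrier (sm_sec M W))" by (rule D(1))
  show "\<phi> W (s \<oplus>\<^bsub>sm_sec L W\<^esub> t) = \<phi> W s \<oplus>\<^bsub>sm_sec M W\<^esub> \<phi> W t"
    if "s \<in> carrier (sm_sec L W)" "t \<in> carrier (sm_sec L W)" for s t using that by (rule D(2))
  show "\<phi> W (r \<odot>\<^bsub>sm_sec L W\<^esub> s) = r \<odot>\<^bsub>sm_sec M W\<^esub> \<phi> W s"
    if "r \<in> carrier (rs_ring Y W)" "s \<in> carrier (sm_sec L W)" for r s using that by (rule D(3))
next
  fix W W' s assume W: "rs_open Y W" "rs_open Y W'" "W' \<subseteq> W" "W \<subseteq> V" and s: "s \<in> carrier (sm_sec L W)"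
  then have WU: "W \<subseteq> U" using V by (rule_tac order_trans)
  show "\<phi> W' (sm_res L W W' s) = sm_res M W W' (\<phi> W s)"
    by (rule iso_viaD(4)[OF \<phi> W(1) WU W(2,3) s])
qed

context sheaf_ringed begin

text \<open>
  The isomorphism is \<open>r n \<mapsto> r \<sigma>\<close>.
\<close>

lemma frames_iso:
  assumes n: "frame Y N U n" and \<sigma>: "frame Y T U \<sigma>"
  shows "sheaf_iso_on Y U N T"
proof -
  define \<phi> where "\<phi> V s = inv_into (carrier (\<O> V)) (\<lambda>r. r \<odot>\<^bsub>sm_sec N V\<^esub> sm_res N U V n) s
    \<odot>\<^bsub>sm_sec T V\<^esub> sm_res T U V \<sigma>" for V s
  have \<phi>: "\<phi> V (a \<odot>\<^bsub>sm_sec N V\<^esub> sm_res N U V n) = a \<odot>\<^bsub>sm_sec T V\<^esub> sm_res T U V \<sigma>"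
    if "rs_open Y V" "V \<subseteq> U" "a \<in> carrier (\<O> V)" for V a
    using inv_into_f_f[of "\<lambda>r. r \<odot>\<^bsub>sm_sec N V\<^esub> sm_res N U V n" "carrier (\<O> V)" a]
      frameD(3)[OF n that(1,2)] that(3)
    by (simp add: \<phi>_def bij_betw_def)
  have "iso_via Y \<phi> U N T"
    unfolding iso_via_def
  proof (intro conjI allI impI ballI; elim conjE)
    fix V assume V: "rs_open Y V" "V \<subseteq> U"
    interpret R: cring "\<O> V" by (rule cring_O) fact
    have "bij_betw (\<phi> V \<circ> (\<lambda>r. r \<odot>\<^bsub>sm_sec N V\<^esub> sm_res N U V n)) (carrier (\<O> V)) (carrier (sm_sec T V))"
      using frameD(3)[OF \<sigma> V] \<phi>[OF V]
      by (subst bij_betw_cong[where g = "\<lambda>r. r \<odot>\<^bsub>sm_sec T V\<^esub> sm_res T U V \<sigma>"]) simp_all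
    then show "bij_betw (\<phi> V) (carrier (sm_sec N V)) (carrier (sm_sec T V))"
      using bij_betw_comp_iff[OF frameD(3)[OF n V]] by blast
    fix s assume s: "s \<in> carrier (sm_sec N V)"
    then obtain a where a: "a \<in> carrier (\<O> V)" "s = a \<odot>\<^bsub>sm_sec N V\<^esub> sm_res N U V n"
      using frame_coeff[OF n V] by blast
    show "\<phi> V (s \<oplus>\<^bsub>sm_sec N V\<^esub> t) = \<phi> V s \<oplus>\<^bsub>sm_sec T V\<^esub> \<phi> V t" if t: "t \<in> carrier (sm_sec N V)" for t
    proof -
      obtain b where b: "b \<in> carrier (\<O> V)" "t = b \<odot>\<^bsub>sm_sec N V\<^esub> sm_res N U V n"
        using frame_coeff[OF n V t] by blast
      show ?thesis
        using a b \<phi>[OF V] by (simp add: frameD(4)[OF n V, symmetric] frameD(4)[OF \<sigma> V])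
    qed
    show "\<phi> V (r \<odot>\<^bsub>sm_sec N V\<^esub> s) = r \<odot>\<^bsub>sm_sec T V\<^esub> \<phi> V s" if "r \<in> carrier (\<O> V)" for r
      using a \<phi>[OF V] that by (simp add: frameD(5)[OF n V, symmetric] frameD(5)[OF \<sigma> V, symmetric])
  next
    fix V W s assume V: "rs_open Y V" "V \<subseteq> U" and W: "rs_open Y W" "W \<subseteq> V" and s: "s \<in> carrier (sm_sec N V)"
    have WU: "W \<subseteq> U" using V W by blast
    obtain a where a: "a \<in> carrier (\<O> V)" "s = a \<odot>\<^bsub>sm_sec N V\<^esub> sm_res N U V n"
      using frame_coeff[OF n V s] by blast
    show "\<phi> W (sm_res N V W s) = sm_res T V W (\<phi> V s)"
      using a \<phi>[OF V a(1)] \<phi>[OF W(1) WU, of "rs_res Y V W a"] frameD(6)[OF n V W a(1)] frameD(6)[OF \<sigma> V W a(1)]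
        res_closed[OF V(1) W a(1)] by simp
  qed
  then show ?thesis unfolding sheaf_iso_on_iff by blast
qed

lemma structure_frame: "rs_open Y U \<Longrightarrow> frame Y (structure_mod Y) U \<one>\<^bsub>\<O> U\<^esub>"
proof (rule frame_presheafI[OF structure_presheaf])
  assume U: "rs_open Y U"
  interpret R: cring "\<O> U" by (rule cring_O) fact
  show "\<one>\<^bsub>\<O> U\<^esub> \<in> carrier (sm_sec (structure_mod Y) U)" by simp
  fix V assume V: "rs_open Y V" "V \<subseteq> U"
  interpret RV: cring "\<O> V" by (rule cring_O) fact
  show "bij_betw (\<lambda>r. r \<odot>\<^bsub>sm_sec (structure_mod Y) V\<^esub> sm_res (structure_mod Y) U V \<one>\<^bsub>\<O> U\<^esub>)
          (carrier (\<O> V)) (carrier (sm_sec (structure_mod Y) V))"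
    using U V by (subst bij_betw_cong[where g = id]) (simp_all add: res_one)
qed

lemma tensor_presheaf_frame:
  assumes L: "module_presheaf Y L" and M: "module_presheaf Y M"
    and e: "frame Y L U e" and f: "frame Y M U f"
  shows "frame Y (tensor_presheaf Y L M) U (tensor_class (\<O> U) (sm_sec L U) (sm_sec M U) (frag_of (e, f)))"
proof (rule frame_presheafI[OF tensor_presheaf_presheaf[OF L M]])
  show U: "rs_open Y U" by (rule frameD(1)[OF e])
  interpret U: tensor_pair "\<O> U" "sm_sec L U" "sm_sec M U" by (rule tensor_pair_presheaf) fact+
  show "U.cls (frag_of (e, f)) \<in> carrier (sm_sec (tensor_presheaf Y L M) U)"
    using frameD(2)[OF e] frameD(2)[OF f] by (auto simp: tensor_presheaf_sec U.carrier_tensor keys_frag_of)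
  fix V assume V: "rs_open Y V" "V \<subseteq> U"
  interpret V: tensor_pair "\<O> V" "sm_sec L V" "sm_sec M V" by (rule tensor_pair_presheaf) fact+
  have "bij_betw (\<lambda>r. V.cls (frag_of (r \<odot>\<^bsub>sm_sec L V\<^esub> sm_res L U V e, sm_res M U V f))) (carrier (\<O> V))
      (carrier (tensor (\<O> V) (sm_sec L V) (sm_sec M V)))"
    by (intro V.tensor_rank_one presheaf_res_closed[OF L U V] presheaf_res_closed[OF M U V]
        frameD(2)[OF e] frameD(2)[OF f] frameD(3)[OF e V] frameD(3)[OF f V])
  then show "bij_betw (\<lambda>r. r \<odot>\<^bsub>sm_sec (tensor_presheaf Y L M) V\<^esub> sm_res (tensor_presheaf Y L M) U V
      (U.cls (frag_of (e, f)))) (carrier (\<O> V)) (carrier (sm_sec (tensor_presheaf Y L M) V))"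
    unfolding tensor_presheaf_sec
    by (subst bij_betw_cong[where g = "\<lambda>r. V.cls (frag_of (r \<odot>\<^bsub>sm_sec L V\<^esub> sm_res L U V e, sm_res M U V f))"])
      (simp_all add: tensor_presheaf_res[OF L M U V] V.smult_tensor)
qed

text \<open>
  Transition functions multiply, since \<open>a e \<otimes> b f = (a b) (e \<otimes> f)\<close>.
\<close>

lemma tensor_presheaf_transition:
  assumes L: "module_presheaf Y L" and M: "module_presheaf Y M"
    and e: "frame Y L U e" "frame Y L U' e'" and f: "frame Y M U f" "frame Y M U' f'"
    and V: "rs_open Y V" "V \<subseteq> U" "V \<subseteq> U'" and a: "a \<in> carrier (\<O> V)" and b: "b \<in> carrier (\<O> V)"
    and ea: "sm_res L U' V e' = a \<odot>\<^bsub>sm_sec L V\<^esub> sm_res L U V e"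
    and fb: "sm_res M U' V f' = b \<odot>\<^bsub>sm_sec M V\<^esub> sm_res M U V f"
  shows "sm_res (tensor_presheaf Y L M) U' V (tensor_class (\<O> U') (sm_sec L U') (sm_sec M U') (frag_of (e', f'))) =
    (a \<otimes>\<^bsub>\<O> V\<^esub> b) \<odot>\<^bsub>sm_sec (tensor_presheaf Y L M) V\<^esub>
      sm_res (tensor_presheaf Y L M) U V (tensor_class (\<O> U) (sm_sec L U) (sm_sec M U) (frag_of (e, f)))"
proof -
  interpret V: tensor_pair "\<O> V" "sm_sec L V" "sm_sec M V" by (rule tensor_pair_presheaf) fact+
  note U = frameD(1)[OF e(1)] and U' = frameD(1)[OF e(2)]
  have eV: "sm_res L U V e \<in> carrier (sm_sec L V)"
    by (rule presheaf_res_closed[OF L U V(1,2) frameD(2)[OF e(1)]])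
  have fV: "sm_res M U V f \<in> carrier (sm_sec M V)"
    by (rule presheaf_res_closed[OF M U V(1,2) frameD(2)[OF f(1)]])
  have "V.cls (frag_of (a \<odot>\<^bsub>sm_sec L V\<^esub> sm_res L U V e, b \<odot>\<^bsub>sm_sec M V\<^esub> sm_res M U V f)) =
    V.cls (frag_of (b \<odot>\<^bsub>sm_sec L V\<^esub> (a \<odot>\<^bsub>sm_sec L V\<^esub> sm_res L U V e), sm_res M U V f))"
    using V.cls_smult[of b "a \<odot>\<^bsub>sm_sec L V\<^esub> sm_res L U V e" "sm_res M U V f"] a b eV fV by simp
  also have "b \<odot>\<^bsub>sm_sec L V\<^esub> (a \<odot>\<^bsub>sm_sec L V\<^esub> sm_res L U V e) = (a \<otimes>\<^bsub>\<O> V\<^esub> b) \<odot>\<^bsub>sm_sec L V\<^esub> sm_res L U V e"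
    using a b eV by (simp add: V.M.smult_assoc1[symmetric] V.M.R.m_comm)
  finally show ?thesis
    using a b
    by (simp add: tensor_presheaf_res[OF L M U V(1,2)] tensor_presheaf_res[OF L M U' V(1,3)] tensor_presheaf_sec
        V.smult_tensor ea fb)
qed

end

section \<open>Gluing\<close>

lemma sheaf_presheaf: "module_sheaf Y L \<Longrightarrow> module_presheaf Y L"
  unfolding module_sheaf_def by blast

lemma sheaf_amalgamation:
  assumes "module_sheaf Y L" "\<And>V. V \<in> \<U> \<Longrightarrow> rs_open Y V" "\<And>V. V \<in> \<U> \<Longrightarrow> s V \<in> carrier (sm_sec L V)"
    and "\<And>V W. V \<in> \<U> \<Longrightarrow> W \<in> \<U> \<Longrightarrow> sm_res L V (V \<inter> W) (s V) = sm_res L W (V \<inter> W) (s W)"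
  shows "\<exists>!t. t \<in> carrier (sm_sec L (\<Union>\<U>)) \<and> (\<forall>V\<in>\<U>. sm_res L (\<Union>\<U>) V t = s V)"
proof -
  have "\<forall>\<U> s. (\<forall>V\<in>\<U>. rs_open Y V \<and> s V \<in> carrier (sm_sec L V)) \<and>
        (\<forall>V\<in>\<U>. \<forall>W\<in>\<U>. sm_res L V (V \<inter> W) (s V) = sm_res L W (V \<inter> W) (s W)) \<longrightarrow>
        (\<exists>!t. t \<in> carrier (sm_sec L (\<Union>\<U>)) \<and> (\<forall>V\<in>\<U>. sm_res L (\<Union>\<U>) V t = s V))"
    using assms(1) unfolding module_sheaf_def by (rule conjunct2)
  then have "(\<forall>V\<in>\<U>. rs_open Y V \<and> s V \<in> carrier (sm_sec L V)) \<and>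
        (\<forall>V\<in>\<U>. \<forall>W\<in>\<U>. sm_res L V (V \<inter> W) (s V) = sm_res L W (V \<inter> W) (s W)) \<longrightarrow> ?thesis"
    by (elim allE)
  then show ?thesis
    by (rule mp) (intro conjI ballI assms(2-4))
qed

lemma sheaf_separated:
  assumes L: "module_sheaf Y L" and V: "rs_open Y V"
    and t: "t \<in> carrier (sm_sec L V)" "t' \<in> carrier (sm_sec L V)"
    and eq: "\<And>x. x \<in> V \<Longrightarrow> \<exists>W. rs_open Y W \<and> x \<in> W \<and> W \<subseteq> V \<and> sm_res L V W t = sm_res L V W t'"
  shows "t = t'"
proof -
  note P = sheaf_presheaf[OF L]
  define \<U> where "\<U> = {W. rs_open Y W \<and> W \<subseteq> V \<and> sm_res L V W t = sm_res L V W t'}"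
  have un: "\<Union>\<U> = V" using eq unfolding \<U>_def by blast
  have "\<exists>!t0. t0 \<in> carrier (sm_sec L (\<Union>\<U>)) \<and> (\<forall>W\<in>\<U>. sm_res L (\<Union>\<U>) W t0 = sm_res L V W t)"
  proof (rule sheaf_amalgamation[OF L])
    fix W W' assume W: "W \<in> \<U>" "W' \<in> \<U>"
    then show "sm_res L W (W \<inter> W') (sm_res L V W t) = sm_res L W' (W \<inter> W') (sm_res L V W' t)"
      using presheaf_res_comp[OF P V _ _ _ _ t(1), of W "W \<inter> W'"]
        presheaf_res_comp[OF P V _ _ _ _ t(1), of W' "W \<inter> W'"]
      unfolding \<U>_def by (simp add: openin_Int)
  next
    show "rs_open Y W" if "W \<in> \<U>" for W using that unfolding \<U>_def by blast
    show "sm_res L V W t \<in> carrier (sm_sec L W)" if "W \<in> \<U>" for W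
      using presheaf_res_closed[OF P V _ _ t(1)] that unfolding \<U>_def by blast
  qed
  moreover have "sm_res L V W t' = sm_res L V W t" if "W \<in> \<U>" for W
    using that unfolding \<U>_def by simp
  ultimately show ?thesis unfolding un using t by blast
qed

text \<open>
  The gluing axiom for a cover that is indexed by the points, as it arises from local existence
  statements.
\<close>

lemma sheaf_glue:
  assumes L: "module_sheaf Y L" and V: "rs_open Y V"
    and W: "\<And>x. x \<in> V \<Longrightarrow> rs_open Y (W x)" "\<And>x. x \<in> V \<Longrightarrow> x \<in> W x" "\<And>x. x \<in> V \<Longrightarrow> W x \<subseteq> V"
    and s: "\<And>x. x \<in> V \<Longrightarrow> s x \<in> carrier (sm_sec L (W x))"
    and eq: "\<And>x y. x \<in> V \<Longrightarrow> y \<in> V \<Longrightarrow>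
      sm_res L (W x) (W x \<inter> W y) (s x) = sm_res L (W y) (W x \<inter> W y) (s y)"
  obtains t where "t \<in> carrier (sm_sec L V)" "\<And>x. x \<in> V \<Longrightarrow> sm_res L V (W x) t = s x"
proof -
  note P = sheaf_presheaf[OF L]
  have un: "\<Union>(W ` V) = V" using W by blast
  define pt where "pt U = (SOME x. x \<in> V \<and> W x = U)" for U
  have pt: "pt U \<in> V" "W (pt U) = U" if "U \<in> W ` V" for U
    using someI_ex[of "\<lambda>x. x \<in> V \<and> W x = U"] that unfolding pt_def by auto
  have "\<exists>!t. t \<in> carrier (sm_sec L (\<Union>(W ` V))) \<and> (\<forall>U\<in>W ` V. sm_res L (\<Union>(W ` V)) U t = s (pt U))"
  proof (rule sheaf_amalgamation[OF L])
    show "rs_open Y U" if "U \<in> W ` V" for U using that W by blast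
    show "s (pt U) \<in> carrier (sm_sec L U)" if "U \<in> W ` V" for U
      using s[OF pt(1)[OF that]] pt(2)[OF that] by simp
    show "sm_res L U (U \<inter> U') (s (pt U)) = sm_res L U' (U \<inter> U') (s (pt U'))"
      if "U \<in> W ` V" "U' \<in> W ` V" for U U'
      using eq[OF pt(1)[OF that(1)] pt(1)[OF that(2)]] pt(2)[OF that(1)] pt(2)[OF that(2)] by simp
  qed
  then have "\<exists>t. t \<in> carrier (sm_sec L V) \<and> (\<forall>U\<in>W ` V. sm_res L V U t = s (pt U))"
    unfolding un by (rule ex1_implies_ex)
  then obtain t where t: "t \<in> carrier (sm_sec L V)" and t': "\<forall>U\<in>W ` V. sm_res L V U t = s (pt U)"
    by (elim exE conjE)
  have "s (pt (W x)) = s x" if x: "x \<in> V" for x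
  proof -
    have p: "pt (W x) \<in> V" "W (pt (W x)) = W x" using pt x by blast+
    then show ?thesis
      using eq[OF x p(1)] s[OF x] s[OF p(1)] by (simp add: presheaf_res_id[OF P W(1)[OF x]])
  qed
  then show ?thesis using t t' that by simp
qed

section \<open>Sheafification of a presheaf with a frame\<close>

text \<open>
  The canonical map from a presheaf to its sheafification.
\<close>

definition germs :: "('p, 's) ringed_space \<Rightarrow> ('p, 's, 'm) sheaf_mod \<Rightarrow> 'p set \<Rightarrow> 'm
    \<Rightarrow> 'p \<Rightarrow> ('p set \<times> 'm) set" where
  "germs Y L U t = (\<lambda>x\<in>U. germ Y L x U t)"

context sheaf_ringed begin

context
  fixes P :: "('p, 's, 'm) sheaf_mod"
  assumes P: "module_presheaf Y P"
begin

lemma mem_germ: "(V, t) \<in> germ Y P x U s \<longleftrightarrow> rs_open Y V \<and> x \<in> V \<and> t \<in> carrier (sm_sec P V) \<and>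
    (\<exists>W. rs_open Y W \<and> x \<in> W \<and> W \<subseteq> U \<inter> V \<and> sm_res P U W s = sm_res P V W t)"
  unfolding germ_def by simp

text \<open>
  If \<open>s\<close> and \<open>t\<close> agree near \<open>x\<close>, then whatever agrees with \<open>s\<close> near \<open>x\<close> agrees with \<open>t\<close> on a smaller
  neighbourhood.
\<close>

lemma germ_subset:
  assumes U: "rs_open Y U" "s \<in> carrier (sm_sec P U)" and V: "rs_open Y V" "t \<in> carrier (sm_sec P V)"
    and W: "rs_open Y W" "x \<in> W" "W \<subseteq> U" "W \<subseteq> V" "sm_res P U W s = sm_res P V W t"
  shows "germ Y P x U s \<subseteq> germ Y P x V t"
proof clarify
  fix Z z assume "(Z, z) \<in> germ Y P x U s"
  then obtain W' where Z: "rs_open Y Z" "x \<in> Z" "z \<in> carrier (sm_sec P Z)"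
    and W': "rs_open Y W'" "x \<in> W'" "W' \<subseteq> U" "W' \<subseteq> Z" "sm_res P U W' s = sm_res P Z W' z"
    unfolding mem_germ by auto
  have o: "rs_open Y (W \<inter> W')" using W W' by (simp add: openin_Int)
  have "sm_res P V (W \<inter> W') t = sm_res P W (W \<inter> W') (sm_res P V W t)"
    by (rule presheaf_res_comp[OF P V(1) W(1) o _ W(4) V(2), symmetric]) simp
  also have "\<dots> = sm_res P U (W \<inter> W') s"
    unfolding W(5)[symmetric] by (rule presheaf_res_comp[OF P U(1) W(1) o _ W(3) U(2)]) simp
  also have "\<dots> = sm_res P W' (W \<inter> W') (sm_res P U W' s)"
    by (rule presheaf_res_comp[OF P U(1) W'(1) o _ W'(3) U(2), symmetric]) simp
  also have "\<dots> = sm_res P Z (W \<inter> W') z"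
    unfolding W'(5) by (rule presheaf_res_comp[OF P Z(1) W'(1) o _ W'(4) Z(3)]) simp
  finally show "(Z, z) \<in> germ Y P x V t"
    unfolding mem_germ using Z o W W' by blast
qed

lemma germ_eqI:
  assumes "rs_open Y U" "s \<in> carrier (sm_sec P U)" "rs_open Y V" "t \<in> carrier (sm_sec P V)"
    and "rs_open Y W" "x \<in> W" "W \<subseteq> U" "W \<subseteq> V" "sm_res P U W s = sm_res P V W t"
  shows "germ Y P x U s = germ Y P x V t"
  using germ_subset[of U s V t W x] germ_subset[of V t U s W x] assms by (simp add: subset_antisym)

lemma germ_self: "rs_open Y U \<Longrightarrow> x \<in> U \<Longrightarrow> s \<in> carrier (sm_sec P U) \<Longrightarrow> (U, s) \<in> germ Y P x U s"
  unfolding mem_germ by blast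

lemma germ_eqD:
  assumes "rs_open Y V" "x \<in> V" "t \<in> carrier (sm_sec P V)" "germ Y P x U s = germ Y P x V t"
  obtains W where "rs_open Y W" "x \<in> W" "W \<subseteq> U" "W \<subseteq> V" "sm_res P U W s = sm_res P V W t"
  using germ_self[OF assms(1-3)] unfolding assms(4)[symmetric] mem_germ by blast

lemma germ_res:
  assumes U: "rs_open Y U" "rs_open Y V" "x \<in> V" "V \<subseteq> U" "s \<in> carrier (sm_sec P U)"
  shows "germ Y P x V (sm_res P U V s) = germ Y P x U s"
  by (rule germ_eqI[where W = V])
    (use U presheaf_res_closed[OF P U(1,2,4,5)] in \<open>simp_all add: presheaf_res_id[OF P]\<close>)

abbreviation "Psh \<equiv> sheafification Y P"

lemma germs_closed: "rs_open Y U \<Longrightarrow> t \<in> carrier (sm_sec P U) \<Longrightarrow> germs Y P U t \<in> carrier (sm_sec Psh U)"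
  unfolding sheafification_def germs_def stalk_def by fastforce

lemma germs_res:
  assumes "rs_open Y U" "rs_open Y V" "V \<subseteq> U" "t \<in> carrier (sm_sec P U)"
  shows "sm_res Psh U V (germs Y P U t) = germs Y P V (sm_res P U V t)"
proof
  fix x show "sm_res Psh U V (germs Y P U t) x = germs Y P V (sm_res P U V t) x"
    using germ_res[OF assms(1,2) _ assms(3,4), of x] assms(3) by (auto simp: sheafification_def germs_def)
qed

lemma germs_smult:
  assumes U: "rs_open Y U" and t: "t \<in> carrier (sm_sec P U)" and r: "r \<in> carrier (\<O> U)"
  shows "r \<odot>\<^bsub>sm_sec Psh U\<^esub> germs Y P U t = germs Y P U (r \<odot>\<^bsub>sm_sec P U\<^esub> t)"
proof -
  have "(\<Union>(V, s)\<in>germ Y P x U t. germ Y P x (U \<inter> V)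
      (rs_res Y U (U \<inter> V) r \<odot>\<^bsub>sm_sec P (U \<inter> V)\<^esub> sm_res P V (U \<inter> V) s)) = germ Y P x U (r \<odot>\<^bsub>sm_sec P U\<^esub> t)"
    if x: "x \<in> U" for x
  proof (rule UN_constant_eq[OF germ_self[OF U x t]], clarify)
    fix V s assume "(V, s) \<in> germ Y P x U t"
    then obtain W where V: "rs_open Y V" "x \<in> V" "s \<in> carrier (sm_sec P V)"
      and W: "rs_open Y W" "x \<in> W" "W \<subseteq> U" "W \<subseteq> V" "sm_res P U W t = sm_res P V W s"
      unfolding mem_germ by auto
    have o: "rs_open Y (U \<inter> V)" using U V by (simp add: openin_Int)
    interpret A: module "\<O> U" "sm_sec P U" by (rule presheaf_module[OF P U])
    interpret B: module "\<O> (U \<inter> V)" "sm_sec P (U \<inter> V)" by (rule presheaf_module[OF P o])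
    have rV: "rs_res Y U (U \<inter> V) r \<in> carrier (\<O> (U \<inter> V))" using res_closed[OF U o _ r] by simp
    have sV: "sm_res P V (U \<inter> V) s \<in> carrier (sm_sec P (U \<inter> V))"
      using presheaf_res_closed[OF P V(1) o _ V(3)] by simp
    have WUV: "W \<subseteq> U \<inter> V" using W by simp
    show "germ Y P x (U \<inter> V) (rs_res Y U (U \<inter> V) r \<odot>\<^bsub>sm_sec P (U \<inter> V)\<^esub> sm_res P V (U \<inter> V) s) =
      germ Y P x U (r \<odot>\<^bsub>sm_sec P U\<^esub> t)"
    proof (rule germ_eqI[OF o _ U _ W(1,2) WUV W(3)])
      show "sm_res P (U \<inter> V) W (rs_res Y U (U \<inter> V) r \<odot>\<^bsub>sm_sec P (U \<inter> V)\<^esub> sm_res P V (U \<inter> V) s) =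
        sm_res P U W (r \<odot>\<^bsub>sm_sec P U\<^esub> t)"
        using presheaf_res_smult[OF P o W(1) WUV rV sV] presheaf_res_smult[OF P U W(1,3) r t]
          presheaf_res_comp[OF P V(1) o W(1) WUV _ V(3)] res_comp[OF U o W(1) WUV _ r] W(5) by simp
    qed (use rV sV r t in auto)
  qed
  then show ?thesis by (auto simp: sheafification_def germs_def fun_eq_iff)
qed

lemma germs_add:
  assumes U: "rs_open Y U" and t: "t \<in> carrier (sm_sec P U)" and t': "t' \<in> carrier (sm_sec P U)"
  shows "germs Y P U t \<oplus>\<^bsub>sm_sec Psh U\<^esub> germs Y P U t' = germs Y P U (t \<oplus>\<^bsub>sm_sec P U\<^esub> t')"
proof -
  have "(\<Union>(V, s)\<in>germ Y P x U t. \<Union>(V', s')\<in>germ Y P x U t'. germ Y P x (V \<inter> V')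
      (sm_res P V (V \<inter> V') s \<oplus>\<^bsub>sm_sec P (V \<inter> V')\<^esub> sm_res P V' (V \<inter> V') s')) = germ Y P x U (t \<oplus>\<^bsub>sm_sec P U\<^esub> t')"
    if x: "x \<in> U" for x
  proof (rule UN_constant_eq[OF germ_self[OF U x t]], clarify,
      rule UN_constant_eq[OF germ_self[OF U x t']], clarify)
    fix V s V' s' assume "(V, s) \<in> germ Y P x U t" "(V', s') \<in> germ Y P x U t'"
    then obtain W W' where V: "rs_open Y V" "x \<in> V" "s \<in> carrier (sm_sec P V)"
      and W: "rs_open Y W" "x \<in> W" "W \<subseteq> U" "W \<subseteq> V" "sm_res P U W t = sm_res P V W s"
      and V': "rs_open Y V'" "x \<in> V'" "s' \<in> carrier (sm_sec P V')"
      and W': "rs_open Y W'" "x \<in> W'" "W' \<subseteq> U" "W' \<subseteq> V'" "sm_res P U W' t' = sm_res P V' W' s'"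
      unfolding mem_germ by auto
    let ?Z = "W \<inter> W'"
    have o: "rs_open Y (V \<inter> V')" "rs_open Y ?Z" using V V' W W' by (simp_all add: openin_Int)
    have Z: "x \<in> ?Z" "?Z \<subseteq> U" "?Z \<subseteq> V \<inter> V'" "?Z \<subseteq> W" "?Z \<subseteq> W'" using W W' by auto
    interpret A: module "\<O> U" "sm_sec P U" by (rule presheaf_module[OF P U])
    interpret B: module "\<O> (V \<inter> V')" "sm_sec P (V \<inter> V')" by (rule presheaf_module[OF P o(1)])
    have sV: "sm_res P V (V \<inter> V') s \<in> carrier (sm_sec P (V \<inter> V'))"
      using presheaf_res_closed[OF P V(1) o(1) _ V(3)] by simp
    have sV': "sm_res P V' (V \<inter> V') s' \<in> carrier (sm_sec P (V \<inter> V'))"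
      using presheaf_res_closed[OF P V'(1) o(1) _ V'(3)] by simp
    have 1: "sm_res P U ?Z t = sm_res P V ?Z s"
      using presheaf_res_comp[OF P U W(1) o(2) Z(4) W(3) t] presheaf_res_comp[OF P V(1) W(1) o(2) Z(4) W(4) V(3)] W(5) by simp
    have 2: "sm_res P U ?Z t' = sm_res P V' ?Z s'"
      using presheaf_res_comp[OF P U W'(1) o(2) Z(5) W'(3) t'] presheaf_res_comp[OF P V'(1) W'(1) o(2) Z(5) W'(4) V'(3)] W'(5) by simp
    show "germ Y P x (V \<inter> V') (sm_res P V (V \<inter> V') s \<oplus>\<^bsub>sm_sec P (V \<inter> V')\<^esub> sm_res P V' (V \<inter> V') s') =
      germ Y P x U (t \<oplus>\<^bsub>sm_sec P U\<^esub> t')"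
    proof (rule germ_eqI[OF o(1) _ U _ o(2) Z(1,3,2)])
      show "sm_res P (V \<inter> V') ?Z (sm_res P V (V \<inter> V') s \<oplus>\<^bsub>sm_sec P (V \<inter> V')\<^esub> sm_res P V' (V \<inter> V') s') =
        sm_res P U ?Z (t \<oplus>\<^bsub>sm_sec P U\<^esub> t')"
        using presheaf_res_add[OF P o(1,2) Z(3) sV sV'] presheaf_res_add[OF P U o(2) Z(2) t t']
          presheaf_res_comp[OF P V(1) o(1,2) Z(3) _ V(3)] presheaf_res_comp[OF P V'(1) o(1,2) Z(3) _ V'(3)] 1 2 by simp
    qed (use sV sV' t t' in auto)
  qed
  then show ?thesis by (auto simp: sheafification_def germs_def fun_eq_iff)
qed

text \<open>
  A section of the sheafification is locally the family of germs of a multiple \<open>a e\<close>, and the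
  coefficient \<open>a\<close> is locally unique because \<open>e\<close> is a frame. So the local coefficients agree on
  intersections, and they glue because the structure sheaf is a sheaf.
\<close>

lemma sheafification_frame:
  assumes e: "frame Y P U e"
  shows "frame Y Psh U (germs Y P U e)"
proof -
  note U = frameD(1)[OF e] and eU = frameD(2)[OF e]
  have eV: "sm_res P U V e \<in> carrier (sm_sec P V)" if "rs_open Y V" "V \<subseteq> U" for V
    by (rule presheaf_res_closed[OF P U that eU])
  have sm: "a \<odot>\<^bsub>sm_sec Psh V\<^esub> sm_res Psh U V (germs Y P U e) = germs Y P V (a \<odot>\<^bsub>sm_sec P V\<^esub> sm_res P U V e)"
    if "rs_open Y V" "V \<subseteq> U" "a \<in> carrier (\<O> V)" for V a
    using that by (simp add: germs_res[OF U _ _ eU] germs_smult eV)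
  have inj: "inj_on (\<lambda>a. germs Y P V (a \<odot>\<^bsub>sm_sec P V\<^esub> sm_res P U V e)) (carrier (\<O> V))"
    if V: "rs_open Y V" "V \<subseteq> U" for V
  proof (rule inj_onI)
    fix a b assume a: "a \<in> carrier (\<O> V)" and b: "b \<in> carrier (\<O> V)"
      and eq: "germs Y P V (a \<odot>\<^bsub>sm_sec P V\<^esub> sm_res P U V e) = germs Y P V (b \<odot>\<^bsub>sm_sec P V\<^esub> sm_res P U V e)"
    show "a = b"
    proof (rule sheaf_separated[OF structure_sheaf V(1)])
      fix x assume x: "x \<in> V"
      from fun_cong[OF eq, of x] x
      have "germ Y P x V (a \<odot>\<^bsub>sm_sec P V\<^esub> sm_res P U V e) = germ Y P x V (b \<odot>\<^bsub>sm_sec P V\<^esub> sm_res P U V e)"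
        by (simp add: germs_def)
      then obtain W where W: "rs_open Y W" "x \<in> W" "W \<subseteq> V" "W \<subseteq> V"
        "sm_res P V W (a \<odot>\<^bsub>sm_sec P V\<^esub> sm_res P U V e) = sm_res P V W (b \<odot>\<^bsub>sm_sec P V\<^esub> sm_res P U V e)"
        by (rule germ_eqD[OF V(1) x frame_closed[OF e V b]])
      then have "rs_res Y V W a = rs_res Y V W b"
        using frameD(6)[OF e V W(1,3)] a b frame_eq_iff[OF e W(1) order_trans[OF W(3) V(2)]]
          res_closed[OF V(1) W(1,3)] by simp
      then show "\<exists>W. rs_open Y W \<and> x \<in> W \<and> W \<subseteq> V \<and>
          sm_res (structure_mod Y) V W a = sm_res (structure_mod Y) V W b" using W by auto
    qed (use a b in simp_all)
  qed
  have surj: "\<exists>a\<in>carrier (\<O> V). \<sigma> = germs Y P V (a \<odot>\<^bsub>sm_sec P V\<^esub> sm_res P U V e)"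
    if V: "rs_open Y V" "V \<subseteq> U" and \<sigma>: "\<sigma> \<in> carrier (sm_sec Psh V)" for V \<sigma>
  proof -
    have "\<exists>W a. rs_open Y W \<and> x \<in> W \<and> W \<subseteq> V \<and> a \<in> carrier (\<O> W) \<and>
        (\<forall>y\<in>W. \<sigma> y = germ Y P y W (a \<odot>\<^bsub>sm_sec P W\<^esub> sm_res P U W e))" if "x \<in> V" for x
    proof -
      from \<sigma> that obtain W t where W: "rs_open Y W" "x \<in> W" "W \<subseteq> V" "t \<in> carrier (sm_sec P W)"
        "\<forall>y\<in>W. \<sigma> y = germ Y P y W t" unfolding sheafification_def by auto
      from frame_coeff[OF e W(1) order_trans[OF W(3) V(2)] W(4)] W show ?thesis by metis
    qed
    then obtain W a where W: "\<And>x. x \<in> V \<Longrightarrow> rs_open Y (W x)" "\<And>x. x \<in> V \<Longrightarrow> x \<in> W x" "\<And>x. x \<in> V \<Longrightarrow> W x \<subseteq> V"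
      and a: "\<And>x. x \<in> V \<Longrightarrow> a x \<in> carrier (\<O> (W x))"
      and \<sigma>W: "\<And>x y. x \<in> V \<Longrightarrow> y \<in> W x \<Longrightarrow> \<sigma> y = germ Y P y (W x) (a x \<odot>\<^bsub>sm_sec P (W x)\<^esub> sm_res P U (W x) e)"
      by metis
    have WU: "W x \<subseteq> U" if "x \<in> V" for x using W(3)[OF that] V by blast
    have agree: "rs_res Y (W x) (W x \<inter> W y) (a x) = rs_res Y (W y) (W x \<inter> W y) (a y)"
      if x: "x \<in> V" and y: "y \<in> V" for x y
    proof (rule sheaf_separated[OF structure_sheaf])
      show o: "rs_open Y (W x \<inter> W y)" using W x y by (simp add: openin_Int)
      show "rs_res Y (W x) (W x \<inter> W y) (a x) \<in> carrier (sm_sec (structure_mod Y) (W x \<inter> W y))"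
        "rs_res Y (W y) (W x \<inter> W y) (a y) \<in> carrier (sm_sec (structure_mod Y) (W x \<inter> W y))"
        using res_closed[OF W(1)[OF x] o _ a[OF x]] res_closed[OF W(1)[OF y] o _ a[OF y]] by simp_all
      fix z assume z: "z \<in> W x \<inter> W y"
      then have germ: "germ Y P z (W x) (a x \<odot>\<^bsub>sm_sec P (W x)\<^esub> sm_res P U (W x) e) =
        germ Y P z (W y) (a y \<odot>\<^bsub>sm_sec P (W y)\<^esub> sm_res P U (W y) e)"
        using \<sigma>W[OF x, of z] \<sigma>W[OF y, of z] by simp
      have zy: "z \<in> W y" using z by simp
      from germ obtain Z where Z: "rs_open Y Z" "z \<in> Z" "Z \<subseteq> W x" "Z \<subseteq> W y"
        "sm_res P (W x) Z (a x \<odot>\<^bsub>sm_sec P (W x)\<^esub> sm_res P U (W x) e) =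
         sm_res P (W y) Z (a y \<odot>\<^bsub>sm_sec P (W y)\<^esub> sm_res P U (W y) e)"
        by (rule germ_eqD[OF W(1)[OF y] zy frame_closed[OF e W(1)[OF y] WU[OF y] a[OF y]]])
      then have "rs_res Y (W x) Z (a x) = rs_res Y (W y) Z (a y)"
        using frameD(6)[OF e W(1)[OF x] WU[OF x] Z(1,3) a[OF x]] frameD(6)[OF e W(1)[OF y] WU[OF y] Z(1,4) a[OF y]]
          frame_eq_iff[OF e Z(1) order_trans[OF Z(3) WU[OF x]] res_closed[OF W(1)[OF x] Z(1,3) a[OF x]]
            res_closed[OF W(1)[OF y] Z(1,4) a[OF y]]] by simp
      then have "rs_res Y (W x \<inter> W y) Z (rs_res Y (W x) (W x \<inter> W y) (a x)) =
          rs_res Y (W x \<inter> W y) Z (rs_res Y (W y) (W x \<inter> W y) (a y))"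
        using res_comp[OF W(1)[OF x] o Z(1) _ _ a[OF x]] res_comp[OF W(1)[OF y] o Z(1) _ _ a[OF y]] Z(3,4) by simp
      then show "\<exists>Z. rs_open Y Z \<and> z \<in> Z \<and> Z \<subseteq> W x \<inter> W y \<and>
          sm_res (structure_mod Y) (W x \<inter> W y) Z (rs_res Y (W x) (W x \<inter> W y) (a x)) =
          sm_res (structure_mod Y) (W x \<inter> W y) Z (rs_res Y (W y) (W x \<inter> W y) (a y))"
        using Z(1-4) by auto
    qed
    obtain b where "b \<in> carrier (sm_sec (structure_mod Y) V)"
      "\<And>x. x \<in> V \<Longrightarrow> sm_res (structure_mod Y) V (W x) b = a x"
      by (rule sheaf_glue[OF structure_sheaf V(1), of W a]) (use W a agree in auto)
    then have b: "b \<in> carrier (\<O> V)" "\<And>x. x \<in> V \<Longrightarrow> rs_res Y V (W x) b = a x" by simp_all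
    have "\<sigma> x = germs Y P V (b \<odot>\<^bsub>sm_sec P V\<^esub> sm_res P U V e) x" for x
    proof (cases "x \<in> V")
      case True
      have "\<sigma> x = germ Y P x (W x) (sm_res P V (W x) (b \<odot>\<^bsub>sm_sec P V\<^esub> sm_res P U V e))"
        using \<sigma>W[OF True W(2)[OF True]] frameD(6)[OF e V W(1)[OF True] W(3)[OF True] b(1)] b(2)[OF True] by simp
      then show ?thesis
        using germ_res[OF V(1) W(1-3)[OF True] frame_closed[OF e V b(1)]] True by (simp add: germs_def)
    next
      case False
      then show ?thesis using \<sigma> by (auto simp: sheafification_def germs_def)
    qed
    then show ?thesis using b by blast
  qed
  show ?thesis
    unfolding frame_def
  proof (intro conjI allI impI ballI; (elim conjE)?)
    fix V assume V: "rs_open Y V" "V \<subseteq> U"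
    have "bij_betw (\<lambda>a. germs Y P V (a \<odot>\<^bsub>sm_sec P V\<^esub> sm_res P U V e)) (carrier (\<O> V)) (carrier (sm_sec Psh V))"
      unfolding bij_betw_def using inj[OF V] surj[OF V] germs_closed[OF V(1) frame_closed[OF e V]]
      by (auto simp: image_iff)
    then show "bij_betw (\<lambda>r. r \<odot>\<^bsub>sm_sec Psh V\<^esub> sm_res Psh U V (germs Y P U e)) (carrier (\<O> V)) (carrier (sm_sec Psh V))"
      using sm[OF V] by (subst bij_betw_cong) simp_all
    interpret module "\<O> V" "sm_sec P V" by (rule presheaf_module[OF P V(1)])
    fix a b assume ab: "a \<in> carrier (\<O> V)" "b \<in> carrier (\<O> V)"
    show "(a \<oplus>\<^bsub>\<O> V\<^esub> b) \<odot>\<^bsub>sm_sec Psh V\<^esub> sm_res Psh U V (germs Y P U e) =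
      a \<odot>\<^bsub>sm_sec Psh V\<^esub> sm_res Psh U V (germs Y P U e) \<oplus>\<^bsub>sm_sec Psh V\<^esub> b \<odot>\<^bsub>sm_sec Psh V\<^esub> sm_res Psh U V (germs Y P U e)"
      using ab V by (simp add: sm germs_add frame_closed[OF e] frameD(4)[OF e])
    show "(a \<otimes>\<^bsub>\<O> V\<^esub> b) \<odot>\<^bsub>sm_sec Psh V\<^esub> sm_res Psh U V (germs Y P U e) =
      a \<odot>\<^bsub>sm_sec Psh V\<^esub> (b \<odot>\<^bsub>sm_sec Psh V\<^esub> sm_res Psh U V (germs Y P U e))"
      using ab V by (simp add: sm germs_smult frame_closed[OF e] frameD(5)[OF e])
  next
    fix V W a assume V: "rs_open Y V" "V \<subseteq> U" and W: "rs_open Y W" "W \<subseteq> V" and a: "a \<in> carrier (\<O> V)"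
    have WU: "W \<subseteq> U" using W V by blast
    show "sm_res Psh V W (a \<odot>\<^bsub>sm_sec Psh V\<^esub> sm_res Psh U V (germs Y P U e)) =
      rs_res Y V W a \<odot>\<^bsub>sm_sec Psh W\<^esub> sm_res Psh U W (germs Y P U e)"
      using sm[OF V a] sm[OF W(1) WU res_closed[OF V(1) W a]] frameD(6)[OF e V W a]
        germs_res[OF V(1) W frame_closed[OF e V a]] by simp
  qed (use U germs_closed eU in auto)
qed

lemma sheafification_transition:
  assumes e: "e \<in> carrier (sm_sec P U)" "e' \<in> carrier (sm_sec P U')" "rs_open Y U" "rs_open Y U'"
    and V: "rs_open Y V" "V \<subseteq> U" "V \<subseteq> U'" and a: "a \<in> carrier (\<O> V)"
    and eq: "sm_res P U' V e' = a \<odot>\<^bsub>sm_sec P V\<^esub> sm_res P U V e"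
  shows "sm_res Psh U' V (germs Y P U' e') = a \<odot>\<^bsub>sm_sec Psh V\<^esub> sm_res Psh U V (germs Y P U e)"
  using assms by (simp add: germs_res germs_smult presheaf_res_closed[OF P])

end

end

section \<open>Torsion in the Picard group\<close>

text \<open>
  A copy of \<open>L\<close> whose sections have another type. The line bundles that make up the Picard group have
  sections of one fixed type, which is not that of the structure sheaf.
\<close>

definition transport_mod :: "('m \<Rightarrow> 'n) \<Rightarrow> ('p, 's, 'm) sheaf_mod \<Rightarrow> ('p, 's, 'n) sheaf_mod" where
  "transport_mod j L =
     \<lparr>sm_sec = (\<lambda>U. \<lparr>carrier = j ` carrier (sm_sec L U), monoid.mult = undefined, monoid.one = undefined,
        ring.zero = j \<zero>\<^bsub>sm_sec L U\<^esub>,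
        ring.add = (\<lambda>s t. j (inv_into UNIV j s \<oplus>\<^bsub>sm_sec L U\<^esub> inv_into UNIV j t)),
        smult = (\<lambda>r s. j (r \<odot>\<^bsub>sm_sec L U\<^esub> inv_into UNIV j s))\<rparr>),
      sm_res = (\<lambda>U V s. j (sm_res L U V (inv_into UNIV j s)))\<rparr>"

lemma transport_module:
  assumes j: "inj j" and "module R (sm_sec L U)"
  shows "module R (sm_sec (transport_mod j L) U)"
proof -
  interpret module R "sm_sec L U" by fact
  show ?thesis
  proof (rule moduleI)
    show "cring R" by unfold_locales
    show "abelian_group (sm_sec (transport_mod j L) U)"
    proof (rule abelian_groupI)
      fix x assume "x \<in> carrier (sm_sec (transport_mod j L) U)"
      then obtain s where s: "x = j s" "s \<in> carrier (sm_sec L U)" by (auto simp: transport_mod_def)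
      show "\<exists>y\<in>carrier (sm_sec (transport_mod j L) U).
          y \<oplus>\<^bsub>sm_sec (transport_mod j L) U\<^esub> x = \<zero>\<^bsub>sm_sec (transport_mod j L) U\<^esub>"
        using s j by (auto simp: transport_mod_def M.l_neg intro!: bexI[of _ "\<ominus>\<^bsub>sm_sec L U\<^esub> s"])
    qed (use j in \<open>auto simp: transport_mod_def M.a_ac\<close>)
  qed (use j in \<open>auto simp: transport_mod_def smult_l_distr smult_r_distr smult_assoc1\<close>)
qed

lemma transport_iso:
  assumes j: "inj j" and L: "module_presheaf Y L"
  shows "iso_via Y (\<lambda>V. inv_into UNIV j) U (transport_mod j L) L"
  unfolding iso_via_def
  using j module.smult_closed[OF presheaf_module[OF L]] presheaf_res_closed[OF L]
  by (auto simp: transport_mod_def bij_betw_def inj_on_def)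

lemma transport_presheaf:
  assumes j: "inj j" and L: "module_presheaf Y L"
  shows "module_presheaf Y (transport_mod j L)"
  unfolding module_presheaf_def
proof (intro conjI allI impI ballI; (elim conjE)?)
  fix U assume U: "rs_open Y U"
  show "module (rs_ring Y U) (sm_sec (transport_mod j L) U)"
    by (rule transport_module[OF j presheaf_module[OF L U]])
  show "sm_res (transport_mod j L) U U s = s" if "s \<in> carrier (sm_sec (transport_mod j L) U)" for s
    using that j by (auto simp: transport_mod_def presheaf_res_id[OF L U])
next
  fix U V assume U: "rs_open Y U" and V: "rs_open Y V" "V \<subseteq> U"
  interpret module "rs_ring Y U" "sm_sec L U" by (rule presheaf_module[OF L U])
  show "sm_res (transport_mod j L) U V \<in> carrier (sm_sec (transport_mod j L) U) \<rightarrow> carrier (sm_sec (transport_mod j L) V)"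
    using j presheaf_res_closed[OF L U V] by (auto simp: transport_mod_def)
  fix s assume s: "s \<in> carrier (sm_sec (transport_mod j L) U)"
  show "sm_res (transport_mod j L) U V (s \<oplus>\<^bsub>sm_sec (transport_mod j L) U\<^esub> t) =
      sm_res (transport_mod j L) U V s \<oplus>\<^bsub>sm_sec (transport_mod j L) V\<^esub> sm_res (transport_mod j L) U V t"
    if t: "t \<in> carrier (sm_sec (transport_mod j L) U)" for t
    using j s t presheaf_res_add[OF L U V] by (auto simp: transport_mod_def)
  show "sm_res (transport_mod j L) U V (r \<odot>\<^bsub>sm_sec (transport_mod j L) U\<^esub> s) =
      rs_res Y U V r \<odot>\<^bsub>sm_sec (transport_mod j L) V\<^esub> sm_res (transport_mod j L) U V s"
    if t: "r \<in> carrier (rs_ring Y U)" for r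
    using j s t presheaf_res_smult[OF L U V] by (auto simp: transport_mod_def)
next
  fix U V W s assume UVW: "rs_open Y U" "rs_open Y V" "rs_open Y W" "W \<subseteq> V" "V \<subseteq> U"
    and "s \<in> carrier (sm_sec (transport_mod j L) U)"
  then show "sm_res (transport_mod j L) V W (sm_res (transport_mod j L) U V s) = sm_res (transport_mod j L) U W s"
    using j presheaf_res_comp[OF L UVW] by (auto simp: transport_mod_def)
qed

lemma transport_sheaf:
  assumes j: "inj j" and L: "module_sheaf Y L"
  shows "module_sheaf Y (transport_mod j L)"
  unfolding module_sheaf_def
proof (intro conjI allI impI; (elim conjE)?)
  show "module_presheaf Y (transport_mod j L)"
    by (rule transport_presheaf[OF j sheaf_presheaf[OF L]])
  fix \<U> s assume s: "\<forall>V\<in>\<U>. rs_open Y V \<and> s V \<in> carrier (sm_sec (transport_mod j L) V)"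
    and eq: "\<forall>V\<in>\<U>. \<forall>W\<in>\<U>. sm_res (transport_mod j L) V (V \<inter> W) (s V) = sm_res (transport_mod j L) W (V \<inter> W) (s W)"
  have sV: "\<exists>z\<in>carrier (sm_sec L V). s V = j z" if "V \<in> \<U>" for V using s that by (auto simp: transport_mod_def)
  have "\<exists>!t. t \<in> carrier (sm_sec L (\<Union>\<U>)) \<and> (\<forall>V\<in>\<U>. sm_res L (\<Union>\<U>) V t = inv_into UNIV j (s V))"
  proof (rule sheaf_amalgamation[OF L])
    fix V assume V: "V \<in> \<U>"
    then show "rs_open Y V" using s by blast
    show "inv_into UNIV j (s V) \<in> carrier (sm_sec L V)" using sV[OF V] j by auto
    fix W assume W: "W \<in> \<U>"
    have "j (sm_res L V (V \<inter> W) (inv_into UNIV j (s V))) = j (sm_res L W (V \<inter> W) (inv_into UNIV j (s W)))"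
      using bspec[OF bspec[OF eq V] W] by (simp only: transport_mod_def sheaf_mod.simps)
    then show "sm_res L V (V \<inter> W) (inv_into UNIV j (s V)) = sm_res L W (V \<inter> W) (inv_into UNIV j (s W))"
      using j by (simp add: inj_eq)
  qed
  then obtain t where t: "t \<in> carrier (sm_sec L (\<Union>\<U>))" "\<forall>V\<in>\<U>. sm_res L (\<Union>\<U>) V t = inv_into UNIV j (s V)"
    and t_uniq: "\<And>t'. t' \<in> carrier (sm_sec L (\<Union>\<U>)) \<and> (\<forall>V\<in>\<U>. sm_res L (\<Union>\<U>) V t' = inv_into UNIV j (s V)) \<Longrightarrow> t' = t"
    by (elim ex1E conjE) blast
  have jinv: "j (inv_into UNIV j (s V)) = s V" if "V \<in> \<U>" for V using sV[OF that] j by auto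
  show "\<exists>!t. t \<in> carrier (sm_sec (transport_mod j L) (\<Union>\<U>)) \<and>
      (\<forall>V\<in>\<U>. sm_res (transport_mod j L) (\<Union>\<U>) V t = s V)"
  proof (rule ex1I[of _ "j t"])
    show "j t \<in> carrier (sm_sec (transport_mod j L) (\<Union>\<U>)) \<and>
      (\<forall>V\<in>\<U>. sm_res (transport_mod j L) (\<Union>\<U>) V (j t) = s V)"
      using t j jinv by (simp add: transport_mod_def)
    fix t' assume t': "t' \<in> carrier (sm_sec (transport_mod j L) (\<Union>\<U>)) \<and>
      (\<forall>V\<in>\<U>. sm_res (transport_mod j L) (\<Union>\<U>) V t' = s V)"
    then obtain z where z: "z \<in> carrier (sm_sec L (\<Union>\<U>))" "t' = j z" by (auto simp: transport_mod_def)
    have "sm_res L (\<Union>\<U>) V z = inv_into UNIV j (s V)" if V: "V \<in> \<U>" for V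
    proof -
      have "j (sm_res L (\<Union>\<U>) V z) = s V" using t' V z j by (simp add: transport_mod_def)
      then show ?thesis using j by (metis inv_f_f)
    qed
    then show "t' = j t" using t_uniq z by blast
  qed
qed

context sheaf_ringed begin

abbreviation "top_space \<equiv> topspace (rs_top Y)"

lemma sub_top: "rs_open Y U \<Longrightarrow> U \<subseteq> top_space"
  by (rule openin_subset)

lemma invertible_presheaf: "invertible_sheaf Y L \<Longrightarrow> module_presheaf Y L"
  unfolding invertible_sheaf_def by (auto dest: sheaf_presheaf)

lemma invertibleI:
  assumes "module_sheaf Y L" "frame Y L top_space e"
  shows "invertible_sheaf Y L"
  unfolding invertible_sheaf_def
  using assms frames_iso[OF assms(2) structure_frame] by (auto intro: exI[of _ top_space])

text \<open>
  By \<open>frames_iso\<close> a global frame makes \<open>T\<close> isomorphic to the structure sheaf.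
\<close>

lemma iso_class_of_frame:
  assumes \<sigma>: "frame Y T top_space \<sigma>"
  shows "iso_class Y T = iso_class Y (structure_mod Y)"
proof -
  have "sheaf_iso Y N T \<longleftrightarrow> sheaf_iso Y N (structure_mod Y)" if N: "invertible_sheaf Y N" for N :: "('p, 's) line_bundle"
  proof
    assume "sheaf_iso Y N T"
    then obtain \<phi> where "iso_via Y \<phi> top_space N T" unfolding sheaf_iso_def sheaf_iso_on_iff by blast
    from iso_frame_ex[OF invertible_presheaf[OF N] this \<sigma>]
    obtain n where "frame Y N top_space n" by blast
    then show "sheaf_iso Y N (structure_mod Y)"
      unfolding sheaf_iso_def by (rule frames_iso) (rule structure_frame, simp)
  next
    assume "sheaf_iso Y N (structure_mod Y)"
    then obtain \<phi> where "iso_via Y \<phi> top_space N (structure_mod Y)" unfolding sheaf_iso_def sheaf_iso_on_iff by blast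
    from iso_frame_ex[OF invertible_presheaf[OF N] this structure_frame]
    obtain n where "frame Y N top_space n" by auto
    then show "sheaf_iso Y N T"
      unfolding sheaf_iso_def by (rule frames_iso) (rule \<sigma>)
  qed
  then show ?thesis unfolding iso_class_def by blast
qed

lemma trivial_class_frame:
  assumes "N \<in> iso_class Y (structure_mod Y)"
  obtains n where "frame Y N top_space n"
proof -
  from assms have N: "invertible_sheaf Y N" and "sheaf_iso Y N (structure_mod Y)"
    unfolding iso_class_def by auto
  then obtain \<phi> where "iso_via Y \<phi> top_space N (structure_mod Y)" unfolding sheaf_iso_def sheaf_iso_on_iff by blast
  from iso_frame_ex[OF invertible_presheaf[OF N] this structure_frame]
  show ?thesis using that by auto
qed

text \<open>
  The unit of the Picard group is the class of the structure sheaf; to see that it belongs to the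
  carrier, the structure sheaf is copied to the type of line bundles, along the injection
  \<open>r \<mapsto> (\<lambda>_. {({}, r)})\<close>.
\<close>

lemma trivial_line_bundle:
  obtains L0 :: "('p, 's) line_bundle" where "invertible_sheaf Y L0" "L0 \<in> iso_class Y (structure_mod Y)"
    "iso_class Y L0 = iso_class Y (structure_mod Y)"
proof -
  define j :: "'s \<Rightarrow> 'p \<Rightarrow> ('p set \<times> 's) set" where "j r = (\<lambda>_. {({}, r)})" for r
  have j: "inj j" unfolding j_def inj_on_def by (auto simp: fun_eq_iff)
  let ?L = "transport_mod j (structure_mod Y)"
  have iso: "iso_via Y (\<lambda>V. inv_into UNIV j) top_space ?L (structure_mod Y)"
    by (rule transport_iso[OF j structure_presheaf])
  obtain e where e: "frame Y ?L top_space e"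
    by (rule iso_frame_ex[OF transport_presheaf[OF j structure_presheaf] iso structure_frame]) simp
  have inv: "invertible_sheaf Y ?L" by (rule invertibleI[OF transport_sheaf[OF j structure_sheaf] e])
  have "sheaf_iso Y ?L (structure_mod Y)" using iso unfolding sheaf_iso_def sheaf_iso_on_iff by blast
  then have "?L \<in> iso_class Y (structure_mod Y)" unfolding iso_class_def using inv by blast
  then show ?thesis using that inv iso_class_of_frame[OF e] by blast
qed

lemma tensor_sheaf_frame:
  assumes "module_presheaf Y L" "module_presheaf Y M" "frame Y L U e" "frame Y M U f"
  shows "frame Y (tensor_sheaf Y L M) U (germs Y (tensor_presheaf Y L M) U
    (tensor_class (\<O> U) (sm_sec L U) (sm_sec M U) (frag_of (e, f))))"
  unfolding tensor_sheaf_def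
  by (rule sheafification_frame[OF tensor_presheaf_presheaf tensor_presheaf_frame]) fact+

lemma Pic_one_power: "\<one>\<^bsub>Pic Y\<^esub> [^]\<^bsub>Pic Y\<^esub> (k::nat) = \<one>\<^bsub>Pic Y\<^esub>"
proof -
  let ?I = "iso_class Y (structure_mod Y)"
  obtain L0 where L0: "L0 \<in> ?I" using trivial_line_bundle by blast
  have t: "iso_class Y (tensor_sheaf Y L M) = ?I" if LM: "L \<in> ?I" "M \<in> ?I" for L M
  proof -
    have p: "module_presheaf Y L" "module_presheaf Y M"
      using LM invertible_presheaf unfolding iso_class_def by blast+
    obtain e f where "frame Y L top_space e" "frame Y M top_space f"
      using trivial_class_frame LM by metis
    then show ?thesis by (rule iso_class_of_frame[OF tensor_sheaf_frame[OF p]])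
  qed
  have "(\<Union>M\<in>?I. iso_class Y (tensor_sheaf Y L M)) = ?I" if "L \<in> ?I" for L
    by (rule UN_constant_eq[OF L0]) (simp add: t that)
  then have "(\<Union>L\<in>?I. \<Union>M\<in>?I. iso_class Y (tensor_sheaf Y L M)) = ?I"
    by (intro UN_constant_eq[OF L0]) simp
  then have "\<one>\<^bsub>Pic Y\<^esub> \<otimes>\<^bsub>Pic Y\<^esub> \<one>\<^bsub>Pic Y\<^esub> = \<one>\<^bsub>Pic Y\<^esub>" by (simp add: Pic_def)
  then show ?thesis unfolding nat_pow_def by (induction k) simp_all
qed

lemma Pic_one_torsion: "\<one>\<^bsub>Pic Y\<^esub> \<in> torsion_part (Pic Y) k"
proof -
  obtain L0 :: "('p, 's) line_bundle" where L0: "invertible_sheaf Y L0" "iso_class Y L0 = iso_class Y (structure_mod Y)"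
    using trivial_line_bundle by metis
  then have "\<one>\<^bsub>Pic Y\<^esub> \<in> carrier (Pic Y)" unfolding Pic_def by auto
  then show ?thesis unfolding torsion_part_def using Pic_one_power by blast
qed

text \<open>
  The frames \<open>n\<close> have the \<open>k\<close>-th powers of the transition functions of \<open>e\<close>, as the frames
  \<open>e \<otimes> \<dots> \<otimes> e\<close> of the \<open>k\<close>-th tensor power do.
\<close>

definition power_frames :: "('p, 's, 'm) sheaf_mod \<Rightarrow> 'i set \<Rightarrow> ('i \<Rightarrow> 'p set) \<Rightarrow> ('i \<Rightarrow> 'm) \<Rightarrow> nat
    \<Rightarrow> ('p, 's, 'n) sheaf_mod \<Rightarrow> ('i \<Rightarrow> 'n) \<Rightarrow> bool" where
  "power_frames L I U e k N n \<longleftrightarrow> (\<forall>x\<in>I. frame Y N (U x) (n x)) \<and>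
     (\<forall>x\<in>I. \<forall>y\<in>I. \<forall>V g. rs_open Y V \<and> V \<subseteq> U x \<and> V \<subseteq> U y \<and> g \<in> carrier (\<O> V) \<and>
        sm_res L (U y) V (e y) = g \<odot>\<^bsub>sm_sec L V\<^esub> sm_res L (U x) V (e x) \<longrightarrow>
        sm_res N (U y) V (n y) = (g [^]\<^bsub>\<O> V\<^esub> k) \<odot>\<^bsub>sm_sec N V\<^esub> sm_res N (U x) V (n x))"

lemma power_framesD:
  assumes h: "power_frames L I U e k N n" and x: "x \<in> I"
  shows "frame Y N (U x) (n x)"
    and "y \<in> I \<Longrightarrow> rs_open Y V \<Longrightarrow> V \<subseteq> U x \<Longrightarrow> V \<subseteq> U y \<Longrightarrow> g \<in> carrier (\<O> V) \<Longrightarrow>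
       sm_res L (U y) V (e y) = g \<odot>\<^bsub>sm_sec L V\<^esub> sm_res L (U x) V (e x) \<Longrightarrow>
       sm_res N (U y) V (n y) = (g [^]\<^bsub>\<O> V\<^esub> k) \<odot>\<^bsub>sm_sec N V\<^esub> sm_res N (U x) V (n x)"
proof -
  show "frame Y N (U x) (n x)"
    by (rule h[unfolded power_frames_def, THEN conjunct1, THEN bspec[OF _ x]])
  assume y: "y \<in> I" and V: "rs_open Y V" "V \<subseteq> U x" "V \<subseteq> U y" "g \<in> carrier (\<O> V)"
    and eg: "sm_res L (U y) V (e y) = g \<odot>\<^bsub>sm_sec L V\<^esub> sm_res L (U x) V (e x)"
  show "sm_res N (U y) V (n y) = (g [^]\<^bsub>\<O> V\<^esub> k) \<odot>\<^bsub>sm_sec N V\<^esub> sm_res N (U x) V (n x)"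
    by (rule h[unfolded power_frames_def, THEN conjunct2, THEN bspec[OF _ x], THEN bspec[OF _ y],
          THEN spec, THEN spec, THEN mp]) (intro conjI V eg)
qed

text \<open>
  Induction on \<open>k\<close>: transition functions multiply under tensor products, are kept by sheafification, and
  are carried along an isomorphism to any other member of the class.
\<close>

lemma Pic_power_frames:
  fixes L :: "('p, 's) line_bundle"
  assumes L: "invertible_sheaf Y L" and e: "\<And>x. x \<in> I \<Longrightarrow> frame Y L (U x) (e x)"
    and N: "N \<in> iso_class Y L [^]\<^bsub>Pic Y\<^esub> (k::nat)"
  shows "invertible_sheaf Y N \<and> (\<exists>n. power_frames L I U e k N n)"
  using N
proof (induction k arbitrary: N)
  case 0
  have "iso_class Y L [^]\<^bsub>Pic Y\<^esub> (0::nat) = iso_class Y (structure_mod Y)"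
    by (simp add: nat_pow_def Pic_def)
  then have N: "N \<in> iso_class Y (structure_mod Y)" using 0 by simp
  then have inv: "invertible_sheaf Y N" unfolding iso_class_def by blast
  note P = invertible_presheaf[OF inv]
  obtain n where n: "frame Y N top_space n" by (rule trivial_class_frame[OF N])
  have trans: "sm_res N (U y) V (sm_res N top_space (U y) n) = (g [^]\<^bsub>\<O> V\<^esub> (0::nat)) \<odot>\<^bsub>sm_sec N V\<^esub> sm_res N (U x) V (sm_res N top_space (U x) n)"
    if x: "x \<in> I" "y \<in> I" and V: "rs_open Y V" "V \<subseteq> U x" "V \<subseteq> U y" for x y V g
  proof -
    note o = frameD(1)[OF e]
    interpret module "\<O> V" "sm_sec N V" by (rule presheaf_module[OF P V(1)])
    have "sm_res N top_space V n \<in> carrier (sm_sec N V)"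
      by (rule presheaf_res_closed[OF P frameD(1)[OF n] V(1) sub_top[OF V(1)] frameD(2)[OF n]])
    then show ?thesis
      using presheaf_res_comp[OF P frameD(1)[OF n] o[OF x(1)] V(1,2) sub_top[OF o[OF x(1)]] frameD(2)[OF n]]
        presheaf_res_comp[OF P frameD(1)[OF n] o[OF x(2)] V(1,3) sub_top[OF o[OF x(2)]] frameD(2)[OF n]] by simp
  qed
  have fr: "frame Y N (U x) (sm_res N top_space (U x) n)" if "x \<in> I" for x
    by (rule frame_restrict[OF P n frameD(1)[OF e[OF that]] sub_top[OF frameD(1)[OF e[OF that]]]])
  have "power_frames L I U e 0 N (\<lambda>x. sm_res N top_space (U x) n)"
    unfolding power_frames_def
    by (intro conjI ballI allI impI; (elim conjE)?; (rule fr trans; assumption))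
  with inv show ?case by blast
next
  case (Suc k)
  have "iso_class Y L [^]\<^bsub>Pic Y\<^esub> (Suc k) = (\<Union>L'\<in>iso_class Y L [^]\<^bsub>Pic Y\<^esub> k. \<Union>M\<in>iso_class Y L. iso_class Y (tensor_sheaf Y L' M))"
    by (simp add: nat_pow_def Pic_def)
  then obtain L' M where L': "L' \<in> iso_class Y L [^]\<^bsub>Pic Y\<^esub> k" and M: "M \<in> iso_class Y L"
    and N: "N \<in> iso_class Y (tensor_sheaf Y L' M)" using Suc.prems by auto
  from Suc.IH[OF L'] obtain n where L'i: "invertible_sheaf Y L'" and pf: "power_frames L I U e k L' n"
    by (elim conjE exE)
  note n = power_framesD(1)[OF pf] and n' = power_framesD(2)[OF pf]
  from M have Mi: "invertible_sheaf Y M" and "sheaf_iso Y M L" unfolding iso_class_def by auto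
  then obtain \<phi> where \<phi>: "iso_via Y \<phi> top_space M L" unfolding sheaf_iso_def sheaf_iso_on_iff by blast
  from N have Ni: "invertible_sheaf Y N" and "sheaf_iso Y N (tensor_sheaf Y L' M)" unfolding iso_class_def by auto
  then obtain \<psi> where \<psi>: "iso_via Y \<psi> top_space N (tensor_sheaf Y L' M)" unfolding sheaf_iso_def sheaf_iso_on_iff by blast
  note PL = invertible_presheaf[OF L] and PL' = invertible_presheaf[OF L'i]
    and PM = invertible_presheaf[OF Mi] and PN = invertible_presheaf[OF Ni]
  have o: "rs_open Y (U x)" if "x \<in> I" for x by (rule frameD(1)[OF e[OF that]])
  have "\<exists>f. frame Y M (U x) f \<and> \<phi> (U x) f = e x" if "x \<in> I" for x
    using iso_frame_ex[OF PM iso_via_restrict[OF \<phi> sub_top[OF o[OF that]]] e[OF that]] by blast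
  then obtain f where f: "\<And>x. x \<in> I \<Longrightarrow> frame Y M (U x) (f x)" "\<And>x. x \<in> I \<Longrightarrow> \<phi> (U x) (f x) = e x"
    by metis
  define \<sigma> where "\<sigma> x = germs Y (tensor_presheaf Y L' M) (U x)
    (tensor_class (\<O> (U x)) (sm_sec L' (U x)) (sm_sec M (U x)) (frag_of (n x, f x)))" for x
  have \<sigma>: "frame Y (tensor_sheaf Y L' M) (U x) (\<sigma> x)" if "x \<in> I" for x
    unfolding \<sigma>_def by (rule tensor_sheaf_frame[OF PL' PM n[OF that] f(1)[OF that]])
  have "\<exists>m. frame Y N (U x) m \<and> \<psi> (U x) m = \<sigma> x" if "x \<in> I" for x
    using iso_frame_ex[OF PN iso_via_restrict[OF \<psi> sub_top[OF o[OF that]]] \<sigma>[OF that]] by blast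
  then obtain m where m: "\<And>x. x \<in> I \<Longrightarrow> frame Y N (U x) (m x)" "\<And>x. x \<in> I \<Longrightarrow> \<psi> (U x) (m x) = \<sigma> x"
    by metis
  have trans: "sm_res N (U y) V (m y) = (g [^]\<^bsub>\<O> V\<^esub> Suc k) \<odot>\<^bsub>sm_sec N V\<^esub> sm_res N (U x) V (m x)"
    if x: "x \<in> I" and y: "y \<in> I" and V: "rs_open Y V" "V \<subseteq> U x" "V \<subseteq> U y" and g: "g \<in> carrier (\<O> V)"
      and eg: "sm_res L (U y) V (e y) = g \<odot>\<^bsub>sm_sec L V\<^esub> sm_res L (U x) V (e x)" for x y V g
  proof -
    interpret R: cring "\<O> V" by (rule cring_O[OF V(1)])
    interpret MV: module "\<O> V" "sm_sec M V" by (rule presheaf_module[OF PM V(1)])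
    interpret NV: module "\<O> V" "sm_sec N V" by (rule presheaf_module[OF PN V(1)])
    note VT = sub_top[OF V(1)]
    have fV: "sm_res M (U x) V (f x) \<in> carrier (sm_sec M V)" "sm_res M (U y) V (f y) \<in> carrier (sm_sec M V)"
      using presheaf_res_closed[OF PM o[OF x] V(1,2) frameD(2)[OF f(1)[OF x]]]
        presheaf_res_closed[OF PM o[OF y] V(1,3) frameD(2)[OF f(1)[OF y]]] .
    have mV: "sm_res N (U x) V (m x) \<in> carrier (sm_sec N V)" "sm_res N (U y) V (m y) \<in> carrier (sm_sec N V)"
      using presheaf_res_closed[OF PN o[OF x] V(1,2) frameD(2)[OF m(1)[OF x]]]
        presheaf_res_closed[OF PN o[OF y] V(1,3) frameD(2)[OF m(1)[OF y]]] .
    have "\<phi> V (sm_res M (U y) V (f y)) = \<phi> V (g \<odot>\<^bsub>sm_sec M V\<^esub> sm_res M (U x) V (f x))"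
      using iso_viaD(4)[OF \<phi> o[OF x] sub_top[OF o[OF x]] V(1,2) frameD(2)[OF f(1)[OF x]]]
        iso_viaD(4)[OF \<phi> o[OF y] sub_top[OF o[OF y]] V(1,3) frameD(2)[OF f(1)[OF y]]]
        iso_viaD(3)[OF \<phi> V(1) VT g fV(1)] f(2)[OF x] f(2)[OF y] eg by simp
    then have fg: "sm_res M (U y) V (f y) = g \<odot>\<^bsub>sm_sec M V\<^esub> sm_res M (U x) V (f x)"
      using bij_betw_imp_inj_on[OF iso_viaD(1)[OF \<phi> V(1) VT]] fV g by (simp add: inj_on_eq_iff)
    have gk: "g [^]\<^bsub>\<O> V\<^esub> k \<otimes>\<^bsub>\<O> V\<^esub> g \<in> carrier (\<O> V)" using g by simp
    have \<sigma>g: "sm_res (tensor_sheaf Y L' M) (U y) V (\<sigma> y) = (g [^]\<^bsub>\<O> V\<^esub> k \<otimes>\<^bsub>\<O> V\<^esub> g)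
        \<odot>\<^bsub>sm_sec (tensor_sheaf Y L' M) V\<^esub> sm_res (tensor_sheaf Y L' M) (U x) V (\<sigma> x)"
      unfolding \<sigma>_def tensor_sheaf_def
      by (rule sheafification_transition[OF tensor_presheaf_presheaf[OF PL' PM]
            frameD(2)[OF tensor_presheaf_frame[OF PL' PM n[OF x] f(1)[OF x]]]
            frameD(2)[OF tensor_presheaf_frame[OF PL' PM n[OF y] f(1)[OF y]]] o[OF x] o[OF y] V gk
            tensor_presheaf_transition[OF PL' PM n[OF x] n[OF y] f(1)[OF x] f(1)[OF y] V _ g n'[OF x y V g eg] fg]])
        (use g in simp)
    have "\<psi> V (sm_res N (U y) V (m y)) = \<psi> V ((g [^]\<^bsub>\<O> V\<^esub> k \<otimes>\<^bsub>\<O> V\<^esub> g) \<odot>\<^bsub>sm_sec N V\<^esub> sm_res N (U x) V (m x))"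
      using iso_viaD(4)[OF \<psi> o[OF x] sub_top[OF o[OF x]] V(1,2) frameD(2)[OF m(1)[OF x]]]
        iso_viaD(4)[OF \<psi> o[OF y] sub_top[OF o[OF y]] V(1,3) frameD(2)[OF m(1)[OF y]]]
        iso_viaD(3)[OF \<psi> V(1) VT gk mV(1)] m(2)[OF x] m(2)[OF y] \<sigma>g by simp
    then show ?thesis
      using bij_betw_imp_inj_on[OF iso_viaD(1)[OF \<psi> V(1) VT]] mV g by (simp add: inj_on_eq_iff)
  qed
  have "power_frames L I U e (Suc k) N m"
    unfolding power_frames_def
    by (intro conjI ballI allI impI; (elim conjE)?; (rule m(1) trans; assumption))
  with Ni show ?case by blast
qed

text \<open>
  The structure sheaf is a member of the trivial class \<open>L\<^sup>k\<close>. Its frames from \<open>Pic_power_frames\<close> are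
  generators of the unit ideal, that is, units.
\<close>

lemma torsion_units:
  fixes L :: "('p, 's) line_bundle"
  assumes L: "invertible_sheaf Y L" and e: "\<And>x. x \<in> I \<Longrightarrow> frame Y L (U x) (e x)"
    and tors: "iso_class Y L [^]\<^bsub>Pic Y\<^esub> (k::nat) = \<one>\<^bsub>Pic Y\<^esub>"
  obtains u where "\<forall>x\<in>I. u x \<in> Units (\<O> (U x))"
    and "\<forall>x\<in>I. \<forall>y\<in>I. \<forall>V g. rs_open Y V \<and> V \<subseteq> U x \<and> V \<subseteq> U y \<and> g \<in> carrier (\<O> V) \<and>
       sm_res L (U y) V (e y) = g \<odot>\<^bsub>sm_sec L V\<^esub> sm_res L (U x) V (e x) \<longrightarrow>
       rs_res Y (U y) V (u y) = (g [^]\<^bsub>\<O> V\<^esub> k) \<otimes>\<^bsub>\<O> V\<^esub> rs_res Y (U x) V (u x)"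
proof -
  obtain L0 where L0: "L0 \<in> iso_class Y (structure_mod Y)" using trivial_line_bundle by blast
  then have h: "L0 \<in> iso_class Y L [^]\<^bsub>Pic Y\<^esub> k" unfolding tors by (simp add: Pic_def)
  have "invertible_sheaf Y L0 \<and> (\<exists>n. power_frames L I U e k L0 n)"
    by (rule Pic_power_frames[OF L _ h]) (rule e)
  then obtain n where L0i: "invertible_sheaf Y L0" and pf: "power_frames L I U e k L0 n"
    by (elim conjE exE)
  note n = power_framesD(1)[OF pf] and n' = power_framesD(2)[OF pf]
  note P = invertible_presheaf[OF L0i]
  from L0 obtain \<theta> where \<theta>: "iso_via Y \<theta> top_space L0 (structure_mod Y)"
    unfolding iso_class_def sheaf_iso_def sheaf_iso_on_iff by blast
  have o: "rs_open Y (U x)" if "x \<in> I" for x by (rule frameD(1)[OF e[OF that]])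
  show thesis
  proof (rule that[of "\<lambda>x. \<theta> (U x) (n x)"]; (intro ballI allI impI)?; (elim conjE)?)
    fix x assume x: "x \<in> I"
    interpret R: cring "\<O> (U x)" by (rule cring_O[OF o[OF x]])
    note \<theta>x = iso_viaD[OF \<theta> o[OF x] sub_top[OF o[OF x]]]
    have nx: "n x \<in> carrier (sm_sec L0 (U x))" by (rule frameD(2)[OF n[OF x]])
    have ux: "\<theta> (U x) (n x) \<in> carrier (\<O> (U x))" using bij_betw_apply[OF \<theta>x(1) nx] by simp
    have "\<one>\<^bsub>\<O> (U x)\<^esub> \<in> \<theta> (U x) ` carrier (sm_sec L0 (U x))"
      unfolding bij_betw_imp_surj_on[OF \<theta>x(1)] by simp
    then obtain t where t: "t \<in> carrier (sm_sec L0 (U x))" "\<theta> (U x) t = \<one>\<^bsub>\<O> (U x)\<^esub>" by (elim imageE) simp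
    obtain a where a: "a \<in> carrier (\<O> (U x))" "t = a \<odot>\<^bsub>sm_sec L0 (U x)\<^esub> sm_res L0 (U x) (U x) (n x)"
      by (rule frame_coeff[OF n[OF x] o[OF x] order_refl t(1)])
    have "a \<otimes>\<^bsub>\<O> (U x)\<^esub> \<theta> (U x) (n x) = \<one>\<^bsub>\<O> (U x)\<^esub>"
      using \<theta>x(3)[OF a(1) nx] t(2) a(2) presheaf_res_id[OF P o[OF x] nx] by simp
    then show "\<theta> (U x) (n x) \<in> Units (\<O> (U x))"
      using a(1) ux R.m_comm[OF a(1) ux] unfolding Units_def by auto
  next
    fix x y V g assume x: "x \<in> I" and y: "y \<in> I" and V: "rs_open Y V" "V \<subseteq> U x" "V \<subseteq> U y" and g: "g \<in> carrier (\<O> V)"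
      and eg: "sm_res L (U y) V (e y) = g \<odot>\<^bsub>sm_sec L V\<^esub> sm_res L (U x) V (e x)"
    interpret R: cring "\<O> V" by (rule cring_O[OF V(1)])
    have "sm_res L0 (U x) V (n x) \<in> carrier (sm_sec L0 V)"
      by (rule presheaf_res_closed[OF P o[OF x] V(1,2) frameD(2)[OF n[OF x]]])
    then show "rs_res Y (U y) V (\<theta> (U y) (n y)) = (g [^]\<^bsub>\<O> V\<^esub> k) \<otimes>\<^bsub>\<O> V\<^esub> rs_res Y (U x) V (\<theta> (U x) (n x))"
      using iso_viaD(4)[OF \<theta> o[OF x] sub_top[OF o[OF x]] V(1,2) frameD(2)[OF n[OF x]]]
        iso_viaD(4)[OF \<theta> o[OF y] sub_top[OF o[OF y]] V(1,3) frameD(2)[OF n[OF y]]]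
        iso_viaD(3)[OF \<theta> V(1) sub_top[OF V(1)], of "g [^]\<^bsub>\<O> V\<^esub> k"] n'[OF x y V g eg] g by simp
  qed
qed

text \<open>
  The frames glue to a section over the whole space. It is a frame, because the local coefficients of
  any section with respect to it glue as well.
\<close>

lemma agreeing_frames_trivial:
  assumes L: "invertible_sheaf Y L"
    and cover: "\<And>x. x \<in> top_space \<Longrightarrow> x \<in> U x"
    and e: "\<And>x. x \<in> top_space \<Longrightarrow> frame Y L (U x) (e x)"
    and agree: "\<And>x y. x \<in> top_space \<Longrightarrow> y \<in> top_space \<Longrightarrow>
      sm_res L (U x) (U x \<inter> U y) (e x) = sm_res L (U y) (U x \<inter> U y) (e y)"
  shows "iso_class Y L = \<one>\<^bsub>Pic Y\<^esub>"
proof -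
  have Ls: "module_sheaf Y L" using L unfolding invertible_sheaf_def by blast
  note P = invertible_presheaf[OF L]
  have o: "rs_open Y (U x)" if "x \<in> top_space" for x by (rule frameD(1)[OF e[OF that]])
  have T: "rs_open Y top_space" by simp
  obtain t where t: "t \<in> carrier (sm_sec L top_space)" "\<And>x. x \<in> top_space \<Longrightarrow> sm_res L top_space (U x) t = e x"
    by (rule sheaf_glue[OF Ls T, of U e]) (use o cover sub_top[OF o] frameD(2)[OF e] agree in auto)
  have tr: "sm_res L (U x) W (e x) = sm_res L top_space W t" if "x \<in> top_space" "rs_open Y W" "W \<subseteq> U x" for x W
    using presheaf_res_comp[OF P T o[OF that(1)] that(2,3) sub_top[OF o[OF that(1)]] t(1)] t(2)[OF that(1)] by simp
  have "frame Y L top_space t"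
  proof (rule frame_presheafI[OF P T t(1)])
    fix V assume V: "rs_open Y V" "V \<subseteq> top_space"
    interpret R: module "\<O> V" "sm_sec L V" by (rule presheaf_module[OF P V(1)])
    have tV: "sm_res L top_space V t \<in> carrier (sm_sec L V)" by (rule presheaf_res_closed[OF P T V t(1)])
    have oV: "rs_open Y (V \<inter> U x)" if "x \<in> V" for x
      using V o[OF subsetD[OF V(2) that]] by (simp add: openin_Int)
    have res: "sm_res L V W (a \<odot>\<^bsub>sm_sec L V\<^esub> sm_res L top_space V t) =
        rs_res Y V W a \<odot>\<^bsub>sm_sec L W\<^esub> sm_res L (U x) W (e x)"
      if x: "x \<in> V" and W: "rs_open Y W" "W \<subseteq> V" "W \<subseteq> U x" and a: "a \<in> carrier (\<O> V)" for x W a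
      using presheaf_res_smult[OF P V(1) W(1,2) a tV] presheaf_res_comp[OF P T V(1) W(1,2) V(2) t(1)]
        tr[OF subsetD[OF V(2) x] W(1,3)] by simp
    have "inj_on (\<lambda>r. r \<odot>\<^bsub>sm_sec L V\<^esub> sm_res L top_space V t) (carrier (\<O> V))"
    proof (rule inj_onI)
      fix a b assume a: "a \<in> carrier (\<O> V)" and b: "b \<in> carrier (\<O> V)"
        and eq: "a \<odot>\<^bsub>sm_sec L V\<^esub> sm_res L top_space V t = b \<odot>\<^bsub>sm_sec L V\<^esub> sm_res L top_space V t"
      show "a = b"
      proof (rule sheaf_separated[OF structure_sheaf V(1)])
        fix x assume x: "x \<in> V"
        have "rs_res Y V (V \<inter> U x) a \<odot>\<^bsub>sm_sec L (V \<inter> U x)\<^esub> sm_res L (U x) (V \<inter> U x) (e x) =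
          rs_res Y V (V \<inter> U x) b \<odot>\<^bsub>sm_sec L (V \<inter> U x)\<^esub> sm_res L (U x) (V \<inter> U x) (e x)"
          using res[OF x oV[OF x] _ _ a] res[OF x oV[OF x] _ _ b] eq by simp
        then have "rs_res Y V (V \<inter> U x) a = rs_res Y V (V \<inter> U x) b"
          using frame_eq_iff[OF e[OF subsetD[OF V(2) x]] oV[OF x]] res_closed[OF V(1) oV[OF x]] a b by simp
        then show "\<exists>W. rs_open Y W \<and> x \<in> W \<and> W \<subseteq> V \<and>
            sm_res (structure_mod Y) V W a = sm_res (structure_mod Y) V W b"
          using oV[OF x] x cover[OF subsetD[OF V(2) x]] by (intro exI[of _ "V \<inter> U x"]) simp
      qed (use a b in simp_all)
    qed
    moreover have "\<exists>a\<in>carrier (\<O> V). s = a \<odot>\<^bsub>sm_sec L V\<^esub> sm_res L top_space V t" if s: "s \<in> carrier (sm_sec L V)" for s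
    proof -
      have "\<exists>a. a \<in> carrier (\<O> (V \<inter> U x)) \<and>
          sm_res L V (V \<inter> U x) s = a \<odot>\<^bsub>sm_sec L (V \<inter> U x)\<^esub> sm_res L (U x) (V \<inter> U x) (e x)" if x: "x \<in> V" for x
        using frame_coeff[OF e[OF subsetD[OF V(2) x]] oV[OF x] Int_lower2
            presheaf_res_closed[OF P V(1) oV[OF x] Int_lower1 s]] by metis
      then obtain a where a: "\<And>x. x \<in> V \<Longrightarrow> a x \<in> carrier (\<O> (V \<inter> U x))"
        "\<And>x. x \<in> V \<Longrightarrow> sm_res L V (V \<inter> U x) s = a x \<odot>\<^bsub>sm_sec L (V \<inter> U x)\<^esub> sm_res L (U x) (V \<inter> U x) (e x)"
        by metis
      have loc: "sm_res L V W s = rs_res Y (V \<inter> U x) W (a x) \<odot>\<^bsub>sm_sec L W\<^esub> sm_res L top_space W t"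
        if x: "x \<in> V" and W: "rs_open Y W" "W \<subseteq> V \<inter> U x" for x W
      proof -
        have "sm_res L V W s = sm_res L (V \<inter> U x) W (sm_res L V (V \<inter> U x) s)"
          by (rule presheaf_res_comp[OF P V(1) oV[OF x] W Int_lower1 s, symmetric])
        also have "\<dots> = rs_res Y (V \<inter> U x) W (a x) \<odot>\<^bsub>sm_sec L W\<^esub> sm_res L (U x) W (e x)"
          unfolding a(2)[OF x]
          by (rule frameD(6)[OF e[OF subsetD[OF V(2) x]] oV[OF x] Int_lower2 W a(1)[OF x]])
        also have "sm_res L (U x) W (e x) = sm_res L top_space W t"
          by (rule tr[OF subsetD[OF V(2) x] W(1)]) (use W in auto)
        finally show ?thesis .
      qed
      have "rs_res Y (V \<inter> U x) ((V \<inter> U x) \<inter> (V \<inter> U y)) (a x) =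
          rs_res Y (V \<inter> U y) ((V \<inter> U x) \<inter> (V \<inter> U y)) (a y)" if x: "x \<in> V" and y: "y \<in> V" for x y
      proof -
        let ?W = "(V \<inter> U x) \<inter> (V \<inter> U y)"
        have W: "rs_open Y ?W" using oV[OF x] oV[OF y] by (rule openin_Int)
        have Wx: "?W \<subseteq> U x" "?W \<subseteq> V \<inter> U x" "?W \<subseteq> V \<inter> U y" by blast+
        note xT = subsetD[OF V(2) x]
        have "rs_res Y (V \<inter> U x) ?W (a x) \<odot>\<^bsub>sm_sec L ?W\<^esub> sm_res L (U x) ?W (e x) =
          rs_res Y (V \<inter> U y) ?W (a y) \<odot>\<^bsub>sm_sec L ?W\<^esub> sm_res L (U x) ?W (e x)"
          unfolding tr[OF xT W Wx(1)] using loc[OF x W Wx(2)] loc[OF y W Wx(3)] by (rule subst)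
        then show ?thesis
          by (rule iffD1[OF frame_eq_iff[OF e[OF xT] W Wx(1) res_closed[OF oV[OF x] W Wx(2) a(1)[OF x]]
              res_closed[OF oV[OF y] W Wx(3) a(1)[OF y]]]])
      qed
      then obtain b where b: "b \<in> carrier (sm_sec (structure_mod Y) V)"
        "\<And>x. x \<in> V \<Longrightarrow> sm_res (structure_mod Y) V (V \<inter> U x) b = a x"
        using sheaf_glue[OF structure_sheaf V(1), of "\<lambda>x. V \<inter> U x" a] oV cover V a(1) by (auto simp: subset_iff)
      have b': "b \<in> carrier (\<O> V)" "\<And>x. x \<in> V \<Longrightarrow> rs_res Y V (V \<inter> U x) b = a x" using b by simp_all
      have "s = b \<odot>\<^bsub>sm_sec L V\<^esub> sm_res L top_space V t"
      proof (rule sheaf_separated[OF Ls V(1) s])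
        show "b \<odot>\<^bsub>sm_sec L V\<^esub> sm_res L top_space V t \<in> carrier (sm_sec L V)" using b' tV by simp
        fix x assume x: "x \<in> V"
        have "sm_res L V (V \<inter> U x) s = sm_res L V (V \<inter> U x) (b \<odot>\<^bsub>sm_sec L V\<^esub> sm_res L top_space V t)"
          using res[OF x oV[OF x] Int_lower1 Int_lower2 b'(1)] a(2)[OF x] b'(2)[OF x] by simp
        then show "\<exists>W. rs_open Y W \<and> x \<in> W \<and> W \<subseteq> V \<and>
            sm_res L V W s = sm_res L V W (b \<odot>\<^bsub>sm_sec L V\<^esub> sm_res L top_space V t)"
          using oV[OF x] x cover[OF subsetD[OF V(2) x]] by (intro exI[of _ "V \<inter> U x"]) simp
      qed
      then show ?thesis using b'(1) by blast
    qed
    moreover have "a \<odot>\<^bsub>sm_sec L V\<^esub> sm_res L top_space V t \<in> carrier (sm_sec L V)" if "a \<in> carrier (\<O> V)" for a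
      using that tV by simp
    ultimately show "bij_betw (\<lambda>r. r \<odot>\<^bsub>sm_sec L V\<^esub> sm_res L top_space V t) (carrier (\<O> V)) (carrier (sm_sec L V))"
      unfolding bij_betw_def by (intro conjI equalityI subsetI) (auto simp: image_iff)
  qed
  from iso_class_of_frame[OF this] show ?thesis by (simp add: Pic_def)
qed

end

section \<open>The spectrum of a domain\<close>

locale mult_subset = domain A for A (structure) +
  fixes S
  assumes S_sub: "S \<subseteq> carrier A" and S_one: "\<one> \<in> S" and S_zero: "\<zero> \<notin> S"
    and S_mult: "s \<in> S \<Longrightarrow> t \<in> S \<Longrightarrow> s \<otimes> t \<in> S"
begin

abbreviation "fr \<equiv> loc_frac A S"

lemma S_carrier: "s \<in> S \<Longrightarrow> s \<in> carrier A"
  using S_sub by blast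

lemma S_nonzero: "s \<in> S \<Longrightarrow> s \<noteq> \<zero>"
  using S_zero by blast

lemma mem_fr:
  assumes "a \<in> carrier A" "s \<in> S"
  shows "(b, t) \<in> fr a s \<longleftrightarrow> b \<in> carrier A \<and> t \<in> S \<and> a \<otimes> t = b \<otimes> s"
proof
  assume "(b, t) \<in> fr a s"
  then obtain u where u: "b \<in> carrier A" "t \<in> S" "u \<in> S" "u \<otimes> (a \<otimes> t) = u \<otimes> (b \<otimes> s)"
    unfolding loc_frac_def by auto
  then have "a \<otimes> t = b \<otimes> s"
    using assms m_lcancel[of u "a \<otimes> t" "b \<otimes> s"] S_carrier S_nonzero by auto
  then show "b \<in> carrier A \<and> t \<in> S \<and> a \<otimes> t = b \<otimes> s" using u by simp
next
  assume "b \<in> carrier A \<and> t \<in> S \<and> a \<otimes> t = b \<otimes> s"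
  then show "(b, t) \<in> fr a s" unfolding loc_frac_def using S_one by auto
qed

text \<open>
  In a domain, the factor from \<open>S\<close> that occurs in the general criterion for equality of fractions can
  be cancelled.
\<close>

lemma fr_eq:
  assumes a: "a \<in> carrier A" "s \<in> S" and b: "b \<in> carrier A" "t \<in> S"
  shows "fr a s = fr b t \<longleftrightarrow> a \<otimes> t = b \<otimes> s"
proof
  assume eq: "fr a s = fr b t"
  have "(b, t) \<in> fr b t" using mem_fr[OF b] b by simp
  then show "a \<otimes> t = b \<otimes> s" unfolding eq[symmetric] mem_fr[OF a] by simp
next
  assume eq: "a \<otimes> t = b \<otimes> s"
  have "a \<otimes> d = c \<otimes> s \<longleftrightarrow> b \<otimes> d = c \<otimes> t" if c: "c \<in> carrier A" "d \<in> S" for c d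
  proof -
    note car = a(1) b(1) c(1) S_carrier[OF a(2)] S_carrier[OF b(2)] S_carrier[OF c(2)]
    have "a \<otimes> d = c \<otimes> s \<longleftrightarrow> t \<otimes> (a \<otimes> d) = t \<otimes> (c \<otimes> s)"
      using car S_nonzero[OF b(2)] by (simp add: m_lcancel)
    also have "t \<otimes> (a \<otimes> d) = (a \<otimes> t) \<otimes> d" using car by (simp add: m_ac)
    also have "\<dots> = s \<otimes> (b \<otimes> d)" unfolding eq using car by (simp add: m_ac)
    also have "t \<otimes> (c \<otimes> s) = s \<otimes> (c \<otimes> t)" using car by (simp add: m_ac)
    also have "s \<otimes> (b \<otimes> d) = s \<otimes> (c \<otimes> t) \<longleftrightarrow> b \<otimes> d = c \<otimes> t"
      using car S_nonzero[OF a(2)] by (simp add: m_lcancel)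
    finally show ?thesis .
  qed
  then have "z \<in> fr a s \<longleftrightarrow> z \<in> fr b t" for z
    by (cases z) (use mem_fr[OF a] mem_fr[OF b] in auto)
  then show "fr a s = fr b t" by blast
qed

lemma fr_self: "a \<in> carrier A \<Longrightarrow> s \<in> S \<Longrightarrow> (a, s) \<in> fr a s"
  by (simp add: mem_fr)

lemma carrier_loc: "carrier (localization A S) = {fr a s |a s. a \<in> carrier A \<and> s \<in> S}"
  by (simp add: localization_def)

lemma fr_closed: "a \<in> carrier A \<Longrightarrow> s \<in> S \<Longrightarrow> fr a s \<in> carrier (localization A S)"
  unfolding carrier_loc by blast

lemma fr_mult:
  assumes a: "a \<in> carrier A" "s \<in> S" and b: "b \<in> carrier A" "t \<in> S"
  shows "fr a s \<otimes>\<^bsub>localization A S\<^esub> fr b t = fr (a \<otimes> b) (s \<otimes> t)"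
proof -
  have "(\<Union>(a', s')\<in>fr a s. \<Union>(b', t')\<in>fr b t. fr (a' \<otimes> b') (s' \<otimes> t')) = fr (a \<otimes> b) (s \<otimes> t)"
  proof (rule UN_constant_eq[OF fr_self[OF a]], clarify, rule UN_constant_eq[OF fr_self[OF b]], clarify)
    fix a' s' b' t' assume "(a', s') \<in> fr a s" "(b', t') \<in> fr b t"
    then have 1: "a' \<in> carrier A" "s' \<in> S" "a \<otimes> s' = a' \<otimes> s" and 2: "b' \<in> carrier A" "t' \<in> S" "b \<otimes> t' = b' \<otimes> t"
      using mem_fr a b by auto
    note car = a(1) b(1) 1(1) 2(1) S_carrier[OF a(2)] S_carrier[OF b(2)] S_carrier[OF 1(2)] S_carrier[OF 2(2)]
    have "(a' \<otimes> b') \<otimes> (s \<otimes> t) = (a' \<otimes> s) \<otimes> (b' \<otimes> t)" using car by (simp add: m_ac)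
    also have "\<dots> = (a \<otimes> b) \<otimes> (s' \<otimes> t')"
      unfolding 1(3)[symmetric] 2(3)[symmetric] using car by (simp add: m_ac)
    finally show "fr (a' \<otimes> b') (s' \<otimes> t') = fr (a \<otimes> b) (s \<otimes> t)"
      using car a(2) b(2) 1(2) 2(2) by (simp add: fr_eq S_mult)
  qed
  then show ?thesis by (simp add: localization_def)
qed

lemma fr_add:
  assumes a: "a \<in> carrier A" "s \<in> S" and b: "b \<in> carrier A" "t \<in> S"
  shows "fr a s \<oplus>\<^bsub>localization A S\<^esub> fr b t = fr (a \<otimes> t \<oplus> b \<otimes> s) (s \<otimes> t)"
proof -
  have "(\<Union>(a', s')\<in>fr a s. \<Union>(b', t')\<in>fr b t. fr (a' \<otimes> t' \<oplus> b' \<otimes> s') (s' \<otimes> t')) = fr (a \<otimes> t \<oplus> b \<otimes> s) (s \<otimes> t)"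
  proof (rule UN_constant_eq[OF fr_self[OF a]], clarify, rule UN_constant_eq[OF fr_self[OF b]], clarify)
    fix a' s' b' t' assume "(a', s') \<in> fr a s" "(b', t') \<in> fr b t"
    then have 1: "a' \<in> carrier A" "s' \<in> S" "a \<otimes> s' = a' \<otimes> s" and 2: "b' \<in> carrier A" "t' \<in> S" "b \<otimes> t' = b' \<otimes> t"
      using mem_fr a b by auto
    note car = a(1) b(1) 1(1) 2(1) S_carrier[OF a(2)] S_carrier[OF b(2)] S_carrier[OF 1(2)] S_carrier[OF 2(2)]
    have "(a' \<otimes> t' \<oplus> b' \<otimes> s') \<otimes> (s \<otimes> t) = (a' \<otimes> s) \<otimes> (t \<otimes> t') \<oplus> (b' \<otimes> t) \<otimes> (s \<otimes> s')"
      using car by (simp add: m_ac l_distr r_distr)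
    also have "\<dots> = (a \<otimes> t \<oplus> b \<otimes> s) \<otimes> (s' \<otimes> t')"
      unfolding 1(3)[symmetric] 2(3)[symmetric] using car by (simp add: m_ac l_distr r_distr)
    finally show "fr (a' \<otimes> t' \<oplus> b' \<otimes> s') (s' \<otimes> t') = fr (a \<otimes> t \<oplus> b \<otimes> s) (s \<otimes> t)"
      using car a(2) b(2) 1(2) 2(2) by (simp add: fr_eq S_mult)
  qed
  then show ?thesis by (simp add: localization_def)
qed

lemma one_loc: "\<one>\<^bsub>localization A S\<^esub> = fr \<one> \<one>" and zero_loc: "\<zero>\<^bsub>localization A S\<^esub> = fr \<zero> \<one>"
  by (simp_all add: localization_def)

lemma localization_cring: "cring (localization A S)"
proof (rule cringI)
  let ?L = "localization A S"
  have ex: "\<exists>a s. x = fr a s \<and> a \<in> carrier A \<and> s \<in> S" if "x \<in> carrier ?L" for x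
    using that unfolding carrier_loc by blast
  note simps = fr_mult fr_add fr_eq fr_closed S_mult S_carrier one_loc zero_loc S_one
  show "abelian_group ?L"
  proof (rule abelian_groupI)
    fix x y assume "x \<in> carrier ?L" "y \<in> carrier ?L"
    then obtain a s b t where 1: "x = fr a s" "a \<in> carrier A" "s \<in> S" "y = fr b t" "b \<in> carrier A" "t \<in> S"
      using ex by meson
    then show "x \<oplus>\<^bsub>?L\<^esub> y \<in> carrier ?L" by (simp add: simps)
    show "x \<oplus>\<^bsub>?L\<^esub> y = y \<oplus>\<^bsub>?L\<^esub> x" using 1 by (simp add: simps) (simp add: simps m_ac a_ac)
    show "\<zero>\<^bsub>?L\<^esub> \<oplus>\<^bsub>?L\<^esub> x = x" using 1 by (simp add: simps)
    have "fr (\<ominus> a) s \<oplus>\<^bsub>?L\<^esub> x = \<zero>\<^bsub>?L\<^esub>" using 1 by (simp add: simps l_minus l_neg)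
    moreover have "fr (\<ominus> a) s \<in> carrier ?L" using 1 by (simp add: simps)
    ultimately show "\<exists>y\<in>carrier ?L. y \<oplus>\<^bsub>?L\<^esub> x = \<zero>\<^bsub>?L\<^esub>" by blast
    fix z assume "z \<in> carrier ?L"
    then obtain c u where "z = fr c u" "c \<in> carrier A" "u \<in> S" using ex by meson
    with 1 show "x \<oplus>\<^bsub>?L\<^esub> y \<oplus>\<^bsub>?L\<^esub> z = x \<oplus>\<^bsub>?L\<^esub> (y \<oplus>\<^bsub>?L\<^esub> z)"
      by (simp add: simps) (simp add: simps m_ac a_ac l_distr r_distr)
  qed (simp add: simps)
  show "comm_monoid ?L"
  proof (rule comm_monoidI)
    fix x y assume "x \<in> carrier ?L" "y \<in> carrier ?L"
    then obtain a s b t where 1: "x = fr a s" "a \<in> carrier A" "s \<in> S" "y = fr b t" "b \<in> carrier A" "t \<in> S"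
      using ex by meson
    then show "x \<otimes>\<^bsub>?L\<^esub> y \<in> carrier ?L" by (simp add: simps)
    show "x \<otimes>\<^bsub>?L\<^esub> y = y \<otimes>\<^bsub>?L\<^esub> x" using 1 by (simp add: simps) (simp add: simps m_ac)
    show "\<one>\<^bsub>?L\<^esub> \<otimes>\<^bsub>?L\<^esub> x = x" using 1 by (simp add: simps)
    fix z assume "z \<in> carrier ?L"
    then obtain c u where "z = fr c u" "c \<in> carrier A" "u \<in> S" using ex by meson
    with 1 show "x \<otimes>\<^bsub>?L\<^esub> y \<otimes>\<^bsub>?L\<^esub> z = x \<otimes>\<^bsub>?L\<^esub> (y \<otimes>\<^bsub>?L\<^esub> z)"
      by (simp add: simps) (simp add: simps m_ac)
  qed (simp add: simps)
  fix x y z assume "x \<in> carrier ?L" "y \<in> carrier ?L" "z \<in> carrier ?L"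
  then obtain a s b t c u where "x = fr a s" "a \<in> carrier A" "s \<in> S" "y = fr b t" "b \<in> carrier A" "t \<in> S"
    "z = fr c u" "c \<in> carrier A" "u \<in> S" using ex by meson
  then show "(x \<oplus>\<^bsub>?L\<^esub> y) \<otimes>\<^bsub>?L\<^esub> z = x \<otimes>\<^bsub>?L\<^esub> z \<oplus>\<^bsub>?L\<^esub> y \<otimes>\<^bsub>?L\<^esub> z"
    by (simp add: simps) (simp add: simps m_ac a_ac l_distr r_distr)
qed

end

lemma Spec_open: "rs_open (Spec A) U \<longleftrightarrow> zariski_open A U"
  by (simp add: Spec_def topology_inverse'[OF istopology_zariski])

lemma zariski_open_prime: "zariski_open A U \<Longrightarrow> P \<in> U \<Longrightarrow> primeideal P A"
  unfolding zariski_open_def by auto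

lemma zariski_open_Int: "zariski_open A U \<Longrightarrow> zariski_open A V \<Longrightarrow> zariski_open A (U \<inter> V)"
  using istopology_zariski[of A] unfolding istopology_def by blast

context domain begin

lemma mult_subset_prime:
  assumes "primeideal P R"
  shows "mult_subset R (carrier R - P)"
proof -
  interpret P: primeideal P R by fact
  show ?thesis
  proof (unfold_locales)
    show "\<one> \<in> carrier R - P" using P.I_notcarr P.one_imp_carrier by (metis DiffI one_closed)
    show "s \<otimes> t \<in> carrier R - P" if "s \<in> carrier R - P" "t \<in> carrier R - P" for s t
      using that P.I_prime[of s t] by auto
  qed auto
qed

lemma not_mem_prime_power:
  assumes "primeideal P R" "s \<in> carrier R" "s \<notin> P"
  shows "s [^] (k::nat) \<notin> P"
proof (induction k)
  case 0
  interpret P: primeideal P R by fact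
  show ?case using P.I_notcarr P.one_imp_carrier by (metis nat_pow_0)
next
  case (Suc k)
  interpret P: primeideal P R by fact
  show ?case using Suc assms P.I_prime[of "s [^] k" s] by auto
qed

abbreviation "Oring \<equiv> rs_ring (Spec R)"
abbreviation frac_at :: "'a set \<Rightarrow> 'a \<Rightarrow> 'a \<Rightarrow> ('a \<times> 'a) set" where
  "frac_at Q \<equiv> loc_frac R (carrier R - Q)"

lemma Spec_carrier:
  "f \<in> carrier (Oring U) \<longleftrightarrow> f \<in> (\<Pi>\<^sub>E P\<in>U. carrier (local_ring R P)) \<and>
     (\<forall>P\<in>U. \<exists>V a s. zariski_open R V \<and> P \<in> V \<and> V \<subseteq> U \<and> a \<in> carrier R \<and> s \<in> carrier R \<and>
       (\<forall>Q\<in>V. s \<notin> Q \<and> f Q = frac_at Q a s))"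
  by (simp add: Spec_def)

lemma Spec_section_local:
  assumes "f \<in> carrier (Oring U)" "P \<in> U"
  obtains V a s where "zariski_open R V" "P \<in> V" "V \<subseteq> U" "a \<in> carrier R" "s \<in> carrier R"
    "\<forall>Q\<in>V. s \<notin> Q \<and> f Q = frac_at Q a s"
proof -
  have "\<forall>P\<in>U. \<exists>V a s. zariski_open R V \<and> P \<in> V \<and> V \<subseteq> U \<and> a \<in> carrier R \<and> s \<in> carrier R \<and>
       (\<forall>Q\<in>V. s \<notin> Q \<and> f Q = frac_at Q a s)"
    using assms(1) unfolding Spec_carrier by (rule conjunct2)
  then show ?thesis
    by (rule bspec[OF _ assms(2), elim_format]) (elim exE conjE, rule that)
qed

lemma Spec_sectionI:
  assumes U: "zariski_open R U" and ext: "f \<in> extensional U"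
    and loc: "\<And>P. P \<in> U \<Longrightarrow> \<exists>V a s. zariski_open R V \<and> P \<in> V \<and> V \<subseteq> U \<and> a \<in> carrier R \<and> s \<in> carrier R \<and>
       (\<forall>Q\<in>V. s \<notin> Q \<and> f Q = frac_at Q a s)"
  shows "f \<in> carrier (Oring U)"
proof -
  have "f P \<in> carrier (local_ring R P)" if P: "P \<in> U" for P
  proof -
    interpret mult_subset R "carrier R - P" by (rule mult_subset_prime[OF zariski_open_prime[OF U P]])
    from loc[OF P] obtain V a s where "P \<in> V" "a \<in> carrier R" "s \<in> carrier R"
      and V: "\<forall>Q\<in>V. s \<notin> Q \<and> f Q = frac_at Q a s" by (elim exE conjE)
    then show ?thesis using bspec[OF V, of P] fr_closed[of a s] by simp
  qed
  then have "f \<in> (\<Pi>\<^sub>E P\<in>U. carrier (local_ring R P))" using ext by (simp add: PiE_def)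
  then show ?thesis unfolding Spec_carrier by (intro conjI ballI loc)
qed

lemma Spec_ops:
  "P \<in> U \<Longrightarrow> (f \<otimes>\<^bsub>Oring U\<^esub> g) P = f P \<otimes>\<^bsub>local_ring R P\<^esub> g P"
  "P \<in> U \<Longrightarrow> (f \<oplus>\<^bsub>Oring U\<^esub> g) P = f P \<oplus>\<^bsub>local_ring R P\<^esub> g P"
  "P \<in> U \<Longrightarrow> \<one>\<^bsub>Oring U\<^esub> P = \<one>\<^bsub>local_ring R P\<^esub>"
  "P \<in> U \<Longrightarrow> \<zero>\<^bsub>Oring U\<^esub> P = \<zero>\<^bsub>local_ring R P\<^esub>"
  by (simp_all add: Spec_def)

lemma Spec_ops_ext:
  "f \<otimes>\<^bsub>Oring U\<^esub> g \<in> extensional U" "f \<oplus>\<^bsub>Oring U\<^esub> g \<in> extensional U"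
  "\<one>\<^bsub>Oring U\<^esub> \<in> extensional U" "\<zero>\<^bsub>Oring U\<^esub> \<in> extensional U"
  by (simp_all add: Spec_def)

lemma Spec_ext: "f \<in> carrier (Oring U) \<Longrightarrow> f \<in> extensional U"
  unfolding Spec_carrier by (auto simp: PiE_def)

lemma Spec_value: "f \<in> carrier (Oring U) \<Longrightarrow> P \<in> U \<Longrightarrow> f P \<in> carrier (local_ring R P)"
  unfolding Spec_carrier by auto

definition frac_sec :: "'a set set \<Rightarrow> 'a \<Rightarrow> 'a \<Rightarrow> 'a set \<Rightarrow> ('a \<times> 'a) set" where
  "frac_sec U a s = (\<lambda>Q\<in>U. frac_at Q a s)"

lemma frac_sec_closed:
  assumes "zariski_open R U" "a \<in> carrier R" "s \<in> carrier R" "\<And>Q. Q \<in> U \<Longrightarrow> s \<notin> Q"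
  shows "frac_sec U a s \<in> carrier (Oring U)"
  by (rule Spec_sectionI[OF assms(1)]) (use assms in \<open>auto simp: frac_sec_def\<close>)

text \<open>
  Sums and products of sections have the same common denominator; \<open>c\<close> is the numerator.
\<close>

lemma Spec_binop_closed:
  assumes U: "zariski_open R U" and f: "f \<in> carrier (Oring U)" and g: "g \<in> carrier (Oring U)"
    and h: "h \<in> extensional U" "\<And>Q a s b t. Q \<in> U \<Longrightarrow> a \<in> carrier R \<Longrightarrow> b \<in> carrier R \<Longrightarrow>
      s \<in> carrier R - Q \<Longrightarrow> t \<in> carrier R - Q \<Longrightarrow> f Q = frac_at Q a s \<Longrightarrow> g Q = frac_at Q b t \<Longrightarrow>
      h Q = frac_at Q (c a s b t) (s \<otimes> t)"
    and c: "\<And>a s b t. a \<in> carrier R \<Longrightarrow> b \<in> carrier R \<Longrightarrow> s \<in> carrier R \<Longrightarrow> t \<in> carrier R \<Longrightarrow> c a s b t \<in> carrier R"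
  shows "h \<in> carrier (Oring U)"
proof (rule Spec_sectionI[OF U h(1)])
  fix P assume P: "P \<in> U"
  obtain V a s where V: "zariski_open R V" "P \<in> V" "V \<subseteq> U" "a \<in> carrier R" "s \<in> carrier R"
    "\<forall>Q\<in>V. s \<notin> Q \<and> f Q = frac_at Q a s"
    by (rule Spec_section_local[OF f P])
  obtain W b t where W: "zariski_open R W" "P \<in> W" "W \<subseteq> U" "b \<in> carrier R" "t \<in> carrier R"
    "\<forall>Q\<in>W. t \<notin> Q \<and> g Q = frac_at Q b t"
    by (rule Spec_section_local[OF g P])
  have "s \<otimes> t \<notin> Q \<and> h Q = frac_at Q (c a s b t) (s \<otimes> t)" if Q: "Q \<in> V \<inter> W" for Q
  proof
    interpret primeideal Q R using zariski_open_prime[OF V(1)] Q by blast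
    show "s \<otimes> t \<notin> Q" using I_prime[of s t] V(5,6) W(5,6) Q by blast
    show "h Q = frac_at Q (c a s b t) (s \<otimes> t)" using V W Q by (intro h(2)) auto
  qed
  then show "\<exists>V a s. zariski_open R V \<and> P \<in> V \<and> V \<subseteq> U \<and> a \<in> carrier R \<and> s \<in> carrier R \<and>
       (\<forall>Q\<in>V. s \<notin> Q \<and> h Q = frac_at Q a s)"
    using V(1-5) W(1-5) zariski_open_Int[OF V(1) W(1)] c[OF V(4) W(4) V(5) W(5)]
    by (intro exI[of _ "V \<inter> W"] exI[of _ "c a s b t"] exI[of _ "s \<otimes> t"]) auto
qed

lemma Spec_local_cring:
  assumes "zariski_open R U" "P \<in> U"
  shows "cring (local_ring R P)"
  by (rule mult_subset.localization_cring[OF mult_subset_prime[OF zariski_open_prime[OF assms]]])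

lemma Spec_eqI:
  assumes "f \<in> extensional U" "g \<in> extensional U" "\<And>P. P \<in> U \<Longrightarrow> f P = g P"
  shows "f = g"
  by (rule extensionalityI[OF assms])

lemma Spec_cring:
  assumes U: "zariski_open R U"
  shows "cring (Oring U)"
proof -
  note loc = cring.cring_simprules[OF Spec_local_cring[OF U]]
  have add: "f \<oplus>\<^bsub>Oring U\<^esub> g \<in> carrier (Oring U)" if "f \<in> carrier (Oring U)" "g \<in> carrier (Oring U)" for f g
    by (rule Spec_binop_closed[where c = "\<lambda>a s b t. a \<otimes> t \<oplus> b \<otimes> s", OF U that Spec_ops_ext(2)])
      (auto simp: Spec_ops mult_subset.fr_add[OF mult_subset_prime[OF zariski_open_prime[OF U]]])
  have mult: "f \<otimes>\<^bsub>Oring U\<^esub> g \<in> carrier (Oring U)" if "f \<in> carrier (Oring U)" "g \<in> carrier (Oring U)" for f g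
    by (rule Spec_binop_closed[where c = "\<lambda>a s b t. a \<otimes> b", OF U that Spec_ops_ext(1)])
      (auto simp: Spec_ops mult_subset.fr_mult[OF mult_subset_prime[OF zariski_open_prime[OF U]]])
  have one_notin: "\<one> \<notin> Q" if "Q \<in> U" for Q
    using not_mem_prime_power[OF zariski_open_prime[OF U that], of _ 0]
      mult_subset.S_one[OF mult_subset_prime[OF zariski_open_prime[OF U that]]] by auto
  have one: "\<one>\<^bsub>Oring U\<^esub> \<in> carrier (Oring U)"
  proof -
    have "\<one>\<^bsub>Oring U\<^esub> = frac_sec U \<one> \<one>"
      by (rule Spec_eqI[OF Spec_ops_ext(3)]) (auto simp: frac_sec_def Spec_ops localization_def)
    then show ?thesis using frac_sec_closed[OF U _ _ one_notin] by simp
  qed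
  have zero: "\<zero>\<^bsub>Oring U\<^esub> \<in> carrier (Oring U)"
  proof -
    have "\<zero>\<^bsub>Oring U\<^esub> = frac_sec U \<zero> \<one>"
      by (rule Spec_eqI[OF Spec_ops_ext(4)]) (auto simp: frac_sec_def Spec_ops localization_def)
    then show ?thesis using frac_sec_closed[OF U _ _ one_notin] by simp
  qed
  have neg: "\<exists>g\<in>carrier (Oring U). g \<oplus>\<^bsub>Oring U\<^esub> f = \<zero>\<^bsub>Oring U\<^esub>" if f: "f \<in> carrier (Oring U)" for f
  proof
    let ?g = "frac_sec U (\<ominus> \<one>) \<one> \<otimes>\<^bsub>Oring U\<^esub> f"
    have m: "frac_sec U (\<ominus> \<one>) \<one> \<in> carrier (Oring U)" using frac_sec_closed[OF U _ _ one_notin] by simp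
    show "?g \<in> carrier (Oring U)" by (rule mult[OF m f])
    show "?g \<oplus>\<^bsub>Oring U\<^esub> f = \<zero>\<^bsub>Oring U\<^esub>"
    proof (rule Spec_eqI[OF Spec_ops_ext(2,4)])
      fix P assume P: "P \<in> U"
      interpret mult_subset R "carrier R - P" by (rule mult_subset_prime[OF zariski_open_prime[OF U P]])
      obtain a s where a: "a \<in> carrier R" "s \<in> carrier R - P" "f P = fr a s"
        using Spec_value[OF f P] unfolding carrier_loc by blast
      have "s \<otimes> s \<in> carrier R - P" using a by (intro S_mult)
      then have "fr \<zero> (s \<otimes> s) = fr \<zero> \<one>"
        using fr_eq[of \<zero> "s \<otimes> s" \<zero> \<one>] a S_one by simp
      with a show "(?g \<oplus>\<^bsub>Oring U\<^esub> f) P = \<zero>\<^bsub>Oring U\<^esub> P"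
        using P S_one by (simp add: Spec_ops frac_sec_def fr_mult fr_add zero_loc S_mult S_carrier l_minus l_neg)
    qed
  qed
  show ?thesis
  proof (rule cringI)
    show "abelian_group (Oring U)"
    proof (rule abelian_groupI)
      fix f g h assume f: "f \<in> carrier (Oring U)" and g: "g \<in> carrier (Oring U)"
      show "f \<oplus>\<^bsub>Oring U\<^esub> g \<in> carrier (Oring U)" by (rule add[OF f g])
      show "f \<oplus>\<^bsub>Oring U\<^esub> g = g \<oplus>\<^bsub>Oring U\<^esub> f"
        by (rule Spec_eqI[OF Spec_ops_ext(2) Spec_ops_ext(2)])
          (simp only: Spec_ops loc(10) Spec_value[OF f] Spec_value[OF g])
      show "\<zero>\<^bsub>Oring U\<^esub> \<oplus>\<^bsub>Oring U\<^esub> f = f"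
        by (rule Spec_eqI[OF Spec_ops_ext(2) Spec_ext[OF f]]) (simp add: Spec_ops loc(8) Spec_value[OF f])
      show "\<exists>g\<in>carrier (Oring U). g \<oplus>\<^bsub>Oring U\<^esub> f = \<zero>\<^bsub>Oring U\<^esub>" by (rule neg[OF f])
      assume h: "h \<in> carrier (Oring U)"
      show "f \<oplus>\<^bsub>Oring U\<^esub> g \<oplus>\<^bsub>Oring U\<^esub> h = f \<oplus>\<^bsub>Oring U\<^esub> (g \<oplus>\<^bsub>Oring U\<^esub> h)"
        by (rule Spec_eqI[OF Spec_ops_ext(2) Spec_ops_ext(2)])
          (simp add: Spec_ops loc(7) Spec_value[OF f] Spec_value[OF g] Spec_value[OF h])
    qed (rule zero)
    show "comm_monoid (Oring U)"
    proof (rule comm_monoidI)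
      fix f g h assume f: "f \<in> carrier (Oring U)" and g: "g \<in> carrier (Oring U)"
      show "f \<otimes>\<^bsub>Oring U\<^esub> g \<in> carrier (Oring U)" by (rule mult[OF f g])
      show "f \<otimes>\<^bsub>Oring U\<^esub> g = g \<otimes>\<^bsub>Oring U\<^esub> f"
        by (rule Spec_eqI[OF Spec_ops_ext(1) Spec_ops_ext(1)])
          (simp only: Spec_ops loc(14) Spec_value[OF f] Spec_value[OF g])
      show "\<one>\<^bsub>Oring U\<^esub> \<otimes>\<^bsub>Oring U\<^esub> f = f"
        by (rule Spec_eqI[OF Spec_ops_ext(1) Spec_ext[OF f]]) (simp add: Spec_ops loc(12) Spec_value[OF f])
      assume h: "h \<in> carrier (Oring U)"
      show "f \<otimes>\<^bsub>Oring U\<^esub> g \<otimes>\<^bsub>Oring U\<^esub> h = f \<otimes>\<^bsub>Oring U\<^esub> (g \<otimes>\<^bsub>Oring U\<^esub> h)"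
        by (rule Spec_eqI[OF Spec_ops_ext(1) Spec_ops_ext(1)])
          (simp add: Spec_ops loc(11) Spec_value[OF f] Spec_value[OF g] Spec_value[OF h])
    qed (rule one)
    show "(f \<oplus>\<^bsub>Oring U\<^esub> g) \<otimes>\<^bsub>Oring U\<^esub> h = f \<otimes>\<^bsub>Oring U\<^esub> h \<oplus>\<^bsub>Oring U\<^esub> g \<otimes>\<^bsub>Oring U\<^esub> h"
      if "f \<in> carrier (Oring U)" "g \<in> carrier (Oring U)" "h \<in> carrier (Oring U)" for f g h
      by (rule Spec_eqI[OF Spec_ops_ext(1,2)]) (use that in \<open>simp add: Spec_ops loc Spec_value\<close>)
  qed
qed

lemma Spec_res: "rs_res (Spec R) U V f = restrict f V"
  by (simp add: Spec_def)

lemma Spec_restrict_closed: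
  assumes U: "zariski_open R U" and V: "zariski_open R V" "V \<subseteq> U" and f: "f \<in> carrier (Oring U)"
  shows "restrict f V \<in> carrier (Oring V)"
proof (rule Spec_sectionI[OF V(1)])
  fix P assume P: "P \<in> V"
  then have "P \<in> U" using V by blast
  then obtain W a s where W: "zariski_open R W" "P \<in> W" "W \<subseteq> U" "a \<in> carrier R" "s \<in> carrier R"
    "\<forall>Q\<in>W. s \<notin> Q \<and> f Q = frac_at Q a s" by (rule Spec_section_local[OF f])
  show "\<exists>W a s. zariski_open R W \<and> P \<in> W \<and> W \<subseteq> V \<and> a \<in> carrier R \<and> s \<in> carrier R \<and>
       (\<forall>Q\<in>W. s \<notin> Q \<and> restrict f V Q = frac_at Q a s)"
  proof (intro exI conjI ballI)
    show "zariski_open R (W \<inter> V)" by (rule zariski_open_Int[OF W(1) V(1)])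
    show "P \<in> W \<inter> V" using P W(2) by simp
    fix Q assume Q: "Q \<in> W \<inter> V"
    show "s \<notin> Q" using W(6) Q by simp
    show "restrict f V Q = frac_at Q a s" using bspec[OF W(6), of Q] Q by simp
  qed (use W in simp_all)
qed simp

text \<open>
  Restriction is restriction of functions, so sections glue to their union, and being a fraction is a
  local property.
\<close>

lemma Spec_module_sheaf: "module_sheaf (Spec R) (structure_mod (Spec R))"
  unfolding module_sheaf_def
proof (intro conjI allI impI; (elim conjE)?)
  show "module_presheaf (Spec R) (structure_mod (Spec R))"
    unfolding module_presheaf_def
  proof (intro conjI allI impI ballI; (elim conjE)?)
    fix U assume "rs_open (Spec R) U"
    then have U: "zariski_open R U" by (simp add: Spec_open)
    interpret U: cring "Oring U" by (rule Spec_cring[OF U])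
    have "abelian_group (sm_sec (structure_mod (Spec R)) U)"
      by (rule abelian_groupI)
        (use U.a_inv_closed U.l_neg in \<open>auto simp: structure_mod_def U.a_ac intro!: bexI[of _ "\<ominus>\<^bsub>Oring U\<^esub> _"]\<close>)
    then show "module (Oring U) (sm_sec (structure_mod (Spec R)) U)"
      by (intro moduleI U.is_cring) (simp_all add: U.l_distr U.r_distr U.m_assoc)
    show "sm_res (structure_mod (Spec R)) U U s = s" if "s \<in> carrier (sm_sec (structure_mod (Spec R)) U)" for s
      using Spec_ext[of s U] that by (simp add: Spec_res extensional_restrict)
  next
    fix U V assume "rs_open (Spec R) U" "rs_open (Spec R) V" and VU: "V \<subseteq> U"
    then have U: "zariski_open R U" and V: "zariski_open R V" by (simp_all add: Spec_open)
    show "sm_res (structure_mod (Spec R)) U V \<in> carrier (sm_sec (structure_mod (Spec R)) U) \<rightarrow> carrier (sm_sec (structure_mod (Spec R)) V)"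
      using Spec_restrict_closed[OF U V VU] by (simp add: Spec_res)
    show "sm_res (structure_mod (Spec R)) U V (s \<oplus>\<^bsub>sm_sec (structure_mod (Spec R)) U\<^esub> t) =
      sm_res (structure_mod (Spec R)) U V s \<oplus>\<^bsub>sm_sec (structure_mod (Spec R)) V\<^esub> sm_res (structure_mod (Spec R)) U V t" for s t
      unfolding structure_mod_simps Spec_res
      by (rule Spec_eqI[OF restrict_extensional Spec_ops_ext(2)]) (use VU in \<open>auto simp: Spec_ops\<close>)
    show "sm_res (structure_mod (Spec R)) U V (s \<odot>\<^bsub>sm_sec (structure_mod (Spec R)) U\<^esub> t) =
      rs_res (Spec R) U V s \<odot>\<^bsub>sm_sec (structure_mod (Spec R)) V\<^esub> sm_res (structure_mod (Spec R)) U V t" for s t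
      unfolding structure_mod_simps Spec_res
      by (rule Spec_eqI[OF restrict_extensional Spec_ops_ext(1)]) (use VU in \<open>auto simp: Spec_ops\<close>)
  next
    fix U V W :: "'a set set" and s assume "W \<subseteq> V" "V \<subseteq> U"
    then show "sm_res (structure_mod (Spec R)) V W (sm_res (structure_mod (Spec R)) U V s) = sm_res (structure_mod (Spec R)) U W s"
      by (auto simp: Spec_res fun_eq_iff)
  qed
  fix \<U> s assume sU: "\<forall>V\<in>\<U>. rs_open (Spec R) V \<and> s V \<in> carrier (sm_sec (structure_mod (Spec R)) V)"
    and eq: "\<forall>V\<in>\<U>. \<forall>W\<in>\<U>. sm_res (structure_mod (Spec R)) V (V \<inter> W) (s V) = sm_res (structure_mod (Spec R)) W (V \<inter> W) (s W)"
  then have V: "zariski_open R V" "s V \<in> carrier (Oring V)" if "V \<in> \<U>" for V using that by (simp_all add: Spec_open)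
  have agree: "s V P = s W P" if "V \<in> \<U>" "W \<in> \<U>" "P \<in> V" "P \<in> W" for V W P
    using fun_cong[OF bspec[OF bspec[OF eq that(1)] that(2)], of P] that by (simp add: Spec_res)
  have "openin (rs_top (Spec R)) (\<Union>\<U>)" using sU by (intro openin_Union) blast
  then have un: "zariski_open R (\<Union>\<U>)" by (simp add: Spec_open)
  define t where "t = (\<lambda>P\<in>\<Union>\<U>. s (SOME V. V \<in> \<U> \<and> P \<in> V) P)"
  have t: "t P = s V P" if "V \<in> \<U>" "P \<in> V" for V P
  proof -
    let ?W = "SOME V. V \<in> \<U> \<and> P \<in> V"
    have W: "?W \<in> \<U> \<and> P \<in> ?W"
      using that by (intro someI[of "\<lambda>V. V \<in> \<U> \<and> P \<in> V"]) simp
    have "P \<in> \<Union>\<U>" using that by blast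
    then have "t P = s ?W P" unfolding t_def by (rule restrict_apply')
    also have "\<dots> = s V P" by (rule agree) (use that W in simp_all)
    finally show ?thesis .
  qed
  have tc: "t \<in> carrier (Oring (\<Union>\<U>))"
  proof (rule Spec_sectionI[OF un])
    show "t \<in> extensional (\<Union>\<U>)" unfolding t_def by simp
    fix P assume "P \<in> \<Union>\<U>"
    then obtain V where VP: "V \<in> \<U>" "P \<in> V" by blast
    obtain W a b where
      W: "zariski_open R W" "P \<in> W" "W \<subseteq> V" "a \<in> carrier R" "b \<in> carrier R"
      "\<forall>Q\<in>W. b \<notin> Q \<and> s V Q = frac_at Q a b" by (rule Spec_section_local[OF V(2)[OF VP(1)] VP(2)])
    show "\<exists>W a b. zariski_open R W \<and> P \<in> W \<and> W \<subseteq> \<Union>\<U> \<and> a \<in> carrier R \<and> b \<in> carrier R \<and>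
       (\<forall>Q\<in>W. b \<notin> Q \<and> t Q = frac_at Q a b)"
    proof (intro exI conjI ballI)
      show "W \<subseteq> \<Union>\<U>" using W(3) VP(1) by blast
      fix Q assume Q: "Q \<in> W"
      show "b \<notin> Q" using W(6) Q by simp
      show "t Q = frac_at Q a b" using bspec[OF W(6) Q] t[OF VP(1) subsetD[OF W(3) Q]] by simp
    qed (use W in simp_all)
  qed
  show "\<exists>!t. t \<in> carrier (sm_sec (structure_mod (Spec R)) (\<Union>\<U>)) \<and>
    (\<forall>V\<in>\<U>. sm_res (structure_mod (Spec R)) (\<Union>\<U>) V t = s V)"
    unfolding structure_mod_simps Spec_res
  proof (rule ex1I[of _ t])
    have "restrict t V = s V" if "V \<in> \<U>" for V
      by (rule Spec_eqI[OF restrict_extensional Spec_ext[OF V(2)[OF that]]]) (simp add: t that)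
    then show "t \<in> carrier (Oring (\<Union>\<U>)) \<and> (\<forall>V\<in>\<U>. restrict t V = s V)" using tc by blast
    fix t' assume t': "t' \<in> carrier (Oring (\<Union>\<U>)) \<and> (\<forall>V\<in>\<U>. restrict t' V = s V)"
    show "t' = t"
    proof (rule Spec_eqI)
      show "t' \<in> extensional (\<Union>\<U>)" "t \<in> extensional (\<Union>\<U>)" using t' tc Spec_ext by blast+
      fix P assume "P \<in> \<Union>\<U>"
      then obtain V where VP: "V \<in> \<U>" "P \<in> V" by blast
      then have "restrict t' V P = s V P" using t' by simp
      then show "t' P = t P" using t[OF VP] VP(2) by simp
    qed
  qed
qed

lemma Spec_sheaf_ringed: "sheaf_ringed (Spec R)"
proof
  show "module_sheaf (Spec R) (structure_mod (Spec R))" by (rule Spec_module_sheaf)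
  show "rs_res (Spec R) U V \<one>\<^bsub>Oring U\<^esub> = \<one>\<^bsub>Oring V\<^esub>" if "V \<subseteq> U" for U V
    unfolding Spec_res by (rule Spec_eqI[OF restrict_extensional Spec_ops_ext(3)]) (use that in \<open>auto simp: Spec_ops\<close>)
qed

end

context sheaf_ringed begin

lemma frame_unit:
  assumes L: "module_presheaf Y L" and e: "frame Y L U e" and h: "h \<in> Units (\<O> U)"
  shows "frame Y L U (h \<odot>\<^bsub>sm_sec L U\<^esub> e)"
proof -
  note U = frameD(1)[OF e] and eU = frameD(2)[OF e]
  interpret MU: module "\<O> U" "sm_sec L U" by (rule presheaf_module[OF L U])
  obtain h' where h': "h' \<in> carrier (\<O> U)" "h' \<otimes>\<^bsub>\<O> U\<^esub> h = \<one>\<^bsub>\<O> U\<^esub>" and hU: "h \<in> carrier (\<O> U)"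
    using h unfolding Units_def by auto
  show ?thesis
  proof (rule frame_presheafI[OF L U])
    show "h \<odot>\<^bsub>sm_sec L U\<^esub> e \<in> carrier (sm_sec L U)" using hU eU by simp
    fix V assume V: "rs_open Y V" "V \<subseteq> U"
    interpret module "\<O> V" "sm_sec L V" by (rule presheaf_module[OF L V(1)])
    let ?h = "rs_res Y U V h" and ?h' = "rs_res Y U V h'" and ?e = "sm_res L U V e"
    have hV: "?h \<in> carrier (\<O> V)" "?h' \<in> carrier (\<O> V)" "?e \<in> carrier (sm_sec L V)"
      by (rule res_closed[OF U V hU] res_closed[OF U V h'(1)] presheaf_res_closed[OF L U V eU])+
    have inv: "?h' \<otimes>\<^bsub>\<O> V\<^esub> ?h = \<one>\<^bsub>\<O> V\<^esub>"
      using res_mult[OF U V h'(1) hU] h'(2) res_one[OF U V] by simp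
    have eq: "sm_res L U V (h \<odot>\<^bsub>sm_sec L U\<^esub> e) = ?h \<odot>\<^bsub>sm_sec L V\<^esub> ?e"
      by (rule presheaf_res_smult[OF L U V hU eU])
    have "bij_betw (\<lambda>r. r \<otimes>\<^bsub>\<O> V\<^esub> ?h) (carrier (\<O> V)) (carrier (\<O> V))"
    proof (rule bij_betw_byWitness[where f' = "\<lambda>r. r \<otimes>\<^bsub>\<O> V\<^esub> ?h'"])
      show "\<forall>a\<in>carrier (\<O> V). a \<otimes>\<^bsub>\<O> V\<^esub> ?h \<otimes>\<^bsub>\<O> V\<^esub> ?h' = a"
        using hV inv by (simp add: R.m_assoc R.m_comm[of ?h ?h'])
      show "\<forall>a\<in>carrier (\<O> V). a \<otimes>\<^bsub>\<O> V\<^esub> ?h' \<otimes>\<^bsub>\<O> V\<^esub> ?h = a"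
        using hV inv by (simp add: R.m_assoc)
    qed (use hV in auto)
    from bij_betw_trans[OF this frameD(3)[OF e V]]
    show "bij_betw (\<lambda>r. r \<odot>\<^bsub>sm_sec L V\<^esub> sm_res L U V (h \<odot>\<^bsub>sm_sec L U\<^esub> e)) (carrier (\<O> V)) (carrier (sm_sec L V))"
      by (rule iffD1[OF bij_betw_cong, rotated]) (use hV in \<open>simp add: eq smult_assoc1\<close>)
  qed
qed

end

context domain begin

lemma frac_sec_mult:
  assumes "zariski_open R U" "a \<in> carrier R" "s \<in> carrier R" "b \<in> carrier R" "t \<in> carrier R"
    and "\<And>Q. Q \<in> U \<Longrightarrow> s \<notin> Q" "\<And>Q. Q \<in> U \<Longrightarrow> t \<notin> Q"
  shows "frac_sec U a s \<otimes>\<^bsub>Oring U\<^esub> frac_sec U b t = frac_sec U (a \<otimes> b) (s \<otimes> t)"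
proof (rule Spec_eqI[OF Spec_ops_ext(1)])
  show "frac_sec U (a \<otimes> b) (s \<otimes> t) \<in> extensional U" by (simp add: frac_sec_def)
  fix Q assume Q: "Q \<in> U"
  interpret mult_subset R "carrier R - Q" by (rule mult_subset_prime[OF zariski_open_prime[OF assms(1) Q]])
  show "(frac_sec U a s \<otimes>\<^bsub>Oring U\<^esub> frac_sec U b t) Q = frac_sec U (a \<otimes> b) (s \<otimes> t) Q"
    using Q assms by (simp add: Spec_ops frac_sec_def fr_mult)
qed

lemma frac_sec_unit:
  assumes U: "zariski_open R U" and a: "a \<in> carrier R" "s \<in> carrier R"
    and n: "\<And>Q. Q \<in> U \<Longrightarrow> s \<notin> Q" "\<And>Q. Q \<in> U \<Longrightarrow> a \<notin> Q"
  shows "frac_sec U a s \<in> Units (Oring U)"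
proof -
  interpret C: cring "Oring U" by (rule Spec_cring[OF U])
  have "frac_sec U (a \<otimes> s) (s \<otimes> a) = \<one>\<^bsub>Oring U\<^esub>"
  proof (rule Spec_eqI[OF _ Spec_ops_ext(3)])
    show "frac_sec U (a \<otimes> s) (s \<otimes> a) \<in> extensional U" by (simp add: frac_sec_def)
    fix Q assume Q: "Q \<in> U"
    interpret mult_subset R "carrier R - Q" by (rule mult_subset_prime[OF zariski_open_prime[OF U Q]])
    have "s \<otimes> a \<in> carrier R - Q" using n Q a by (intro S_mult) auto
    then show "frac_sec U (a \<otimes> s) (s \<otimes> a) Q = \<one>\<^bsub>Oring U\<^esub> Q"
      using Q a S_one by (simp add: Spec_ops frac_sec_def one_loc) (simp add: fr_eq m_comm)
  qed
  then have 1: "frac_sec U a s \<otimes>\<^bsub>Oring U\<^esub> frac_sec U s a = \<one>\<^bsub>Oring U\<^esub>"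
    using frac_sec_mult[OF U a(1,2,2,1) n] by simp
  have c: "frac_sec U a s \<in> carrier (Oring U)" "frac_sec U s a \<in> carrier (Oring U)"
    using frac_sec_closed[OF U a n(1)] frac_sec_closed[OF U a(2,1) n(2)] by simp_all
  then show ?thesis using 1 C.m_comm[OF c] unfolding Units_def by auto
qed

lemma unit_value:
  assumes U: "zariski_open R U" and u: "u \<in> Units (Oring U)" and Q: "Q \<in> U"
    and a: "a \<in> carrier R" "s \<in> carrier R" "s \<notin> Q" "u Q = frac_at Q a s"
  shows "a \<notin> Q"
proof
  assume aQ: "a \<in> Q"
  interpret P: primeideal Q R by (rule zariski_open_prime[OF U Q])
  interpret mult_subset R "carrier R - Q" by (rule mult_subset_prime[OF zariski_open_prime[OF U Q]])
  obtain u' where u': "u' \<in> carrier (Oring U)" "u \<otimes>\<^bsub>Oring U\<^esub> u' = \<one>\<^bsub>Oring U\<^esub>"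
    using u unfolding Units_def by auto
  obtain b t where b: "u' Q = fr b t" "b \<in> carrier R" "t \<in> carrier R - Q"
    using Spec_value[OF u'(1) Q] unfolding carrier_loc by blast
  have s: "s \<in> carrier R - Q" using a by simp
  have "fr (a \<otimes> b) (s \<otimes> t) = fr \<one> \<one>"
    using fun_cong[OF u'(2), of Q] Q a b s by (simp add: Spec_ops fr_mult one_loc)
  then have "a \<otimes> b = s \<otimes> t"
    using fr_eq[of "a \<otimes> b" "s \<otimes> t" \<one> \<one>] S_mult[OF s b(3)] S_one a b by simp
  then have "s \<otimes> t \<in> Q" using P.I_r_closed[OF aQ b(2)] by simp
  then show False using S_mult[OF s b(3)] by simp
qed

text \<open>
  The generic point lies in every nonempty open set.
\<close>

lemma zero_mem_zariski:
  assumes "zariski_open R U" "P \<in> U"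
  shows "{\<zero>} \<in> U"
proof -
  obtain E where E: "E \<subseteq> carrier R" "U = {P. primeideal P R \<and> \<not> E \<subseteq> P}"
    using assms(1) unfolding zariski_open_def by auto
  then interpret P: primeideal P R using assms(2) by simp
  have "\<not> E \<subseteq> {\<zero>}" using assms(2) E P.zero_closed by auto
  then show ?thesis using zeroprimeideal E by simp
qed

lemma Oring_pow_value:
  assumes U: "zariski_open R U" and Q: "Q \<in> U" and g: "g Q = frac_at Q b t" "b \<in> carrier R" "t \<in> carrier R - Q"
  shows "(g [^]\<^bsub>Oring U\<^esub> (k::nat)) Q = frac_at Q (b [^] k) (t [^] k)"
proof (induction k)
  case 0
  interpret C: cring "Oring U" by (rule Spec_cring[OF U])
  show ?case using Q by (simp add: Spec_ops localization_def)
next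
  case (Suc k)
  interpret C: cring "Oring U" by (rule Spec_cring[OF U])
  interpret mult_subset R "carrier R - Q" by (rule mult_subset_prime[OF zariski_open_prime[OF U Q]])
  have "t [^] k \<in> carrier R - Q"
    using not_mem_prime_power[OF zariski_open_prime[OF U Q], of t] g by simp
  then show ?case using Suc Q g by (simp add: Spec_ops fr_mult)
qed

text \<open>
  Near \<open>x\<close>, a unit \<open>u\<^sub>x\<close> from \<open>torsion_units\<close> is a fraction \<open>a / s\<close>. The element \<open>f\<^sub>x = a s\<^bsup>p-1\<^esup> = s\<^sup>p u\<^sub>x\<close>
  is not in \<open>x\<close>, and any two of these elements agree up to \<open>p\<close>-th powers of fractions; \<open>alg\<close> provides
  \<open>f\<^sub>x = w v\<^sub>x\<^sup>p\<close>. Then \<open>u\<^sub>y = g\<^sup>p u\<^sub>x\<close> says \<open>(v\<^sub>y / s\<^sub>y)\<^sup>p = g\<^sup>p (v\<^sub>x / s\<^sub>x)\<^sup>p\<close>, and \<open>frob\<close> extracts the \<open>p\<close>-th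
  root: the frames \<open>(s\<^sub>x / v\<^sub>x) e\<^sub>x\<close> agree.
\<close>

theorem Pic_Spec_torsion_trivial:
  fixes p :: nat
  assumes p: "p > 0"
    and frob: "\<And>a b. a \<in> carrier R \<Longrightarrow> b \<in> carrier R \<Longrightarrow> a [^] p = b [^] p \<Longrightarrow> a = b"
    and alg: "\<And>f. (\<And>P. primeideal P R \<Longrightarrow> f P \<in> carrier R - P) \<Longrightarrow>
      (\<And>P P'. primeideal P R \<Longrightarrow> primeideal P' R \<Longrightarrow>
         \<exists>b\<in>carrier R - {\<zero>}. \<exists>t\<in>carrier R - {\<zero>}. f P \<otimes> t [^] p = f P' \<otimes> b [^] p) \<Longrightarrow>
      \<exists>w\<in>Units R. \<exists>v. \<forall>P. primeideal P R \<longrightarrow> v P \<in> carrier R \<and> f P = w \<otimes> v P [^] p"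
  shows "torsion_part (Pic (Spec R)) p = {\<one>\<^bsub>Pic (Spec R)\<^esub>}"
proof -
  interpret Y: sheaf_ringed "Spec R" by (rule Spec_sheaf_ringed)
  have top: "x \<in> Y.top_space \<longleftrightarrow> primeideal x R" for x
  proof
    assume "x \<in> Y.top_space"
    then show "primeideal x R" using zariski_open_prime[of R] by (auto simp: topspace_def Spec_open)
  next
    assume x: "primeideal x R"
    then interpret P: primeideal x R .
    have "zariski_open R {P. primeideal P R \<and> \<not> carrier R \<subseteq> P}" unfolding zariski_open_def by auto
    moreover have "x \<in> {P. primeideal P R \<and> \<not> carrier R \<subseteq> P}" using x P.I_notcarr P.a_subset by auto
    ultimately show "x \<in> Y.top_space" unfolding topspace_def by (auto simp: Spec_open)
  qed
  have "c = \<one>\<^bsub>Pic (Spec R)\<^esub>" if c: "c \<in> torsion_part (Pic (Spec R)) p" for c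
  proof -
    from c obtain L :: "('a set, 'a set \<Rightarrow> ('a \<times> 'a) set) line_bundle" where L: "invertible_sheaf (Spec R) L"
      and cL: "c = iso_class (Spec R) L" and tors: "iso_class (Spec R) L [^]\<^bsub>Pic (Spec R)\<^esub> p = \<one>\<^bsub>Pic (Spec R)\<^esub>"
      unfolding torsion_part_def Pic_def by auto
    note PL = Y.invertible_presheaf[OF L]
    have "\<exists>U e. frame (Spec R) L U e \<and> x \<in> U" if x: "x \<in> Y.top_space" for x
    proof -
      from L x obtain U where U: "rs_open (Spec R) U" "x \<in> U" "sheaf_iso_on (Spec R) U L (structure_mod (Spec R))"
        unfolding invertible_sheaf_def by blast
      then obtain \<phi> where "iso_via (Spec R) \<phi> U L (structure_mod (Spec R))" unfolding sheaf_iso_on_iff by blast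
      from iso_frame_ex[OF PL this Y.structure_frame[OF U(1)]] U(2) show ?thesis by metis
    qed
    then obtain U e where e: "\<And>x. x \<in> Y.top_space \<Longrightarrow> frame (Spec R) L (U x) (e x)"
      and xU: "\<And>x. x \<in> Y.top_space \<Longrightarrow> x \<in> U x" by metis
    have U: "zariski_open R (U x)" if "x \<in> Y.top_space" for x
      using frameD(1)[OF e[OF that]] by (simp add: Spec_open)
    obtain u where u0: "\<forall>x\<in>Y.top_space. u x \<in> Units (Oring (U x))"
      and trans: "\<forall>x\<in>Y.top_space. \<forall>y\<in>Y.top_space. \<forall>V g. rs_open (Spec R) V \<and> V \<subseteq> U x \<and> V \<subseteq> U y \<and>
        g \<in> carrier (Oring V) \<and> sm_res L (U y) V (e y) = g \<odot>\<^bsub>sm_sec L V\<^esub> sm_res L (U x) V (e x) \<longrightarrow>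
        rs_res (Spec R) (U y) V (u y) = (g [^]\<^bsub>Oring V\<^esub> p) \<otimes>\<^bsub>Oring V\<^esub> rs_res (Spec R) (U x) V (u x)"
      by (rule Y.torsion_units[OF L e tors])
    note u = bspec[OF u0]
    define G where "G x z \<longleftrightarrow> zariski_open R (fst z) \<and> x \<in> fst z \<and> fst z \<subseteq> U x \<and> fst (snd z) \<in> carrier R \<and>
       snd (snd z) \<in> carrier R \<and> (\<forall>Q\<in>fst z. snd (snd z) \<notin> Q \<and> u x Q = frac_at Q (fst (snd z)) (snd (snd z)))" for x z
    have "\<exists>z. G x z" if x: "x \<in> Y.top_space" for x
    proof -
      have "u x \<in> carrier (Oring (U x))" using u[OF x] unfolding Units_def by blast
      then obtain V a s where "zariski_open R V" "x \<in> V" "V \<subseteq> U x" "a \<in> carrier R" "s \<in> carrier R"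
        "\<forall>Q\<in>V. s \<notin> Q \<and> u x Q = frac_at Q a s" by (rule Spec_section_local[OF _ xU[OF x]])
      then have "G x (V, a, s)" unfolding G_def by simp
      then show ?thesis by blast
    qed
    then obtain c where c: "\<And>x. x \<in> Y.top_space \<Longrightarrow> G x (c x)" by metis
    define V a s where "V x = fst (c x)" and "a x = fst (snd (c x))" and "s x = snd (snd (c x))" for x
    have "zariski_open R (V x) \<and> x \<in> V x \<and> V x \<subseteq> U x \<and> a x \<in> carrier R \<and> s x \<in> carrier R \<and>
        (\<forall>Q\<in>V x. s x \<notin> Q \<and> u x Q = frac_at Q (a x) (s x))" if "x \<in> Y.top_space" for x
      using c[OF that] unfolding G_def V_def a_def s_def .
    then have V: "\<And>x. x \<in> Y.top_space \<Longrightarrow> zariski_open R (V x)" "\<And>x. x \<in> Y.top_space \<Longrightarrow> x \<in> V x"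
      "\<And>x. x \<in> Y.top_space \<Longrightarrow> V x \<subseteq> U x"
      and a: "\<And>x. x \<in> Y.top_space \<Longrightarrow> a x \<in> carrier R" and s: "\<And>x. x \<in> Y.top_space \<Longrightarrow> s x \<in> carrier R"
      and us: "\<And>x. x \<in> Y.top_space \<Longrightarrow> \<forall>Q\<in>V x. s x \<notin> Q \<and> u x Q = frac_at Q (a x) (s x)" by simp_all
    have sQ: "s x \<notin> Q" and uQ: "u x Q = frac_at Q (a x) (s x)" if "x \<in> Y.top_space" "Q \<in> V x" for x Q
      using bspec[OF us[OF that(1)] that(2)] by simp_all
    have aQ: "a x \<notin> Q" if x: "x \<in> Y.top_space" and Q: "Q \<in> V x" for x Q
      by (rule unit_value[OF U[OF x] u[OF x] subsetD[OF V(3)[OF x] Q] a[OF x] s[OF x] sQ[OF x Q] uQ[OF x Q]])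
    have prime: "primeideal Q R" if "x \<in> Y.top_space" "Q \<in> V x" for x Q
      by (rule zariski_open_prime[OF V(1)[OF that(1)] that(2)])
    have zV: "{\<zero>} \<in> V x" if "x \<in> Y.top_space" for x
      by (rule zero_mem_zariski[OF V(1,2)[OF that]])
    have nz: "a x \<noteq> \<zero>" "s x \<noteq> \<zero>" if "x \<in> Y.top_space" for x
      using aQ[OF that zV[OF that]] sQ[OF that zV[OF that]] by simp_all
    \<comment> \<open>\<open>gQ\<close> below is the rule \<open>u\<^sub>y = g\<^sup>p u\<^sub>x\<close> at \<open>Q\<close>, with denominators cleared\<close>
    have "\<exists>g. g \<in> carrier (Oring (V x \<inter> V y)) \<and>
        sm_res L (U y) (V x \<inter> V y) (e y) = g \<odot>\<^bsub>sm_sec L (V x \<inter> V y)\<^esub> sm_res L (U x) (V x \<inter> V y) (e x)"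
      if x: "x \<in> Y.top_space" and y: "y \<in> Y.top_space" for x y
    proof -
      have o: "rs_open (Spec R) (V x \<inter> V y)" using zariski_open_Int[OF V(1)[OF x] V(1)[OF y]] by (simp add: Spec_open)
      have sub: "V x \<inter> V y \<subseteq> U x" "V x \<inter> V y \<subseteq> U y" using V(3)[OF x] V(3)[OF y] by auto
      have "sm_res L (U y) (V x \<inter> V y) (e y) \<in> carrier (sm_sec L (V x \<inter> V y))"
        by (rule presheaf_res_closed[OF PL frameD(1)[OF e[OF y]] o sub(2) frameD(2)[OF e[OF y]]])
      from frame_coeff[OF e[OF x] o sub(1) this] show ?thesis by metis
    qed
    then obtain g where g: "\<And>x y. x \<in> Y.top_space \<Longrightarrow> y \<in> Y.top_space \<Longrightarrow> g x y \<in> carrier (Oring (V x \<inter> V y))"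
      and ge: "\<And>x y. x \<in> Y.top_space \<Longrightarrow> y \<in> Y.top_space \<Longrightarrow>
        sm_res L (U y) (V x \<inter> V y) (e y) = g x y \<odot>\<^bsub>sm_sec L (V x \<inter> V y)\<^esub> sm_res L (U x) (V x \<inter> V y) (e x)"
      by metis
    have gQ: "\<exists>b t. b \<in> carrier R \<and> t \<in> carrier R - Q \<and> g x y Q = frac_at Q b t \<and>
        a y \<otimes> (t [^] p \<otimes> s x) = (b [^] p \<otimes> a x) \<otimes> s y"
      if x: "x \<in> Y.top_space" and y: "y \<in> Y.top_space" and Q: "Q \<in> V x" "Q \<in> V y" for x y Q
    proof -
      have o: "zariski_open R (V x \<inter> V y)" by (rule zariski_open_Int[OF V(1)[OF x] V(1)[OF y]])
      have sub: "V x \<inter> V y \<subseteq> U x" "V x \<inter> V y \<subseteq> U y" using V(3)[OF x] V(3)[OF y] by auto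
      have Q': "Q \<in> V x \<inter> V y" using Q by simp
      interpret mult_subset R "carrier R - Q" by (rule mult_subset_prime[OF prime[OF x Q(1)]])
      obtain b t where b: "b \<in> carrier R" "t \<in> carrier R - Q" "g x y Q = fr b t"
        using Spec_value[OF g[OF x y] Q'] unfolding carrier_loc by blast
      have ss: "s x \<in> carrier R - Q" "s y \<in> carrier R - Q"
        using sQ[OF x Q(1)] sQ[OF y Q(2)] s[OF x] s[OF y] by simp_all
      have tp: "t [^] p \<in> carrier R - Q" using not_mem_prime_power[OF prime[OF x Q(1)], of t p] b by simp
      have "rs_res (Spec R) (U y) (V x \<inter> V y) (u y) = (g x y [^]\<^bsub>Oring (V x \<inter> V y)\<^esub> p) \<otimes>\<^bsub>Oring (V x \<inter> V y)\<^esub>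
          rs_res (Spec R) (U x) (V x \<inter> V y) (u x)"
        by (rule bspec[OF bspec[OF trans x] y, THEN spec, THEN spec, THEN mp])
          (intro conjI sub g[OF x y] ge[OF x y], simp add: Spec_open o)
      from fun_cong[OF this, of Q]
      have "fr (a y) (s y) = fr (b [^] p \<otimes> a x) (t [^] p \<otimes> s x)"
        using Q' uQ[OF x Q(1)] uQ[OF y Q(2)] Oring_pow_value[where g = "g x y" and b = b and t = t and k = p, OF o Q' b(3,1,2)] b(1) a[OF x] tp ss
        by (simp add: Spec_res Spec_ops fr_mult)
      then have "a y \<otimes> (t [^] p \<otimes> s x) = (b [^] p \<otimes> a x) \<otimes> s y"
        using fr_eq[of "a y" "s y" "b [^] p \<otimes> a x" "t [^] p \<otimes> s x"] S_mult[OF tp ss(1)] ss a[OF x] a[OF y] b(1) by simp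
      then show ?thesis using b by blast
    qed
    \<comment> \<open>\<open>f x\<close> is \<open>u x = a x / s x\<close> times the \<open>p\<close>-th power of \<open>s x\<close>\<close>
    define f where "f x = a x \<otimes> s x [^] (p - 1)" for x
    have pow_p: "z [^] p = z [^] (p - 1) \<otimes> z" if "z \<in> carrier R" for z
      using p that by (metis Suc_pred' nat_pow_Suc)
    have "\<exists>w\<in>Units R. \<exists>v. \<forall>P. primeideal P R \<longrightarrow> v P \<in> carrier R \<and> f P = w \<otimes> v P [^] p"
    proof (rule alg)
      fix P assume "primeideal P R"
      then have P: "P \<in> Y.top_space" by (simp add: top)
      interpret mult_subset R "carrier R - P" by (rule mult_subset_prime) fact
      have "s P [^] (p - 1) \<in> carrier R - P"
        using not_mem_prime_power[OF \<open>primeideal P R\<close> s[OF P] sQ[OF P V(2)[OF P]]] s[OF P] by simp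
      then show "f P \<in> carrier R - P"
        unfolding f_def using aQ[OF P V(2)[OF P]] a[OF P] by (intro S_mult) simp_all
      fix P' assume "primeideal P' R"
      then have P': "P' \<in> Y.top_space" by (simp add: top)
      obtain b t where b: "b \<in> carrier R" "t \<in> carrier R - {\<zero>}"
        and eq: "a P \<otimes> (t [^] p \<otimes> s P') = (b [^] p \<otimes> a P') \<otimes> s P"
        using gQ[OF P' P zV[OF P'] zV[OF P]] by blast
      note car = a[OF P] a[OF P'] s[OF P] s[OF P'] b(1)
      have t: "t \<in> carrier R" "t \<noteq> \<zero>" using b by simp_all
      have "b \<noteq> \<zero>"
      proof
        assume "b = \<zero>"
        then have "a P \<otimes> (t [^] p \<otimes> s P') = \<zero>" using eq car p by (simp add: nat_pow_zero)
        then show False using nz[OF P] nz[OF P'] car t not_mem_prime_power[OF zeroprimeideal t(1), of p] by (simp add: integral_iff)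
      qed
      then have 1: "b \<otimes> s P \<in> carrier R - {\<zero>}" "t \<otimes> s P' \<in> carrier R - {\<zero>}"
        using nz[OF P] nz[OF P'] car t by (simp_all add: integral_iff)
      have "f P \<otimes> (t \<otimes> s P') [^] p = (a P \<otimes> (t [^] p \<otimes> s P')) \<otimes> (s P [^] (p - 1) \<otimes> s P' [^] (p - 1))"
        unfolding f_def using car t by (simp add: nat_pow_distrib pow_p[of "s P'"] m_ac)
      also have "\<dots> = f P' \<otimes> (b \<otimes> s P) [^] p"
        unfolding eq f_def using car t by (simp add: nat_pow_distrib pow_p[of "s P"] m_ac)
      finally show "\<exists>b\<in>carrier R - {\<zero>}. \<exists>t\<in>carrier R - {\<zero>}. f P \<otimes> t [^] p = f P' \<otimes> b [^] p"
        using 1 by blast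
    qed
    then obtain w v where w: "w \<in> Units R" and v: "\<And>P. P \<in> Y.top_space \<Longrightarrow> v P \<in> carrier R"
      and fv: "\<And>P. P \<in> Y.top_space \<Longrightarrow> f P = w \<otimes> v P [^] p" unfolding top by blast
    have wc: "w \<in> carrier R" "w \<noteq> \<zero>" using w zero_not_one unfolding Units_def by auto
    have vQ: "v x \<notin> Q" if x: "x \<in> Y.top_space" and Q: "Q \<in> V x" for x Q
    proof
      assume vx: "v x \<in> Q"
      interpret P: primeideal Q R by (rule prime[OF x Q])
      interpret mult_subset R "carrier R - Q" by (rule mult_subset_prime[OF prime[OF x Q]])
      have "v x [^] p \<in> Q" using P.I_l_closed[OF vx, of "v x [^] (p - 1)"] v[OF x] by (simp add: pow_p)
      then have "f x \<in> Q" using P.I_l_closed[OF _ wc(1)] fv[OF x] by simp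
      moreover have "s x [^] (p - 1) \<in> carrier R - Q"
        using not_mem_prime_power[OF prime[OF x Q] s[OF x] sQ[OF x Q]] s[OF x] by simp
      then have "f x \<in> carrier R - Q"
        unfolding f_def using aQ[OF x Q] a[OF x] by (intro S_mult) simp_all
      ultimately show False by simp
    qed
    \<comment> \<open>\<open>h x = s x / v x\<close> is a unit on \<open>V x\<close>, because \<open>f x = w (v x)\<^sup>p\<close> lies in no \<open>Q\<close> of \<open>V x\<close>\<close>
    define h where "h x = frac_sec (V x) (s x) (v x)" for x
    have h: "h x \<in> Units (Oring (V x))" if x: "x \<in> Y.top_space" for x
      unfolding h_def by (rule frac_sec_unit[OF V(1)[OF x] s[OF x] v[OF x] vQ[OF x] sQ[OF x]])
    then have hc: "h x \<in> carrier (Oring (V x))" if x: "x \<in> Y.top_space" for x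
      using x unfolding Units_def by blast
    have oV: "rs_open (Spec R) (V x)" if "x \<in> Y.top_space" for x using V(1)[OF that] by (simp add: Spec_open)
    define e' where "e' x = h x \<odot>\<^bsub>sm_sec L (V x)\<^esub> sm_res L (U x) (V x) (e x)" for x
    have eV: "frame (Spec R) L (V x) (sm_res L (U x) (V x) (e x))" if x: "x \<in> Y.top_space" for x
      by (rule frame_restrict[OF PL e[OF x] oV[OF x] V(3)[OF x]])
    have e': "frame (Spec R) L (V x) (e' x)" if x: "x \<in> Y.top_space" for x
      unfolding e'_def by (rule Y.frame_unit[OF PL eV[OF x] h[OF x]])
    have "iso_class (Spec R) L = \<one>\<^bsub>Pic (Spec R)\<^esub>"
    proof (rule Y.agreeing_frames_trivial[OF L V(2) e'])
      fix x y assume x: "x \<in> Y.top_space" and y: "y \<in> Y.top_space"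
      let ?W = "V x \<inter> V y"
      have W: "zariski_open R ?W" by (rule zariski_open_Int[OF V(1)[OF x] V(1)[OF y]])
      have oW: "rs_open (Spec R) ?W" using W by (simp add: Spec_open)
      interpret C: module "Oring ?W" "sm_sec L ?W" by (rule presheaf_module[OF PL oW])
      have WU: "?W \<subseteq> U x" "?W \<subseteq> U y" using V(3)[OF x] V(3)[OF y] by auto
      have res: "sm_res L (V z) ?W (e' z) = restrict (h z) ?W \<odot>\<^bsub>sm_sec L ?W\<^esub> sm_res L (U z) ?W (e z)"
        if z: "z \<in> Y.top_space" "?W \<subseteq> V z" for z
        unfolding e'_def
        using presheaf_res_smult[OF PL oV[OF z(1)] oW z(2) hc[OF z(1)] frameD(2)[OF eV[OF z(1)]]]
          presheaf_res_comp[OF PL frameD(1)[OF e[OF z(1)]] oV[OF z(1)] oW z(2) V(3)[OF z(1)] frameD(2)[OF e[OF z(1)]]]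
        by (simp add: Spec_res)
      have rc: "restrict (h x) ?W \<in> carrier (Oring ?W)" "restrict (h y) ?W \<in> carrier (Oring ?W)"
        by (rule Spec_restrict_closed[OF V(1)[OF x] W Int_lower1 hc[OF x]]
            Spec_restrict_closed[OF V(1)[OF y] W Int_lower2 hc[OF y]])+
      have key: "restrict (h y) ?W \<otimes>\<^bsub>Oring ?W\<^esub> g x y = restrict (h x) ?W"
      proof (rule Spec_eqI[OF Spec_ops_ext(1) restrict_extensional])
        fix Q assume Q: "Q \<in> ?W"
        then have Q': "Q \<in> V x" "Q \<in> V y" by simp_all
        interpret mult_subset R "carrier R - Q" by (rule mult_subset_prime[OF prime[OF x Q'(1)]])
        obtain b t where b: "b \<in> carrier R" and t: "t \<in> carrier R - Q" and gb: "g x y Q = fr b t"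
          and eq: "a y \<otimes> (t [^] p \<otimes> s x) = (b [^] p \<otimes> a x) \<otimes> s y"
          using gQ[OF x y Q'] by blast
        have tc: "t \<in> carrier R" using t by simp
        note car = a[OF x] a[OF y] s[OF x] s[OF y] v[OF x] v[OF y] b tc wc(1)
        have "w \<otimes> (v y \<otimes> (t \<otimes> s x)) [^] p = f y \<otimes> (t \<otimes> s x) [^] p"
          unfolding fv[OF y] using car by (simp add: nat_pow_distrib m_assoc)
        also have "\<dots> = (a y \<otimes> (t [^] p \<otimes> s x)) \<otimes> (s x [^] (p - 1) \<otimes> s y [^] (p - 1))"
          unfolding f_def using car by (simp add: nat_pow_distrib pow_p[of "s x"] m_ac)
        also have "\<dots> = f x \<otimes> (b \<otimes> s y) [^] p"
          unfolding eq f_def using car by (simp add: nat_pow_distrib pow_p[of "s y"] m_ac)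
        also have "\<dots> = w \<otimes> (v x \<otimes> (b \<otimes> s y)) [^] p"
          unfolding fv[OF x] using car by (simp add: nat_pow_distrib m_assoc)
        finally have "(v y \<otimes> (t \<otimes> s x)) [^] p = (v x \<otimes> (b \<otimes> s y)) [^] p"
          using car wc(2) by (simp add: m_lcancel)
        then have "v y \<otimes> (t \<otimes> s x) = v x \<otimes> (b \<otimes> s y)" by (rule frob[rotated 2]) (use car in simp_all)
        then have "fr (s y \<otimes> b) (v y \<otimes> t) = fr (s x) (v x)"
          using car t vQ[OF x Q'(1)] vQ[OF y Q'(2)] S_mult[of "v y" t]
          by (simp add: fr_eq) (simp add: m_ac)
        then show "(restrict (h y) ?W \<otimes>\<^bsub>Oring ?W\<^esub> g x y) Q = restrict (h x) ?W Q"
          using Q Q' car t vQ[OF y Q'(2)] by (simp add: Spec_ops h_def frac_sec_def gb fr_mult)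
      qed
      have ex: "sm_res L (U x) ?W (e x) \<in> carrier (sm_sec L ?W)"
        by (rule presheaf_res_closed[OF PL frameD(1)[OF e[OF x]] oW WU(1) frameD(2)[OF e[OF x]]])
      show "sm_res L (V x) ?W (e' x) = sm_res L (V y) ?W (e' y)"
        using res[OF x] res[OF y] ge[OF x y] key C.smult_assoc1[OF rc(2) g[OF x y] ex] by simp
    qed
    then show ?thesis using cL by simp
  qed
  then show ?thesis using Y.Pic_one_torsion[of p] by blast
qed

end

section \<open>Rings of prime characteristic\<close>

definition int_elem :: "('a, 'b) ring_scheme \<Rightarrow> nat \<Rightarrow> 'a" where
  "int_elem R n = add_pow R n \<one>\<^bsub>R\<^esub>"

context cring begin

abbreviation "\<nu> \<equiv> int_elem R"

lemma nu_closed [simp]: "\<nu> n \<in> carrier R"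
  by (simp add: int_elem_def)

lemma nu_0 [simp]: "\<nu> 0 = \<zero>" and nu_1 [simp]: "\<nu> (Suc 0) = \<one>"
  by (simp_all add: int_elem_def)

lemma nu_add: "\<nu> (m + n) = \<nu> m \<oplus> \<nu> n"
  by (simp add: int_elem_def add.nat_pow_mult)

lemma nu_Suc: "\<nu> (Suc n) = \<nu> n \<oplus> \<one>"
  using nu_add[of n 1] by simp

lemma nu_mult: "\<nu> (m * n) = \<nu> m \<otimes> \<nu> n"
  by (induction m) (simp_all add: nu_add nu_Suc l_distr a_comm)

text \<open>
  \<open>W k m\<close> is the part of degree \<open>m\<close> in \<open>g\<close> of \<open>(T + g)\<^sup>k\<close>, applied to \<open>B 0\<close>.
\<close>

lemma sum_two_term_recursion:
  assumes T: "\<And>a. a \<in> carrier R \<Longrightarrow> T a \<in> carrier R" "T \<zero> = \<zero>"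
      "\<And>a b. a \<in> carrier R \<Longrightarrow> b \<in> carrier R \<Longrightarrow> T (a \<oplus> b) = T a \<oplus> T b"
    and g: "g \<in> carrier R"
    and W: "\<And>k m. W k m \<in> carrier R" "W 0 0 = B 0" "\<And>k m. k < m \<Longrightarrow> W k m = \<zero>"
      "\<And>k. W (Suc k) 0 = T (W k 0)" "\<And>k m. W (Suc k) (Suc m) = T (W k (Suc m)) \<oplus> g \<otimes> W k m"
    and B: "\<And>k. B (Suc k) = T (B k) \<oplus> g \<otimes> B k"
  shows "B k = (\<Oplus>m\<in>{..k}. W k m)"
proof (induction k)
  case 0
  have "(\<Oplus>m\<in>{..0}. W 0 m) = W 0 0" by (rule finsum_0) (simp add: W(1))
  then show ?case by (simp only: W(2))
next
  case (Suc k)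
  have T_sum: "T (\<Oplus>m\<in>{..n}. f m) = (\<Oplus>m\<in>{..n}. T (f m))" if "\<And>m. f m \<in> carrier R" for f and n :: nat
    using that by (induction n) (simp_all add: T Pi_def)
  have "(\<Oplus>m\<in>{..Suc k}. W (Suc k) m) = (\<Oplus>m\<in>{..k}. T (W k (Suc m)) \<oplus> g \<otimes> W k m) \<oplus> T (W k 0)"
    using W T g by (subst finsum_Suc2) (simp_all add: Pi_def)
  also have "(\<Oplus>m\<in>{..k}. T (W k (Suc m)) \<oplus> g \<otimes> W k m) = (\<Oplus>m\<in>{..k}. T (W k (Suc m))) \<oplus> (\<Oplus>m\<in>{..k}. g \<otimes> W k m)"
    using W T g by (intro finsum_addf) auto
  also have "(\<Oplus>m\<in>{..k}. g \<otimes> W k m) = g \<otimes> B k"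
    using W g Suc by (simp add: finsum_rdistr Pi_def)
  also have "(\<Oplus>m\<in>{..k}. T (W k (Suc m))) \<oplus> g \<otimes> B k \<oplus> T (W k 0) = ((\<Oplus>m\<in>{..k}. T (W k (Suc m))) \<oplus> T (W k 0)) \<oplus> g \<otimes> B k"
    using W T g Suc by (simp add: a_ac Pi_def finsum_closed)
  also have "(\<Oplus>m\<in>{..k}. T (W k (Suc m))) \<oplus> T (W k 0) = (\<Oplus>m\<in>{..Suc k}. T (W k m))"
    using W T by (subst finsum_Suc2) (simp_all add: Pi_def)
  also have "\<dots> = (\<Oplus>m\<in>{..k}. T (W k m))"
    using W T by (simp add: Pi_def finsum_closed)
  also have "\<dots> = T (B k)" unfolding Suc by (rule T_sum[OF W(1), symmetric])
  finally show ?case by (simp add: B)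
qed

end

lemma (in ring) chain_of_proper_ideals:
  assumes C: "subset.chain {I. ideal I R \<and> \<one> \<notin> I} C" "C \<noteq> {}"
  shows "ideal (\<Union>C) R" "\<one> \<notin> \<Union>C"
proof -
  have "subset.chain {I. ideal I R} C" using C(1) unfolding subset.chain_def by blast
  from chain_Union_is_ideal[OF this] show "ideal (\<Union>C) R" using C(2) by simp
  show "\<one> \<notin> \<Union>C" using C(1) unfolding subset.chain_def by blast
qed

text \<open>
  By Zorn's lemma a proper ideal lies in a maximal one.
\<close>

lemma (in cring) proper_ideal_in_prime:
  assumes J: "ideal J R" "\<one> \<notin> J"
  obtains P where "primeideal P R" "J \<subseteq> P"
proof -
  define \<A> where "\<A> = {I. ideal I R \<and> \<one> \<notin> I \<and> J \<subseteq> I}"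
  have "\<exists>M\<in>\<A>. \<forall>Z\<in>\<A>. M \<subseteq> Z \<longrightarrow> Z = M"
  proof (rule subset_Zorn_nonempty)
    show "\<A> \<noteq> {}" using J unfolding \<A>_def by blast
    fix C assume C: "C \<noteq> {}" "subset.chain \<A> C"
    then have "subset.chain {I. ideal I R \<and> \<one> \<notin> I} C" unfolding subset.chain_def \<A>_def by blast
    from chain_of_proper_ideals[OF this C(1)] show "\<Union>C \<in> \<A>"
      using C unfolding \<A>_def subset.chain_def by blast
  qed
  then obtain M where "M \<in> \<A>" and max0: "\<forall>Z\<in>\<A>. M \<subseteq> Z \<longrightarrow> Z = M" by (elim bexE)
  then have M: "ideal M R" "\<one> \<notin> M" "J \<subseteq> M" unfolding \<A>_def by simp_all
  have max: "I = M" if I: "ideal I R" "\<one> \<notin> I" "M \<subseteq> I" for I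
  proof -
    have "I \<in> \<A>" using I M(3) unfolding \<A>_def by simp
    from bspec[OF max0 this] I(3) show ?thesis by simp
  qed
  interpret M: ideal M R by (rule M(1))
  have "maximalideal M R"
  proof (rule maximalidealI[OF M(1)])
    show "carrier R \<noteq> M" using M(2) one_closed by blast
    fix I assume I: "ideal I R" "M \<subseteq> I" "I \<subseteq> carrier R"
    show "I = M \<or> I = carrier R"
      using max[OF I(1) _ I(2)] ideal.one_imp_carrier[OF I(1)] by blast
  qed
  from maximalideal_prime[OF this] M(3) show ?thesis by (rule that)
qed

locale char_p_domain = domain R for R (structure) +
  fixes p :: nat
  assumes prime_p: "Factorial_Ring.prime p" and char_p: "int_elem R p = \<zero>"
begin

lemma p_pos: "p > 0" and p_gt1: "p > 1"
  using prime_gt_0_nat[OF prime_p] prime_gt_1_nat[OF prime_p] by simp_all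

lemma nu_multiple: "p dvd n \<Longrightarrow> \<nu> n = \<zero>"
  by (elim dvdE) (simp add: nu_mult char_p)

lemma nu_nonzero:
  assumes "\<not> p dvd n"
  shows "\<nu> n \<noteq> \<zero>"
proof
  assume z: "\<nu> n = \<zero>"
  have "coprime n p" using prime_imp_coprime[OF prime_p assms] by (simp add: coprime_commute)
  then obtain x y where "n * x = p * y + 1"
    using coprime_bezout_strong[of n p] p_gt1 by (auto simp: coprime_commute)
  then have "\<nu> n \<otimes> \<nu> x = \<nu> p \<otimes> \<nu> y \<oplus> \<one>" by (simp add: nu_mult[symmetric] nu_Suc[symmetric])
  then show False using z char_p zero_not_one by simp
qed

lemma nu_wilson: "\<nu> (fact (p - 1)) = \<ominus> \<one>"
proof -
  have "[fact (p - 1) = (- 1 :: int)] (mod int p)" by (rule wilson_theorem[OF prime_p])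
  then have "int p dvd int (fact (p - 1) + 1)" by (simp add: cong_iff_dvd_diff add.commute)
  then have "p dvd fact (p - 1) + 1" by (simp only: int_dvd_int_iff)
  from nu_multiple[OF this] have "\<nu> (fact (p - 1)) \<oplus> \<one> = \<zero>" by (simp add: nu_Suc)
  then show ?thesis by (simp add: minus_equality[symmetric] a_comm)
qed

lemma nu_choose: "0 < k \<Longrightarrow> k < p \<Longrightarrow> \<nu> (p choose k) = \<zero>"
  using prime_p by (intro nu_multiple dvd_choose_prime) simp_all

lemma frobenius_add:
  assumes a: "a \<in> carrier R" and b: "b \<in> carrier R"
  shows "(a \<oplus> b) [^] p = a [^] p \<oplus> b [^] p"
proof -
  let ?W = "\<lambda>k m. \<nu> (k choose m) \<otimes> (a [^] (k - m) \<otimes> b [^] m)"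
  have "(a \<oplus> b) [^] k = (\<Oplus>m\<in>{..k}. ?W k m)" for k :: nat
  proof (rule sum_two_term_recursion[where T = "\<lambda>z. a \<otimes> z" and g = b])
    fix k m :: nat
    show "?W (Suc k) (Suc m) = a \<otimes> ?W k (Suc m) \<oplus> b \<otimes> ?W k m"
    proof (cases "m < k")
      case True
      then have "k - m = Suc (k - Suc m)" by simp
      then show ?thesis using a b by (simp add: nu_add l_distr r_distr m_ac a_ac)
    next
      case False
      then show ?thesis using a b by (simp add: nu_add l_distr m_ac binomial_eq_0)
    qed
  qed (use a b in \<open>auto simp: r_distr m_ac l_distr binomial_eq_0\<close>)
  from this[of p] have "(a \<oplus> b) [^] p = (\<Oplus>m\<in>{..p}. ?W p m)" .
  also have "\<dots> = (\<Oplus>m\<in>{0, p}. ?W p m)"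
    using a b nu_choose by (intro add.finprod_mono_neutral_cong_right) auto
  also have "\<dots> = b [^] p \<oplus> a [^] p" using a b p_pos by (simp add: a_comm)
  finally show ?thesis using a b by (simp add: a_comm)
qed

lemma frobenius_zero: "\<zero> [^] p = \<zero>"
  using p_pos by (simp add: nat_pow_zero)

lemma frobenius_minus:
  assumes a: "a \<in> carrier R"
  shows "(\<ominus> a) [^] p = \<ominus> (a [^] p)"
proof -
  have "(\<ominus> a) [^] p \<oplus> a [^] p = \<zero>" using frobenius_add[of "\<ominus> a" a] a frobenius_zero by (simp add: l_neg)
  then show ?thesis using a by (simp add: minus_equality[symmetric] a_comm)
qed

lemma pow_eq_zero:
  assumes "a \<in> carrier R" "a [^] (n::nat) = \<zero>"
  shows "a = \<zero>"
  using assms by (induction n) (auto simp: integral_iff)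

lemma frobenius_inj:
  assumes a: "a \<in> carrier R" "b \<in> carrier R" and eq: "a [^] p = b [^] p"
  shows "a = b"
proof -
  have "(a \<ominus> b) [^] p = \<zero>"
    using a eq frobenius_add[of a "\<ominus> b"] by (simp add: a_minus_def frobenius_minus r_neg)
  then have "a \<ominus> b = \<zero>" using pow_eq_zero[of "a \<ominus> b" p] a by simp
  then show ?thesis using a by simp
qed

end

section \<open>Derivations in characteristic \<open>p\<close>\<close>

locale char_p_derivation = char_p_domain +
  fixes D
  assumes D_closed [simp]: "a \<in> carrier R \<Longrightarrow> D a \<in> carrier R"
    and D_add: "a \<in> carrier R \<Longrightarrow> b \<in> carrier R \<Longrightarrow> D (a \<oplus> b) = D a \<oplus> D b"
    and D_mult: "a \<in> carrier R \<Longrightarrow> b \<in> carrier R \<Longrightarrow> D (a \<otimes> b) = D a \<otimes> b \<oplus> a \<otimes> D b"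
begin

lemma D_zero [simp]: "D \<zero> = \<zero>"
proof -
  have "D \<zero> \<oplus> D \<zero> = D \<zero>" using D_add[of \<zero> \<zero>] by simp
  then show ?thesis using add.l_cancel_one[of "D \<zero>" "D \<zero>"] by simp
qed

lemma D_one [simp]: "D \<one> = \<zero>"
proof -
  have "D \<one> \<oplus> D \<one> = D \<one>" using D_mult[of \<one> \<one>] by simp
  then show ?thesis using add.l_cancel_one[of "D \<one>" "D \<one>"] by simp
qed

lemma D_nu [simp]: "D (\<nu> n) = \<zero>"
  by (induction n) (simp_all add: nu_Suc D_add)

lemma D_minus:
  assumes a: "a \<in> carrier R"
  shows "D (\<ominus> a) = \<ominus> D a"
proof -
  have "D (\<ominus> a) \<oplus> D a = D (\<ominus> a \<oplus> a)" using a by (simp add: D_add)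
  then have "D (\<ominus> a) \<oplus> D a = \<zero>" using a by (simp only: l_neg D_zero)
  then show ?thesis using minus_equality[of "D (\<ominus> a)" "D a"] a by simp
qed

lemma D_pow: "a \<in> carrier R \<Longrightarrow> D (a [^] n) = \<nu> n \<otimes> (a [^] (n - 1) \<otimes> D a)"
proof (induction n)
  case (Suc n)
  have a: "a \<in> carrier R" by (rule Suc.prems)
  have "(\<nu> n \<otimes> (a [^] (n - 1) \<otimes> D a)) \<otimes> a = \<nu> n \<otimes> (a [^] n \<otimes> D a)"
    using a by (cases n) (simp_all add: m_ac)
  then have "D (a [^] Suc n) = \<nu> n \<otimes> (a [^] n \<otimes> D a) \<oplus> a [^] n \<otimes> D a"
    using Suc.IH[OF a] a by (simp add: D_mult)
  then show ?case using a by (simp add: nu_Suc l_distr)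
qed simp

lemma D_pow_p [simp]: "a \<in> carrier R \<Longrightarrow> D (a [^] p) = \<zero>"
  by (simp add: D_pow char_p)

lemma Dn_closed [simp]: "a \<in> carrier R \<Longrightarrow> (D ^^ n) a \<in> carrier R"
  by (induction n) simp_all

lemma Dn_add: "a \<in> carrier R \<Longrightarrow> b \<in> carrier R \<Longrightarrow> (D ^^ n) (a \<oplus> b) = (D ^^ n) a \<oplus> (D ^^ n) b"
  by (induction n) (simp_all add: D_add)

lemma Dn_const_mult:
  "c \<in> carrier R \<Longrightarrow> D c = \<zero> \<Longrightarrow> a \<in> carrier R \<Longrightarrow> (D ^^ n) (c \<otimes> a) = c \<otimes> (D ^^ n) a"
  by (induction n) (simp_all add: D_mult)

lemma Dn_pow_self:
  assumes z: "z \<in> carrier R" "D z = \<one>"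
  shows "(D ^^ i) (z [^] i) = \<nu> (fact i)"
proof (induction i)
  case (Suc i)
  have "(D ^^ Suc i) (z [^] Suc i) = (D ^^ i) (D (z [^] Suc i))" by (simp only: funpow_Suc_right comp_apply)
  also have "D (z [^] Suc i) = \<nu> (Suc i) \<otimes> z [^] i" using z by (subst D_pow) simp_all
  also have "(D ^^ i) \<dots> = \<nu> (Suc i) \<otimes> \<nu> (fact i)" using z Suc by (simp only: Dn_const_mult nu_closed D_nu nat_pow_closed)
  finally show ?case by (simp only: nu_mult[symmetric] fact_Suc of_nat_id)
qed simp

lemma Dn_pow_above:
  assumes z: "z \<in> carrier R" "D z = \<one>" and ij: "i < j"
  shows "(D ^^ j) (z [^] i) = \<zero>"
proof -
  have "(D ^^ n) \<zero> = \<zero>" for n by (induction n) simp_all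
  moreover have "(D ^^ Suc i) (z [^] i) = \<zero>" using Dn_pow_self[OF z, of i] by simp
  moreover have "j = (j - Suc i) + Suc i" using ij by simp
  ultimately show ?thesis by (metis funpow_add comp_apply)
qed

text \<open>
  The sign is Wilson's theorem, \<open>(p - 1)! = -1\<close>.
\<close>

lemma Dtop_pow:
  assumes z: "z \<in> carrier R" "D z = \<one>" and i: "i < p"
  shows "(D ^^ (p - 1)) (z [^] i) = (if i = p - 1 then \<ominus> \<one> else \<zero>)"
  using Dn_pow_self[OF z, of "p - 1"] Dn_pow_above[OF z, of i "p - 1"] i nu_wilson by auto

text \<open>
  The sum over all words of length \<open>k\<close> in the operators \<open>D\<close> and multiplication by \<open>g\<close> that contain \<open>m\<close>
  letters \<open>g\<close>, applied to \<open>1\<close>; the two summands of the last equation are the words that begin with \<open>D\<close> and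
  with \<open>g\<close>.
\<close>

fun word_sum :: "'a \<Rightarrow> nat \<Rightarrow> nat \<Rightarrow> 'a" where
  "word_sum g 0 m = (if m = 0 then \<one> else \<zero>)"
| "word_sum g (Suc k) 0 = D (word_sum g k 0)"
| "word_sum g (Suc k) (Suc m) = D (word_sum g k (Suc m)) \<oplus> g \<otimes> word_sum g k m"

context
  fixes g
  assumes g [simp]: "g \<in> carrier R"
begin

lemma word_sum_closed [simp]: "word_sum g k m \<in> carrier R"
  by (induction k arbitrary: m) (case_tac m; simp)+

lemma word_sum_above: "k < m \<Longrightarrow> word_sum g k m = \<zero>"
  by (induction k arbitrary: m) (case_tac m; simp)+

lemma word_sum_0: "k > 0 \<Longrightarrow> word_sum g k 0 = \<zero>"
proof (induction k)
  case (Suc k)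
  then show ?case by (cases k) simp_all
qed simp

lemma word_sum_1: "word_sum g (Suc k) (Suc 0) = (D ^^ k) g"
proof (induction k)
  case (Suc k)
  then show ?case by (simp add: word_sum_0 del: word_sum.simps(2))
qed simp

lemma word_sum_diag: "word_sum g k k = g [^] k"
  by (induction k) (simp_all add: word_sum_above m_comm)

text \<open>
  The coefficient of \<open>t\<^sup>m\<close> in the derivative of \<open>(D + t g)\<^sup>k 1\<close> with respect to a central variable \<open>t\<close>.
  Moving the letter that is differentiated to the left turns it into an iterated commutator
  with \<open>D + t g\<close>, and the \<open>j\<close>-fold commutator is multiplication by \<open>D\<^sup>j g\<close>.
\<close>

lemma word_sum_derivative:
  "\<nu> (Suc m) \<otimes> word_sum g k (Suc m) =
    (\<Oplus>j\<in>{..<k}. \<nu> (k choose Suc j) \<otimes> ((D ^^ j) g \<otimes> word_sum g (k - Suc j) m))"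
proof (induction k arbitrary: m)
  case 0
  then show ?case by simp
next
  case (Suc k)
  let ?S = "\<lambda>m. \<Oplus>j\<in>{..<k}. \<nu> (k choose Suc j) \<otimes> ((D ^^ j) g \<otimes> word_sum g (k - Suc j) m)"
  have D_sum: "D (\<Oplus>j\<in>{..<n}. f j) = (\<Oplus>j\<in>{..<n}. D (f j))" if "\<And>j. f j \<in> carrier R" for f and n :: nat
    using that by (induction n) (simp_all add: lessThan_Suc D_add Pi_def)
  \<comment> \<open>the words of length \<open>i + 1\<close> that begin with \<open>g\<close>\<close>
  define w' where "w' i = (case m of 0 \<Rightarrow> \<zero> | Suc m' \<Rightarrow> g \<otimes> word_sum g i m')" for i
  have w'_closed [simp]: "w' i \<in> carrier R" for i unfolding w'_def by (cases m) simp_all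
  have step: "word_sum g (Suc i) m = D (word_sum g i m) \<oplus> w' i" for i
    unfolding w'_def by (cases m) simp_all
  have mw: "\<nu> m \<otimes> (g \<otimes> word_sum g k m) = (\<Oplus>j\<in>{..<k}. \<nu> (k choose Suc j) \<otimes> ((D ^^ j) g \<otimes> w' (k - Suc j)))"
  proof (cases m)
    case 0
    then show ?thesis by (simp add: w'_def)
  next
    case (Suc m')
    have "\<nu> m \<otimes> (g \<otimes> word_sum g k m) = g \<otimes> (\<nu> (Suc m') \<otimes> word_sum g k (Suc m'))"
      unfolding Suc by (simp add: m_lcomm)
    also have "\<dots> = (\<Oplus>j\<in>{..<k}. g \<otimes> (\<nu> (k choose Suc j) \<otimes> ((D ^^ j) g \<otimes> word_sum g (k - Suc j) m')))"
      unfolding Suc.IH by (simp add: finsum_rdistr Pi_def)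
    also have "\<dots> = (\<Oplus>j\<in>{..<k}. \<nu> (k choose Suc j) \<otimes> ((D ^^ j) g \<otimes> w' (k - Suc j)))"
      unfolding Suc w'_def by (intro finsum_cong') (auto simp: m_ac)
    finally show ?thesis .
  qed
  have "\<nu> (Suc m) \<otimes> word_sum g (Suc k) (Suc m) =
    D (\<nu> (Suc m) \<otimes> word_sum g k (Suc m)) \<oplus> (\<nu> m \<otimes> (g \<otimes> word_sum g k m) \<oplus> g \<otimes> word_sum g k m)"
    by (simp add: D_mult D_add nu_Suc r_distr l_distr a_ac)
  also have "D (\<nu> (Suc m) \<otimes> word_sum g k (Suc m)) = (\<Oplus>j\<in>{..<k}.
      \<nu> (k choose Suc j) \<otimes> ((D ^^ Suc j) g \<otimes> word_sum g (k - Suc j) m) \<oplus>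
      \<nu> (k choose Suc j) \<otimes> ((D ^^ j) g \<otimes> D (word_sum g (k - Suc j) m)))"
    unfolding Suc.IH by (subst D_sum) (auto simp: D_mult r_distr intro!: finsum_cong')
  also have "\<dots> = (\<Oplus>j\<in>{..<k}. \<nu> (k choose Suc j) \<otimes> ((D ^^ Suc j) g \<otimes> word_sum g (k - Suc j) m)) \<oplus>
      (\<Oplus>j\<in>{..<k}. \<nu> (k choose Suc j) \<otimes> ((D ^^ j) g \<otimes> D (word_sum g (k - Suc j) m)))"
    (is "_ = ?X \<oplus> ?Y") by (intro finsum_addf) auto
  \<comment> \<open>\<open>?X\<close> and \<open>?Y\<close> absorb one term each, and Pascal's rule then adds their binomial coefficients\<close>
  also have "?X \<oplus> ?Y \<oplus> (\<nu> m \<otimes> (g \<otimes> word_sum g k m) \<oplus> g \<otimes> word_sum g k m) =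
      (?X \<oplus> g \<otimes> word_sum g k m) \<oplus> (?Y \<oplus> \<nu> m \<otimes> (g \<otimes> word_sum g k m))"
    by (simp add: a_ac finsum_closed Pi_def)
  also have "?Y \<oplus> \<nu> m \<otimes> (g \<otimes> word_sum g k m) =
      (\<Oplus>j\<in>{..<k}. \<nu> (k choose Suc j) \<otimes> ((D ^^ j) g \<otimes> D (word_sum g (k - Suc j) m)) \<oplus>
        \<nu> (k choose Suc j) \<otimes> ((D ^^ j) g \<otimes> w' (k - Suc j)))"
    unfolding mw by (intro finsum_addf[symmetric]) auto
  also have "\<dots> = (\<Oplus>j\<in>{..<k}. \<nu> (k choose Suc j) \<otimes> ((D ^^ j) g \<otimes> word_sum g (k - j) m))"
  proof (rule finsum_cong'[OF refl])
    fix j assume "j \<in> {..<k}"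
    then have "k - j = Suc (k - Suc j)" by simp
    then show "\<nu> (k choose Suc j) \<otimes> ((D ^^ j) g \<otimes> D (word_sum g (k - Suc j) m)) \<oplus>
        \<nu> (k choose Suc j) \<otimes> ((D ^^ j) g \<otimes> w' (k - Suc j)) =
      \<nu> (k choose Suc j) \<otimes> ((D ^^ j) g \<otimes> word_sum g (k - j) m)"
      by (simp only: step) (simp add: r_distr)
  qed auto
  also have "\<dots> = (\<Oplus>j\<in>{..k}. \<nu> (k choose Suc j) \<otimes> ((D ^^ j) g \<otimes> word_sum g (k - j) m))"
    by (intro add.finprod_mono_neutral_cong_left) (auto simp: binomial_eq_0)
  also have "?X \<oplus> g \<otimes> word_sum g k m = (\<Oplus>j\<in>{..k}. \<nu> (k choose j) \<otimes> ((D ^^ j) g \<otimes> word_sum g (k - j) m))"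
  proof (cases k)
    case (Suc k')
    show ?thesis unfolding Suc
      by (subst finsum_Suc2) (auto simp: lessThan_Suc_atMost)
  qed simp
  also have "\<dots> \<oplus> (\<Oplus>j\<in>{..k}. \<nu> (k choose Suc j) \<otimes> ((D ^^ j) g \<otimes> word_sum g (k - j) m)) =
      (\<Oplus>j\<in>{..k}. \<nu> (k choose j) \<otimes> ((D ^^ j) g \<otimes> word_sum g (k - j) m) \<oplus>
        \<nu> (k choose Suc j) \<otimes> ((D ^^ j) g \<otimes> word_sum g (k - j) m))"
    by (intro finsum_addf[symmetric]) auto
  also have "\<dots> = (\<Oplus>j\<in>{..<Suc k}. \<nu> (Suc k choose Suc j) \<otimes> ((D ^^ j) g \<otimes> word_sum g (Suc k - Suc j) m))"
    unfolding lessThan_Suc_atMost by (intro finsum_cong') (auto simp: nu_add l_distr)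
  finally show ?case .
qed

text \<open>
  For \<open>k = p\<close> the binomial coefficients in \<open>word_sum_derivative\<close> vanish except for the last one, which
  comes with a word sum of length zero; and \<open>m\<close> is invertible.
\<close>

lemma word_sum_middle:
  assumes "1 < m" "m < p"
  shows "word_sum g p m = \<zero>"
proof -
  obtain m' where m': "m = Suc m'" "m' > 0" using assms by (cases m) auto
  have "(\<Oplus>j\<in>{..<p}. \<nu> (p choose Suc j) \<otimes> ((D ^^ j) g \<otimes> word_sum g (p - Suc j) m')) = \<zero>"
  proof (rule add.finprod_one_eqI)
    fix j assume "j \<in> {..<p}"
    then consider "Suc j < p" | "Suc j = p" by fastforce
    then show "\<nu> (p choose Suc j) \<otimes> ((D ^^ j) g \<otimes> word_sum g (p - Suc j) m') = \<zero>"
      by cases (use m' in \<open>auto simp: nu_choose\<close>)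
  qed
  then have "\<nu> m \<otimes> word_sum g p m = \<zero>" unfolding m'(1) word_sum_derivative .
  moreover have "\<nu> m \<noteq> \<zero>" using assms by (intro nu_nonzero) (auto dest: dvd_imp_le)
  ultimately show ?thesis by (simp add: integral_iff)
qed

text \<open>
  \<open>B k\<close> is \<open>(D + g)\<^sup>k 1\<close>. By \<open>word_sum_middle\<close> only the words with one letter \<open>g\<close> and the word \<open>g\<^sup>p\<close>
  contribute to \<open>(D + g)\<^sup>p 1\<close>.
\<close>

lemma p_curvature:
  assumes B: "B 0 = \<one>" "\<And>k. B (Suc k) = D (B k) \<oplus> g \<otimes> B k"
  shows "B p = (D ^^ (p - 1)) g \<oplus> g [^] p"
proof -
  have "B p = (\<Oplus>m\<in>{..p}. word_sum g p m)"
    by (rule sum_two_term_recursion[where T = D and g = g]) (simp_all add: D_add word_sum_above B)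
  also have "\<dots> = (\<Oplus>m\<in>{1, p}. word_sum g p m)"
  proof -
    have "word_sum g p i = \<zero>" if i: "i \<in> {..p} - {1, p}" for i
      using i p_pos word_sum_middle[of i] word_sum_0[of p] by (cases "i = 0") auto
    then show ?thesis using p_pos by (intro add.finprod_mono_neutral_cong_right) auto
  qed
  also have "\<dots> = word_sum g p 1 \<oplus> word_sum g p p" using p_gt1 by simp
  also have "word_sum g p 1 = (D ^^ (p - 1)) g" using word_sum_1[of "p - 1"] p_pos by simp
  finally show ?thesis by (simp add: word_sum_diag)
qed

end

end

locale nilpotent_derivation = char_p_derivation +
  assumes D_nilpotent: "a \<in> carrier R \<Longrightarrow> (D ^^ p) a = \<zero>"
begin

text \<open>
  If \<open>D f = g f\<close>, then \<open>D\<^sup>k f = ((D + g)\<^sup>k 1) f\<close>. For \<open>k = p\<close> the left hand side is zero.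
\<close>

lemma log_derivative_equation:
  assumes f: "f \<in> carrier R" "f \<noteq> \<zero>" and g: "g \<in> carrier R" and eq: "D f = g \<otimes> f"
  shows "(D ^^ (p - 1)) g = \<ominus> (g [^] p)"
proof -
  define B where "B = rec_nat \<one> (\<lambda>k b. D b \<oplus> g \<otimes> b)"
  have B: "B 0 = \<one>" "\<And>k. B (Suc k) = D (B k) \<oplus> g \<otimes> B k" unfolding B_def by simp_all
  have Bc: "B k \<in> carrier R" for k by (induction k) (simp_all add: B g)
  have "(D ^^ k) f = B k \<otimes> f" for k
    by (induction k) (simp_all add: B f g Bc D_mult eq l_distr r_distr m_ac a_ac)
  then have "B p \<otimes> f = \<zero>" using D_nilpotent[OF f(1)] by metis
  then have "B p = \<zero>" using f Bc by (simp add: integral_iff)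
  then have "(D ^^ (p - 1)) g \<oplus> g [^] p = \<zero>" using p_curvature[OF g B] by simp
  then show ?thesis using g by (simp add: minus_equality[symmetric] a_comm)
qed

text \<open>
  The \<open>f P\<close> agree up to \<open>p\<close>-th powers of fractions, which are constants for \<open>D\<close>, so all \<open>D (f P) / f P\<close>
  are the same fraction. It has denominator \<open>f P\<close>, which is not in \<open>P\<close>; so its ideal of denominators lies in no
  prime ideal, and the fraction is an element \<open>g\<close> of the ring. If \<open>g = D w / w\<close>, then \<open>f P / w\<close> is a constant,
  hence a \<open>p\<close>-th power.
\<close>

theorem local_p_powers:
  assumes ker: "\<And>a. a \<in> carrier R \<Longrightarrow> D a = \<zero> \<Longrightarrow> \<exists>b\<in>carrier R. a = b [^] p"
    and log: "\<And>g. g \<in> carrier R \<Longrightarrow> (D ^^ (p - 1)) g = \<ominus> (g [^] p) \<Longrightarrow> \<exists>w\<in>Units R. D w = g \<otimes> w"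
    and f: "\<And>P. primeideal P R \<Longrightarrow> f P \<in> carrier R - P"
    and loc: "\<And>P P'. primeideal P R \<Longrightarrow> primeideal P' R \<Longrightarrow>
         \<exists>b\<in>carrier R - {\<zero>}. \<exists>t\<in>carrier R - {\<zero>}. f P \<otimes> t [^] p = f P' \<otimes> b [^] p"
  shows "\<exists>w\<in>Units R. \<exists>v. \<forall>P. primeideal P R \<longrightarrow> v P \<in> carrier R \<and> f P = w \<otimes> v P [^] p"
proof -
  have fc: "f P \<in> carrier R" "f P \<noteq> \<zero>" if P: "primeideal P R" for P
  proof -
    interpret P: primeideal P R by (rule P)
    show "f P \<in> carrier R" "f P \<noteq> \<zero>" using f[OF P] P.zero_closed by auto
  qed
  define f0 where "f0 = f {\<zero>}"
  note f0 = fc[OF zeroprimeideal, folded f0_def]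
  have cross: "D (f P) \<otimes> f0 = D f0 \<otimes> f P" if P: "primeideal P R" for P
  proof -
    obtain b t where b: "b \<in> carrier R" "b \<noteq> \<zero>" and t: "t \<in> carrier R" "t \<noteq> \<zero>"
      and eq: "f P \<otimes> t [^] p = f0 \<otimes> b [^] p"
      using loc[OF P zeroprimeideal] unfolding f0_def by blast
    note car = fc(1)[OF P] f0(1) b(1) t(1)
    have D: "D (f P) \<otimes> t [^] p = D f0 \<otimes> b [^] p"
      using arg_cong[OF eq, of D] car by (simp add: D_mult)
    have "(D (f P) \<otimes> f0) \<otimes> (t [^] p \<otimes> b [^] p) = (D (f P) \<otimes> t [^] p) \<otimes> (f0 \<otimes> b [^] p)"
      using car by (simp add: m_ac)
    also have "\<dots> = (D f0 \<otimes> f P) \<otimes> (t [^] p \<otimes> b [^] p)"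
      unfolding D eq[symmetric] using car by (simp add: m_ac)
    finally have "(D (f P) \<otimes> f0) \<otimes> (t [^] p \<otimes> b [^] p) = (D f0 \<otimes> f P) \<otimes> (t [^] p \<otimes> b [^] p)" .
    moreover have "t [^] p \<otimes> b [^] p \<noteq> \<zero>"
      using b t pow_eq_zero[of b p] pow_eq_zero[of t p] by (auto simp: integral_iff)
    ultimately show ?thesis using m_rcancel[of "t [^] p \<otimes> b [^] p"] car by simp
  qed
  \<comment> \<open>the ideal of denominators of \<open>D f0 / f0\<close>\<close>
  define J where "J = {d \<in> carrier R. \<exists>c\<in>carrier R. d \<otimes> D f0 = c \<otimes> f0}"
  have "ideal J R"
  proof (rule idealI)
    show "ring R" by unfold_locales
    show "subgroup J (add_monoid R)"
    proof (rule group.subgroupI[OF a_group])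
      show "J \<noteq> {}" using f0 unfolding J_def by (auto intro!: exI[of _ \<zero>] bexI[of _ \<zero>])
      show "inv\<^bsub>add_monoid R\<^esub> a \<in> J" if "a \<in> J" for a
      proof -
        from that obtain c where "a \<in> carrier R" "c \<in> carrier R" "a \<otimes> D f0 = c \<otimes> f0" unfolding J_def by blast
        then have "\<ominus> a \<in> carrier R \<and> (\<ominus> c) \<in> carrier R \<and> (\<ominus> a) \<otimes> D f0 = (\<ominus> c) \<otimes> f0"
          using f0 by (simp add: l_minus)
        then show ?thesis unfolding J_def a_inv_def[symmetric] by blast
      qed
      show "a \<otimes>\<^bsub>add_monoid R\<^esub> b \<in> J" if "a \<in> J" "b \<in> J" for a b
      proof -
        from that obtain c d where "a \<in> carrier R" "c \<in> carrier R" "a \<otimes> D f0 = c \<otimes> f0"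
          "b \<in> carrier R" "d \<in> carrier R" "b \<otimes> D f0 = d \<otimes> f0" unfolding J_def by blast
        then have "a \<oplus> b \<in> carrier R \<and> c \<oplus> d \<in> carrier R \<and> (a \<oplus> b) \<otimes> D f0 = (c \<oplus> d) \<otimes> f0"
          using f0 by (simp add: l_distr)
        then show ?thesis unfolding J_def by auto
      qed
    qed (auto simp: J_def)
    have *: "x \<otimes> a \<in> J" if a: "a \<in> J" and x: "x \<in> carrier R" for a x
    proof -
      from a obtain c where c: "a \<in> carrier R" "c \<in> carrier R" "a \<otimes> D f0 = c \<otimes> f0" unfolding J_def by blast
      then have "(x \<otimes> a) \<otimes> D f0 = (x \<otimes> c) \<otimes> f0" using x f0 by (simp add: m_assoc)
      then show ?thesis using c x unfolding J_def by (auto intro!: bexI[of _ "x \<otimes> c"])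
    qed
    then show "x \<otimes> a \<in> J" if "a \<in> J" "x \<in> carrier R" for a x using that by blast
    show "a \<otimes> x \<in> J" if "a \<in> J" "x \<in> carrier R" for a x
      using *[OF that] that m_comm[of a x] unfolding J_def by auto
  qed
  moreover have "\<not> J \<subseteq> P" if P: "primeideal P R" for P
  proof -
    have "f P \<in> J" using cross[OF P] fc[OF P] f0 unfolding J_def by (auto simp: m_comm intro!: bexI[of _ "D (f P)"])
    then show ?thesis using f[OF P] by blast
  qed
  ultimately have "\<one> \<in> J" using proper_ideal_in_prime by blast
  then obtain g where g: "g \<in> carrier R" "D f0 = g \<otimes> f0" unfolding J_def using f0 by auto
  obtain w where w: "w \<in> Units R" "D w = g \<otimes> w"
    using log[OF g(1) log_derivative_equation[OF f0 g]] by blast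
  have wc: "w \<in> carrier R" "inv w \<in> carrier R" "w \<otimes> inv w = \<one>" using w(1) by (auto simp: Units_r_inv)
  have "w \<otimes> D (inv w) \<oplus> D w \<otimes> inv w = D (w \<otimes> inv w)" using wc(1,2) by (simp only: D_mult D_closed m_closed a_comm)
  then have "w \<otimes> D (inv w) \<oplus> g = \<zero>" using wc g(1) by (simp add: w(2) m_assoc)
  then have wD: "w \<otimes> D (inv w) = \<ominus> g" using g(1) wc by (simp add: minus_equality[symmetric])
  have "\<exists>v\<in>carrier R. f P = w \<otimes> v [^] p" if P: "primeideal P R" for P
  proof -
    note fP = fc[OF P]
    have "(D (f P) \<otimes> f0) = (g \<otimes> f P) \<otimes> f0" unfolding cross[OF P] g(2) using g(1) f0 fP by (simp add: m_ac)
    then have DfP: "D (f P) = g \<otimes> f P" using f0 fP g(1) by (simp add: m_rcancel)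
    have "w \<otimes> D (inv w \<otimes> f P) = (w \<otimes> D (inv w)) \<otimes> f P \<oplus> (w \<otimes> inv w) \<otimes> (g \<otimes> f P)"
      using wc fP g(1) m_assoc[of w "inv w" "g \<otimes> f P"] by (simp add: D_mult DfP r_distr m_assoc)
    also have "\<dots> = \<zero>" unfolding wD wc(3) using fP g(1) by (simp add: l_minus l_neg)
    finally have "w \<otimes> D (inv w \<otimes> f P) = \<zero>" .
    moreover have "w \<noteq> \<zero>" using wc zero_not_one by auto
    ultimately have "D (inv w \<otimes> f P) = \<zero>" using wc fP by (simp add: integral_iff)
    then obtain v where v: "v \<in> carrier R" "inv w \<otimes> f P = v [^] p" using ker[of "inv w \<otimes> f P"] wc fP by auto
    have "f P = w \<otimes> (inv w \<otimes> f P)" using wc fP by (simp add: m_assoc[symmetric])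
    then show ?thesis using v by metis
  qed
  then show ?thesis using w(1) by metis
qed

end

section \<open>Graded covers of the line\<close>

text \<open>
  Degree at most \<open>d\<close>, with coefficient \<open>c\<close> in degree \<open>d\<close>; the value \<open>c = 0\<close> is not excluded.
\<close>

definition has_top :: "('f, 'c) ring_scheme \<Rightarrow> (nat \<Rightarrow> 'f) \<Rightarrow> nat \<Rightarrow> 'f \<Rightarrow> bool" where
  "has_top F h d c \<longleftrightarrow> (\<forall>i>d. up_ring.coeff (UP F) h i = \<zero>\<^bsub>F\<^esub>) \<and> up_ring.coeff (UP F) h d = c"

lemma (in UP_domain) has_top_mult:
  assumes h: "h \<in> carrier P" "h' \<in> carrier P" and t: "has_top R h d c" "has_top R h' d' c'"
  shows "has_top R (h \<otimes>\<^bsub>P\<^esub> h') (d + d') (c \<otimes> c')"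
proof -
  have t': "\<And>i. i > d \<Longrightarrow> up_ring.coeff P h i = \<zero>" "up_ring.coeff P h d = c" "\<And>i. i > d' \<Longrightarrow> up_ring.coeff P h' i = \<zero>" "up_ring.coeff P h' d' = c'"
    using t unfolding has_top_def P_def by auto
  have "up_ring.coeff P (h \<otimes>\<^bsub>P\<^esub> h') n = \<zero>" if n: "n > d + d'" for n
  proof -
    have "up_ring.coeff P h i \<otimes> up_ring.coeff P h' (n - i) = \<zero>" if "i \<in> {..n}" for i
      using t'(1)[of i] t'(3)[of "n - i"] h n by (cases "i > d") auto
    then have "(\<Oplus>i\<in>{..n}. up_ring.coeff P h i \<otimes> up_ring.coeff P h' (n - i)) = \<zero>"
      by (rule R.add.finprod_one_eqI)
    then show ?thesis using h by simp
  qed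
  moreover have "up_ring.coeff P (h \<otimes>\<^bsub>P\<^esub> h') (d + d') = c \<otimes> c'"
  proof -
    have "(\<Oplus>i\<in>{..d + d'}. up_ring.coeff P h i \<otimes> up_ring.coeff P h' (d + d' - i)) =
      (\<Oplus>i\<in>{d}. up_ring.coeff P h i \<otimes> up_ring.coeff P h' (d + d' - i))"
    proof -
      have "up_ring.coeff P h i \<otimes> up_ring.coeff P h' (d + d' - i) = \<zero>" if "i \<in> {..d + d'} - {d}" for i
      proof -
        have "i > d \<or> d + d' - i > d'" using that by auto
        then show ?thesis using t'(1)[of i] t'(3)[of "d + d' - i"] h by auto
      qed
      then show ?thesis using h by (intro R.add.finprod_mono_neutral_cong_right) auto
    qed
    also have "\<dots> = up_ring.coeff P h d \<otimes> up_ring.coeff P h' d'" using h by simp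
    finally show ?thesis using h t' by simp
  qed
  ultimately show ?thesis unfolding has_top_def P_def by simp
qed

lemma (in UP_domain) has_top_monom: "c \<in> carrier R \<Longrightarrow> has_top R (up_ring.monom P c j) j c"
  unfolding has_top_def P_def[symmetric] by simp

lemma (in UP_domain) has_top_pow:
  assumes h: "h \<in> carrier P" "has_top R h d \<one>"
  shows "has_top R (h [^]\<^bsub>P\<^esub> (n::nat)) (d * n) \<one>"
proof (induction n)
  case 0
  show ?case using has_top_monom[of \<one> 0] by simp
next
  case (Suc n)
  show ?case using has_top_mult[OF _ h(1) Suc h(2)] h(1) by (simp add: add.commute)
qed

text \<open>
  The condition on \<open>c\<close> in \<open>mono\<close> restricts to monomials that occur in \<open>h\<close>, as is required for
  properties that depend on the support of \<open>h\<close>.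
\<close>

lemma (in UP_domain) poly_induct:
  assumes h: "h \<in> carrier P"
    and mono: "\<And>c j. c \<in> carrier R \<Longrightarrow> (up_ring.coeff P h j = \<zero> \<Longrightarrow> c = \<zero>) \<Longrightarrow> Q (up_ring.monom P c j)"
    and add: "\<And>a b. a \<in> carrier P \<Longrightarrow> b \<in> carrier P \<Longrightarrow> Q a \<Longrightarrow> Q b \<Longrightarrow> Q (a \<oplus>\<^bsub>P\<^esub> b)"
  shows "Q h"
proof -
  have "Q (\<Oplus>\<^bsub>P\<^esub>i\<in>{..n}. up_ring.monom P (up_ring.coeff P h i) i)" for n
  proof (induction n)
    case 0
    then show ?case using h by (simp add: mono)
  next
    case (Suc n)
    have "(\<Oplus>\<^bsub>P\<^esub>i\<in>{..Suc n}. up_ring.monom P (up_ring.coeff P h i) i) =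
      up_ring.monom P (up_ring.coeff P h (Suc n)) (Suc n) \<oplus>\<^bsub>P\<^esub> (\<Oplus>\<^bsub>P\<^esub>i\<in>{..n}. up_ring.monom P (up_ring.coeff P h i) i)"
      using h by (intro P.finsum_Suc) auto
    then show ?case using h Suc by (auto intro!: add mono P.finsum_closed)
  qed
  from this[of "deg R h"] show ?thesis using up_repr[OF h] by simp
qed

text \<open>
  A model of \<open>F[s, x] / ((s\<^sup>q - s) x\<^bsup>q+1\<^esup> - 1)\<close>, with \<open>\<iota>\<close> the evaluation of polynomials at \<open>s\<close>. Negative
  powers of \<open>x\<close> are avoided by letting the window of exponents in \<open>free\<close> move upwards.
\<close>

locale graded_cover = U: UP_domain F P + A?: cring A for F :: "('f, 'g) ring_scheme" and P and A :: "('a, 'b) ring_scheme" (structure) +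
  fixes \<iota> and x and q :: nat
  assumes iota: "\<iota> \<in> ring_hom P A" and x_closed [simp]: "x \<in> carrier A" and q_ge2: "q \<ge> 2"
    and x_unit: "\<iota> (up_ring.monom P \<one>\<^bsub>F\<^esub> q \<ominus>\<^bsub>P\<^esub> up_ring.monom P \<one>\<^bsub>F\<^esub> 1) \<otimes> x [^] (q + 1) = \<one>"
    and span: "\<And>Q a. a \<in> carrier A \<Longrightarrow> (\<And>c j (k::nat). c \<in> carrier F \<Longrightarrow> Q (\<iota> (up_ring.monom P c j) \<otimes> x [^] k)) \<Longrightarrow>
      (\<And>a b. a \<in> carrier A \<Longrightarrow> b \<in> carrier A \<Longrightarrow> Q a \<Longrightarrow> Q b \<Longrightarrow> Q (a \<oplus> b)) \<Longrightarrow> Q a"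
    and free: "\<And>M h k. (\<And>k. h k \<in> carrier P) \<Longrightarrow> (\<Oplus>k\<in>{M..M + q}. \<iota> (h k) \<otimes> x [^] k) = \<zero> \<Longrightarrow>
      k \<in> {M..M + q} \<Longrightarrow> h k = \<zero>\<^bsub>P\<^esub>"
begin

definition T where "T = up_ring.monom P \<one>\<^bsub>F\<^esub> q \<ominus>\<^bsub>P\<^esub> up_ring.monom P \<one>\<^bsub>F\<^esub> 1"

lemma T_closed [simp]: "T \<in> carrier P" unfolding T_def by simp

lemma T_x: "\<iota> T \<otimes> x [^] (q + 1) = \<one>" unfolding T_def by (rule x_unit)

lemma iota_closed [simp]: "h \<in> carrier P \<Longrightarrow> \<iota> h \<in> carrier A"
  by (rule ring_hom_closed[OF iota])
lemma iota_mult: "h \<in> carrier P \<Longrightarrow> h' \<in> carrier P \<Longrightarrow> \<iota> (h \<otimes>\<^bsub>P\<^esub> h') = \<iota> h \<otimes> \<iota> h'"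
  by (rule ring_hom_mult[OF iota])
lemma iota_add: "h \<in> carrier P \<Longrightarrow> h' \<in> carrier P \<Longrightarrow> \<iota> (h \<oplus>\<^bsub>P\<^esub> h') = \<iota> h \<oplus> \<iota> h'"
  by (rule ring_hom_add[OF iota])
lemma iota_one: "\<iota> \<one>\<^bsub>P\<^esub> = \<one>"
  by (rule ring_hom_one[OF iota])
lemma iota_zero [simp]: "\<iota> \<zero>\<^bsub>P\<^esub> = \<zero>"
  by (rule ring_hom_zero[OF iota]) unfold_locales
lemma iota_pow: "h \<in> carrier P \<Longrightarrow> \<iota> (h [^]\<^bsub>P\<^esub> (n::nat)) = \<iota> h [^] n"
  by (induction n) (simp_all add: iota_one iota_mult)

lemma T_pow_x: "\<iota> (T [^]\<^bsub>P\<^esub> e) \<otimes> x [^] (e * (q + 1)) = \<one>"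
proof -
  have "\<iota> (T [^]\<^bsub>P\<^esub> e) \<otimes> x [^] (e * (q + 1)) = (\<iota> T \<otimes> x [^] (q + 1)) [^] e"
    by (simp only: iota_pow nat_pow_distrib nat_pow_pow T_closed iota_closed x_closed nat_pow_closed mult.commute)
  then show ?thesis unfolding T_x by simp
qed

text \<open>
  Since \<open>T x\<^bsup>q+1\<^esup> = 1\<close>, exponents of \<open>x\<close> can be raised by multiples of \<open>q + 1\<close>.
\<close>

lemma raise_x: "h \<in> carrier P \<Longrightarrow> \<iota> h \<otimes> x [^] k = \<iota> (h \<otimes>\<^bsub>P\<^esub> T [^]\<^bsub>P\<^esub> e) \<otimes> x [^] (k + e * (q + 1))"
proof -
  assume h: "h \<in> carrier P"
  have "\<iota> (h \<otimes>\<^bsub>P\<^esub> T [^]\<^bsub>P\<^esub> e) \<otimes> x [^] (k + e * (q + 1)) =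
    (\<iota> h \<otimes> x [^] k) \<otimes> (\<iota> (T [^]\<^bsub>P\<^esub> e) \<otimes> x [^] (e * (q + 1)))"
    using h by (simp add: iota_mult nat_pow_mult[symmetric] m_ac)
  then show ?thesis unfolding T_pow_x using h by simp
qed

lemma T_top: "has_top F T q \<one>\<^bsub>F\<^esub>"
  unfolding has_top_def U.P_def[symmetric] T_def using q_ge2 by (simp add: a_minus_def)

definition repr where
  "repr M a h \<longleftrightarrow> (\<forall>k. h k \<in> carrier P) \<and> a = (\<Oplus>k\<in>{M..M + q}. \<iota> (h k) \<otimes> x [^] k)"

lemma repr_add:
  assumes "repr M a h" "repr M b h'"
  shows "repr M (a \<oplus> b) (\<lambda>k. h k \<oplus>\<^bsub>P\<^esub> h' k)"
proof -
  have h: "\<And>k. h k \<in> carrier P" "\<And>k. h' k \<in> carrier P" using assms unfolding repr_def by auto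
  have "(\<Oplus>k\<in>{M..M + q}. \<iota> (h k \<oplus>\<^bsub>P\<^esub> h' k) \<otimes> x [^] k) =
    (\<Oplus>k\<in>{M..M + q}. \<iota> (h k) \<otimes> x [^] k \<oplus> \<iota> (h' k) \<otimes> x [^] k)"
    using h by (intro finsum_cong') (auto simp: iota_add l_distr)
  also have "\<dots> = a \<oplus> b" using h assms unfolding repr_def by (subst finsum_addf) auto
  finally show ?thesis using h unfolding repr_def by auto
qed

lemma repr_single:
  assumes h: "h \<in> carrier P" and k: "k \<in> {M..M + q}"
  shows "repr M (\<iota> h \<otimes> x [^] k) (\<lambda>i. if i = k then h else \<zero>\<^bsub>P\<^esub>)"
proof -
  have "(\<Oplus>i\<in>{M..M + q}. \<iota> (if i = k then h else \<zero>\<^bsub>P\<^esub>) \<otimes> x [^] i) =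
    (\<Oplus>i\<in>{M..M + q}. if k = i then \<iota> h \<otimes> x [^] i else \<zero>)"
    using h by (intro finsum_cong') auto
  also have "\<dots> = \<iota> h \<otimes> x [^] k" using h k by (intro finsum_singleton) auto
  finally show ?thesis using h unfolding repr_def by auto
qed

lemma window:
  assumes "k \<le> M"
  obtains k' e where "k' \<in> {M..M + q}" "k' = k + e * (q + 1)"
proof -
  define e where "e = (M - k + q) div (q + 1)"
  have "M - k \<le> e * (q + 1)" "e * (q + 1) \<le> M - k + q"
  proof -
    have "e * (q + 1) + (M - k + q) mod (q + 1) = M - k + q" unfolding e_def by (rule div_mult_mod_eq)
    moreover have "(M - k + q) mod (q + 1) < q + 1" by simp
    ultimately show "M - k \<le> e * (q + 1)" "e * (q + 1) \<le> M - k + q" by linarith+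
  qed
  then show ?thesis using assms by (intro that[of "k + e * (q + 1)" e]) auto
qed

lemma repr_exists:
  assumes a: "a \<in> carrier A"
  shows "\<exists>M0. \<forall>M\<ge>M0. \<exists>h. repr M a h"
  using a
proof (rule span)
  fix c j and k :: nat assume c: "c \<in> carrier F"
  have "\<exists>h. repr M (\<iota> (up_ring.monom P c j) \<otimes> x [^] k) h" if M: "k \<le> M" for M
  proof -
    obtain k' e where k': "k' \<in> {M..M + q}" "k' = k + e * (q + 1)" by (rule window[OF M])
    have "repr M (\<iota> (up_ring.monom P c j \<otimes>\<^bsub>P\<^esub> T [^]\<^bsub>P\<^esub> e) \<otimes> x [^] k') (\<lambda>i. if i = k' then up_ring.monom P c j \<otimes>\<^bsub>P\<^esub> T [^]\<^bsub>P\<^esub> e else \<zero>\<^bsub>P\<^esub>)"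
      by (rule repr_single[OF _ k'(1)]) (use c in simp)
    then show ?thesis using raise_x[of "up_ring.monom P c j" k e] c k'(2) by auto
  qed
  then show "\<exists>M0. \<forall>M\<ge>M0. \<exists>h. repr M (\<iota> (up_ring.monom P c j) \<otimes> x [^] k) h" by blast
next
  fix a b assume "\<exists>M0. \<forall>M\<ge>M0. \<exists>h. repr M a h" "\<exists>M0. \<forall>M\<ge>M0. \<exists>h. repr M b h"
  then obtain M0 M1 where M: "\<And>M. M \<ge> M0 \<Longrightarrow> \<exists>h. repr M a h" "\<And>M. M \<ge> M1 \<Longrightarrow> \<exists>h. repr M b h" by blast
  have "\<exists>h. repr M (a \<oplus> b) h" if "M \<ge> max M0 M1" for M
  proof -
    have "M \<ge> M0" "M \<ge> M1" using that by simp_all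
    then obtain h h' where "repr M a h" "repr M b h'" using M(1)[of M] M(2)[of M] by blast
    then show ?thesis using repr_add by blast
  qed
  then show "\<exists>M0. \<forall>M\<ge>M0. \<exists>h. repr M (a \<oplus> b) h" by blast
qed

subsection \<open>Leading coefficients\<close>

text \<open>
  The weight of \<open>s\<^sup>d x\<^sup>k\<close>: up to scaling, \<open>s\<close> must have weight \<open>q + 1\<close> and \<open>x\<close> weight \<open>- q\<close> for the leading
  term \<open>s\<^sup>q x\<^bsup>q+1\<^esup>\<close> of \<open>T x\<^bsup>q+1\<^esup>\<close> to have the weight of \<open>1\<close>.
\<close>

definition wt :: "nat \<Rightarrow> nat \<Rightarrow> int" where "wt d k = int (q + 1) * int d - int q * int k"

lemma wt_add: "wt (d + d') (k + k') = wt d k + wt d' k'"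
  by (simp add: wt_def algebra_simps)

lemma wt_raise: "wt (d + q * e) (k + e * (q + 1)) = wt d k"
  by (simp add: wt_def algebra_simps)

lemma wt_inj:
  assumes "wt d k = wt d' k'" "k \<in> {M..M + q}" "k' \<in> {M..M + q}"
  shows "k = k' \<and> d = d'"
proof -
  have *: "int (q + 1) * (int d - int d') = int q * (int k - int k')"
    using assms(1) by (simp add: wt_def algebra_simps)
  then have "int (q + 1) dvd int q * (int k - int k')" by (metis dvd_triv_left)
  moreover have "coprime (q + 1) q" by simp
  then have "coprime (int (q + 1)) (int q)" by (simp only: coprime_int_iff)
  ultimately have dvd: "int (q + 1) dvd int k - int k'" by (simp add: coprime_dvd_mult_right_iff)
  have "\<bar>int k - int k'\<bar> < int (q + 1)" using assms(2,3) by auto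
  then have "int k - int k' = 0" using dvd_imp_le_int[OF _ dvd] by (cases "int k - int k' = 0") auto
  then have "k = k'" by simp
  with * show ?thesis by simp
qed

text \<open>
  \<open>a\<close> is a sum of terms \<open>c s\<^sup>d x\<^sup>k\<close> with \<open>k \<le> K\<close> and weight at most \<open>w\<close>, and the last argument is the sum of the
  coefficients in weight \<open>w\<close>. This is a relation, because an element has many such representations; that it
  determines the coefficient amounts to \<open>lead_zero\<close>.
\<close>

inductive lead :: "nat \<Rightarrow> int \<Rightarrow> 'a \<Rightarrow> 'f \<Rightarrow> bool" for K :: nat and w :: int where
  lead_eq: "c \<in> carrier F \<Longrightarrow> k \<le> K \<Longrightarrow> wt d k = w \<Longrightarrow> lead K w (\<iota> (up_ring.monom P c d) \<otimes> x [^] k) c"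
| lead_less: "c \<in> carrier F \<Longrightarrow> k \<le> K \<Longrightarrow> wt d k < w \<Longrightarrow> lead K w (\<iota> (up_ring.monom P c d) \<otimes> x [^] k) \<zero>\<^bsub>F\<^esub>"
| lead_null: "lead K w \<zero> \<zero>\<^bsub>F\<^esub>"
| lead_add: "lead K w a c \<Longrightarrow> lead K w b c' \<Longrightarrow> lead K w (a \<oplus> b) (c \<oplus>\<^bsub>F\<^esub> c')"

lemma lead_closed: "lead K w a c \<Longrightarrow> a \<in> carrier A \<and> c \<in> carrier F"
  by (induction rule: lead.induct) auto

lemma lead_mult:
  assumes "lead K w a c" "lead K' w' b c'"
  shows "lead (K + K') (w + w') (a \<otimes> b) (c \<otimes>\<^bsub>F\<^esub> c')"
proof -
  have mono: "(\<iota> (up_ring.monom P c d) \<otimes> x [^] k) \<otimes> (\<iota> (up_ring.monom P c' d') \<otimes> x [^] k') = \<iota> (up_ring.monom P (c \<otimes>\<^bsub>F\<^esub> c') (d + d')) \<otimes> x [^] (k + k')"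
    if "c \<in> carrier F" "c' \<in> carrier F" for c c' d d' and k k' :: nat
    using that by (simp add: iota_mult nat_pow_mult[symmetric] m_ac)
  have 1: "lead (K + K') (w + w') ((\<iota> (up_ring.monom P c d) \<otimes> x [^] k) \<otimes> b) ((if wt d k = w then c else \<zero>\<^bsub>F\<^esub>) \<otimes>\<^bsub>F\<^esub> c')"
    if c: "c \<in> carrier F" and k: "k \<le> K" "wt d k \<le> w" and b: "lead K' w' b c'" for c d k b c'
    using b
  proof (induction b c' rule: lead.induct)
    case (lead_eq c' k' d')
    show ?case
    proof (cases "wt d k = w")
      case True
      then show ?thesis using c k lead_eq lead.lead_eq[of "c \<otimes>\<^bsub>F\<^esub> c'" "k + k'" "K + K'" "d + d'" "w + w'"]
        by (simp only: mono wt_add if_True) simp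
    next
      case False
      then show ?thesis using c k lead_eq lead.lead_less[of "c \<otimes>\<^bsub>F\<^esub> c'" "k + k'" "K + K'" "d + d'" "w + w'"]
        by (simp only: mono wt_add if_False) simp
    qed
  next
    case (lead_less c' k' d')
    then show ?case using c k lead.lead_less[of "c \<otimes>\<^bsub>F\<^esub> c'" "k + k'" "K + K'" "d + d'" "w + w'"]
      by (simp only: mono wt_add) simp
  next
    case lead_null
    then show ?case using c lead.lead_null by simp
  next
    case (lead_add a c1 b c2)
    let ?m = "\<iota> (up_ring.monom P c d) \<otimes> x [^] k" and ?c = "if wt d k = w then c else \<zero>\<^bsub>F\<^esub>"
    have "?m \<otimes> (a \<oplus> b) = ?m \<otimes> a \<oplus> ?m \<otimes> b" "?c \<otimes>\<^bsub>F\<^esub> (c1 \<oplus>\<^bsub>F\<^esub> c2) = ?c \<otimes>\<^bsub>F\<^esub> c1 \<oplus>\<^bsub>F\<^esub> ?c \<otimes>\<^bsub>F\<^esub> c2"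
      using lead_closed[OF lead_add(1)] lead_closed[OF lead_add(2)] c by (simp_all add: r_distr U.R.r_distr)
    then show ?case using lead.lead_add[OF lead_add.IH] by simp
  qed
  show ?thesis using assms(1)
  proof (induction a c rule: lead.induct)
    case (lead_eq c k d)
    then show ?case using 1[of c k d, OF _ _ _ assms(2)] by simp
  next
    case (lead_less c k d)
    then show ?case using 1[of c k d, OF _ _ _ assms(2)] lead_closed[OF assms(2)] by simp
  next
    case lead_null
    then show ?case using lead_closed[OF assms(2)] lead.lead_null by simp
  next
    case (lead_add a c1 a' c2)
    have "(a \<oplus> a') \<otimes> b = a \<otimes> b \<oplus> a' \<otimes> b" "(c1 \<oplus>\<^bsub>F\<^esub> c2) \<otimes>\<^bsub>F\<^esub> c' = c1 \<otimes>\<^bsub>F\<^esub> c' \<oplus>\<^bsub>F\<^esub> c2 \<otimes>\<^bsub>F\<^esub> c'"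
      using lead_closed[OF lead_add(1)] lead_closed[OF lead_add(2)] lead_closed[OF assms(2)] by (simp_all add: l_distr U.R.l_distr)
    then show ?case using lead.lead_add[OF lead_add.IH] by simp
  qed
qed

text \<open>
  Raising the exponents of \<open>x\<close> into a common window does not change the terms of weight \<open>w\<close>, and
  inside a window there is only one place of that weight, by \<open>wt_inj\<close>.
\<close>

lemma lead_repr:
  assumes "lead K w a c" "K \<le> M"
  shows "\<exists>h. repr M a h \<and> (\<forall>k\<in>{M..M + q}. \<forall>d. wt d k = w \<longrightarrow> up_ring.coeff P (h k) d = c)"
  using assms
proof (induction rule: lead.induct)
  case (lead_eq c k d)
  obtain k' e where k': "k' \<in> {M..M + q}" "k' = k + e * (q + 1)" using window[of k M] lead_eq by auto
  let ?h = "up_ring.monom P c d \<otimes>\<^bsub>P\<^esub> T [^]\<^bsub>P\<^esub> e"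
  have top: "has_top F ?h (d + q * e) c"
    using U.has_top_mult[OF _ _ U.has_top_monom U.has_top_pow[OF T_closed T_top]] lead_eq(1) by simp
  have "repr M (\<iota> ?h \<otimes> x [^] k') (\<lambda>i. if i = k' then ?h else \<zero>\<^bsub>P\<^esub>)"
    by (rule repr_single[OF _ k'(1)]) (use lead_eq in simp)
  then have r: "repr M (\<iota> (up_ring.monom P c d) \<otimes> x [^] k) (\<lambda>i. if i = k' then ?h else \<zero>\<^bsub>P\<^esub>)"
    using raise_x[of "up_ring.monom P c d" k e] lead_eq k'(2) by simp
  have "up_ring.coeff P (if i = k' then ?h else \<zero>\<^bsub>P\<^esub>) d' = c" if "i \<in> {M..M + q}" "wt d' i = w" for i d'
  proof -
    have "wt (d + q * e) k' = w" using lead_eq(3) wt_raise k'(2) by simp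
    then have "i = k' \<and> d' = d + q * e" using wt_inj[of d' i "d + q * e" k' M] that k'(1) by simp
    then show ?thesis using top unfolding has_top_def U.P_def[symmetric] by simp
  qed
  then show ?case using r by blast
next
  case (lead_less c k d)
  obtain k' e where k': "k' \<in> {M..M + q}" "k' = k + e * (q + 1)" using window[of k M] lead_less by auto
  let ?h = "up_ring.monom P c d \<otimes>\<^bsub>P\<^esub> T [^]\<^bsub>P\<^esub> e"
  have top: "has_top F ?h (d + q * e) c"
    using U.has_top_mult[OF _ _ U.has_top_monom U.has_top_pow[OF T_closed T_top]] lead_less(1) by simp
  have "repr M (\<iota> ?h \<otimes> x [^] k') (\<lambda>i. if i = k' then ?h else \<zero>\<^bsub>P\<^esub>)"
    by (rule repr_single[OF _ k'(1)]) (use lead_less in simp)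
  then have r: "repr M (\<iota> (up_ring.monom P c d) \<otimes> x [^] k) (\<lambda>i. if i = k' then ?h else \<zero>\<^bsub>P\<^esub>)"
    using raise_x[of "up_ring.monom P c d" k e] lead_less k'(2) by simp
  have "up_ring.coeff P (if i = k' then ?h else \<zero>\<^bsub>P\<^esub>) d' = \<zero>\<^bsub>F\<^esub>" if "i \<in> {M..M + q}" "wt d' i = w" for i d'
  proof (cases "i = k'")
    case True
    have "wt (d + q * e) k' < wt d' k'" using lead_less(3) wt_raise[of d e k] k'(2) that(2) True by simp
    then have "int (q + 1) * int (d + q * e) < int (q + 1) * int d'" unfolding wt_def by linarith
    then have "int (d + q * e) < int d'" by (rule mult_left_less_imp_less) simp
    then have "d' > d + q * e" by (simp only: of_nat_less_iff)
    then show ?thesis using top True unfolding has_top_def U.P_def[symmetric] by simp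
  qed simp
  then show ?case using r by blast
next
  case lead_null
  have "repr M \<zero> (\<lambda>_. \<zero>\<^bsub>P\<^esub>)" unfolding repr_def by (simp add: finsum_zero)
  then show ?case by (intro exI[of _ "\<lambda>_. \<zero>\<^bsub>P\<^esub>"]) simp
next
  case (lead_add a c b c')
  then obtain h h' where h: "repr M a h" "\<forall>k\<in>{M..M + q}. \<forall>d. wt d k = w \<longrightarrow> up_ring.coeff P (h k) d = c"
    "repr M b h'" "\<forall>k\<in>{M..M + q}. \<forall>d. wt d k = w \<longrightarrow> up_ring.coeff P (h' k) d = c'" by blast
  have "\<And>k. h k \<in> carrier P" "\<And>k. h' k \<in> carrier P" using h(1,3) unfolding repr_def by auto
  then show ?case using repr_add[OF h(1,3)] h(2,4) by (intro exI[of _ "\<lambda>k. h k \<oplus>\<^bsub>P\<^esub> h' k"]) simp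
qed

lemma lead_zero:
  assumes "lead K w \<zero> c"
  shows "c = \<zero>\<^bsub>F\<^esub>"
proof -
  define M where "M = K + nat \<bar>w\<bar>"
  obtain h where h: "repr M \<zero> h" and c: "\<And>k d. k \<in> {M..M + q} \<Longrightarrow> wt d k = w \<Longrightarrow> up_ring.coeff P (h k) d = c"
    using lead_repr[OF assms, of M] unfolding M_def by auto
  \<comment> \<open>the residue class of \<open>w\<close> modulo \<open>q + 1\<close> determines a place in the window\<close>
  define r where "r = (w - int M) mod int (q + 1)"
  have r: "0 \<le> r" "r < int (q + 1)" unfolding r_def by simp_all
  define k where "k = M + nat r"
  have k: "k \<in> {M..M + q}" "int k = int M + r" unfolding k_def using r by auto
  have "int (q + 1) dvd (w - int M) - r" unfolding r_def by (rule dvd_minus_mod)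
  then have "int (q + 1) dvd w - int k" unfolding k(2) by (simp add: algebra_simps)
  then obtain z where z: "w - int k = int (q + 1) * z" by (rule dvdE)
  have wk: "w + int q * int k = int (q + 1) * (z + int k)" using z by (simp add: algebra_simps)
  have "int q * int k \<ge> int M" using k(1) q_ge2 by (intro order_trans[OF _ mult_mono[of 1 "int q" "int M" "int k"]]) auto
  then have "w + int q * int k \<ge> 0" unfolding M_def by linarith
  then have "z + int k \<ge> 0" unfolding wk by (simp add: zero_le_mult_iff)
  then have "wt (nat (z + int k)) k = w" unfolding wt_def using wk by simp
  then have "up_ring.coeff P (h k) (nat (z + int k)) = c" by (rule c[OF k(1)])
  moreover have "h k = \<zero>\<^bsub>P\<^esub>" by (rule free[of h M k]) (use h k(1) in \<open>auto simp: repr_def\<close>)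
  ultimately show ?thesis by simp
qed

lemma lead_sum:
  assumes "finite I" "\<And>i. i \<in> I \<Longrightarrow> lead K w (a i) (c i)"
  shows "lead K w (\<Oplus>i\<in>I. a i) (\<Oplus>\<^bsub>F\<^esub>i\<in>I. c i)"
  using assms
proof (induction rule: finite_induct)
  case empty
  then show ?case using lead_null by simp
next
  case (insert j I)
  have "\<And>i. i \<in> insert j I \<Longrightarrow> a i \<in> carrier A" "\<And>i. i \<in> insert j I \<Longrightarrow> c i \<in> carrier F"
    using lead_closed[OF insert.prems] by blast+
  then have "(\<Oplus>i\<in>insert j I. a i) = a j \<oplus> (\<Oplus>i\<in>I. a i)" "(\<Oplus>\<^bsub>F\<^esub>i\<in>insert j I. c i) = c j \<oplus>\<^bsub>F\<^esub> (\<Oplus>\<^bsub>F\<^esub>i\<in>I. c i)"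
    using insert.hyps by (auto intro!: finsum_insert U.R.finsum_insert)
  then show ?case using lead_add insert by simp
qed

lemma lead_poly:
  fixes k :: nat
  assumes h: "h \<in> carrier P" and c: "\<And>i. lead K w (\<iota> (up_ring.monom P (up_ring.coeff P h i) i) \<otimes> x [^] k) (c i)"
  shows "lead K w (\<iota> h \<otimes> x [^] k) (\<Oplus>\<^bsub>F\<^esub>i\<in>{..deg F h}. c i)"
proof -
  have cF: "c i \<in> carrier F" for i using lead_closed[OF c] by blast
  have "lead K w (\<iota> (\<Oplus>\<^bsub>P\<^esub>i\<in>{..n}. up_ring.monom P (up_ring.coeff P h i) i) \<otimes> x [^] k) (\<Oplus>\<^bsub>F\<^esub>i\<in>{..n}. c i)" for n
  proof (induction n)
    case 0
    show ?case using c[of 0] h cF by simp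
  next
    case (Suc n)
    have "(\<Oplus>\<^bsub>P\<^esub>i\<in>{..Suc n}. up_ring.monom P (up_ring.coeff P h i) i) =
      up_ring.monom P (up_ring.coeff P h (Suc n)) (Suc n) \<oplus>\<^bsub>P\<^esub> (\<Oplus>\<^bsub>P\<^esub>i\<in>{..n}. up_ring.monom P (up_ring.coeff P h i) i)"
      using h by (intro U.P.finsum_Suc) auto
    moreover have mc: "up_ring.monom P (up_ring.coeff P h (Suc n)) (Suc n) \<in> carrier P" using h by simp
    moreover have cl: "(\<Oplus>\<^bsub>P\<^esub>i\<in>{..n}. up_ring.monom P (up_ring.coeff P h i) i) \<in> carrier P"
      using h by (intro U.P.finsum_closed) auto
    ultimately have "\<iota> (\<Oplus>\<^bsub>P\<^esub>i\<in>{..Suc n}. up_ring.monom P (up_ring.coeff P h i) i) \<otimes> x [^] k =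
      \<iota> (up_ring.monom P (up_ring.coeff P h (Suc n)) (Suc n)) \<otimes> x [^] k \<oplus> \<iota> (\<Oplus>\<^bsub>P\<^esub>i\<in>{..n}. up_ring.monom P (up_ring.coeff P h i) i) \<otimes> x [^] k"
      by (simp add: iota_add l_distr)
    moreover have "(\<Oplus>\<^bsub>F\<^esub>i\<in>{..Suc n}. c i) = c (Suc n) \<oplus>\<^bsub>F\<^esub> (\<Oplus>\<^bsub>F\<^esub>i\<in>{..n}. c i)"
      using cF by (intro U.R.finsum_Suc) auto
    ultimately show ?case using lead_add[OF c Suc] by simp
  qed
  from this[of "deg F h"] show ?thesis using U.up_repr[OF h] by simp
qed

lemma lead_exists:
  assumes a: "a \<in> carrier A" "a \<noteq> \<zero>"
  shows "\<exists>K w c. lead K w a c \<and> c \<noteq> \<zero>\<^bsub>F\<^esub>"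
proof -
  obtain M h where r: "repr M a h" using repr_exists[OF a(1)] by blast
  then have h: "\<And>k. h k \<in> carrier P" and ah: "a = (\<Oplus>k\<in>{M..M + q}. \<iota> (h k) \<otimes> x [^] k)" unfolding repr_def by auto
  define Z where "Z = {(k, d). k \<in> {M..M + q} \<and> d \<le> deg F (h k) \<and> up_ring.coeff P (h k) d \<noteq> \<zero>\<^bsub>F\<^esub>}"
  have "Z \<subseteq> Sigma {M..M + q} (\<lambda>k. {..deg F (h k)})" unfolding Z_def by auto
  then have finZ: "finite Z" by (rule finite_subset) auto
  have memZ: "(k, d) \<in> Z" if "k \<in> {M..M + q}" "up_ring.coeff P (h k) d \<noteq> \<zero>\<^bsub>F\<^esub>" for k d
    using that U.deg_belowI[of d "h k"] h unfolding Z_def by auto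
  have "Z \<noteq> {}"
  proof
    assume Z: "Z = {}"
    have "h k = \<zero>\<^bsub>P\<^esub>" if "k \<in> {M..M + q}" for k
      using memZ[OF that] Z h by (intro U.up_eqI) auto
    then have "a = (\<Oplus>k\<in>{M..M + q}. \<zero>)" unfolding ah by (intro finsum_cong') auto
    then show False using a(2) by (simp add: finsum_zero)
  qed
  define wz where "wz = (\<lambda>(k, d). wt d k)"
  have "Max (wz ` Z) \<in> wz ` Z" using finZ \<open>Z \<noteq> {}\<close> by (intro Max_in) auto
  then obtain k0 d0 where Z0: "(k0, d0) \<in> Z" and m: "wt d0 k0 = Max (wz ` Z)" unfolding wz_def by auto
  have max: "wt d k \<le> wt d0 k0" if "(k, d) \<in> Z" for k d
  proof -
    have "wz (k, d) \<le> Max (wz ` Z)" using finZ that by (intro Max_ge) auto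
    then show ?thesis unfolding m wz_def by simp
  qed
  let ?w = "wt d0 k0" and ?c0 = "up_ring.coeff P (h k0) d0"
  have k0: "k0 \<in> {M..M + q}" "?c0 \<noteq> \<zero>\<^bsub>F\<^esub>" "d0 \<le> deg F (h k0)" using Z0 unfolding Z_def by auto
  define c where "c k i = (if k0 = k then (if d0 = i then ?c0 else \<zero>\<^bsub>F\<^esub>) else \<zero>\<^bsub>F\<^esub>)" for k i
  have "lead (M + q) ?w (\<iota> (up_ring.monom P (up_ring.coeff P (h k) i) i) \<otimes> x [^] k) (c k i)" if k: "k \<in> {M..M + q}" for k i
  proof (cases "up_ring.coeff P (h k) i = \<zero>\<^bsub>F\<^esub>")
    case True
    then have "c k i = \<zero>\<^bsub>F\<^esub>" using k0 unfolding c_def by auto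
    then show ?thesis using True lead_null by simp
  next
    case False
    then have le: "wt i k \<le> ?w" using max memZ k by blast
    show ?thesis
    proof (cases "wt i k = ?w")
      case True
      then have "k = k0 \<and> i = d0" using wt_inj k k0(1) by blast
      then show ?thesis using lead_eq[of ?c0 k0 "M + q" d0 ?w] k h unfolding c_def by simp
    next
      case False
      then have "c k i = \<zero>\<^bsub>F\<^esub>" unfolding c_def by auto
      then show ?thesis using lead_less[of "up_ring.coeff P (h k) i" k "M + q" i ?w] k h le False by simp
    qed
  qed
  then have "lead (M + q) ?w (\<iota> (h k) \<otimes> x [^] k) (\<Oplus>\<^bsub>F\<^esub>i\<in>{..deg F (h k)}. c k i)" if "k \<in> {M..M + q}" for k
    using that by (intro lead_poly h) blast
  moreover have "(\<Oplus>\<^bsub>F\<^esub>i\<in>{..deg F (h k)}. c k i) = (if k0 = k then ?c0 else \<zero>\<^bsub>F\<^esub>)" for k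
  proof (cases "k0 = k")
    case True
    have "(\<Oplus>\<^bsub>F\<^esub>i\<in>{..deg F (h k0)}. if d0 = i then ?c0 else \<zero>\<^bsub>F\<^esub>) = ?c0"
      using k0(3) h by (intro U.R.finsum_singleton) auto
    then show ?thesis using True unfolding c_def by simp
  next
    case False
    then show ?thesis unfolding c_def by (simp add: U.R.finsum_zero)
  qed
  ultimately have "lead (M + q) ?w (\<iota> (h k) \<otimes> x [^] k) (if k0 = k then ?c0 else \<zero>\<^bsub>F\<^esub>)" if "k \<in> {M..M + q}" for k
    using that by simp
  then have "lead (M + q) ?w a (\<Oplus>\<^bsub>F\<^esub>k\<in>{M..M + q}. if k0 = k then ?c0 else \<zero>\<^bsub>F\<^esub>)"
    unfolding ah by (rule lead_sum[OF finite_atLeastAtMost])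
  moreover have "(\<Oplus>\<^bsub>F\<^esub>k\<in>{M..M + q}. if k0 = k then ?c0 else \<zero>\<^bsub>F\<^esub>) = ?c0"
    using k0(1) h by (intro U.R.finsum_singleton) auto
  ultimately show ?thesis using k0(2) by auto
qed

text \<open>
  Leading coefficients multiply, they can be chosen nonzero for nonzero elements, and those of zero vanish.
\<close>

theorem cover_domain: "domain A"
proof (rule domainI)
  show "cring A" by unfold_locales
  have "lead 0 0 (\<iota> (up_ring.monom P \<one>\<^bsub>F\<^esub> 0) \<otimes> x [^] (0::nat)) \<one>\<^bsub>F\<^esub>"
    by (rule lead_eq) (simp_all add: wt_def)
  then have "lead 0 0 \<one> \<one>\<^bsub>F\<^esub>" by (simp add: iota_one)
  then show "\<one> \<noteq> \<zero>" using lead_zero[of 0 0 "\<one>\<^bsub>F\<^esub>"] by auto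
  show "a = \<zero> \<or> b = \<zero>" if ab: "a \<otimes> b = \<zero>" "a \<in> carrier A" "b \<in> carrier A" for a b
  proof (rule ccontr)
    assume "\<not> (a = \<zero> \<or> b = \<zero>)"
    then obtain K w c K' w' c' where l: "lead K w a c" "c \<noteq> \<zero>\<^bsub>F\<^esub>" "lead K' w' b c'" "c' \<noteq> \<zero>\<^bsub>F\<^esub>"
      using lead_exists[of a] lead_exists[of b] ab by metis
    have "c \<otimes>\<^bsub>F\<^esub> c' = \<zero>\<^bsub>F\<^esub>" using lead_mult[OF l(1,3)] unfolding ab(1) by (rule lead_zero)
    then show False using l lead_closed U.R.integral by blast
  qed
qed

end

section \<open>The Cartier operator\<close>

text \<open>
  \<open>D\<close> is differentiation with respect to \<open>s\<close>, and \<open>K\<close> is the field of \<open>q\<close> elements, the set of zeros of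
  \<open>s\<^sup>q - s\<close>.
\<close>

locale drinfeld_cover = graded_cover +
  fixes p n :: nat and K and D
  assumes prime_p: "Factorial_Ring.prime p" and n_pos: "n > 0" and q_def: "q = p ^ n"
    and char_F: "int_elem F p = \<zero>\<^bsub>F\<^esub>"
    and perfect: "c \<in> carrier F \<Longrightarrow> \<exists>d\<in>carrier F. c = d [^]\<^bsub>F\<^esub> p"
    and K: "K \<subseteq> carrier F" "finite K" "card K = q" "\<And>a. a \<in> K \<Longrightarrow> a [^]\<^bsub>F\<^esub> q = a"
    and D_closed: "a \<in> carrier A \<Longrightarrow> D a \<in> carrier A"
    and D_add: "a \<in> carrier A \<Longrightarrow> b \<in> carrier A \<Longrightarrow> D (a \<oplus> b) = D a \<oplus> D b"
    and D_mult: "a \<in> carrier A \<Longrightarrow> b \<in> carrier A \<Longrightarrow> D (a \<otimes> b) = D a \<otimes> b \<oplus> a \<otimes> D b"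
    and D_const: "c \<in> carrier F \<Longrightarrow> D (\<iota> (up_ring.monom P c 0)) = \<zero>"
    and D_s: "D (\<iota> (up_ring.monom P \<one>\<^bsub>F\<^esub> 1)) = \<one>"
begin

definition s where "s = \<iota> (up_ring.monom P \<one>\<^bsub>F\<^esub> 1)"
definition \<kappa> where "\<kappa> c = \<iota> (up_ring.monom P c 0)"

lemma s_closed [simp]: "s \<in> carrier A" by (simp add: s_def)
lemma kappa_closed [simp]: "c \<in> carrier F \<Longrightarrow> \<kappa> c \<in> carrier A" by (simp add: \<kappa>_def)
lemma kappa_mult: "c \<in> carrier F \<Longrightarrow> d \<in> carrier F \<Longrightarrow> \<kappa> (c \<otimes>\<^bsub>F\<^esub> d) = \<kappa> c \<otimes> \<kappa> d"
  using U.monom_mult[of c d 0 0] by (simp add: \<kappa>_def iota_mult[symmetric])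
lemma kappa_add: "c \<in> carrier F \<Longrightarrow> d \<in> carrier F \<Longrightarrow> \<kappa> (c \<oplus>\<^bsub>F\<^esub> d) = \<kappa> c \<oplus> \<kappa> d"
  by (simp add: \<kappa>_def iota_add[symmetric])
lemma kappa_one: "\<kappa> \<one>\<^bsub>F\<^esub> = \<one>" by (simp add: \<kappa>_def iota_one)
lemma kappa_zero: "\<kappa> \<zero>\<^bsub>F\<^esub> = \<zero>" by (simp add: \<kappa>_def)
lemma kappa_pow: "c \<in> carrier F \<Longrightarrow> \<kappa> (c [^]\<^bsub>F\<^esub> (m::nat)) = \<kappa> c [^] m"
  by (induction m) (simp_all add: kappa_one kappa_mult)

lemma iota_monom:
  assumes c: "c \<in> carrier F"
  shows "\<iota> (up_ring.monom P c j) = \<kappa> c \<otimes> s [^] j"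
proof -
  have "s [^] j = \<iota> (up_ring.monom P \<one>\<^bsub>F\<^esub> j)"
  proof (induction j)
    case (Suc j)
    then show ?case using U.monom_mult[of "\<one>\<^bsub>F\<^esub>" "\<one>\<^bsub>F\<^esub>" j 1] by (simp add: s_def iota_mult[symmetric])
  qed (simp add: iota_one)
  then show ?thesis using U.monom_mult[of c "\<one>\<^bsub>F\<^esub>" 0 j] c by (simp add: \<kappa>_def iota_mult[symmetric])
qed

lemma int_elem_kappa: "int_elem A m = \<kappa> (int_elem F m)"
  by (induction m) (simp_all add: kappa_zero nu_Suc U.R.nu_Suc kappa_add kappa_one)

sublocale FD: char_p_domain F p
  by unfold_locales (simp_all add: prime_p char_F)

sublocale AD: char_p_derivation A p D
proof -
  interpret domain A by (rule cover_domain)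
  show "char_p_derivation A p D"
    by unfold_locales (simp_all add: prime_p int_elem_kappa char_F kappa_zero D_closed D_add D_mult)
qed

lemma D_s': "D s = \<one>" using D_s by (simp add: s_def)

text \<open>
  The ring is generated over its \<open>p\<close>-th powers by \<open>1, s, \<dots>, s\<^bsup>p-1\<^esup>\<close>: coefficients from \<open>F\<close> are \<open>p\<close>-th
  powers, and \<open>raise_x\<close> makes the exponent of \<open>x\<close> divisible by \<open>p\<close>, as
  \<open>k + (p - 1) k (q + 1)\<close> is.
\<close>

lemma p_basis_induct:
  assumes a: "a \<in> carrier A"
    and gen: "\<And>b i. b \<in> carrier A \<Longrightarrow> i < p \<Longrightarrow> Q (b [^] p \<otimes> s [^] i)"
    and add: "\<And>a b. a \<in> carrier A \<Longrightarrow> b \<in> carrier A \<Longrightarrow> Q a \<Longrightarrow> Q b \<Longrightarrow> Q (a \<oplus> b)"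
  shows "Q a"
proof -
  have gen': "Q (b [^] p \<otimes> s [^] i)" if b: "b \<in> carrier A" for b and i :: nat
  proof -
    have "(b \<otimes> s [^] (i div p)) [^] p \<otimes> s [^] (i mod p) = b [^] p \<otimes> (s [^] (i div p * p) \<otimes> s [^] (i mod p))"
      using b by (simp add: nat_pow_distrib nat_pow_pow m_assoc)
    also have "s [^] (i div p * p) \<otimes> s [^] (i mod p) = s [^] i" by (simp only: nat_pow_mult s_closed div_mult_mod_eq)
    finally show ?thesis using gen[of "b \<otimes> s [^] (i div p)" "i mod p"] b AD.p_pos by simp
  qed
  have poly: "Q (b [^] p \<otimes> \<iota> h)" if b: "b \<in> carrier A" and h: "h \<in> carrier P" for b h
    using h
  proof (rule U.poly_induct)
    fix c j assume c: "c \<in> carrier F"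
    obtain d where d: "d \<in> carrier F" "c = d [^]\<^bsub>F\<^esub> p" using perfect[OF c] by blast
    have "b [^] p \<otimes> \<iota> (up_ring.monom P c j) = (b \<otimes> \<kappa> d) [^] p \<otimes> s [^] j"
      using b c d by (simp add: iota_monom kappa_pow nat_pow_distrib m_assoc)
    then show "Q (b [^] p \<otimes> \<iota> (up_ring.monom P c j))" using gen'[of "b \<otimes> \<kappa> d" j] b d by simp
  next
    fix f g assume "f \<in> carrier P" "g \<in> carrier P" "Q (b [^] p \<otimes> \<iota> f)" "Q (b [^] p \<otimes> \<iota> g)"
    then show "Q (b [^] p \<otimes> \<iota> (f \<oplus>\<^bsub>P\<^esub> g))" using b add by (simp add: iota_add r_distr)
  qed
  show ?thesis
  proof (rule span[OF a])
    fix c j and k :: nat assume c: "c \<in> carrier F"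
    define r where "r = (p - 1) * k"
    obtain m where m: "n = Suc m" using n_pos by (cases n) auto
    have e: "k + r * (q + 1) = k * (1 + (p - 1) * p ^ m) * p"
    proof -
      obtain p' where p': "p = Suc p'" using AD.p_pos by (cases p) auto
      show ?thesis unfolding r_def q_def m p' by (simp add: algebra_simps)
    qed
    let ?h = "up_ring.monom P c j \<otimes>\<^bsub>P\<^esub> T [^]\<^bsub>P\<^esub> r"
    have "\<iota> (up_ring.monom P c j) \<otimes> x [^] k = \<iota> ?h \<otimes> x [^] (k * (1 + (p - 1) * p ^ m) * p)"
      unfolding e[symmetric] using c by (intro raise_x) simp
    also have "\<dots> = (x [^] (k * (1 + (p - 1) * p ^ m))) [^] p \<otimes> \<iota> ?h"
      using c by (simp only: nat_pow_pow x_closed) (intro m_comm; simp)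
    finally show "Q (\<iota> (up_ring.monom P c j) \<otimes> x [^] k)"
      using poly[of "x [^] (k * (1 + (p - 1) * p ^ m))" ?h] c by simp
  qed (rule add)
qed

sublocale AD: nilpotent_derivation A p D
proof
  fix a assume "a \<in> carrier A"
  then show "(D ^^ p) a = \<zero>"
  proof (rule p_basis_induct)
    fix b i assume "b \<in> carrier A" "i < p"
    then show "(D ^^ p) (b [^] p \<otimes> s [^] i) = \<zero>"
      by (simp add: AD.Dn_const_mult AD.Dn_pow_above[OF s_closed D_s'])
  qed (simp add: AD.Dn_add)
qed

lemma Dtop_const_mult: "b \<in> carrier A \<Longrightarrow> a \<in> carrier A \<Longrightarrow> (D ^^ k) (b [^] p \<otimes> a) = b [^] p \<otimes> (D ^^ k) a"
  by (simp add: AD.Dn_const_mult)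

lemma Cartier_exists:
  assumes "a \<in> carrier A"
  shows "\<exists>c\<in>carrier A. (D ^^ (p - 1)) a = \<ominus> (c [^] p)"
  using assms
proof (rule p_basis_induct)
  fix b i assume b: "b \<in> carrier A" and i: "i < p"
  show "\<exists>c\<in>carrier A. (D ^^ (p - 1)) (b [^] p \<otimes> s [^] i) = \<ominus> (c [^] p)"
  proof (cases "i = p - 1")
    case True
    then show ?thesis using b i AD.Dtop_pow[OF s_closed D_s' i]
      by (intro bexI[of _ b]) (simp_all add: Dtop_const_mult r_minus)
  next
    case False
    then show ?thesis using b i AD.Dtop_pow[OF s_closed D_s' i]
      by (intro bexI[of _ \<zero>]) (simp_all add: Dtop_const_mult AD.frobenius_zero)
  qed
next
  fix a b assume ab: "a \<in> carrier A" "b \<in> carrier A" and "\<exists>c\<in>carrier A. (D ^^ (p - 1)) a = \<ominus> (c [^] p)"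
    "\<exists>c\<in>carrier A. (D ^^ (p - 1)) b = \<ominus> (c [^] p)"
  then obtain c d where "c \<in> carrier A" "(D ^^ (p - 1)) a = \<ominus> (c [^] p)" "d \<in> carrier A" "(D ^^ (p - 1)) b = \<ominus> (d [^] p)"
    by blast
  then show "\<exists>c\<in>carrier A. (D ^^ (p - 1)) (a \<oplus> b) = \<ominus> (c [^] p)"
    using ab by (intro bexI[of _ "c \<oplus> d"]) (simp_all add: AD.Dn_add AD.frobenius_add minus_add)
qed

text \<open>
  The Cartier operator: if \<open>a\<close> is the sum of \<open>b\<^sub>i\<^sup>p s\<^sup>i\<close> over \<open>i < p\<close>, then \<open>C a\<close> is \<open>b\<^sub>i\<close> for \<open>i = p - 1\<close>.
\<close>

definition C where "C a = (THE c. c \<in> carrier A \<and> (D ^^ (p - 1)) a = \<ominus> (c [^] p))"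

lemma Cartier_eq:
  assumes "c \<in> carrier A" "(D ^^ (p - 1)) a = \<ominus> (c [^] p)"
  shows "C a = c"
  unfolding C_def
proof (rule the_equality)
  fix d assume d: "d \<in> carrier A \<and> (D ^^ (p - 1)) a = \<ominus> (d [^] p)"
  then have "\<ominus> (d [^] p) = \<ominus> (c [^] p)" using trans[OF sym assms(2)] by blast
  from arg_cong[OF this, of "a_inv A"] have "d [^] p = c [^] p"
    using d assms(1) by (simp only: minus_minus nat_pow_closed)
  then show "d = c" using AD.frobenius_inj d assms by blast
qed (use assms in simp)

lemma Cartier_spec:
  assumes "a \<in> carrier A"
  shows "C a \<in> carrier A" "(D ^^ (p - 1)) a = \<ominus> (C a [^] p)"
  using Cartier_exists[OF assms] Cartier_eq by auto

lemma Cartier_add: "a \<in> carrier A \<Longrightarrow> b \<in> carrier A \<Longrightarrow> C (a \<oplus> b) = C a \<oplus> C b"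
  by (intro Cartier_eq) (simp_all add: Cartier_spec AD.Dn_add AD.frobenius_add minus_add del: One_nat_def)

lemma Cartier_mult: "a \<in> carrier A \<Longrightarrow> b \<in> carrier A \<Longrightarrow> C (b [^] p \<otimes> a) = b \<otimes> C a"
  by (intro Cartier_eq) (simp_all add: Cartier_spec Dtop_const_mult nat_pow_distrib r_minus del: One_nat_def)

lemma Cartier_pow:
  assumes "z \<in> carrier A" "D z = \<one>" "i < p"
  shows "C (z [^] i) = (if i = p - 1 then \<one> else \<zero>)"
  by (intro Cartier_eq) (use AD.Dtop_pow[OF assms] in \<open>simp_all add: AD.frobenius_zero\<close>)

text \<open>
  In the expansion of \<open>a\<close> in powers of \<open>s\<close>, the coefficient of \<open>s\<^sup>i\<close> is detected by
  \<open>D\<^bsup>p-1\<^esup> (s\<^bsup>p-1-i\<^esup> a)\<close>. If \<open>D a = 0\<close>, this is \<open>a D\<^bsup>p-1\<^esup> (s\<^bsup>p-1-i\<^esup>)\<close>, which is zero for \<open>i > 0\<close>.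
\<close>

lemma Cartier_kernel:
  assumes a: "a \<in> carrier A" and Da: "D a = \<zero>"
  shows "\<exists>b\<in>carrier A. a = b [^] p"
proof -
  \<comment> \<open>the coefficient of \<open>s\<^sup>i\<close> in \<open>a\<close> with respect to the basis of powers of \<open>s\<close> is \<open>C (s\<^bsup>p-1-i\<^esup> a)\<^sup>p\<close>\<close>
  have "\<exists>b\<in>carrier A. a = b [^] p \<oplus> (\<Oplus>i\<in>{1..<p}. C (s [^] (p - 1 - i) \<otimes> a) [^] p \<otimes> s [^] i)"
    using a
  proof (rule p_basis_induct)
    fix b i assume b: "b \<in> carrier A" and i: "i < p"
    have Cj: "C (s [^] (p - 1 - j) \<otimes> (b [^] p \<otimes> s [^] i)) = (if i = j then b else \<zero>)" if j: "j \<in> {1..<p}" for j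
    proof -
      have "s [^] (p - 1 - j) \<otimes> (b [^] p \<otimes> s [^] i) = b [^] p \<otimes> s [^] (p - 1 - j + i)"
        using b by (simp add: nat_pow_mult[symmetric] m_ac)
      moreover have "C (s [^] (p - 1 - j + i)) = (if i = j then \<one> else \<zero>)"
      proof (cases "p - 1 - j + i < p")
        case True
        then show ?thesis using Cartier_pow[OF s_closed D_s' True] j by auto
      next
        case False
        define l where "l = p - 1 - j + i - p"
        have l: "p - 1 - j + i = p + l" "l < p - 1" using False i j unfolding l_def by auto
        have "s [^] (p + l) = s [^] p \<otimes> s [^] l" by (simp add: nat_pow_mult)
        then have "C (s [^] (p - 1 - j + i)) = s \<otimes> C (s [^] l)" unfolding l(1) by (simp add: Cartier_mult)
        also have "\<dots> = \<zero>" using Cartier_pow[OF s_closed D_s', of l] l(2) by simp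
        finally show ?thesis using False i j by auto
      qed
      ultimately show ?thesis using b by (simp add: Cartier_mult)
    qed
    have "(\<Oplus>j\<in>{1..<p}. C (s [^] (p - 1 - j) \<otimes> (b [^] p \<otimes> s [^] i)) [^] p \<otimes> s [^] j) =
      (\<Oplus>j\<in>{1..<p}. if i = j then b [^] p \<otimes> s [^] j else \<zero>)"
      using b Cj by (intro finsum_cong') (auto simp: AD.frobenius_zero)
    also have "\<dots> = (if i \<in> {1..<p} then b [^] p \<otimes> s [^] i else \<zero>)"
    proof (cases "i \<in> {1..<p}")
      case True
      then show ?thesis using b by (simp only: if_True) (rule finsum_singleton, auto)
    next
      case False
      then have "(\<Oplus>j\<in>{1..<p}. if i = j then b [^] p \<otimes> s [^] j else \<zero>) = (\<Oplus>j\<in>{1..<p}. \<zero>)"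
        using b by (intro finsum_cong') auto
      then show ?thesis using False by (simp only: if_False finsum_zero)
    qed
    finally have sum: "(\<Oplus>j\<in>{1..<p}. C (s [^] (p - 1 - j) \<otimes> (b [^] p \<otimes> s [^] i)) [^] p \<otimes> s [^] j) =
      (if i \<in> {1..<p} then b [^] p \<otimes> s [^] i else \<zero>)" .
    show "\<exists>b'\<in>carrier A. b [^] p \<otimes> s [^] i = b' [^] p \<oplus>
      (\<Oplus>j\<in>{1..<p}. C (s [^] (p - 1 - j) \<otimes> (b [^] p \<otimes> s [^] i)) [^] p \<otimes> s [^] j)"
      unfolding sum
    proof (cases "i = 0")
      case True
      then show "\<exists>b'\<in>carrier A. b [^] p \<otimes> s [^] i = b' [^] p \<oplus> (if i \<in> {1..<p} then b [^] p \<otimes> s [^] i else \<zero>)"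
        using b by (intro bexI[of _ b]) simp_all
    next
      case False
      then show "\<exists>b'\<in>carrier A. b [^] p \<otimes> s [^] i = b' [^] p \<oplus> (if i \<in> {1..<p} then b [^] p \<otimes> s [^] i else \<zero>)"
        using b i by (intro bexI[of _ \<zero>]) (simp_all add: AD.frobenius_zero)
    qed
  next
    let ?S = "\<lambda>a. \<Oplus>i\<in>{1..<p}. C (s [^] (p - 1 - i) \<otimes> a) [^] p \<otimes> s [^] i"
    fix a b assume ab: "a \<in> carrier A" "b \<in> carrier A" and "\<exists>c\<in>carrier A. a = c [^] p \<oplus> ?S a" "\<exists>c\<in>carrier A. b = c [^] p \<oplus> ?S b"
    then obtain c d where c: "c \<in> carrier A" "a = c [^] p \<oplus> ?S a" "d \<in> carrier A" "b = d [^] p \<oplus> ?S b" by blast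
    have cl: "C (s [^] (p - 1 - i) \<otimes> a) [^] p \<otimes> s [^] i \<in> carrier A" "C (s [^] (p - 1 - i) \<otimes> b) [^] p \<otimes> s [^] i \<in> carrier A" for i
      using ab by (simp_all add: Cartier_spec)
    have "?S (a \<oplus> b) = (\<Oplus>i\<in>{1..<p}. C (s [^] (p - 1 - i) \<otimes> a) [^] p \<otimes> s [^] i \<oplus> C (s [^] (p - 1 - i) \<otimes> b) [^] p \<otimes> s [^] i)"
      using ab cl by (intro finsum_cong') (auto simp: r_distr Cartier_add AD.frobenius_add Cartier_spec l_distr)
    also have "\<dots> = ?S a \<oplus> ?S b" using cl by (intro finsum_addf) auto
    finally have S: "?S (a \<oplus> b) = ?S a \<oplus> ?S b" .
    have Sc: "?S a \<in> carrier A" "?S b \<in> carrier A" using cl by (auto intro!: finsum_closed)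
    have "a \<oplus> b = (c [^] p \<oplus> ?S a) \<oplus> (d [^] p \<oplus> ?S b)" using c(2,4) by metis
    also have "\<dots> = (c \<oplus> d) [^] p \<oplus> ?S (a \<oplus> b)" unfolding S using c(1,3) Sc by (simp add: AD.frobenius_add a_ac)
    finally show "\<exists>c\<in>carrier A. a \<oplus> b = c [^] p \<oplus> ?S (a \<oplus> b)" using c by blast
  qed
  then obtain b where b: "b \<in> carrier A" and ab: "a = b [^] p \<oplus> (\<Oplus>i\<in>{1..<p}. C (s [^] (p - 1 - i) \<otimes> a) [^] p \<otimes> s [^] i)"
    by blast
  have "C (s [^] (p - 1 - i) \<otimes> a) = \<zero>" if i: "i \<in> {1..<p}" for i
  proof (rule Cartier_eq)
    have "s [^] (p - 1 - i) \<otimes> a = a \<otimes> s [^] (p - 1 - i)" using a by (simp add: m_comm)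
    moreover have "p - 1 - i < p - 1" using i by auto
    ultimately show "(D ^^ (p - 1)) (s [^] (p - 1 - i) \<otimes> a) = \<ominus> (\<zero> [^] p)"
      using a Da AD.Dn_pow_above[OF s_closed D_s', of "p - 1 - i" "p - 1"]
      by (simp add: AD.Dn_const_mult AD.frobenius_zero del: One_nat_def diff_diff_left)
  qed simp
  then have "(\<Oplus>i\<in>{1..<p}. C (s [^] (p - 1 - i) \<otimes> a) [^] p \<otimes> s [^] i) = (\<Oplus>i\<in>{1..<p}. \<zero>)"
    by (intro finsum_cong') (simp_all add: AD.frobenius_zero)
  then have "(\<Oplus>i\<in>{1..<p}. C (s [^] (p - 1 - i) \<otimes> a) [^] p \<otimes> s [^] i) = \<zero>" by (simp only: finsum_zero)
  then show ?thesis using ab b by (intro bexI[of _ b]) simp_all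
qed

subsection \<open>Action on polynomials\<close>

lemma Cartier_zero: "C \<zero> = \<zero>"
proof (rule Cartier_eq)
  have "(D ^^ k) \<zero> = \<zero>" for k by (induction k) simp_all
  then show "(D ^^ (p - 1)) \<zero> = \<ominus> (\<zero> [^] p)" by (simp add: AD.frobenius_zero)
qed simp

lemma Cartier_iota:
  assumes h: "h \<in> carrier P"
  shows "\<exists>h'\<in>carrier P. C (\<iota> h) = \<iota> h' \<and>
    (\<forall>j. up_ring.coeff P h' j [^]\<^bsub>F\<^esub> p = up_ring.coeff P h (p * (j + 1) - 1))"
  using h
proof (rule U.poly_induct)
  fix c j assume c: "c \<in> carrier F"
  obtain d where d: "d \<in> carrier F" "c = d [^]\<^bsub>F\<^esub> p" using perfect[OF c] by blast
  have "s [^] j = s [^] (j div p * p) \<otimes> s [^] (j mod p)" by (simp only: nat_pow_mult s_closed div_mult_mod_eq)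
  then have "\<iota> (up_ring.monom P c j) = (\<kappa> d \<otimes> s [^] (j div p)) [^] p \<otimes> s [^] (j mod p)"
    using c d by (simp add: iota_monom kappa_pow nat_pow_distrib nat_pow_pow m_assoc)
  then have C: "C (\<iota> (up_ring.monom P c j)) = (\<kappa> d \<otimes> s [^] (j div p)) \<otimes> (if j mod p = p - 1 then \<one> else \<zero>)"
    using d Cartier_pow[OF s_closed D_s', of "j mod p"] AD.p_pos by (simp add: Cartier_mult)
  have mod: "j = p * (i + 1) - 1 \<longleftrightarrow> j mod p = p - 1 \<and> j div p = i" for i
  proof
    assume "j = p * (i + 1) - 1"
    moreover obtain p' where "p = Suc p'" using AD.p_pos by (cases p) auto
    ultimately have "p = Suc p'" "j = p' + Suc p' * i" by (simp_all add: algebra_simps)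
    then show "j mod p = p - 1 \<and> j div p = i" by (simp del: mult_Suc)
  next
    assume "j mod p = p - 1 \<and> j div p = i"
    then have "j = p * i + (p - 1)" using mult_div_mod_eq[of p j] by simp
    then show "j = p * (i + 1) - 1" using AD.p_pos by (simp add: algebra_simps)
  qed
  show "\<exists>h'\<in>carrier P. C (\<iota> (up_ring.monom P c j)) = \<iota> h' \<and>
    (\<forall>i. up_ring.coeff P h' i [^]\<^bsub>F\<^esub> p = up_ring.coeff P (up_ring.monom P c j) (p * (i + 1) - 1))"
  proof (cases "j mod p = p - 1")
    case True
    then show ?thesis using C c d mod FD.frobenius_zero
      by (intro bexI[of _ "up_ring.monom P d (j div p)"]) (auto simp: iota_monom)
  next
    case False
    then show ?thesis using C c d mod FD.frobenius_zero
      by (intro bexI[of _ "\<zero>\<^bsub>P\<^esub>"]) auto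
  qed
next
  fix f g assume f: "f \<in> carrier P" and g: "g \<in> carrier P"
    and "\<exists>h'\<in>carrier P. C (\<iota> f) = \<iota> h' \<and> (\<forall>j. up_ring.coeff P h' j [^]\<^bsub>F\<^esub> p = up_ring.coeff P f (p * (j + 1) - 1))"
    "\<exists>h'\<in>carrier P. C (\<iota> g) = \<iota> h' \<and> (\<forall>j. up_ring.coeff P h' j [^]\<^bsub>F\<^esub> p = up_ring.coeff P g (p * (j + 1) - 1))"
  then obtain f' g' where "f' \<in> carrier P" "C (\<iota> f) = \<iota> f'" "\<forall>j. up_ring.coeff P f' j [^]\<^bsub>F\<^esub> p = up_ring.coeff P f (p * (j + 1) - 1)"
    "g' \<in> carrier P" "C (\<iota> g) = \<iota> g'" "\<forall>j. up_ring.coeff P g' j [^]\<^bsub>F\<^esub> p = up_ring.coeff P g (p * (j + 1) - 1)" by blast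
  then show "\<exists>h'\<in>carrier P. C (\<iota> (f \<oplus>\<^bsub>P\<^esub> g)) = \<iota> h' \<and>
      (\<forall>j. up_ring.coeff P h' j [^]\<^bsub>F\<^esub> p = up_ring.coeff P (f \<oplus>\<^bsub>P\<^esub> g) (p * (j + 1) - 1))"
    using f g by (intro bexI[of _ "f' \<oplus>\<^bsub>P\<^esub> g'"]) (simp_all add: iota_add Cartier_add FD.frobenius_add)
qed

abbreviation "Cn k \<equiv> C ^^ k"

lemma Cn_closed: "a \<in> carrier A \<Longrightarrow> Cn k a \<in> carrier A"
  by (induction k) (simp_all add: Cartier_spec)

lemma Cn_add: "a \<in> carrier A \<Longrightarrow> b \<in> carrier A \<Longrightarrow> Cn k (a \<oplus> b) = Cn k a \<oplus> Cn k b"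
  by (induction k) (simp_all add: Cartier_add Cn_closed)

lemma Cn_mult: "a \<in> carrier A \<Longrightarrow> b \<in> carrier A \<Longrightarrow> Cn k (b [^] (p ^ k) \<otimes> a) = b \<otimes> Cn k a"
proof (induction k arbitrary: b)
  case (Suc k)
  have "b [^] (p ^ Suc k) = (b [^] p) [^] (p ^ k)" using Suc.prems by (simp add: nat_pow_pow)
  then have "Cn k (b [^] (p ^ Suc k) \<otimes> a) = b [^] p \<otimes> Cn k a" using Suc by simp
  then show ?case using Suc.prems by (simp add: Cartier_mult Cn_closed)
qed simp

text \<open>
  On polynomials, \<open>C\<^sup>k\<close> keeps the coefficients in degrees congruent to \<open>-1\<close> modulo \<open>p\<^sup>k\<close> and takes their
  \<open>p\<^sup>k\<close>-th roots.
\<close>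

lemma Cn_iota:
  assumes h: "h \<in> carrier P"
  shows "\<exists>h'\<in>carrier P. Cn k (\<iota> h) = \<iota> h' \<and>
    (\<forall>j. up_ring.coeff P h' j [^]\<^bsub>F\<^esub> (p ^ k) = up_ring.coeff P h (p ^ k * (j + 1) - 1))"
proof (induction k)
  case 0
  show ?case using h by (intro bexI[of _ h]) simp_all
next
  case (Suc k)
  then obtain h' where h': "h' \<in> carrier P" "Cn k (\<iota> h) = \<iota> h'"
    "\<And>j. up_ring.coeff P h' j [^]\<^bsub>F\<^esub> (p ^ k) = up_ring.coeff P h (p ^ k * (j + 1) - 1)" by blast
  obtain h'' where h'': "h'' \<in> carrier P" "C (\<iota> h') = \<iota> h''"
    "\<And>j. up_ring.coeff P h'' j [^]\<^bsub>F\<^esub> p = up_ring.coeff P h' (p * (j + 1) - 1)" using Cartier_iota[OF h'(1)] by blast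
  have "up_ring.coeff P h'' j [^]\<^bsub>F\<^esub> (p ^ Suc k) = up_ring.coeff P h (p ^ Suc k * (j + 1) - 1)" for j
  proof -
    have "up_ring.coeff P h'' j [^]\<^bsub>F\<^esub> (p ^ Suc k) = (up_ring.coeff P h'' j [^]\<^bsub>F\<^esub> p) [^]\<^bsub>F\<^esub> (p ^ k)"
      using U.coeff_closed[OF h''(1), of j] by (simp only: U.R.nat_pow_pow power_Suc)
    also have "\<dots> = up_ring.coeff P h (p ^ k * (p * (j + 1) - 1 + 1) - 1)" unfolding h''(3) h'(3) ..
    also have "p * (j + 1) - 1 + 1 = p * (j + 1)" using AD.p_pos by simp
    also have "p ^ k * (p * (j + 1)) = p ^ Suc k * (j + 1)" by (simp only: power_Suc mult_ac)
    finally show ?thesis .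
  qed
  then show ?case using h' h'' by (intro bexI[of _ h'']) simp_all
qed

end

section \<open>Fixed points of the Cartier operator\<close>

lemma (in UP_domain) eval_ring_hom_cring: "a \<in> carrier R \<Longrightarrow> ring_hom_cring P R (UnivPoly.eval R R id a)"
proof -
  assume a: "a \<in> carrier R"
  interpret E: UP_pre_univ_prop R R id P by unfold_locales simp
  show ?thesis by (rule E.ring_homD) (rule E.eval_ring_hom[OF a])
qed

lemma (in UP_domain) eval_id_monom:
  assumes "a \<in> carrier R" "c \<in> carrier R"
  shows "UnivPoly.eval R R id a (up_ring.monom P c j) = c \<otimes> a [^] j"
proof -
  interpret E: UP_pre_univ_prop R R id P by unfold_locales simp
  show ?thesis using E.eval_monom[OF assms(2,1)] by simp
qed

lemma (in UP_domain) zero_if_many_roots: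
  assumes "h \<in> carrier P" "\<And>i. i \<ge> m \<Longrightarrow> up_ring.coeff P h i = \<zero>"
    and "Z \<subseteq> carrier R" "finite Z" "card Z = m" "\<And>b. b \<in> Z \<Longrightarrow> UnivPoly.eval R R id b h = \<zero>"
  shows "h = \<zero>\<^bsub>P\<^esub>"
  using assms
proof (induction m arbitrary: h Z)
  case 0
  then show ?case by (intro up_eqI) auto
next
  case (Suc m)
  obtain a Z' where Z: "Z = insert a Z'" "a \<notin> Z'" "card Z' = m" "finite Z'"
    using Suc.prems(4,5) by (auto simp: card_Suc_eq)
  have a: "a \<in> carrier R" using Suc.prems(3) Z by auto
  have nt: "carrier R \<noteq> {\<zero>}" using R.one_not_zero R.one_closed by blast
  let ?l = "up_ring.monom P \<one> 1 \<ominus>\<^bsub>P\<^esub> up_ring.monom P a 0"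
  have l: "?l \<in> carrier P" "?l \<noteq> \<zero>\<^bsub>P\<^esub>" "deg R ?l = 1"
    using a deg_minus_monom[OF a nt] deg_nzero_nzero[of ?l] by simp_all
  obtain g r where g: "g \<in> carrier P" "h = ?l \<otimes>\<^bsub>P\<^esub> g \<oplus>\<^bsub>P\<^esub> up_ring.monom P (UnivPoly.eval R R id a h) 0"
    using remainder_theorem[OF Suc.prems(1) a nt] by blast
  then have hg: "h = ?l \<otimes>\<^bsub>P\<^esub> g" using Suc.prems(6)[of a] Z(1) l(1) by simp
  have "up_ring.coeff P g i = \<zero>" if i: "i \<ge> m" for i
  proof (cases "g = \<zero>\<^bsub>P\<^esub>")
    case False
    then have h0: "h \<noteq> \<zero>\<^bsub>P\<^esub>" unfolding hg using l(1,2) g(1) integral[of ?l g] by blast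
    have d: "deg R h = 1 + deg R g" unfolding hg using deg_mult[OF l(2) False l(1) g(1)] l(3) by simp
    have "deg R h < Suc m" using lcoeff_nonzero2[OF Suc.prems(1) h0] Suc.prems(2)[of "deg R h"] by (meson not_le)
    then show ?thesis using d i g(1) by (intro deg_aboveD) auto
  qed simp
  moreover have "UnivPoly.eval R R id b g = \<zero>" if b: "b \<in> Z'" for b
  proof -
    have bc: "b \<in> carrier R" using b Z(1) Suc.prems(3) by auto
    interpret E: ring_hom_cring P R "UnivPoly.eval R R id b" by (rule eval_ring_hom_cring[OF bc])
    have "UnivPoly.eval R R id b ?l = b \<ominus> a" using a bc by (simp add: a_minus_def eval_id_monom)
    moreover have "b \<ominus> a \<noteq> \<zero>" using b Z(2) a bc by (metis R.r_right_minus_eq)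
    moreover have "UnivPoly.eval R R id b ?l \<otimes> UnivPoly.eval R R id b g = \<zero>"
      using Suc.prems(6)[of b] b Z(1) hg l(1) g(1) by (metis E.hom_mult insertCI)
    ultimately show ?thesis using g(1) bc a R.integral E.hom_closed[OF g(1)] R.minus_closed by metis
  qed
  moreover have "Z' \<subseteq> carrier R" using Suc.prems(3) Z(1) by auto
  ultimately have "g = \<zero>\<^bsub>P\<^esub>" using Suc.IH[OF g(1) _ _ Z(4,3)] by blast
  then show ?case using hg l(1) by simp
qed

lemma (in ring) minus_minus_cancel:
  assumes "a \<in> carrier R" "b \<in> carrier R" "c \<in> carrier R"
  shows "(a \<ominus> c) \<ominus> (b \<ominus> c) = a \<ominus> b"
  using assms by (simp add: a_minus_def minus_add a_assoc a_comm[of "\<ominus> b" c] r_neg1)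

context char_p_domain
begin

lemma frobenius_iter_add:
  "a \<in> carrier R \<Longrightarrow> b \<in> carrier R \<Longrightarrow> (a \<oplus> b) [^] (p ^ m) = a [^] (p ^ m) \<oplus> b [^] (p ^ m)"
proof (induction m arbitrary: a b)
  case (Suc m)
  then show ?case using Suc.IH[of "a [^] p" "b [^] p"]
    by (simp only: power_Suc nat_pow_pow[symmetric] frobenius_add nat_pow_closed a_closed)
qed simp

lemma frobenius_iter_minus: "a \<in> carrier R \<Longrightarrow> (\<ominus> a) [^] (p ^ m) = \<ominus> (a [^] (p ^ m))"
proof (induction m arbitrary: a)
  case (Suc m)
  then show ?case using Suc.IH[of "a [^] p"]
    by (simp only: power_Suc nat_pow_pow[symmetric] frobenius_minus nat_pow_closed a_inv_closed)
qed simp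

lemma minus_one_pow_pred: "(\<ominus> \<one>) [^] (p - 1) = \<one>"
proof -
  have "(\<ominus> \<one>) [^] (p - 1) \<otimes> (\<ominus> \<one>) = (\<ominus> \<one>) [^] Suc (p - 1)" by simp
  also have "\<dots> = \<ominus> \<one>" using frobenius_minus[of \<one>] p_pos by simp
  finally have "\<ominus> ((\<ominus> \<one>) [^] (p - 1)) = \<ominus> \<one>" by (simp add: r_minus)
  then show ?thesis by (metis minus_minus nat_pow_closed one_closed a_inv_closed)
qed

lemma nu_frobenius: "\<nu> m [^] p = \<nu> m"
  by (induction m) (simp_all add: frobenius_zero frobenius_add nu_Suc)

lemma nu_inj: "inj_on (int_elem R) {..<p}"
proof (rule inj_onI)
  have *: "m = m'" if "m \<le> m'" "m' < p" "\<nu> m = \<nu> m'" for m m'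
  proof (rule ccontr)
    assume "m \<noteq> m'"
    then have "\<not> p dvd m' - m" using that by (auto dest: dvd_imp_le)
    moreover have "\<nu> m' = \<nu> m \<oplus> \<nu> (m' - m)" using nu_add[of m "m' - m"] that by simp
    then have "\<nu> m \<oplus> \<nu> (m' - m) = \<nu> m" using that(3) by simp
    then have "\<nu> (m' - m) = \<zero>" using add.l_cancel_one[OF nu_closed nu_closed] by blast
    ultimately show False using nu_nonzero by blast
  qed
  fix m m' assume "m \<in> {..<p}" "m' \<in> {..<p}" "\<nu> m = \<nu> m'"
  then show "m = m'" using *[of m m'] *[of m' m] by (cases "m \<le> m'") auto
qed

text \<open>
  The integers modulo \<open>p\<close> are already \<open>p\<close> roots of \<open>X\<^sup>p - X\<close>.
\<close>

lemma frobenius_fixed: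
  assumes r: "r \<in> carrier R" "r [^] p = r"
  shows "\<exists>m. r = \<nu> m"
proof (rule ccontr)
  assume c: "\<nexists>m. r = \<nu> m"
  interpret U: UP_domain R "UP R" by unfold_locales
  let ?P = "UP R"
  let ?h = "up_ring.monom ?P \<one> p \<ominus>\<^bsub>?P\<^esub> up_ring.monom ?P \<one> 1"
  let ?Z = "insert r (int_elem R ` {..<p})"
  have "?h = \<zero>\<^bsub>?P\<^esub>"
  proof (rule U.zero_if_many_roots[where Z = ?Z and m = "Suc p"])
    show "up_ring.coeff ?P ?h i = \<zero>" if "i \<ge> Suc p" for i using that p_gt1 by (simp add: a_minus_def)
    have "r \<notin> int_elem R ` {..<p}" using c by auto
    then show "card ?Z = Suc p" by (simp add: card_image[OF nu_inj])
    show "UnivPoly.eval R R id b ?h = \<zero>" if b: "b \<in> ?Z" for b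
    proof -
      have bc: "b \<in> carrier R" "b [^] p = b" using b r nu_frobenius by auto
      interpret E: ring_hom_cring ?P R "UnivPoly.eval R R id b" by (rule U.eval_ring_hom_cring[OF bc(1)])
      show ?thesis using bc by (simp add: a_minus_def U.eval_id_monom r_neg)
    qed
  qed (use r in auto)
  then have "up_ring.coeff ?P ?h p = \<zero>" by simp
  then show False using p_gt1 by (simp add: a_minus_def)
qed

end

context drinfeld_cover
begin

lemma q_pos: "q > 0" using q_ge2 by simp

lemma int_elem_poly: "int_elem P m = up_ring.monom P (int_elem F m) 0"
  by (induction m) (simp_all add: U.P.nu_Suc U.R.nu_Suc)

sublocale PD: char_p_domain P p
  by unfold_locales (simp_all add: prime_p int_elem_poly char_F)

lemma iota_ring_hom_cring: "ring_hom_cring P A \<iota>"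
  by (rule ring_hom_cringI[OF U.P.is_cring is_cring iota])

lemma iota_minus: "h \<in> carrier P \<Longrightarrow> \<iota> (\<ominus>\<^bsub>P\<^esub> h) = \<ominus> \<iota> h"
proof -
  interpret I: ring_hom_cring P A \<iota> by (rule iota_ring_hom_cring)
  show "h \<in> carrier P \<Longrightarrow> \<iota> (\<ominus>\<^bsub>P\<^esub> h) = \<ominus> \<iota> h" by simp
qed

lemma repr_unique:
  assumes r: "repr M a h" "repr M a h'" and k: "k \<in> {M..M + q}"
  shows "h k = h' k"
proof -
  have h: "\<And>k. h k \<in> carrier P" "\<And>k. h' k \<in> carrier P" using r unfolding repr_def by auto
  have a: "a \<in> carrier A" "(\<Oplus>k\<in>{M..M + q}. \<iota> (h k) \<otimes> x [^] k) = a" "(\<Oplus>k\<in>{M..M + q}. \<iota> (h' k) \<otimes> x [^] k) = a"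
    using r h unfolding repr_def by (auto intro!: finsum_closed)
  let ?S = "\<Oplus>k\<in>{M..M + q}. \<iota> (h k \<ominus>\<^bsub>P\<^esub> h' k) \<otimes> x [^] k"
  have S: "?S \<in> carrier A" using h by (auto intro!: finsum_closed)
  have "?S \<oplus> a = (\<Oplus>k\<in>{M..M + q}. \<iota> (h k \<ominus>\<^bsub>P\<^esub> h' k) \<otimes> x [^] k \<oplus> \<iota> (h' k) \<otimes> x [^] k)"
    unfolding a(3)[symmetric] using h by (subst finsum_addf) auto
  also have "\<dots> = (\<Oplus>k\<in>{M..M + q}. \<iota> (h k) \<otimes> x [^] k)"
    using h by (intro finsum_cong') (auto simp: l_distr[symmetric] iota_add[symmetric] a_minus_def U.P.a_assoc U.P.l_neg)
  also have "\<dots> = a" by (rule a(2))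
  finally have "?S = \<zero>" using add.r_cancel_one[OF a(1) S] by blast
  then have "h k \<ominus>\<^bsub>P\<^esub> h' k = \<zero>\<^bsub>P\<^esub>" using free[of "\<lambda>k. h k \<ominus>\<^bsub>P\<^esub> h' k" M k] h k by simp
  then show ?thesis using h by (metis U.P.r_right_minus_eq)
qed

lemma iota_inj:
  assumes "h \<in> carrier P" "h' \<in> carrier P" "\<iota> h = \<iota> h'"
  shows "h = h'"
  using repr_unique[OF repr_single[of h 0 0] , of "\<lambda>i. if i = 0 then h' else \<zero>\<^bsub>P\<^esub>" 0]
    repr_single[of h' 0 0] assms by simp

lemma Cn_fixed: "C g = g \<Longrightarrow> Cn k g = g"
  by (induction k) simp_all

lemma Cn_sum:
  assumes "finite I" "\<And>i. i \<in> I \<Longrightarrow> f i \<in> carrier A"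
  shows "Cn m (\<Oplus>i\<in>I. f i) = (\<Oplus>i\<in>I. Cn m (f i))"
  using assms
proof (induction rule: finite_induct)
  case empty
  have "Cn m \<zero> = \<zero>" by (induction m) (simp_all add: Cartier_zero)
  then show ?case by simp
next
  case (insert j I)
  have "(\<Oplus>i\<in>insert j I. f i) = f j \<oplus> (\<Oplus>i\<in>I. f i)" "(\<Oplus>i\<in>insert j I. Cn m (f i)) = Cn m (f j) \<oplus> (\<Oplus>i\<in>I. Cn m (f i))"
    using insert by (auto intro!: finsum_insert simp: Cn_closed)
  moreover have "(\<Oplus>i\<in>I. f i) \<in> carrier A" using insert.prems by (intro finsum_closed) auto
  ultimately show ?case using insert by (simp add: Cn_add)
qed

text \<open>
  Since \<open>q\<^sup>2 - 1 = (q - 1) (q + 1)\<close>, \<open>raise_x\<close> gives \<open>x\<^sup>k = (x\<^sup>k)\<^bsup>q\<^sup>2\<^esup> T\<^bsup>(q-1)k\<^esup>\<close>. So \<open>C\<^bsup>n+n\<^esup>\<close>, which takes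
  \<open>q\<^sup>2\<close>-th roots of factors, maps each summand \<open>F[s] x\<^sup>k\<close> to itself, and it fixes the components of \<open>g\<close>.
\<close>

lemma fixed_repr:
  assumes g: "C g = g" and r: "repr M g h" and k: "k \<in> {M..M + q}"
  shows "Cn (n + n) (\<iota> (h k \<otimes>\<^bsub>P\<^esub> T [^]\<^bsub>P\<^esub> ((q - 1) * k))) = \<iota> (h k)"
proof -
  have h: "\<And>k. h k \<in> carrier P" and gh: "g = (\<Oplus>k\<in>{M..M + q}. \<iota> (h k) \<otimes> x [^] k)" using r unfolding repr_def by auto
  let ?g = "\<lambda>k. h k \<otimes>\<^bsub>P\<^esub> T [^]\<^bsub>P\<^esub> ((q - 1) * k)"
  have "\<exists>h'. h' \<in> carrier P \<and> Cn (n + n) (\<iota> (?g k)) = \<iota> h'" for k using Cn_iota[of "?g k" "n + n"] h by auto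
  then obtain h' where h': "\<And>k. h' k \<in> carrier P" "\<And>k. Cn (n + n) (\<iota> (?g k)) = \<iota> (h' k)" by metis
  have one: "Cn (n + n) (\<iota> (h k) \<otimes> x [^] k) = \<iota> (h' k) \<otimes> x [^] k" for k
  proof -
    have "k + (q - 1) * k * (q + 1) = k * p ^ (n + n)"
    proof -
      obtain q' where q': "q = Suc q'" using q_pos by (cases q) auto
      have "k + (q - 1) * k * (q + 1) = k * (q * q)" unfolding q' by (simp add: algebra_simps)
      then show ?thesis by (simp add: q_def power_add)
    qed
    then have "\<iota> (h k) \<otimes> x [^] k = \<iota> (?g k) \<otimes> x [^] (k * p ^ (n + n))"
      using raise_x[OF h, of k k "(q - 1) * k"] by simp
    also have "\<dots> = (x [^] k) [^] (p ^ (n + n)) \<otimes> \<iota> (?g k)" using h by (simp only: nat_pow_pow x_closed) (intro m_comm; simp)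
    finally show ?thesis using h h' by (simp only: Cn_mult nat_pow_closed x_closed iota_closed U.P.m_closed U.P.nat_pow_closed T_closed m_comm)
  qed
  have "g = Cn (n + n) g" using Cn_fixed[OF g] by simp
  also have "\<dots> = (\<Oplus>k\<in>{M..M + q}. Cn (n + n) (\<iota> (h k) \<otimes> x [^] k))" unfolding gh using h by (intro Cn_sum) auto
  also have "\<dots> = (\<Oplus>k\<in>{M..M + q}. \<iota> (h' k) \<otimes> x [^] k)" using h' one by (intro finsum_cong') auto
  finally have "repr M g h'" using h' unfolding repr_def by auto
  then have "h k = h' k" using repr_unique[OF r _ k] by blast
  then show ?thesis using h'(2)[of k] by simp
qed

text \<open>
  For \<open>k > q + 1\<close> the exponent \<open>(q - 1) k\<close> is at least \<open>q\<^sup>2\<close>, so by \<open>fixed_repr\<close> the coefficient \<open>h k\<close> is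
  divisible by \<open>T\<close>. As \<open>T x\<^bsup>q+1\<^esup> = 1\<close>, the window can be lowered by \<open>q + 1\<close>.
\<close>

lemma fixed_repr_low:
  assumes g: "g \<in> carrier A" "C g = g"
  shows "\<exists>h. repr 1 g h"
proof -
  obtain M0 where M0: "\<forall>M\<ge>M0. \<exists>h. repr M g h" using repr_exists[OF g(1)] by blast
  have step: "\<exists>h. repr (t * (q + 1) + 1) g h \<Longrightarrow> \<exists>h. repr 1 g h" for t
  proof (induction t)
    case (Suc t)
    define M where "M = t * (q + 1) + 1"
    have e: "Suc t * (q + 1) + 1 = M + (q + 1)" unfolding M_def by simp
    obtain h where h: "repr (M + (q + 1)) g h" using Suc.prems unfolding e by blast
    have hc: "\<And>k. h k \<in> carrier P" using h unfolding repr_def by auto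
    have "\<exists>b\<in>carrier P. \<iota> (h k) = \<iota> (b \<otimes>\<^bsub>P\<^esub> T)" if k: "k \<in> {M + (q + 1)..M + (q + 1) + q}" for k
    proof -
      \<comment> \<open>here \<open>k \<ge> q + 2\<close>, so that \<open>(q - 1) k \<ge> q\<^sup>2 + q - 2\<close>\<close>
      have "q * q + (q - 1) * 1 \<le> (q - 1) * k + 1"
      proof -
        have "(q - 1) * (q + 2) \<le> (q - 1) * k" using k unfolding M_def by (intro mult_left_mono) auto
        moreover obtain q' where "q = Suc (Suc q')" using q_ge2 by (metis add_2_eq_Suc le_Suc_ex)
        ultimately show ?thesis by (simp add: algebra_simps)
      qed
      then have "q * q \<le> (q - 1) * k" using q_ge2 by linarith
      then obtain e where "(q - 1) * k = q * q + e" using le_Suc_ex by blast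
      then have e: "(q - 1) * k = p ^ (n + n) + e" by (simp add: q_def power_add)
      obtain b where b: "b \<in> carrier P" "Cn (n + n) (\<iota> (h k \<otimes>\<^bsub>P\<^esub> T [^]\<^bsub>P\<^esub> e)) = \<iota> b"
        using Cn_iota[of "h k \<otimes>\<^bsub>P\<^esub> T [^]\<^bsub>P\<^esub> e" "n + n"] hc by auto
      have "h k \<otimes>\<^bsub>P\<^esub> T [^]\<^bsub>P\<^esub> ((q - 1) * k) = T [^]\<^bsub>P\<^esub> (p ^ (n + n)) \<otimes>\<^bsub>P\<^esub> (h k \<otimes>\<^bsub>P\<^esub> T [^]\<^bsub>P\<^esub> e)"
        unfolding e using hc by (simp add: U.P.nat_pow_mult[symmetric] U.P.m_ac)
      then have "\<iota> (h k \<otimes>\<^bsub>P\<^esub> T [^]\<^bsub>P\<^esub> ((q - 1) * k)) = \<iota> T [^] (p ^ (n + n)) \<otimes> \<iota> (h k \<otimes>\<^bsub>P\<^esub> T [^]\<^bsub>P\<^esub> e)"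
        using hc by (simp add: iota_mult iota_pow)
      then have "\<iota> (h k) = \<iota> T \<otimes> \<iota> b" using fixed_repr[OF g(2) h k] b hc by (simp add: Cn_mult)
      then show ?thesis using b by (intro bexI[of _ b]) (simp_all add: iota_mult m_comm)
    qed
    then obtain b where b: "\<And>k. k \<in> {M + (q + 1)..M + (q + 1) + q} \<Longrightarrow> b k \<in> carrier P \<and> \<iota> (h k) = \<iota> (b k \<otimes>\<^bsub>P\<^esub> T)"
      by metis
    define h' where "h' k = (if k \<in> {M..M + q} then b (k + (q + 1)) else \<zero>\<^bsub>P\<^esub>)" for k
    have h'c: "h' k \<in> carrier P" for k unfolding h'_def using b[of "k + (q + 1)"] by auto
    have "{M + (q + 1)..M + (q + 1) + q} = (\<lambda>k. k + (q + 1)) ` {M..M + q}"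
      using image_add_atLeastAtMost'[of "q + 1" M "M + q"] by (simp add: ac_simps)
    then have "g = (\<Oplus>k\<in>(\<lambda>k. k + (q + 1)) ` {M..M + q}. \<iota> (h k) \<otimes> x [^] k)" using h unfolding repr_def by simp
    also have "\<dots> = (\<Oplus>k\<in>{M..M + q}. \<iota> (h (k + (q + 1))) \<otimes> x [^] (k + (q + 1)))"
      using hc by (intro finsum_reindex) (auto simp: inj_on_def)
    also have "\<dots> = (\<Oplus>k\<in>{M..M + q}. \<iota> (h' k) \<otimes> x [^] k)"
    proof (rule finsum_cong')
      fix k assume k: "k \<in> {M..M + q}"
      have "\<iota> (h' k) \<otimes> x [^] k = \<iota> (h' k \<otimes>\<^bsub>P\<^esub> T) \<otimes> x [^] (k + (q + 1))"
        using raise_x[OF h'c, of k k 1] by simp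
      also have "\<iota> (h' k \<otimes>\<^bsub>P\<^esub> T) = \<iota> (h (k + (q + 1)))" using b[of "k + (q + 1)"] k unfolding h'_def by simp
      finally show "\<iota> (h (k + (q + 1))) \<otimes> x [^] (k + (q + 1)) = \<iota> (h' k) \<otimes> x [^] k" by simp
    qed (use h'c in auto)
    finally have "repr M g h'" using h'c unfolding repr_def by auto
    then show ?case using Suc.IH unfolding M_def by blast
  qed simp
  have "M0 \<le> M0 * (q + 1) + 1" by simp
  then show ?thesis using step[of M0] M0 by blast
qed

text \<open>
  The residues modulo \<open>q\<close> of the exponents that occur in \<open>h\<close> are at most \<open>e\<close>. Since \<open>C\<^sup>n\<close> keeps only
  exponents congruent to \<open>q - 1\<close>, it kills \<open>h\<close> if \<open>e \<le> q - 2\<close>.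
\<close>

definition res_le where
  "res_le h e \<longleftrightarrow> (\<forall>i. up_ring.coeff P h i \<noteq> \<zero>\<^bsub>F\<^esub> \<longrightarrow> i mod q \<le> e)"

lemma res_le_add:
  assumes "h \<in> carrier P" "h' \<in> carrier P" "res_le h e" "res_le h' e"
  shows "res_le (h \<oplus>\<^bsub>P\<^esub> h') e"
  unfolding res_le_def
proof (intro allI impI)
  fix i assume i: "up_ring.coeff P (h \<oplus>\<^bsub>P\<^esub> h') i \<noteq> \<zero>\<^bsub>F\<^esub>"
  show "i mod q \<le> e"
  proof (rule ccontr)
    assume "\<not> i mod q \<le> e"
    then have "up_ring.coeff P h i = \<zero>\<^bsub>F\<^esub>" "up_ring.coeff P h' i = \<zero>\<^bsub>F\<^esub>" using assms(3,4) unfolding res_le_def by blast+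
    then show False using i assms(1,2) by simp
  qed
qed

lemma res_le_T:
  assumes h: "h \<in> carrier P" "res_le h e" and e: "e + 1 < q"
  shows "res_le (T \<otimes>\<^bsub>P\<^esub> h) (e + 1)"
  using h(1)
proof (rule U.poly_induct)
  fix c j assume c: "c \<in> carrier F" "up_ring.coeff P h j = \<zero>\<^bsub>F\<^esub> \<Longrightarrow> c = \<zero>\<^bsub>F\<^esub>"
  show "res_le (T \<otimes>\<^bsub>P\<^esub> up_ring.monom P c j) (e + 1)"
  proof (cases "c = \<zero>\<^bsub>F\<^esub>")
    case True
    then show ?thesis unfolding res_le_def by simp
  next
    case False
    then have j: "j mod q \<le> e" using c(2) h(2) unfolding res_le_def by blast
    have m: "(q + j) mod q \<le> e + 1" "(1 + j) mod q \<le> e + 1" using j e by (simp_all add: mod_Suc)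
    have "T \<otimes>\<^bsub>P\<^esub> up_ring.monom P c j = up_ring.monom P c (q + j) \<ominus>\<^bsub>P\<^esub> up_ring.monom P c (1 + j)"
    proof -
      have "T \<otimes>\<^bsub>P\<^esub> up_ring.monom P c j = up_ring.monom P \<one>\<^bsub>F\<^esub> q \<otimes>\<^bsub>P\<^esub> up_ring.monom P c j \<ominus>\<^bsub>P\<^esub> up_ring.monom P \<one>\<^bsub>F\<^esub> 1 \<otimes>\<^bsub>P\<^esub> up_ring.monom P c j"
        unfolding T_def using c(1) by (simp add: a_minus_def U.P.l_distr U.P.l_minus)
      then show ?thesis using c(1) U.monom_mult[of "\<one>\<^bsub>F\<^esub>" c q j] U.monom_mult[of "\<one>\<^bsub>F\<^esub>" c 1 j] by simp
    qed
    then have "up_ring.coeff P (T \<otimes>\<^bsub>P\<^esub> up_ring.monom P c j) i =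
      (if q + j = i then c else \<zero>\<^bsub>F\<^esub>) \<ominus>\<^bsub>F\<^esub> (if 1 + j = i then c else \<zero>\<^bsub>F\<^esub>)" for i
      using c(1) by simp
    then have "i = q + j \<or> i = 1 + j" if "up_ring.coeff P (T \<otimes>\<^bsub>P\<^esub> up_ring.monom P c j) i \<noteq> \<zero>\<^bsub>F\<^esub>" for i
      using that by (auto simp: a_minus_def split: if_splits)
    then show ?thesis unfolding res_le_def using m by blast
  qed
next
  fix f g assume "f \<in> carrier P" "g \<in> carrier P" "res_le (T \<otimes>\<^bsub>P\<^esub> f) (e + 1)" "res_le (T \<otimes>\<^bsub>P\<^esub> g) (e + 1)"
  then show "res_le (T \<otimes>\<^bsub>P\<^esub> (f \<oplus>\<^bsub>P\<^esub> g)) (e + 1)" using res_le_add by (simp add: U.P.r_distr)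
qed

lemma res_le_T_pow:
  assumes h: "h \<in> carrier P" "res_le h e" and e: "e + m < q"
  shows "res_le (h \<otimes>\<^bsub>P\<^esub> T [^]\<^bsub>P\<^esub> m) (e + m)"
  using e
proof (induction m)
  case (Suc m)
  then have "res_le (T \<otimes>\<^bsub>P\<^esub> (h \<otimes>\<^bsub>P\<^esub> T [^]\<^bsub>P\<^esub> m)) (e + m + 1)" using h by (intro res_le_T) auto
  moreover have "T \<otimes>\<^bsub>P\<^esub> (h \<otimes>\<^bsub>P\<^esub> T [^]\<^bsub>P\<^esub> m) = h \<otimes>\<^bsub>P\<^esub> T [^]\<^bsub>P\<^esub> Suc m" using h by (simp add: U.P.m_ac)
  ultimately show ?case by simp
qed (use h in simp)

lemma Cn_res_le:
  assumes h: "h \<in> carrier P" "res_le h e" and e: "e + 1 < q"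
  shows "Cn n (\<iota> h) = \<zero>"
proof -
  obtain h' where h': "h' \<in> carrier P" "Cn n (\<iota> h) = \<iota> h'"
    "\<And>j. up_ring.coeff P h' j [^]\<^bsub>F\<^esub> q = up_ring.coeff P h (q * (j + 1) - 1)"
    using Cn_iota[OF h(1), of n] q_def by metis
  have "up_ring.coeff P h' j = \<zero>\<^bsub>F\<^esub>" for j
  proof -
    obtain q' where q': "q = Suc q'" using q_pos by (cases q) auto
    have "q * (j + 1) - 1 = q' + q * j" unfolding q' by simp
    then have "(q * (j + 1) - 1) mod q = q - 1" unfolding q' by (simp del: mult_Suc)
    then have "up_ring.coeff P h (q * (j + 1) - 1) = \<zero>\<^bsub>F\<^esub>" using h(2) e unfolding res_le_def by fastforce
    then show ?thesis using h'(3)[of j] h'(1) FD.pow_eq_zero[of "up_ring.coeff P h' j" q] by simp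
  qed
  then have "h' = \<zero>\<^bsub>P\<^esub>" using h'(1) by (intro U.up_eqI) auto
  then show ?thesis using h'(2) by simp
qed

text \<open>
  The leading coefficient of \<open>h\<close>, in degree \<open>d\<close>, is a root of the coefficient of \<open>h T\<^bsup>(q-1)k\<^esup>\<close> in degree
  \<open>q\<^sup>2 (d + 1) - 1\<close>; so this degree is at most \<open>d + q (q - 1) k\<close>.
\<close>

lemma fixed_degree:
  assumes h: "h \<in> carrier P" "h \<noteq> \<zero>\<^bsub>P\<^esub>" and fx: "Cn (n + n) (\<iota> (h \<otimes>\<^bsub>P\<^esub> T [^]\<^bsub>P\<^esub> ((q - 1) * k))) = \<iota> h"
  shows "(q + 1) * (deg F h + 1) \<le> q * k"
proof -
  define d where "d = deg F h"
  let ?f = "h \<otimes>\<^bsub>P\<^esub> T [^]\<^bsub>P\<^esub> ((q - 1) * k)"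
  obtain h' where h': "h' \<in> carrier P" "Cn (n + n) (\<iota> ?f) = \<iota> h'"
    "\<And>j. up_ring.coeff P h' j [^]\<^bsub>F\<^esub> (p ^ (n + n)) = up_ring.coeff P ?f (p ^ (n + n) * (j + 1) - 1)"
    using Cn_iota[of ?f "n + n"] h(1) by auto
  have hh: "h' = h" using iota_inj[OF h'(1) h(1)] h'(2) fx by simp
  have c: "up_ring.coeff P h d \<noteq> \<zero>\<^bsub>F\<^esub>" using U.lcoeff_nonzero2[OF h] unfolding d_def .
  have "has_top F h d (up_ring.coeff P h d)" unfolding has_top_def U.P_def[symmetric] d_def using h(1) by (auto intro: U.deg_aboveD)
  then have top: "has_top F ?f (d + q * ((q - 1) * k)) (up_ring.coeff P h d \<otimes>\<^bsub>F\<^esub> \<one>\<^bsub>F\<^esub>)"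
    using h(1) by (intro U.has_top_mult U.has_top_pow T_top) auto
  have "up_ring.coeff P h d [^]\<^bsub>F\<^esub> (p ^ (n + n)) \<noteq> \<zero>\<^bsub>F\<^esub>" using c h(1) FD.pow_eq_zero by auto
  then have "up_ring.coeff P ?f (p ^ (n + n) * (d + 1) - 1) \<noteq> \<zero>\<^bsub>F\<^esub>" using h'(3)[of d] unfolding hh by simp
  then have "p ^ (n + n) * (d + 1) - 1 \<le> d + q * ((q - 1) * k)"
    using top unfolding has_top_def U.P_def[symmetric] by (meson not_le)
  then have "q * q * (d + 1) - 1 \<le> d + q * ((q - 1) * k)" by (simp add: power_add q_def[symmetric])
  moreover obtain r where r: "q = Suc r" "r > 0" using q_ge2 by (cases q) auto
  ultimately have "r * ((q + 1) * (d + 1)) \<le> r * (q * k)" by (simp add: algebra_simps)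
  then have "(q + 1) * (d + 1) \<le> q * k" using r(2) by (metis mult_le_cancel1)
  then show ?thesis unfolding d_def .
qed

text \<open>
  By \<open>fixed_degree\<close>, the degree of \<open>h\<close> would be at most \<open>k - 2\<close>. In
  \<open>h T\<^bsup>(q-1)k\<^esup> = (T\<^bsup>k-1\<^esup>)\<^sup>q h T\<^bsup>q-k\<^esup>\<close> the factor \<open>h T\<^bsup>q-k\<^esup>\<close> is then killed by \<open>C\<^sup>n\<close>, because each factor \<open>T\<close>
  raises residues of exponents by at most one.
\<close>

lemma fixed_vanish:
  assumes h: "h \<in> carrier P" and k: "1 \<le> k" "k \<le> q"
    and fx: "Cn (n + n) (\<iota> (h \<otimes>\<^bsub>P\<^esub> T [^]\<^bsub>P\<^esub> ((q - 1) * k))) = \<iota> h"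
  shows "h = \<zero>\<^bsub>P\<^esub>"
proof (rule ccontr)
  assume h0: "h \<noteq> \<zero>\<^bsub>P\<^esub>"
  have "(q + 1) * (deg F h + 1) \<le> q * k" by (rule fixed_degree[OF h h0 fx])
  also have "q * k < (q + 1) * k" using k(1) by simp
  finally have "deg F h + 1 < k" using mult_less_cancel1[of "q + 1"] by blast
  then have d: "deg F h + 2 \<le> k" by simp
  have "res_le h (k - 2)" unfolding res_le_def
  proof (intro allI impI)
    fix i assume "up_ring.coeff P h i \<noteq> \<zero>\<^bsub>F\<^esub>"
    then have "i \<le> deg F h" using h by (intro U.deg_belowI) auto
    then show "i mod q \<le> k - 2" using d mod_less_eq_dividend[of i q] by linarith
  qed
  then have "res_le (h \<otimes>\<^bsub>P\<^esub> T [^]\<^bsub>P\<^esub> (q - k)) (k - 2 + (q - k))" using d k q_ge2 by (intro res_le_T_pow[OF h]) auto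
  then have z: "Cn n (\<iota> (h \<otimes>\<^bsub>P\<^esub> T [^]\<^bsub>P\<^esub> (q - k))) = \<zero>" using h d k q_ge2 by (intro Cn_res_le) auto
  have e: "(q - 1) * k = (k - 1) * p ^ n + (q - k)"
  proof -
    obtain k' where k': "k = Suc k'" using k by (cases k) auto
    obtain r where r: "q = k + r" using k(2) le_Suc_ex by blast
    show ?thesis unfolding q_def[symmetric] r k' by (simp add: algebra_simps)
  qed
  have "h \<otimes>\<^bsub>P\<^esub> T [^]\<^bsub>P\<^esub> ((q - 1) * k) = (T [^]\<^bsub>P\<^esub> (k - 1)) [^]\<^bsub>P\<^esub> (p ^ n) \<otimes>\<^bsub>P\<^esub> (h \<otimes>\<^bsub>P\<^esub> T [^]\<^bsub>P\<^esub> (q - k))"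
    unfolding e using h by (simp add: U.P.nat_pow_mult[symmetric] U.P.nat_pow_pow U.P.m_ac)
  then have "\<iota> (h \<otimes>\<^bsub>P\<^esub> T [^]\<^bsub>P\<^esub> ((q - 1) * k)) = \<iota> (T [^]\<^bsub>P\<^esub> (k - 1)) [^] (p ^ n) \<otimes> \<iota> (h \<otimes>\<^bsub>P\<^esub> T [^]\<^bsub>P\<^esub> (q - k))"
    using h by (simp add: iota_mult iota_pow)
  then have "Cn n (\<iota> (h \<otimes>\<^bsub>P\<^esub> T [^]\<^bsub>P\<^esub> ((q - 1) * k))) = \<zero>" using h z by (simp add: Cn_mult)
  moreover have "Cn n \<zero> = \<zero>" by (induction n) (simp_all add: Cartier_zero)
  ultimately have "\<iota> h = \<zero>" using fx by (simp add: funpow_add)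
  then show False using iota_inj[OF h U.P.zero_closed] h0 by simp
qed

text \<open>
  Only \<open>k = q + 1\<close> is left by \<open>fixed_vanish\<close>. Here \<open>x\<^bsup>q+1\<^esup> = 1 / T\<close>: the differential \<open>g ds\<close> comes from the
  line and has at most simple poles, at the points of \<open>K\<close> and at infinity.
\<close>

lemma fixed_form:
  assumes g: "g \<in> carrier A" "C g = g"
  shows "\<exists>r\<in>carrier P. g = \<iota> r \<otimes> x [^] (q + 1) \<and> (\<forall>i\<ge>q. up_ring.coeff P r i = \<zero>\<^bsub>F\<^esub>)"
proof -
  obtain h where h: "repr 1 g h" using fixed_repr_low[OF g] by blast
  then have hc: "\<And>k. h k \<in> carrier P" and gh: "g = (\<Oplus>k\<in>{1..1 + q}. \<iota> (h k) \<otimes> x [^] k)" unfolding repr_def by auto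
  note fx = fixed_repr[OF g(2) h]
  have "h k = \<zero>\<^bsub>P\<^esub>" if "k \<in> {1..q}" for k using fx[of k] fixed_vanish[OF hc, of k k] that by auto
  then have "g = (\<Oplus>k\<in>{1 + q}. \<iota> (h k) \<otimes> x [^] k)" unfolding gh using hc by (intro add.finprod_mono_neutral_cong_right) auto
  then have gq: "g = \<iota> (h (q + 1)) \<otimes> x [^] (q + 1)" using hc by simp
  have "up_ring.coeff P (h (q + 1)) i = \<zero>\<^bsub>F\<^esub>" if i: "i \<ge> q" for i
  proof (cases "h (q + 1) = \<zero>\<^bsub>P\<^esub>")
    case False
    have "(q + 1) * (deg F (h (q + 1)) + 1) \<le> q * (q + 1)" by (rule fixed_degree[OF hc False]) (use fx[of "q + 1"] in simp)
    then have "(q + 1) * (deg F (h (q + 1)) + 1) \<le> (q + 1) * q" by (simp only: mult.commute)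
    then have "deg F (h (q + 1)) + 1 \<le> q" by (simp only: mult_le_cancel1)
    then show ?thesis using i hc by (intro U.deg_aboveD) auto
  qed simp
  then show ?thesis using gq hc by blast
qed

subsection \<open>Residues\<close>

definition lin where "lin a = up_ring.monom P \<one>\<^bsub>F\<^esub> 1 \<ominus>\<^bsub>P\<^esub> up_ring.monom P a 0"
text \<open>
  The cofactor of \<open>s - a\<close> in \<open>T\<close>.
\<close>

definition cof where "cof a = lin a [^]\<^bsub>P\<^esub> (q - 1) \<ominus>\<^bsub>P\<^esub> \<one>\<^bsub>P\<^esub>"
definition ev where "ev b = UnivPoly.eval F F id b"

lemma lin_closed [simp]: "a \<in> carrier F \<Longrightarrow> lin a \<in> carrier P" by (simp add: lin_def)
lemma cof_closed [simp]: "a \<in> carrier F \<Longrightarrow> cof a \<in> carrier P" by (simp add: cof_def)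

lemma ev_hom: "b \<in> carrier F \<Longrightarrow> ring_hom_cring P F (ev b)" unfolding ev_def by (rule U.eval_ring_hom_cring)

lemma ev_monom: "b \<in> carrier F \<Longrightarrow> c \<in> carrier F \<Longrightarrow> ev b (up_ring.monom P c j) = c \<otimes>\<^bsub>F\<^esub> b [^]\<^bsub>F\<^esub> j"
  unfolding ev_def by (rule U.eval_id_monom)

lemma lin_cof:
  assumes a: "a \<in> K"
  shows "lin a \<otimes>\<^bsub>P\<^esub> cof a = T"
proof -
  have aF: "a \<in> carrier F" using a K(1) by auto
  have "lin a \<otimes>\<^bsub>P\<^esub> cof a = lin a [^]\<^bsub>P\<^esub> (Suc (q - 1)) \<ominus>\<^bsub>P\<^esub> lin a"
    using aF by (simp add: cof_def a_minus_def U.P.r_distr U.P.r_minus U.P.m_comm)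
  also have "Suc (q - 1) = q" using q_pos by simp
  also have "lin a [^]\<^bsub>P\<^esub> q = up_ring.monom P \<one>\<^bsub>F\<^esub> q \<ominus>\<^bsub>P\<^esub> up_ring.monom P a 0"
    using aF a K(4)[OF a] by (simp add: lin_def a_minus_def PD.frobenius_iter_add[where m = n, folded q_def] PD.frobenius_iter_minus[where m = n, folded q_def] U.monom_pow)
  also have "\<dots> \<ominus>\<^bsub>P\<^esub> lin a = T"
    unfolding lin_def T_def using aF by (intro U.P.minus_minus_cancel) auto
  finally show ?thesis .
qed

lemma ev_lin: "a \<in> carrier F \<Longrightarrow> b \<in> carrier F \<Longrightarrow> ev b (lin a) = b \<ominus>\<^bsub>F\<^esub> a"
proof -
  assume a: "a \<in> carrier F" and b: "b \<in> carrier F"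
  interpret E: ring_hom_cring P F "ev b" by (rule ev_hom[OF b])
  show ?thesis using a b by (simp add: lin_def a_minus_def ev_monom)
qed

lemma ev_cof:
  assumes a: "a \<in> K" and b: "b \<in> K"
  shows "ev b (cof a) = (if b = a then \<ominus>\<^bsub>F\<^esub> \<one>\<^bsub>F\<^esub> else \<zero>\<^bsub>F\<^esub>)"
proof -
  have c: "a \<in> carrier F" "b \<in> carrier F" using a b K(1) by auto
  interpret E: ring_hom_cring P F "ev b" by (rule ev_hom[OF c(2)])
  show ?thesis
  proof (cases "b = a")
    case True
    have "ev b (cof a) = (b \<ominus>\<^bsub>F\<^esub> a) [^]\<^bsub>F\<^esub> (q - 1) \<ominus>\<^bsub>F\<^esub> \<one>\<^bsub>F\<^esub>"
      using c by (simp add: cof_def a_minus_def ev_lin)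
    moreover have "b \<ominus>\<^bsub>F\<^esub> a = \<zero>\<^bsub>F\<^esub>" using c True by (simp add: a_minus_def U.R.r_neg)
    moreover have "\<zero>\<^bsub>F\<^esub> [^]\<^bsub>F\<^esub> (q - 1) = \<zero>\<^bsub>F\<^esub>" using q_ge2 by (simp add: U.R.nat_pow_zero)
    ultimately show ?thesis using True by (simp add: a_minus_def)
  next
    case False
    have "ev b T = b [^]\<^bsub>F\<^esub> q \<ominus>\<^bsub>F\<^esub> b" using c by (simp add: T_def a_minus_def ev_monom)
    then have "(b \<ominus>\<^bsub>F\<^esub> a) \<otimes>\<^bsub>F\<^esub> ev b (cof a) = \<zero>\<^bsub>F\<^esub>"
      using K(4)[OF b] c lin_cof[OF a] ev_lin[OF c] E.hom_mult[of "lin a" "cof a"] by (simp add: a_minus_def U.R.r_neg)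
    moreover have "b \<ominus>\<^bsub>F\<^esub> a \<noteq> \<zero>\<^bsub>F\<^esub>" using False c by (metis U.R.r_right_minus_eq)
    ultimately show ?thesis using False c U.R.integral[of "b \<ominus>\<^bsub>F\<^esub> a" "ev b (cof a)"] by auto
  qed
qed

lemma coeff_cof:
  assumes a: "a \<in> carrier F" and i: "i \<ge> q"
  shows "up_ring.coeff P (cof a) i = \<zero>\<^bsub>F\<^esub>"
proof -
  have "has_top F (lin a) 1 \<one>\<^bsub>F\<^esub>" unfolding has_top_def U.P_def[symmetric] lin_def using a by (simp add: a_minus_def)
  then have "has_top F (lin a [^]\<^bsub>P\<^esub> (q - 1)) (1 * (q - 1)) \<one>\<^bsub>F\<^esub>" using a by (intro U.has_top_pow) simp_all
  then have "up_ring.coeff P (lin a [^]\<^bsub>P\<^esub> (q - 1)) i = \<zero>\<^bsub>F\<^esub>" using i q_ge2 unfolding has_top_def U.P_def[symmetric] by simp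
  moreover have "up_ring.coeff P \<one>\<^bsub>P\<^esub> i = \<zero>\<^bsub>F\<^esub>" using i q_ge2 U.coeff_one[of i] by simp
  ultimately show ?thesis unfolding cof_def using a by simp
qed

lemma D_lin:
  assumes a: "a \<in> carrier F"
  shows "D (\<iota> (lin a)) = \<one>"
  using a D_s D_const[OF a] by (simp add: lin_def a_minus_def iota_add iota_minus AD.D_minus AD.D_add)

lemma divide_lin:
  assumes h: "h \<in> carrier P" and a: "a \<in> carrier F"
  obtains b where "b \<in> carrier P" "h = lin a \<otimes>\<^bsub>P\<^esub> b \<oplus>\<^bsub>P\<^esub> up_ring.monom P (ev a h) 0"
proof -
  have "carrier F \<noteq> {\<zero>\<^bsub>F\<^esub>}" using U.R.one_not_zero U.R.one_closed by blast
  then show ?thesis using U.remainder_theorem[OF h a] that unfolding lin_def ev_def by blast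
qed

text \<open>
  Write \<open>r / T = r T\<^bsup>p-1\<^esup> / T\<^sup>p\<close>. Up to a multiple of \<open>(s - a)\<^sup>p\<close>, the numerator is \<open>r(a) (s - a)\<^bsup>p-1\<^esup>\<close>, since
  the cofactor of \<open>s - a\<close> in \<open>T\<close> has value \<open>-1\<close> at \<open>a\<close>; and \<open>C\<close> takes the \<open>p\<close>-th root of this
  coefficient.
\<close>

lemma fixed_residue:
  assumes r: "r \<in> carrier P" and fx: "C (\<iota> r \<otimes> x [^] (q + 1)) = \<iota> r \<otimes> x [^] (q + 1)" and a: "a \<in> K"
  shows "ev a r [^]\<^bsub>F\<^esub> p = ev a r"
proof -
  have aF: "a \<in> carrier F" using a K(1) by auto
  interpret E: ring_hom_cring P F "ev a" by (rule ev_hom[OF aF])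
  let ?z = "\<iota> (r \<otimes>\<^bsub>P\<^esub> T [^]\<^bsub>P\<^esub> (p - 1))"
  have "\<iota> r \<otimes> x [^] (q + 1) = ?z \<otimes> x [^] (q + 1 + (p - 1) * (q + 1))"
    by (rule raise_x[OF r])
  also have "q + 1 + (p - 1) * (q + 1) = (q + 1) * p" using AD.p_pos by (cases p) (simp_all add: algebra_simps)
  also have "?z \<otimes> x [^] ((q + 1) * p) = (x [^] (q + 1)) [^] p \<otimes> ?z"
    using r by (simp only: nat_pow_pow x_closed) (intro m_comm; simp)
  finally have "C (\<iota> r \<otimes> x [^] (q + 1)) = x [^] (q + 1) \<otimes> C ?z"
    using r by (simp only: Cartier_mult nat_pow_closed x_closed iota_closed U.P.m_closed U.P.nat_pow_closed T_closed)
  then have e: "x [^] (q + 1) \<otimes> C ?z = x [^] (q + 1) \<otimes> \<iota> r" using fx r by (simp add: m_comm)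
  have Cz: "C ?z = \<iota> r"
  proof -
    have "C ?z \<in> carrier A" using r by (intro Cartier_spec) simp
    moreover have "u = \<iota> T \<otimes> (x [^] (q + 1) \<otimes> u)" if "u \<in> carrier A" for u
      using that T_x by (simp only: m_assoc[symmetric] T_closed iota_closed nat_pow_closed x_closed l_one)
    ultimately show ?thesis using e r by (metis iota_closed)
  qed
  let ?f = "r \<otimes>\<^bsub>P\<^esub> cof a [^]\<^bsub>P\<^esub> (p - 1)"
  have evf: "ev a ?f = ev a r"
    using r aF FD.minus_one_pow_pred by (simp add: ev_cof[OF a a])
  obtain b where b: "b \<in> carrier P" "?f = lin a \<otimes>\<^bsub>P\<^esub> b \<oplus>\<^bsub>P\<^esub> up_ring.monom P (ev a r) 0"
    using divide_lin[of ?f a] r aF evf by auto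
  obtain d where d: "d \<in> carrier F" "ev a r = d [^]\<^bsub>F\<^esub> p" using perfect[of "ev a r"] r by auto
  obtain b' where b': "b' \<in> carrier P" "C (\<iota> b) = \<iota> b'" using Cartier_iota[OF b(1)] by blast
  have "r \<otimes>\<^bsub>P\<^esub> T [^]\<^bsub>P\<^esub> (p - 1) = lin a [^]\<^bsub>P\<^esub> (p - 1) \<otimes>\<^bsub>P\<^esub> ?f"
    unfolding lin_cof[OF a, symmetric] using r aF by (simp add: U.P.nat_pow_distrib U.P.m_ac)
  also have "\<dots> = lin a [^]\<^bsub>P\<^esub> (Suc (p - 1)) \<otimes>\<^bsub>P\<^esub> b \<oplus>\<^bsub>P\<^esub> up_ring.monom P (ev a r) 0 \<otimes>\<^bsub>P\<^esub> lin a [^]\<^bsub>P\<^esub> (p - 1)"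
    unfolding b(2) using b(1) r aF by (simp add: U.P.r_distr U.P.m_ac)
  also have "Suc (p - 1) = p" using AD.p_pos by simp
  finally have "?z = \<iota> (lin a) [^] p \<otimes> \<iota> b \<oplus> \<kappa> d [^] p \<otimes> \<iota> (lin a) [^] (p - 1)"
    using b(1) r aF d by (simp add: iota_add iota_mult iota_pow kappa_pow[symmetric] \<kappa>_def[symmetric])
  then have "C ?z = \<iota> (lin a) \<otimes> \<iota> b' \<oplus> \<kappa> d"
    using b b' aF d AD.p_pos Cartier_pow[of "\<iota> (lin a)" "p - 1"] D_lin[OF aF] by (simp add: Cartier_add Cartier_mult)
  then have "\<iota> r = \<iota> (lin a \<otimes>\<^bsub>P\<^esub> b' \<oplus>\<^bsub>P\<^esub> up_ring.monom P d 0)"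
    using Cz aF b' d by (simp add: iota_add iota_mult \<kappa>_def)
  then have "r = lin a \<otimes>\<^bsub>P\<^esub> b' \<oplus>\<^bsub>P\<^esub> up_ring.monom P d 0" using iota_inj r aF b' d by simp
  then have "ev a r = ev a (lin a) \<otimes>\<^bsub>F\<^esub> ev a b' \<oplus>\<^bsub>F\<^esub> ev a (up_ring.monom P d 0)" using aF b' d by simp
  then have "ev a r = d" using aF b' d by (simp add: ev_lin ev_monom U.R.r_neg a_minus_def)
  then show ?thesis using d by simp
qed

definition dlog where "dlog g \<longleftrightarrow> (\<exists>w\<in>Units A. D w = g \<otimes> w)"

lemma dlog_zero: "dlog \<zero>" unfolding dlog_def by (intro bexI[of _ \<one>]) simp_all

lemma dlog_add:
  assumes "g \<in> carrier A" "g' \<in> carrier A" "dlog g" "dlog g'"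
  shows "dlog (g \<oplus> g')"
proof -
  obtain w w' where w: "w \<in> Units A" "D w = g \<otimes> w" "w' \<in> Units A" "D w' = g' \<otimes> w'" using assms unfolding dlog_def by blast
  have c: "w \<in> carrier A" "w' \<in> carrier A" using w by auto
  have "D (w \<otimes> w') = (g \<oplus> g') \<otimes> (w \<otimes> w')"
    using w c assms(1,2) by (simp add: AD.D_mult l_distr r_distr m_ac a_comm)
  then show ?thesis unfolding dlog_def using w by blast
qed

lemma dlog_multiple: "g \<in> carrier A \<Longrightarrow> dlog g \<Longrightarrow> dlog (int_elem A m \<otimes> g)"
  by (induction m) (simp_all add: dlog_zero dlog_add nu_Suc l_distr)

lemma dlog_cof:
  assumes a: "a \<in> K"
  shows "dlog (\<iota> (cof a) \<otimes> x [^] (q + 1))"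
proof -
  have aF: "a \<in> carrier F" using a K(1) by auto
  have e: "(\<iota> (cof a) \<otimes> x [^] (q + 1)) \<otimes> \<iota> (lin a) = \<one>"
  proof -
    have "(\<iota> (cof a) \<otimes> x [^] (q + 1)) \<otimes> \<iota> (lin a) = \<iota> (lin a \<otimes>\<^bsub>P\<^esub> cof a) \<otimes> x [^] (q + 1)"
      using aF by (simp add: iota_mult m_ac)
    then show ?thesis using lin_cof[OF a] T_x by simp
  qed
  then have "\<iota> (lin a) \<otimes> (\<iota> (cof a) \<otimes> x [^] (q + 1)) = \<one>" using aF by (simp add: m_comm)
  then have "\<iota> (lin a) \<in> Units A" unfolding Units_def using aF e
    by (intro CollectI conjI bexI[of _ "\<iota> (cof a) \<otimes> x [^] (q + 1)"]) simp_all
  then show ?thesis unfolding dlog_def using D_lin[OF aF] e by (intro bexI[of _ "\<iota> (lin a)"]) simp_all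
qed

text \<open>
  The element \<open>s - a\<close> is a unit with logarithmic derivative \<open>cof a / T\<close>. With \<open>m a\<close> an integer that
  represents \<open>- r(a)\<close>, the numerators of \<open>g\<close> and of the sum of the \<open>m a \<cdot> cof a / T\<close> have the same values
  on \<open>K\<close> and degree less than \<open>q\<close>, so they are equal.
\<close>

lemma dlog_fixed:
  assumes g: "g \<in> carrier A" "C g = g"
  shows "dlog g"
proof -
  obtain r where r: "r \<in> carrier P" "g = \<iota> r \<otimes> x [^] (q + 1)" "\<And>i. i \<ge> q \<Longrightarrow> up_ring.coeff P r i = \<zero>\<^bsub>F\<^esub>"
    using fixed_form[OF g] by blast
  have evc: "ev a r \<in> carrier F" if "a \<in> K" for a
  proof -
    have "a \<in> carrier F" using that K(1) by auto
    then interpret E: ring_hom_cring P F "ev a" by (rule ev_hom)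
    show ?thesis using r(1) by simp
  qed
  have "\<exists>m. \<ominus>\<^bsub>F\<^esub> ev a r = int_elem F m" if a: "a \<in> K" for a
    using fixed_residue[OF r(1) _ a] g(2) evc[OF a] unfolding r(2)
    by (intro FD.frobenius_fixed) (simp_all add: FD.frobenius_minus)
  then obtain m where m: "\<And>a. a \<in> K \<Longrightarrow> \<ominus>\<^bsub>F\<^esub> ev a r = int_elem F (m a)" by metis
  have "\<exists>N\<in>carrier P. (\<forall>i\<ge>q. up_ring.coeff P N i = \<zero>\<^bsub>F\<^esub>) \<and>
    (\<forall>b\<in>K. ev b N = (if b \<in> S then ev b r else \<zero>\<^bsub>F\<^esub>)) \<and> dlog (\<iota> N \<otimes> x [^] (q + 1))" if "finite S" "S \<subseteq> K" for S
    using that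
  proof (induction rule: finite_induct)
    case empty
    have "ev b \<zero>\<^bsub>P\<^esub> = \<zero>\<^bsub>F\<^esub>" if "b \<in> K" for b
    proof -
      have "b \<in> carrier F" using that K(1) by auto
      then interpret E: ring_hom_cring P F "ev b" by (rule ev_hom)
      show ?thesis by simp
    qed
    then show ?case using dlog_zero by (intro bexI[of _ "\<zero>\<^bsub>P\<^esub>"]) simp_all
  next
    case (insert a S)
    have a: "a \<in> K" "a \<in> carrier F" using insert.prems K(1) by auto
    obtain N where N: "N \<in> carrier P" "\<And>i. i \<ge> q \<Longrightarrow> up_ring.coeff P N i = \<zero>\<^bsub>F\<^esub>"
      "\<And>b. b \<in> K \<Longrightarrow> ev b N = (if b \<in> S then ev b r else \<zero>\<^bsub>F\<^esub>)" "dlog (\<iota> N \<otimes> x [^] (q + 1))"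
      using insert.IH insert.prems by auto
    let ?c = "up_ring.monom P (int_elem F (m a)) 0"
    let ?N = "N \<oplus>\<^bsub>P\<^esub> ?c \<otimes>\<^bsub>P\<^esub> cof a"
    have "up_ring.coeff P (?c \<otimes>\<^bsub>P\<^esub> cof a) i = \<zero>\<^bsub>F\<^esub>" if "i \<ge> q" for i
      using U.coeff_monom_mult[of "int_elem F (m a)" "cof a" 0 i] a coeff_cof[OF a(2) that] by simp
    then have 1: "up_ring.coeff P ?N i = \<zero>\<^bsub>F\<^esub>" if "i \<ge> q" for i using that N a by (simp del: U.coeff_mult)
    have 2: "ev b ?N = (if b \<in> insert a S then ev b r else \<zero>\<^bsub>F\<^esub>)" if b: "b \<in> K" for b
    proof -
      have bF: "b \<in> carrier F" using b K(1) by auto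
      interpret E: ring_hom_cring P F "ev b" by (rule ev_hom[OF bF])
      have "ev b ?N = ev b N \<oplus>\<^bsub>F\<^esub> int_elem F (m a) \<otimes>\<^bsub>F\<^esub> (if b = a then \<ominus>\<^bsub>F\<^esub> \<one>\<^bsub>F\<^esub> else \<zero>\<^bsub>F\<^esub>)"
        using N(1) a bF ev_cof[OF a(1) b] by (simp add: ev_monom)
      then show ?thesis using N(3)[OF b] insert.hyps m[OF a(1), symmetric] evc[OF b] evc[OF a(1)]
        by (auto simp: U.R.r_minus U.R.l_minus)
    qed
    have 3: "dlog (\<iota> ?N \<otimes> x [^] (q + 1))"
    proof -
      have "\<iota> ?N \<otimes> x [^] (q + 1) = \<iota> N \<otimes> x [^] (q + 1) \<oplus> int_elem A (m a) \<otimes> (\<iota> (cof a) \<otimes> x [^] (q + 1))"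
        using N(1) a by (simp add: iota_add iota_mult int_elem_kappa \<kappa>_def l_distr m_assoc del: nat_pow_Suc)
      then show ?thesis using N a dlog_cof[OF a(1)] by (simp add: dlog_add dlog_multiple del: nat_pow_Suc)
    qed
    show ?case using 1 2 3 N(1) a by (intro bexI[of _ ?N]) simp_all
  qed
  from this[OF K(2) order_refl] obtain N where N: "N \<in> carrier P" "\<And>i. i \<ge> q \<Longrightarrow> up_ring.coeff P N i = \<zero>\<^bsub>F\<^esub>"
    "\<And>b. b \<in> K \<Longrightarrow> ev b N = ev b r" "dlog (\<iota> N \<otimes> x [^] (q + 1))" by auto
  have "N \<ominus>\<^bsub>P\<^esub> r = \<zero>\<^bsub>P\<^esub>"
  proof (rule U.zero_if_many_roots[OF _ _ K(1,2,3), folded ev_def])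
    show "ev b (N \<ominus>\<^bsub>P\<^esub> r) = \<zero>\<^bsub>F\<^esub>" if b: "b \<in> K" for b
    proof -
      have "b \<in> carrier F" using b K(1) by auto
      then interpret E: ring_hom_cring P F "ev b" by (rule ev_hom)
      show ?thesis using N(1,3) r(1) b evc[OF b] by (simp add: a_minus_def U.R.r_neg)
    qed
  qed (use N r in auto)
  then have "N = r" using N(1) r(1) by (metis U.P.r_right_minus_eq)
  then show ?thesis using N(4) r(2) by simp
qed

theorem log_derivatives:
  assumes "g \<in> carrier A" "(D ^^ (p - 1)) g = \<ominus> (g [^] p)"
  shows "\<exists>w\<in>Units A. D w = g \<otimes> w"
  using dlog_fixed[OF assms(1) Cartier_eq[OF assms]] unfolding dlog_def .

end

section \<open>The base field\<close>

lemma (in field) finite_subfield_pow_card: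
  assumes K: "subfield K R" "finite K" and a: "a \<in> K"
  shows "a [^] card K = a"
proof -
  let ?K = "R\<lparr>carrier := K\<rparr>"
  interpret K: field ?K by (rule subfield_iff(2)[OF K(1)])
  have aR: "a \<in> carrier R" "K \<noteq> {}" using a subfieldE(3)[OF K(1)] by auto
  show ?thesis
  proof (cases "a = \<zero>")
    case True
    then show ?thesis using K(2) aR by (simp add: nat_pow_zero card_gt_0_iff)
  next
    case False
    have "a [^]\<^bsub>Multiplicative_Group.mult_of ?K\<^esub> order (Multiplicative_Group.mult_of ?K) = \<one>\<^bsub>Multiplicative_Group.mult_of ?K\<^esub>"
      using a False by (intro group.pow_order_eq_1[OF K.field_mult_group]) simp
    moreover have "order (Multiplicative_Group.mult_of ?K) = card K - 1" using K.order_mult_of K(2) by (simp add: order_def)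
    ultimately have "a [^] (card K - 1) = \<one>"
      by (simp add: Multiplicative_Group.nat_pow_mult_of nat_pow_consistent[symmetric] del: One_nat_def)
    then have "a [^] Suc (card K - 1) = a" using aR by simp
    moreover have "card K > 0" using K(2) aR by (simp add: card_gt_0_iff)
    ultimately show ?thesis by simp
  qed
qed

lemma (in field) finite_subfield_card_zero:
  assumes K: "subfield K R" "finite K"
  shows "int_elem R (card K) = \<zero>"
proof -
  let ?K = "R\<lparr>carrier := K\<rparr>"
  interpret K: field ?K by (rule subfield_iff(2)[OF K(1)])
  have "\<one> [^]\<^bsub>add_monoid ?K\<^esub> order (add_monoid ?K) = \<one>\<^bsub>add_monoid ?K\<^esub>"
    using K.one_closed by (intro group.pow_order_eq_1[OF K.a_group]) simp
  then show ?thesis unfolding int_elem_def add_pow_def nat_pow_def order_def by simp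
qed

lemma (in field) finite_subfield_char:
  assumes "subfield K R" "finite K" "card K = p ^ n"
  shows "int_elem R p = \<zero>"
proof -
  have "int_elem R (p ^ m) = int_elem R p [^] m" for m
    by (induction m) (simp_all add: nu_mult m_comm)
  then have "int_elem R p [^] n = \<zero>" using finite_subfield_card_zero[OF assms(1,2)] assms(3) by simp
  moreover have "int_elem R p [^] m \<noteq> \<zero>" if "int_elem R p \<noteq> \<zero>" for m :: nat
    using that by (induction m) (simp_all add: integral_iff)
  ultimately show ?thesis by blast
qed

text \<open>
  Frobenius is injective, hence surjective, on the finite ring \<open>K[c]\<close>.
\<close>

lemma (in field) algebraic_over_finite_perfect:
  assumes K: "subfield K R" "finite K" and p: "char_p_domain R p"
    and c: "c \<in> carrier R" "(algebraic over K) c"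
  shows "\<exists>d\<in>carrier R. c = d [^] p"
proof -
  interpret C: char_p_domain R p by (rule p)
  let ?L = "simple_extension K c"
  note subK = subfieldE(1)[OF K(1)]
  have sub: "subring ?L R" by (rule simple_extension_is_subring[OF subK c(1)])
  interpret L: ring "R\<lparr>carrier := ?L\<rparr>" by (rule subring_is_ring[OF sub])
  have LR: "?L \<subseteq> carrier R" by (rule subringE(1)[OF sub])
  have "finite_dimension K ?L" using finite_dimension_simple_extension[OF K(1) c(1)] c(2) by simp
  then obtain m where "dimension m K ?L" unfolding finite_dimension_def by blast
  then obtain Us where Us: "set Us \<subseteq> carrier R" "Span K Us = ?L" using exists_base[OF K(1)] by blast
  have "?L \<subseteq> (\<lambda>Ks. combine Ks Us) ` {Ks. set Ks \<subseteq> K \<and> length Ks = length Us}"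
    unfolding Us(2)[symmetric] using Span_eq_combine_set_length_version[OF K(1) Us(1)] by auto
  then have fin: "finite ?L" using finite_lists_length_eq[OF K(2)] by (meson finite_surj)
  have "a [^] m \<in> ?L" if "a \<in> ?L" for a and m :: nat
    using L.nat_pow_closed[of a m] that by (simp add: nat_pow_consistent[symmetric])
  then have "(\<lambda>a. a [^] p) ` ?L \<subseteq> ?L" by blast
  moreover have "inj_on (\<lambda>a. a [^] p) ?L" using LR C.frobenius_inj by (intro inj_onI) blast
  ultimately have "(\<lambda>a. a [^] p) ` ?L = ?L" by (intro endo_inj_surj fin)
  moreover have "c \<in> ?L" by (rule simple_extension_mem[OF subK c(1)])
  ultimately obtain d where "d \<in> ?L" "c = d [^] p" by blast
  then show ?thesis using LR by blast
qed

section \<open>Quotients by a principal ideal, and dual numbers\<close>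

definition principal_class where "principal_class R r a = PIdl\<^bsub>R\<^esub> r +>\<^bsub>R\<^esub> a"

context cring
begin

context
  fixes r assumes r: "r \<in> carrier R"
begin

lemma ideal_r: "ideal (PIdl r) R" by (rule cgenideal_ideal[OF r])

lemma principal_quotient_cring: "cring (R Quot PIdl r)"
  by (rule ideal.quotient_is_cring[OF ideal_r is_cring])

lemma principal_class_hom: "principal_class R r \<in> ring_hom R (R Quot PIdl r)"
  unfolding principal_class_def[abs_def] by (rule ideal.rcos_ring_hom[OF ideal_r])

lemma principal_class_surj: "c \<in> carrier (R Quot PIdl r) \<Longrightarrow> \<exists>a\<in>carrier R. c = principal_class R r a"
  unfolding principal_class_def FactRing_def A_RCOSETS_def' by auto

lemma principal_class_eq:
  assumes "a \<in> carrier R" "b \<in> carrier R"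
  shows "principal_class R r a = principal_class R r b \<longleftrightarrow> (\<exists>c\<in>carrier R. a \<ominus> b = c \<otimes> r)"
  unfolding principal_class_def quotient_eq_iff_same_a_r_cos[OF ideal_r assms, symmetric]
  by (auto simp: cgenideal_def)

lemma principal_class_generator: "principal_class R r r = \<zero>\<^bsub>R Quot PIdl r\<^esub>"
proof -
  interpret Q: cring "R Quot PIdl r" by (rule principal_quotient_cring)
  have "principal_class R r r = principal_class R r \<zero>" using r
    by (subst principal_class_eq) (auto intro!: bexI[of _ \<one>] simp: a_minus_def)
  then show ?thesis using ring_hom_zero[OF principal_class_hom ring_axioms Q.ring_axioms] by simp
qed

lemma principal_quotient_factor:
  assumes S: "cring S" and h: "h \<in> ring_hom R S" and hr: "h r = \<zero>\<^bsub>S\<^esub>"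
  shows "\<exists>H\<in>ring_hom (R Quot PIdl r) S. \<forall>a\<in>carrier R. H (principal_class R r a) = h a"
proof -
  interpret S: cring S by (rule S)
  interpret h: ring_hom_cring R S h by (rule ring_hom_cringI[OF is_cring S h])
  interpret Q: cring "R Quot PIdl r" by (rule principal_quotient_cring)
  interpret Q: ring_hom_cring R "R Quot PIdl r" "principal_class R r"
    by (rule ring_hom_cringI[OF is_cring Q.is_cring principal_class_hom])
  define H where "H c = h (SOME a. a \<in> carrier R \<and> c = principal_class R r a)" for c
  have H: "H (principal_class R r a) = h a" if a: "a \<in> carrier R" for a
  proof -
    define b where "b = (SOME b. b \<in> carrier R \<and> principal_class R r a = principal_class R r b)"
    have b: "b \<in> carrier R \<and> principal_class R r a = principal_class R r b"
      unfolding b_def by (rule someI[of _ a]) (use a in simp)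
    then obtain c where c: "c \<in> carrier R" "a \<ominus> b = c \<otimes> r" using principal_class_eq[of a b] a by blast
    have "h (a \<ominus> b) = \<zero>\<^bsub>S\<^esub>" unfolding c(2) using c(1) r hr by simp
    then have "h a = h b" using a b by (simp add: a_minus_def S.minus_equality[symmetric] S.r_right_minus_eq[unfolded a_minus_def])
    then show ?thesis unfolding H_def b_def by simp
  qed
  have "H \<in> ring_hom (R Quot PIdl r) S"
  proof (rule ring_hom_memI)
    fix c d assume "c \<in> carrier (R Quot PIdl r)" "d \<in> carrier (R Quot PIdl r)"
    then obtain a b where ab: "a \<in> carrier R" "c = principal_class R r a" "b \<in> carrier R" "d = principal_class R r b"
      using principal_class_surj by metis
    show "H (c \<otimes>\<^bsub>R Quot PIdl r\<^esub> d) = H c \<otimes>\<^bsub>S\<^esub> H d"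
      using ab H[of "a \<otimes> b"] by (simp add: H)
    show "H (c \<oplus>\<^bsub>R Quot PIdl r\<^esub> d) = H c \<oplus>\<^bsub>S\<^esub> H d"
      using ab H[of "a \<oplus> b"] by (simp add: H)
  next
    fix c assume "c \<in> carrier (R Quot PIdl r)"
    then show "H c \<in> carrier S" using principal_class_surj[of c] H by auto
  next
    show "H \<one>\<^bsub>R Quot PIdl r\<^esub> = \<one>\<^bsub>S\<^esub>" using H[of \<one>] by simp
  qed
  then show ?thesis using H by blast
qed

end

end

text \<open>
  \<open>R[\<epsilon>] / (\<epsilon>\<^sup>2)\<close>, with \<open>(a, a')\<close> for \<open>a + a' \<epsilon>\<close>. Ring homomorphisms \<open>a \<mapsto> a + D a \<epsilon>\<close> are the same as
  derivations \<open>D\<close>.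
\<close>

definition dual_numbers :: "('a, 'b) ring_scheme \<Rightarrow> ('a \<times> 'a) ring" where
  "dual_numbers R = \<lparr>carrier = carrier R \<times> carrier R,
     monoid.mult = (\<lambda>(a, a') (b, b'). (a \<otimes>\<^bsub>R\<^esub> b, a' \<otimes>\<^bsub>R\<^esub> b \<oplus>\<^bsub>R\<^esub> a \<otimes>\<^bsub>R\<^esub> b')),
     one = (\<one>\<^bsub>R\<^esub>, \<zero>\<^bsub>R\<^esub>), ring.zero = (\<zero>\<^bsub>R\<^esub>, \<zero>\<^bsub>R\<^esub>),
     add = (\<lambda>(a, a') (b, b'). (a \<oplus>\<^bsub>R\<^esub> b, a' \<oplus>\<^bsub>R\<^esub> b'))\<rparr>"

context cring
begin

lemma dual_numbers_simps [simp]: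
  "carrier (dual_numbers R) = carrier R \<times> carrier R"
  "(a, a') \<otimes>\<^bsub>dual_numbers R\<^esub> (b, b') = (a \<otimes> b, a' \<otimes> b \<oplus> a \<otimes> b')"
  "\<one>\<^bsub>dual_numbers R\<^esub> = (\<one>, \<zero>)" "\<zero>\<^bsub>dual_numbers R\<^esub> = (\<zero>, \<zero>)"
  "(a, a') \<oplus>\<^bsub>dual_numbers R\<^esub> (b, b') = (a \<oplus> b, a' \<oplus> b')"
  by (simp_all add: dual_numbers_def)

lemma dual_numbers_cring: "cring (dual_numbers R)"
proof (rule cringI)
  show "abelian_group (dual_numbers R)"
  proof (rule abelian_groupI)
    fix z assume "z \<in> carrier (dual_numbers R)"
    then show "\<exists>w\<in>carrier (dual_numbers R). w \<oplus>\<^bsub>dual_numbers R\<^esub> z = \<zero>\<^bsub>dual_numbers R\<^esub>"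
      by (intro bexI[of _ "(\<ominus> fst z, \<ominus> snd z)"]) (auto simp: l_neg)
  qed (auto simp: a_ac)
  show "comm_monoid (dual_numbers R)"
    by (rule comm_monoidI) (auto simp: m_ac r_distr l_distr a_ac)
qed (auto simp: l_distr r_distr a_ac)

lemma dual_numbers_pow:
  assumes "a \<in> carrier R" "a' \<in> carrier R"
  shows "(a, a') [^]\<^bsub>dual_numbers R\<^esub> n = (a [^] n, int_elem R n \<otimes> (a [^] (n - 1) \<otimes> a'))"
proof (induction n)
  case (Suc n)
  show ?case
  proof (cases n)
    case (Suc m)
    then show ?thesis using assms Suc.IH by (simp add: nu_Suc l_distr r_distr m_ac a_ac)
  qed (use assms Suc in simp)
qed (use assms in simp)

end

section \<open>The coordinate ring\<close>

text \<open>
  The lowest term of \<open>G\<close>, up to sign, and \<open>t X\<^sup>m\<close> times its highest term both survive in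
  \<open>G (t X\<^sup>m - 1)\<close>, and their degrees differ by at least \<open>m\<close>.
\<close>

lemma (in UP_domain) degree_spread:
  assumes t: "t \<in> carrier R" "t \<noteq> \<zero>" and m: "m > 0" and G: "G \<in> carrier P"
    and window: "\<And>i. up_ring.coeff P (G \<otimes>\<^bsub>P\<^esub> (up_ring.monom P t m \<ominus>\<^bsub>P\<^esub> \<one>\<^bsub>P\<^esub>)) i \<noteq> \<zero> \<Longrightarrow> M \<le> i \<and> i < M + m"
  shows "G = \<zero>\<^bsub>P\<^esub>"
proof (rule ccontr)
  assume G0: "G \<noteq> \<zero>\<^bsub>P\<^esub>"
  let ?N = "up_ring.monom P t m"
  have e: "up_ring.coeff P (G \<otimes>\<^bsub>P\<^esub> (?N \<ominus>\<^bsub>P\<^esub> \<one>\<^bsub>P\<^esub>)) i = up_ring.coeff P (?N \<otimes>\<^bsub>P\<^esub> G) i \<ominus> up_ring.coeff P G i" for i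
  proof -
    have "G \<otimes>\<^bsub>P\<^esub> (?N \<ominus>\<^bsub>P\<^esub> \<one>\<^bsub>P\<^esub>) = ?N \<otimes>\<^bsub>P\<^esub> G \<ominus>\<^bsub>P\<^esub> G"
      using t G by (simp add: a_minus_def P.r_distr P.r_minus P.m_comm)
    then show ?thesis using t G by (simp del: coeff_mult)
  qed
  have high: "up_ring.coeff P (?N \<otimes>\<^bsub>P\<^esub> G) (j + m) = t \<otimes> up_ring.coeff P G j" for j
    by (rule coeff_monom_mult[OF t(1) G])
  have low: "up_ring.coeff P (?N \<otimes>\<^bsub>P\<^esub> G) i = \<zero>" if i: "i < m" for i
  proof -
    have "(\<Oplus>k\<in>{..i}. up_ring.coeff P ?N k \<otimes> up_ring.coeff P G (i - k)) = \<zero>"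
      using i t G by (intro R.add.finprod_one_eqI) auto
    then show ?thesis using t G by simp
  qed
  define g where "g = deg R G"
  have g: "up_ring.coeff P G g \<noteq> \<zero>" unfolding g_def by (rule lcoeff_nonzero2[OF G G0])
  have "up_ring.coeff P G (g + m) = \<zero>" using m G unfolding g_def by (intro deg_aboveD) auto
  then have "up_ring.coeff P (G \<otimes>\<^bsub>P\<^esub> (?N \<ominus>\<^bsub>P\<^esub> \<one>\<^bsub>P\<^esub>)) (g + m) = t \<otimes> up_ring.coeff P G g"
    unfolding e high using t G by (simp add: a_minus_def)
  moreover have "t \<otimes> up_ring.coeff P G g \<noteq> \<zero>" using R.integral[of t "up_ring.coeff P G g"] t g coeff_closed[OF G] by blast
  ultimately have "g + m < M + m" using window[of "g + m"] by simp
  then have gM: "g < M" by simp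
  define l where "l = (LEAST i. up_ring.coeff P G i \<noteq> \<zero>)"
  have l: "up_ring.coeff P G l \<noteq> \<zero>" "l \<le> g" "\<And>i. i < l \<Longrightarrow> up_ring.coeff P G i = \<zero>"
    unfolding l_def using LeastI[of "\<lambda>i. up_ring.coeff P G i \<noteq> \<zero>", OF g] Least_le[of "\<lambda>i. up_ring.coeff P G i \<noteq> \<zero>", OF g]
      not_less_Least[of _ "\<lambda>i. up_ring.coeff P G i \<noteq> \<zero>"] by blast+
  have "up_ring.coeff P (?N \<otimes>\<^bsub>P\<^esub> G) l = \<zero>"
  proof (cases "l < m")
    case False
    then show ?thesis using high[of "l - m"] l(3)[of "l - m"] m t by simp
  qed (rule low)
  then have "up_ring.coeff P (G \<otimes>\<^bsub>P\<^esub> (?N \<ominus>\<^bsub>P\<^esub> \<one>\<^bsub>P\<^esub>)) l = \<ominus> up_ring.coeff P G l"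
    unfolding e using G by (simp add: a_minus_def)
  moreover have "\<ominus> up_ring.coeff P G l \<noteq> \<zero>" using l(1) G by (metis R.minus_minus R.minus_zero coeff_closed)
  ultimately show False using window[of l] l(2) gM by simp
qed

context cring
begin

lemma diff_one_iff:
  assumes "a \<in> carrier R" "b \<in> carrier R"
  shows "a \<ominus> b \<ominus> \<one> = \<zero> \<longleftrightarrow> a = b \<oplus> \<one>"
proof -
  have "a \<ominus> b \<ominus> \<one> = a \<ominus> (b \<oplus> \<one>)" using assms by (simp add: a_minus_def minus_add a_assoc)
  then show ?thesis using assms by (simp add: r_right_minus_eq)
qed

lemma minus_eq_one:
  assumes "a \<in> carrier R" "b \<in> carrier R" "a = b \<oplus> \<one>"
  shows "a \<ominus> b = \<one>"
  unfolding assms(3) using assms(2) by (simp add: a_minus_def a_comm[of b \<one>] a_assoc r_neg)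

lemma drinfeld_unit:
  assumes x: "x \<in> carrier R" "y \<in> carrier R" and rel: "x \<otimes> y [^] q = y \<otimes> x [^] q \<oplus> \<one>" and q: "q > (0::nat)"
  shows "x \<otimes> (y [^] q \<ominus> y \<otimes> x [^] (q - 1)) = \<one>"
proof -
  have "y \<otimes> x [^] q = x \<otimes> (y \<otimes> x [^] (q - 1))"
    using x q by (cases q) (simp_all add: m_ac)
  moreover have "x \<otimes> (y [^] q \<ominus> y \<otimes> x [^] (q - 1)) = x \<otimes> y [^] q \<ominus> x \<otimes> (y \<otimes> x [^] (q - 1))"
    using x by (simp add: a_minus_def r_distr r_minus)
  moreover have "x \<otimes> y [^] q \<ominus> y \<otimes> x [^] q = \<one>" using x by (intro minus_eq_one rel) auto
  ultimately show ?thesis by simp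
qed

lemma drinfeld_ratio:
  fixes q :: nat
  assumes x: "x \<in> carrier R" "s \<in> carrier R" and rel: "x \<otimes> (s \<otimes> x) [^] q = (s \<otimes> x) \<otimes> x [^] q \<oplus> \<one>"
  shows "(s [^] q \<ominus> s) \<otimes> x [^] (q + 1) = \<one>"
proof -
  have "(s [^] q \<ominus> s) \<otimes> x [^] (q + 1) = x \<otimes> (s \<otimes> x) [^] q \<ominus> (s \<otimes> x) \<otimes> x [^] q"
    using x by (simp add: a_minus_def l_distr l_minus r_distr r_minus nat_pow_distrib m_ac)
  also have "\<dots> = \<one>" using x by (intro minus_eq_one rel) auto
  finally show ?thesis .
qed

end

locale drinfeld_curve = U: UP_domain F P for F :: "('f, 'g) ring_scheme" and P +
  fixes q :: nat
  assumes q_ge2: "q \<ge> 2"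

sublocale drinfeld_curve \<subseteq> B: UP_domain P "UP P" by unfold_locales

context drinfeld_curve
begin

abbreviation "B \<equiv> UP P"
abbreviation "vx \<equiv> up_ring.monom B (up_ring.monom P \<one>\<^bsub>F\<^esub> 1) 0"
abbreviation "vy \<equiv> up_ring.monom B \<one>\<^bsub>P\<^esub> 1"
abbreviation "vc c \<equiv> up_ring.monom B (up_ring.monom P c 0) 0"
definition rel where
  "rel = vx \<otimes>\<^bsub>B\<^esub> vy [^]\<^bsub>B\<^esub> q \<ominus>\<^bsub>B\<^esub> vy \<otimes>\<^bsub>B\<^esub> vx [^]\<^bsub>B\<^esub> q \<ominus>\<^bsub>B\<^esub> \<one>\<^bsub>B\<^esub>"
definition A where "A = B Quot PIdl\<^bsub>B\<^esub> rel"
definition cl where "cl = principal_class B rel"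
definition gx where "gx = cl vx"
definition gy where "gy = cl vy"
definition cst where "cst c = cl (vc c)"

lemma rel_closed: "rel \<in> carrier B" unfolding rel_def by simp

lemma A_cring: "cring A" unfolding A_def by (rule B.P.principal_quotient_cring[OF rel_closed])

sublocale A: cring A by (rule A_cring)

lemma cl_hom: "cl \<in> ring_hom B A" unfolding A_def cl_def by (rule B.P.principal_class_hom[OF rel_closed])

sublocale cl: ring_hom_cring B A cl by (rule ring_hom_cringI[OF B.P.is_cring A_cring cl_hom])

lemma cl_surj: "a \<in> carrier A \<Longrightarrow> \<exists>b\<in>carrier B. a = cl b"
  unfolding A_def cl_def by (rule B.P.principal_class_surj[OF rel_closed])

lemma gens_closed [simp]: "gx \<in> carrier A" "gy \<in> carrier A" "c \<in> carrier F \<Longrightarrow> cst c \<in> carrier A"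
  unfolding gx_def gy_def cst_def by simp_all

lemma cst_hom: "cst \<in> ring_hom F A"
proof (rule ring_hom_memI)
  fix c d assume "c \<in> carrier F" "d \<in> carrier F"
  then show "cst (c \<otimes>\<^bsub>F\<^esub> d) = cst c \<otimes>\<^bsub>A\<^esub> cst d" "cst (c \<oplus>\<^bsub>F\<^esub> d) = cst c \<oplus>\<^bsub>A\<^esub> cst d"
    using B.monom_mult[of "up_ring.monom P c 0" "up_ring.monom P d 0" 0 0] U.monom_mult[of c d 0 0]
    unfolding cst_def by (simp_all add: cl.hom_mult[symmetric] cl.hom_add[symmetric] del: cl.hom_mult cl.hom_add)
qed (simp_all add: cst_def)

lemma curve_relation: "gx \<otimes>\<^bsub>A\<^esub> gy [^]\<^bsub>A\<^esub> q = gy \<otimes>\<^bsub>A\<^esub> gx [^]\<^bsub>A\<^esub> q \<oplus>\<^bsub>A\<^esub> \<one>\<^bsub>A\<^esub>"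
proof -
  have "cl rel = \<zero>\<^bsub>A\<^esub>" unfolding A_def cl_def by (rule B.P.principal_class_generator[OF rel_closed])
  then show ?thesis unfolding rel_def
    by (subst A.diff_one_iff[symmetric]) (simp_all add: gx_def gy_def a_minus_def)
qed

lemma curve_induct:
  assumes a: "a \<in> carrier A"
    and gen: "\<And>c i j. c \<in> carrier F \<Longrightarrow> Q (cst c \<otimes>\<^bsub>A\<^esub> gx [^]\<^bsub>A\<^esub> (i::nat) \<otimes>\<^bsub>A\<^esub> gy [^]\<^bsub>A\<^esub> (j::nat))"
    and add: "\<And>a b. a \<in> carrier A \<Longrightarrow> b \<in> carrier A \<Longrightarrow> Q a \<Longrightarrow> Q b \<Longrightarrow> Q (a \<oplus>\<^bsub>A\<^esub> b)"
  shows "Q a"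
proof -
  obtain b where b: "b \<in> carrier B" "a = cl b" using cl_surj[OF a] by blast
  have "Q (cl b)" using b(1)
  proof (rule B.poly_induct)
    fix f j assume "f \<in> carrier P"
    then show "Q (cl (up_ring.monom B f j))"
    proof (rule U.poly_induct)
      fix c i assume c: "c \<in> carrier F"
      have "up_ring.monom B (up_ring.monom P c i) j = vc c \<otimes>\<^bsub>B\<^esub> vx [^]\<^bsub>B\<^esub> i \<otimes>\<^bsub>B\<^esub> vy [^]\<^bsub>B\<^esub> j"
        using c by (simp add: B.monom_pow U.monom_pow B.monom_mult[symmetric] U.monom_mult[symmetric] del: B.monom_mult U.monom_mult)
      then show "Q (cl (up_ring.monom B (up_ring.monom P c i) j))"
        using gen[OF c, of i j] c by (simp add: cst_def gx_def gy_def)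
    next
      fix f g assume "f \<in> carrier P" "g \<in> carrier P" "Q (cl (up_ring.monom B f j))" "Q (cl (up_ring.monom B g j))"
      then show "Q (cl (up_ring.monom B (f \<oplus>\<^bsub>P\<^esub> g) j))" using add by simp
    qed
  next
    fix f g assume "f \<in> carrier B" "g \<in> carrier B" "Q (cl f)" "Q (cl g)"
    then show "Q (cl (f \<oplus>\<^bsub>B\<^esub> g))" using add by simp
  qed
  then show ?thesis using b(2) by simp
qed

text \<open>
  The universal property of a ring given by generators and relations.
\<close>

lemma curve_hom:
  assumes S: "cring S" and \<phi>: "\<phi> \<in> ring_hom F S" and uv: "u \<in> carrier S" "v \<in> carrier S"
    and rl: "u \<otimes>\<^bsub>S\<^esub> v [^]\<^bsub>S\<^esub> q = v \<otimes>\<^bsub>S\<^esub> u [^]\<^bsub>S\<^esub> q \<oplus>\<^bsub>S\<^esub> \<one>\<^bsub>S\<^esub>"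
  shows "\<exists>H\<in>ring_hom A S. H gx = u \<and> H gy = v \<and> (\<forall>c\<in>carrier F. H (cst c) = \<phi> c)"
proof -
  interpret S: cring S by (rule S)
  interpret \<phi>: ring_hom_cring F S \<phi> by (rule ring_hom_cringI[OF U.R.is_cring S \<phi>])
  interpret E: UP_pre_univ_prop F S \<phi> P by unfold_locales
  define e where "e = UnivPoly.eval F S \<phi> u"
  have e: "e \<in> ring_hom P S" unfolding e_def by (rule E.eval_ring_hom[OF uv(1)])
  interpret e: ring_hom_cring P S e by (rule ring_hom_cringI[OF U.P.is_cring S e])
  interpret E': UP_pre_univ_prop P S e B by unfold_locales
  define e' where "e' = UnivPoly.eval P S e v"
  have e': "e' \<in> ring_hom B S" unfolding e'_def by (rule E'.eval_ring_hom[OF uv(2)])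
  interpret e': ring_hom_cring B S e' by (rule ring_hom_cringI[OF B.P.is_cring S e'])
  have ec: "e (up_ring.monom P c 0) = \<phi> c" if "c \<in> carrier F" for c unfolding e_def by (rule E.eval_const[OF uv(1) that])
  have ex: "e (up_ring.monom P \<one>\<^bsub>F\<^esub> 1) = u" unfolding e_def by (rule E.eval_monom1[OF uv(1)])
  have ec': "e' (up_ring.monom B f 0) = e f" if "f \<in> carrier P" for f unfolding e'_def by (rule E'.eval_const[OF uv(2) that])
  have ey': "e' vy = v" unfolding e'_def by (rule E'.eval_monom1[OF uv(2)])
  have ex': "e' vx = u" using ec'[of "up_ring.monom P \<one>\<^bsub>F\<^esub> 1"] ex by simp
  have "e' rel = u \<otimes>\<^bsub>S\<^esub> v [^]\<^bsub>S\<^esub> q \<ominus>\<^bsub>S\<^esub> v \<otimes>\<^bsub>S\<^esub> u [^]\<^bsub>S\<^esub> q \<ominus>\<^bsub>S\<^esub> \<one>\<^bsub>S\<^esub>"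
    unfolding rel_def a_minus_def by (simp add: ex'[simplified] ey'[simplified])
  also have "\<dots> = \<zero>\<^bsub>S\<^esub>" using uv rl by (subst S.diff_one_iff) auto
  finally obtain H where H: "H \<in> ring_hom A S" "\<And>b. b \<in> carrier B \<Longrightarrow> H (cl b) = e' b"
    using B.P.principal_quotient_factor[OF rel_closed S e'] unfolding A_def cl_def by blast
  show ?thesis
    by (rule bexI[OF _ H(1)]) (simp add: gx_def gy_def cst_def H(2) ex'[simplified] ey'[simplified] ec' ec)
qed

text \<open>
  The inverse of \<open>x\<close>, read off from the equation of the curve.
\<close>

definition gi where "gi = gy [^]\<^bsub>A\<^esub> q \<ominus>\<^bsub>A\<^esub> gy \<otimes>\<^bsub>A\<^esub> gx [^]\<^bsub>A\<^esub> (q - 1)"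
text \<open>
  The coordinate \<open>y / x\<close> on the line.
\<close>

definition gs where "gs = gy \<otimes>\<^bsub>A\<^esub> gi"
definition \<iota> where "\<iota> = UnivPoly.eval F A cst gs"

lemma gi_closed [simp]: "gi \<in> carrier A" and gs_closed [simp]: "gs \<in> carrier A"
  unfolding gi_def gs_def by simp_all

lemma gx_gi: "gx \<otimes>\<^bsub>A\<^esub> gi = \<one>\<^bsub>A\<^esub>"
  unfolding gi_def using q_ge2 by (intro A.drinfeld_unit curve_relation) simp_all

lemma gs_gx: "gs \<otimes>\<^bsub>A\<^esub> gx = gy"
proof -
  have "gs \<otimes>\<^bsub>A\<^esub> gx = gy \<otimes>\<^bsub>A\<^esub> (gx \<otimes>\<^bsub>A\<^esub> gi)" by (simp add: gs_def A.m_ac)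
  then show ?thesis unfolding gx_gi by simp
qed

sublocale cst: ring_hom_cring F A cst by (rule ring_hom_cringI[OF U.R.is_cring A_cring cst_hom])

sublocale E: UP_pre_univ_prop F A cst P by unfold_locales

lemma iota_hom: "\<iota> \<in> ring_hom P A" unfolding \<iota>_def by (rule E.eval_ring_hom) simp

sublocale io: ring_hom_cring P A \<iota> by (rule ring_hom_cringI[OF U.P.is_cring A_cring iota_hom])

lemma iota_monom: "c \<in> carrier F \<Longrightarrow> \<iota> (up_ring.monom P c j) = cst c \<otimes>\<^bsub>A\<^esub> gs [^]\<^bsub>A\<^esub> j"
  unfolding \<iota>_def by (rule E.eval_monom) simp_all

lemma iota_T: "\<iota> (up_ring.monom P \<one>\<^bsub>F\<^esub> q \<ominus>\<^bsub>P\<^esub> up_ring.monom P \<one>\<^bsub>F\<^esub> 1) \<otimes>\<^bsub>A\<^esub> gx [^]\<^bsub>A\<^esub> (q + 1) = \<one>\<^bsub>A\<^esub>"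
proof -
  have "\<iota> (up_ring.monom P \<one>\<^bsub>F\<^esub> q \<ominus>\<^bsub>P\<^esub> up_ring.monom P \<one>\<^bsub>F\<^esub> 1) = gs [^]\<^bsub>A\<^esub> q \<ominus>\<^bsub>A\<^esub> gs"
    by (simp add: a_minus_def iota_monom)
  then show ?thesis using A.drinfeld_ratio[of gx gs q] curve_relation by (simp add: gs_gx del: A.nat_pow_Suc)
qed

lemma curve_span:
  assumes a: "a \<in> carrier A"
    and gen: "\<And>c j (k::nat). c \<in> carrier F \<Longrightarrow> Q (\<iota> (up_ring.monom P c j) \<otimes>\<^bsub>A\<^esub> gx [^]\<^bsub>A\<^esub> k)"
    and add: "\<And>a b. a \<in> carrier A \<Longrightarrow> b \<in> carrier A \<Longrightarrow> Q a \<Longrightarrow> Q b \<Longrightarrow> Q (a \<oplus>\<^bsub>A\<^esub> b)"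
  shows "Q a"
  using a
proof (rule curve_induct)
  fix c and i j :: nat assume c: "c \<in> carrier F"
  have "cst c \<otimes>\<^bsub>A\<^esub> gx [^]\<^bsub>A\<^esub> i \<otimes>\<^bsub>A\<^esub> gy [^]\<^bsub>A\<^esub> j = \<iota> (up_ring.monom P c j) \<otimes>\<^bsub>A\<^esub> gx [^]\<^bsub>A\<^esub> (i + j)"
    unfolding gs_gx[symmetric] using c by (simp add: iota_monom A.nat_pow_distrib A.nat_pow_mult[symmetric] A.m_ac)
  then show "Q (cst c \<otimes>\<^bsub>A\<^esub> gx [^]\<^bsub>A\<^esub> i \<otimes>\<^bsub>A\<^esub> gy [^]\<^bsub>A\<^esub> j)" using gen[OF c] by simp
qed (rule add)

definition tq where "tq = up_ring.monom P \<one>\<^bsub>F\<^esub> q \<ominus>\<^bsub>P\<^esub> up_ring.monom P \<one>\<^bsub>F\<^esub> 1"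
definition rel' where "rel' = up_ring.monom B tq (q + 1) \<ominus>\<^bsub>B\<^esub> \<one>\<^bsub>B\<^esub>"

lemma tq_closed [simp]: "tq \<in> carrier P" unfolding tq_def by simp

lemma tq_nonzero: "tq \<noteq> \<zero>\<^bsub>P\<^esub>"
proof
  assume "tq = \<zero>\<^bsub>P\<^esub>"
  then have "up_ring.coeff P tq q = \<zero>\<^bsub>F\<^esub>" by simp
  then show False using q_ge2 unfolding tq_def by (simp add: a_minus_def)
qed

lemma rel'_closed: "rel' \<in> carrier B" unfolding rel'_def by simp

text \<open>
  The substitution \<open>y = s x\<close> turns the equation of the curve into \<open>T x\<^bsup>q+1\<^esup> = 1\<close>. In the quotient of
  \<open>F[s][x]\<close> by this relation, polynomials in \<open>s\<close> and powers of \<open>x\<close> have obvious representatives.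
\<close>

lemma graded_model:
  "\<exists>H\<in>ring_hom A (B Quot PIdl\<^bsub>B\<^esub> rel'). H gx = principal_class B rel' vy \<and>
     (\<forall>h\<in>carrier P. H (\<iota> h) = principal_class B rel' (up_ring.monom B h 0))"
proof -
  let ?S = "B Quot PIdl\<^bsub>B\<^esub> rel'" and ?c = "principal_class B rel'" and ?s = "up_ring.monom P \<one>\<^bsub>F\<^esub> 1"
  interpret S: cring ?S by (rule B.P.principal_quotient_cring[OF rel'_closed])
  interpret c: ring_hom_cring B ?S ?c
    by (rule ring_hom_cringI[OF B.P.is_cring S.is_cring B.P.principal_class_hom[OF rel'_closed]])
  have \<phi>: "(\<lambda>c. ?c (vc c)) \<in> ring_hom F ?S"
  proof (rule ring_hom_memI)
    fix c d assume "c \<in> carrier F" "d \<in> carrier F"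
    then show "?c (vc (c \<otimes>\<^bsub>F\<^esub> d)) = ?c (vc c) \<otimes>\<^bsub>?S\<^esub> ?c (vc d)" "?c (vc (c \<oplus>\<^bsub>F\<^esub> d)) = ?c (vc c) \<oplus>\<^bsub>?S\<^esub> ?c (vc d)"
      using B.monom_mult[of "up_ring.monom P c 0" "up_ring.monom P d 0" 0 0] U.monom_mult[of c d 0 0]
      by (simp_all add: c.hom_mult[symmetric] c.hom_add[symmetric] del: c.hom_mult c.hom_add)
  qed simp_all
  let ?v = "up_ring.monom B ?s 1"
  have "vy \<otimes>\<^bsub>B\<^esub> ?v [^]\<^bsub>B\<^esub> q \<ominus>\<^bsub>B\<^esub> ?v \<otimes>\<^bsub>B\<^esub> vy [^]\<^bsub>B\<^esub> q \<ominus>\<^bsub>B\<^esub> \<one>\<^bsub>B\<^esub> = rel'"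
  proof -
    have "vy \<otimes>\<^bsub>B\<^esub> ?v [^]\<^bsub>B\<^esub> q = up_ring.monom B (up_ring.monom P \<one>\<^bsub>F\<^esub> q) (q + 1)"
      using B.monom_mult[of "\<one>\<^bsub>P\<^esub>" "up_ring.monom P \<one>\<^bsub>F\<^esub> q" 1 q] by (simp add: B.monom_pow U.monom_pow)
    moreover have "?v \<otimes>\<^bsub>B\<^esub> vy [^]\<^bsub>B\<^esub> q = up_ring.monom B ?s (q + 1)"
      using B.monom_mult[of ?s "\<one>\<^bsub>P\<^esub>" 1 q] by (simp add: B.monom_pow)
    ultimately show ?thesis unfolding rel'_def tq_def by (simp add: a_minus_def)
  qed
  then have "?c (vy \<otimes>\<^bsub>B\<^esub> ?v [^]\<^bsub>B\<^esub> q \<ominus>\<^bsub>B\<^esub> ?v \<otimes>\<^bsub>B\<^esub> vy [^]\<^bsub>B\<^esub> q \<ominus>\<^bsub>B\<^esub> \<one>\<^bsub>B\<^esub>) = \<zero>\<^bsub>?S\<^esub>"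
    using B.P.principal_class_generator[OF rel'_closed] by simp
  then have "?c vy \<otimes>\<^bsub>?S\<^esub> ?c ?v [^]\<^bsub>?S\<^esub> q = ?c ?v \<otimes>\<^bsub>?S\<^esub> ?c vy [^]\<^bsub>?S\<^esub> q \<oplus>\<^bsub>?S\<^esub> \<one>\<^bsub>?S\<^esub>"
    by (subst S.diff_one_iff[symmetric]) (simp_all add: a_minus_def)
  then obtain H where H: "H \<in> ring_hom A ?S" "H gx = ?c vy" "H gy = ?c ?v" "\<And>c. c \<in> carrier F \<Longrightarrow> H (cst c) = ?c (vc c)"
    using curve_hom[OF S.is_cring \<phi>, of "?c vy" "?c ?v"] by auto
  interpret H: ring_hom_cring A ?S H by (rule ring_hom_cringI[OF A_cring S.is_cring H(1)])
  let ?w = "?c (up_ring.monom B ?s 0)"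
  have Hgs: "H gs = ?w"
  proof -
    have inv: "H gx \<otimes>\<^bsub>?S\<^esub> H gi = \<one>\<^bsub>?S\<^esub>" using arg_cong[OF gx_gi, of H] by simp
    have "?w \<otimes>\<^bsub>?S\<^esub> H gx = H gs \<otimes>\<^bsub>?S\<^esub> H gx"
    proof -
      have "H gs \<otimes>\<^bsub>?S\<^esub> H gx = ?c ?v" using arg_cong[OF gs_gx, of H] H(3) by simp
      moreover have "?w \<otimes>\<^bsub>?S\<^esub> H gx = ?c ?v" unfolding H(2)
        using B.monom_mult[of ?s "\<one>\<^bsub>P\<^esub>" 0 1] by (simp add: c.hom_mult[symmetric] del: c.hom_mult)
      ultimately show ?thesis by simp
    qed
    moreover have "z \<otimes>\<^bsub>?S\<^esub> H gx \<otimes>\<^bsub>?S\<^esub> H gi = z" if "z \<in> carrier ?S" for z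
      using that inv by (simp add: S.m_assoc)
    ultimately show ?thesis by (metis H.hom_closed gs_closed c.hom_closed B.monom_closed U.monom_closed U.R.one_closed)
  qed
  have "H (\<iota> h) = ?c (up_ring.monom B h 0)" if "h \<in> carrier P" for h
    using that
  proof (rule U.poly_induct)
    fix c j assume c: "c \<in> carrier F"
    have "H (\<iota> (up_ring.monom P c j)) = ?c (vc c) \<otimes>\<^bsub>?S\<^esub> ?w [^]\<^bsub>?S\<^esub> j"
      using c H(4) Hgs by (simp add: iota_monom)
    also have "\<dots> = ?c (vc c \<otimes>\<^bsub>B\<^esub> up_ring.monom B ?s 0 [^]\<^bsub>B\<^esub> j)" using c by simp
    also have "vc c \<otimes>\<^bsub>B\<^esub> up_ring.monom B ?s 0 [^]\<^bsub>B\<^esub> j = up_ring.monom B (up_ring.monom P c j) 0"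
      using c B.monom_mult[of "up_ring.monom P c 0" "up_ring.monom P \<one>\<^bsub>F\<^esub> j" 0 0] U.monom_mult[of c "\<one>\<^bsub>F\<^esub>" 0 j]
      by (simp add: B.monom_pow U.monom_pow)
    finally show "H (\<iota> (up_ring.monom P c j)) = ?c (up_ring.monom B (up_ring.monom P c j) 0)" .
  next
    fix f g assume "f \<in> carrier P" "g \<in> carrier P" "H (\<iota> f) = ?c (up_ring.monom B f 0)" "H (\<iota> g) = ?c (up_ring.monom B g 0)"
    then show "H (\<iota> (f \<oplus>\<^bsub>P\<^esub> g)) = ?c (up_ring.monom B (f \<oplus>\<^bsub>P\<^esub> g) 0)" by simp
  qed
  then show ?thesis using H by blast
qed

text \<open>
  In \<open>graded_model\<close>, a relation between the powers of \<open>x\<close> in a window becomes a multiple of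
  \<open>T x\<^bsup>q+1\<^esup> - 1\<close> in \<open>F[s][x]\<close> that is supported in this window; by \<open>degree_spread\<close> it is zero.
\<close>

lemma curve_free:
  assumes h: "\<And>k. h k \<in> carrier P" and z: "(\<Oplus>\<^bsub>A\<^esub>k\<in>{M..M + q}. \<iota> (h k) \<otimes>\<^bsub>A\<^esub> gx [^]\<^bsub>A\<^esub> k) = \<zero>\<^bsub>A\<^esub>"
    and k: "k \<in> {M..M + q}"
  shows "h k = \<zero>\<^bsub>P\<^esub>"
proof -
  let ?S = "B Quot PIdl\<^bsub>B\<^esub> rel'" and ?c = "principal_class B rel'"
  interpret S: cring ?S by (rule B.P.principal_quotient_cring[OF rel'_closed])
  interpret c: ring_hom_cring B ?S ?c
    by (rule ring_hom_cringI[OF B.P.is_cring S.is_cring B.P.principal_class_hom[OF rel'_closed]])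
  obtain H where H: "H \<in> ring_hom A ?S" "H gx = ?c vy" "\<And>h. h \<in> carrier P \<Longrightarrow> H (\<iota> h) = ?c (up_ring.monom B h 0)"
    using graded_model by blast
  interpret H: ring_hom_cring A ?S H by (rule ring_hom_cringI[OF A_cring S.is_cring H(1)])
  define b where "b = (\<Oplus>\<^bsub>B\<^esub>k\<in>{M..M + q}. up_ring.monom B (h k) k)"
  have b: "b \<in> carrier B" unfolding b_def using h by (intro B.P.finsum_closed) auto
  have Ht: "H (\<iota> (h k) \<otimes>\<^bsub>A\<^esub> gx [^]\<^bsub>A\<^esub> k) = ?c (up_ring.monom B (h k) k)" for k
  proof -
    have "up_ring.monom B (h k) k = up_ring.monom B (h k) 0 \<otimes>\<^bsub>B\<^esub> vy [^]\<^bsub>B\<^esub> k"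
      using h B.monom_mult[of "h k" "\<one>\<^bsub>P\<^esub>" 0 k] by (simp add: B.monom_pow)
    then show ?thesis using h H(2,3) by simp
  qed
  have "\<zero>\<^bsub>?S\<^esub> = H (\<Oplus>\<^bsub>A\<^esub>k\<in>{M..M + q}. \<iota> (h k) \<otimes>\<^bsub>A\<^esub> gx [^]\<^bsub>A\<^esub> k)" unfolding z by simp
  also have "\<dots> = (\<Oplus>\<^bsub>?S\<^esub>k\<in>{M..M + q}. ?c (up_ring.monom B (h k) k))"
    using h Ht by (subst H.hom_finsum) (auto simp: comp_def)
  also have "\<dots> = ?c b" unfolding b_def using h by (subst c.hom_finsum) (auto simp: comp_def)
  finally have "?c b = ?c \<zero>\<^bsub>B\<^esub>" by simp
  then obtain G where "G \<in> carrier B" "b \<ominus>\<^bsub>B\<^esub> \<zero>\<^bsub>B\<^esub> = G \<otimes>\<^bsub>B\<^esub> rel'"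
    unfolding B.P.principal_class_eq[OF rel'_closed b B.P.zero_closed] by blast
  then have G: "G \<in> carrier B" "b = G \<otimes>\<^bsub>B\<^esub> rel'" using b by (simp_all add: a_minus_def)
  have coeff: "up_ring.coeff B b i = (if i \<in> {M..M + q} then h i else \<zero>\<^bsub>P\<^esub>)" for i
  proof -
    have "up_ring.coeff B b i = (\<Oplus>\<^bsub>P\<^esub>k\<in>{M..M + q}. up_ring.coeff B (up_ring.monom B (h k) k) i)"
      unfolding b_def using h by (intro B.coeff_finsum) auto
    also have "\<dots> = (\<Oplus>\<^bsub>P\<^esub>k\<in>{M..M + q}. if i = k then h k else \<zero>\<^bsub>P\<^esub>)"
      using h by (intro U.P.finsum_cong') auto
    also have "\<dots> = (if i \<in> {M..M + q} then h i else \<zero>\<^bsub>P\<^esub>)"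
    proof (cases "i \<in> {M..M + q}")
      case True
      then show ?thesis using h by (simp only: if_True) (rule U.P.finsum_singleton, auto)
    next
      case False
      then have "(\<Oplus>\<^bsub>P\<^esub>k\<in>{M..M + q}. if i = k then h k else \<zero>\<^bsub>P\<^esub>) = (\<Oplus>\<^bsub>P\<^esub>k\<in>{M..M + q}. \<zero>\<^bsub>P\<^esub>)"
        using h by (intro U.P.finsum_cong') auto
      then show ?thesis using False by (simp only: if_False U.P.finsum_zero)
    qed
    finally show ?thesis .
  qed
  have "G = \<zero>\<^bsub>B\<^esub>"
  proof (rule B.degree_spread[OF tq_closed tq_nonzero _ G(1), where m = "q + 1" and M = M])
    fix i assume "up_ring.coeff B (G \<otimes>\<^bsub>B\<^esub> (up_ring.monom B tq (q + 1) \<ominus>\<^bsub>B\<^esub> \<one>\<^bsub>B\<^esub>)) i \<noteq> \<zero>\<^bsub>P\<^esub>"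
    then have "up_ring.coeff B b i \<noteq> \<zero>\<^bsub>P\<^esub>" unfolding G(2) rel'_def .
    then show "M \<le> i \<and> i < M + (q + 1)" unfolding coeff by (auto split: if_splits)
  qed simp
  then have "b = \<zero>\<^bsub>B\<^esub>" using G(2) rel'_closed by simp
  then show ?thesis using coeff[of k] k by simp
qed

subsection \<open>The derivation\<close>

lemma int_elem_curve: "int_elem A m = cst (int_elem F m)"
  by (induction m) (simp_all add: A.nu_Suc U.R.nu_Suc)

text \<open>
  The substitution \<open>x \<mapsto> x + x\<^sup>q \<epsilon>\<close>, \<open>y \<mapsto> y + y\<^sup>q \<epsilon>\<close> respects the equation of the curve: as \<open>q = 0\<close> in
  \<open>F\<close>, the coefficient of \<open>\<epsilon>\<close> in \<open>x y\<^sup>q - y x\<^sup>q\<close> becomes \<open>x\<^sup>q y\<^sup>q - y\<^sup>q x\<^sup>q = 0\<close>.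
\<close>

lemma curve_derivation:
  assumes "int_elem F q = \<zero>\<^bsub>F\<^esub>"
  shows "\<exists>d. (\<forall>a\<in>carrier A. d a \<in> carrier A) \<and>
    (\<forall>a\<in>carrier A. \<forall>b\<in>carrier A. d (a \<oplus>\<^bsub>A\<^esub> b) = d a \<oplus>\<^bsub>A\<^esub> d b) \<and>
    (\<forall>a\<in>carrier A. \<forall>b\<in>carrier A. d (a \<otimes>\<^bsub>A\<^esub> b) = d a \<otimes>\<^bsub>A\<^esub> b \<oplus>\<^bsub>A\<^esub> a \<otimes>\<^bsub>A\<^esub> d b) \<and>
    d gx = gx [^]\<^bsub>A\<^esub> q \<and> d gy = gy [^]\<^bsub>A\<^esub> q \<and> (\<forall>c\<in>carrier F. d (cst c) = \<zero>\<^bsub>A\<^esub>)"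
proof -
  let ?S = "dual_numbers A"
  interpret S: cring ?S by (rule A.dual_numbers_cring)
  have nq: "int_elem A q = \<zero>\<^bsub>A\<^esub>" unfolding int_elem_curve assms by simp
  have \<phi>: "(\<lambda>c. (cst c, \<zero>\<^bsub>A\<^esub>)) \<in> ring_hom F ?S"
    by (rule ring_hom_memI) simp_all
  obtain H where H: "H \<in> ring_hom A ?S" "H gx = (gx, gx [^]\<^bsub>A\<^esub> q)" "H gy = (gy, gy [^]\<^bsub>A\<^esub> q)"
    "\<And>c. c \<in> carrier F \<Longrightarrow> H (cst c) = (cst c, \<zero>\<^bsub>A\<^esub>)"
  proof -
    have "(gx, gx [^]\<^bsub>A\<^esub> q) \<otimes>\<^bsub>?S\<^esub> (gy, gy [^]\<^bsub>A\<^esub> q) [^]\<^bsub>?S\<^esub> q =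
      (gy, gy [^]\<^bsub>A\<^esub> q) \<otimes>\<^bsub>?S\<^esub> (gx, gx [^]\<^bsub>A\<^esub> q) [^]\<^bsub>?S\<^esub> q \<oplus>\<^bsub>?S\<^esub> \<one>\<^bsub>?S\<^esub>"
      using curve_relation by (simp add: A.dual_numbers_pow nq A.m_comm)
    then show ?thesis
      using curve_hom[OF S.is_cring \<phi>, of "(gx, gx [^]\<^bsub>A\<^esub> q)" "(gy, gy [^]\<^bsub>A\<^esub> q)"] that by auto
  qed
  interpret H: ring_hom_cring A ?S H by (rule ring_hom_cringI[OF A_cring S.is_cring H(1)])
  have Hc: "fst (H a) \<in> carrier A" "snd (H a) \<in> carrier A" if "a \<in> carrier A" for a
    using H.hom_closed[OF that] by auto
  have add: "H (a \<oplus>\<^bsub>A\<^esub> b) = (fst (H a) \<oplus>\<^bsub>A\<^esub> fst (H b), snd (H a) \<oplus>\<^bsub>A\<^esub> snd (H b))" if "a \<in> carrier A" "b \<in> carrier A" for a b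
    using that by (cases "H a", cases "H b") simp
  have fst: "fst (H a) = a" if "a \<in> carrier A" for a
    using that
  proof (rule curve_induct)
    fix c and i j :: nat assume c: "c \<in> carrier F"
    then show "fst (H (cst c \<otimes>\<^bsub>A\<^esub> gx [^]\<^bsub>A\<^esub> i \<otimes>\<^bsub>A\<^esub> gy [^]\<^bsub>A\<^esub> j)) = cst c \<otimes>\<^bsub>A\<^esub> gx [^]\<^bsub>A\<^esub> i \<otimes>\<^bsub>A\<^esub> gy [^]\<^bsub>A\<^esub> j"
      by (simp add: H(2-4) A.dual_numbers_pow)
  qed (simp add: add del: H.hom_add)
  then have H': "H a = (a, snd (H a))" if "a \<in> carrier A" for a using that by (metis prod.collapse)
  have mult: "snd (H (a \<otimes>\<^bsub>A\<^esub> b)) = snd (H a) \<otimes>\<^bsub>A\<^esub> b \<oplus>\<^bsub>A\<^esub> a \<otimes>\<^bsub>A\<^esub> snd (H b)" if ab: "a \<in> carrier A" "b \<in> carrier A" for a b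
  proof -
    have "H (a \<otimes>\<^bsub>A\<^esub> b) = (a, snd (H a)) \<otimes>\<^bsub>?S\<^esub> (b, snd (H b))" using ab H'[OF ab(1)] H'[OF ab(2)] by (metis H.hom_mult)
    then show ?thesis by simp
  qed
  show ?thesis
    by (intro exI[of _ "\<lambda>a. snd (H a)"]) (simp add: Hc add mult H(2-4) del: H.hom_add H.hom_mult)
qed

lemma drinfeld_cover_exists:
  assumes p: "Factorial_Ring.prime p" "n > 0" "q = p ^ n" and char: "int_elem F p = \<zero>\<^bsub>F\<^esub>"
    and perfect: "\<And>c. c \<in> carrier F \<Longrightarrow> \<exists>d\<in>carrier F. c = d [^]\<^bsub>F\<^esub> p"
    and K: "K \<subseteq> carrier F" "finite K" "card K = q" "\<And>a. a \<in> K \<Longrightarrow> a [^]\<^bsub>F\<^esub> q = a"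
  shows "\<exists>D. drinfeld_cover F A \<iota> gx q p n K D"
proof -
  have "int_elem F q = int_elem F (p ^ (n - 1)) \<otimes>\<^bsub>F\<^esub> int_elem F p"
    using p(2) unfolding p(3) by (cases n) (simp_all add: U.R.nu_mult[symmetric] mult.commute)
  then have "int_elem F q = \<zero>\<^bsub>F\<^esub>" using char by simp
  from curve_derivation[OF this]
  obtain d where dd: "\<forall>a\<in>carrier A. d a \<in> carrier A"
    "\<forall>a\<in>carrier A. \<forall>b\<in>carrier A. d (a \<oplus>\<^bsub>A\<^esub> b) = d a \<oplus>\<^bsub>A\<^esub> d b"
    "\<forall>a\<in>carrier A. \<forall>b\<in>carrier A. d (a \<otimes>\<^bsub>A\<^esub> b) = d a \<otimes>\<^bsub>A\<^esub> b \<oplus>\<^bsub>A\<^esub> a \<otimes>\<^bsub>A\<^esub> d b"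
    "d gx = gx [^]\<^bsub>A\<^esub> q" "d gy = gy [^]\<^bsub>A\<^esub> q" "\<forall>c\<in>carrier F. d (cst c) = \<zero>\<^bsub>A\<^esub>"
    by (elim exE conjE) (rule that; assumption)
  have d: "\<And>a. a \<in> carrier A \<Longrightarrow> d a \<in> carrier A"
    "\<And>a b. a \<in> carrier A \<Longrightarrow> b \<in> carrier A \<Longrightarrow> d (a \<oplus>\<^bsub>A\<^esub> b) = d a \<oplus>\<^bsub>A\<^esub> d b"
    "\<And>a b. a \<in> carrier A \<Longrightarrow> b \<in> carrier A \<Longrightarrow> d (a \<otimes>\<^bsub>A\<^esub> b) = d a \<otimes>\<^bsub>A\<^esub> b \<oplus>\<^bsub>A\<^esub> a \<otimes>\<^bsub>A\<^esub> d b"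
    "d gx = gx [^]\<^bsub>A\<^esub> q" "d gy = gy [^]\<^bsub>A\<^esub> q" "\<And>c. c \<in> carrier F \<Longrightarrow> d (cst c) = \<zero>\<^bsub>A\<^esub>"
    using dd by simp_all
  \<comment> \<open>\<open>d s = (y\<^sup>q - s x\<^sup>q) / x = 1 / x\<^sup>2\<close>, whence the factor\<close>
  define D where "D a = gx \<otimes>\<^bsub>A\<^esub> (gx \<otimes>\<^bsub>A\<^esub> d a)" for a
  have Ds: "D gs = \<one>\<^bsub>A\<^esub>"
  proof -
    have "d gs \<otimes>\<^bsub>A\<^esub> gx \<oplus>\<^bsub>A\<^esub> gs \<otimes>\<^bsub>A\<^esub> gx [^]\<^bsub>A\<^esub> q = gy [^]\<^bsub>A\<^esub> q"
      using d(3)[of gs gx] by (simp add: gs_gx d(4,5))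
    then have "gx \<otimes>\<^bsub>A\<^esub> (d gs \<otimes>\<^bsub>A\<^esub> gx \<oplus>\<^bsub>A\<^esub> gs \<otimes>\<^bsub>A\<^esub> gx [^]\<^bsub>A\<^esub> q) = gy \<otimes>\<^bsub>A\<^esub> gx [^]\<^bsub>A\<^esub> q \<oplus>\<^bsub>A\<^esub> \<one>\<^bsub>A\<^esub>"
      using curve_relation by simp
    moreover have "gx \<otimes>\<^bsub>A\<^esub> (d gs \<otimes>\<^bsub>A\<^esub> gx \<oplus>\<^bsub>A\<^esub> gs \<otimes>\<^bsub>A\<^esub> gx [^]\<^bsub>A\<^esub> q) = gy \<otimes>\<^bsub>A\<^esub> gx [^]\<^bsub>A\<^esub> q \<oplus>\<^bsub>A\<^esub> D gs"
      unfolding D_def gs_gx[symmetric] using d(1) by (simp add: A.r_distr A.m_ac A.a_comm)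
    moreover have "D gs \<in> carrier A" "gy \<otimes>\<^bsub>A\<^esub> gx [^]\<^bsub>A\<^esub> q \<in> carrier A" unfolding D_def using d(1) by simp_all
    ultimately show ?thesis by (metis A.add.l_cancel A.one_closed)
  qed
  have "drinfeld_cover F A \<iota> gx q p n K D"
  proof (unfold_locales, unfold U.P_def[symmetric])
    fix Q a assume "a \<in> carrier A" "\<And>c j (k::nat). c \<in> carrier F \<Longrightarrow> Q (\<iota> (up_ring.monom P c j) \<otimes>\<^bsub>A\<^esub> gx [^]\<^bsub>A\<^esub> k)"
      "\<And>a b. a \<in> carrier A \<Longrightarrow> b \<in> carrier A \<Longrightarrow> Q a \<Longrightarrow> Q b \<Longrightarrow> Q (a \<oplus>\<^bsub>A\<^esub> b)"
    then show "Q a" by (rule curve_span)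
  next
    fix M h k assume "\<And>k. h k \<in> carrier P" "(\<Oplus>\<^bsub>A\<^esub>k\<in>{M..M + q}. \<iota> (h k) \<otimes>\<^bsub>A\<^esub> gx [^]\<^bsub>A\<^esub> k) = \<zero>\<^bsub>A\<^esub>" "k \<in> {M..M + q}"
    then show "h k = \<zero>\<^bsub>P\<^esub>" by (rule curve_free)
  next
    fix a b assume ab: "a \<in> carrier A" "b \<in> carrier A"
    show "D (a \<oplus>\<^bsub>A\<^esub> b) = D a \<oplus>\<^bsub>A\<^esub> D b" using ab d(1) by (simp add: D_def d(2) A.r_distr)
    show "D (a \<otimes>\<^bsub>A\<^esub> b) = D a \<otimes>\<^bsub>A\<^esub> b \<oplus>\<^bsub>A\<^esub> a \<otimes>\<^bsub>A\<^esub> D b" using ab d(1) by (simp add: D_def d(3) A.r_distr A.m_ac)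
  next
    show "D (\<iota> (up_ring.monom P \<one>\<^bsub>F\<^esub> 1)) = \<one>\<^bsub>A\<^esub>" using Ds iota_monom[of "\<one>\<^bsub>F\<^esub>" 1] by simp
  next
    fix c assume "c \<in> carrier F"
    then show "D (\<iota> (up_ring.monom P c 0)) = \<zero>\<^bsub>A\<^esub>" using iota_monom[of c 0] by (simp add: D_def d(6))
  next
    show "q = p ^ n" by (rule p(3))
  qed (use p(1,2) char perfect K q_ge2 iota_hom iota_T d(1) in \<open>simp_all add: D_def\<close>)
  then show ?thesis by blast
qed

end

theorem theorem2p8:
  fixes F :: "('a, 'b) ring_scheme" and K :: "'a set" and p n q :: nat
  assumes "Factorial_Ring.prime p"
    and "n > 0" and "q = p ^ n"
    and "field F"
    and "subfield K F" and "card K = q"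
    and "\<forall>x\<in>carrier F. (ring.algebraic F over K) x"
  shows "torsion_part (Pic (Spec (coord_ring F q))) p = {\<one>\<^bsub>Pic (Spec (coord_ring F q))\<^esub>}"
proof -
  interpret F: field F by (rule assms(4))
  have p2: "p \<ge> 2" using assms(1) by (rule prime_ge_2_nat)
  have "p ^ 1 \<le> p ^ n" using assms(2) p2 by (intro power_increasing) auto
  then have q2: "q \<ge> 2" using p2 assms(3) by simp
  then have fin: "finite K" using assms(6) card.infinite by fastforce
  have char: "int_elem F p = \<zero>\<^bsub>F\<^esub>"
    using F.finite_subfield_char[OF assms(5) fin] assms(3,6) by simp
  have F_char: "char_p_domain F p" by unfold_locales (use assms(1) char in auto)
  have perfect: "\<exists>d\<in>carrier F. c = d [^]\<^bsub>F\<^esub> p" if "c \<in> carrier F" for c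
    using F.algebraic_over_finite_perfect[OF assms(5) fin F_char that] assms(7) that by blast
  have pow_q: "a [^]\<^bsub>F\<^esub> q = a" if "a \<in> K" for a
    using F.finite_subfield_pow_card[OF assms(5) fin that] assms(6) by simp
  interpret C: drinfeld_curve F "UP F" q by unfold_locales (rule q2)
  obtain D where "drinfeld_cover F C.A C.\<iota> C.gx q p n K D"
    using C.drinfeld_cover_exists[OF assms(1,2,3) char perfect _ fin assms(6) pow_q]
      subfieldE(3)[OF assms(5)] by blast
  then interpret V: drinfeld_cover F "UP F" C.A C.\<iota> C.gx q p n K D .
  have "torsion_part (Pic (Spec C.A)) p = {\<one>\<^bsub>Pic (Spec C.A)\<^esub>}"
  proof (rule domain.Pic_Spec_torsion_trivial[OF V.cover_domain])
    show "p > 0" using p2 by simp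
  next
    fix a b assume "a \<in> carrier C.A" "b \<in> carrier C.A" "a [^]\<^bsub>C.A\<^esub> p = b [^]\<^bsub>C.A\<^esub> p"
    then show "a = b" by (rule V.AD.frobenius_inj)
  next
    fix f
    assume "\<And>P. primeideal P C.A \<Longrightarrow> f P \<in> carrier C.A - P"
      "\<And>P P'. primeideal P C.A \<Longrightarrow> primeideal P' C.A \<Longrightarrow>
         \<exists>b\<in>carrier C.A - {\<zero>\<^bsub>C.A\<^esub>}. \<exists>t\<in>carrier C.A - {\<zero>\<^bsub>C.A\<^esub>}.
           f P \<otimes>\<^bsub>C.A\<^esub> t [^]\<^bsub>C.A\<^esub> p = f P' \<otimes>\<^bsub>C.A\<^esub> b [^]\<^bsub>C.A\<^esub> p"
    then show "\<exists>w\<in>Units C.A. \<exists>v. \<forall>P. primeideal P C.A \<longrightarrow> v P \<in> carrier C.A \<and> f P = w \<otimes>\<^bsub>C.A\<^esub> v P [^]\<^bsub>C.A\<^esub> p"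
      by (intro V.AD.local_p_powers V.Cartier_kernel V.log_derivatives)
  qed
  moreover have "coord_ring F q = C.A"
    by (simp add: coord_ring_def C.A_def C.rel_def poly_xy_def var_x_def var_y_def)
  ultimately show ?thesis by simp
qed

end
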